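(* Let $N\in\mathbb{N}$, $p,q>1$, $a,b>0$, and let $G_1,G_2\in C^1(\mathbb{R})$ satisfy $G_1(0)=G_2(0)=0$, $G_1(s)\ge a|s|^p$ and $G_2(s)\ge b|s|^q$ for all $s\in\mathbb{R}$. Let $f_1,g_1,f_2,g_2\in C_c^\infty(\mathbb{R}^N)$ with $\int_{\mathbb{R}^N}g_1\,dx>0$ and $\int_{\mathbb{R}^N}g_2\,dx>0$, and put $r_0=\sup\{|x|\;;\;x\in\operatorname{supp}(f_1,f_2,g_1,g_2)\}$. Assume $$\Gamma_{SS}(N,p,q)=\max\{F_{SS}(N,p,q),F_{SS}(N,q,p)\}\ge0.$$ Then there exist constants $\varepsilon_0>0$ and $C>0$, independent of $\varepsilon$, such that the following holds for every $\varepsilon\in(0,\varepsilon_0]$: if $(u,v)$ is a weak solution in $(0,T)$ of $$\begin{cases}\partial_t^2u-\Delta u=G_1(v),\quad\partial_t^2v-\Delta v=G_2(u)&\text{in }\mathbb{R}^N\times(0,T),\\ u(0)=\varepsilon f_1,\ \partial_tu(0)=\varepsilon g_1,\ v(0)=\varepsilon f_2,\ \partial_tv(0)=\varepsilon g_2\end{cases}$$ satisfying $\operatorname{supp}(u,v)\subset\{(x,t)\in\mathbb{R}^N\times[0,T)\;;\;|x|\le r_0+t\}$, then $$T\le\begin{cases}C\varepsilon^{-\Gamma_{SS}(N,p,q)^{-1}}&\text{if }\Gamma_{SS}(N,p,q)>0,\\ \exp(C\varepsilon^{-\min\{p(pq-1),q(pq-1)\}})&\text{if }\Gamma_{SS}(N,p,q)=0,\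 p\ne q,\\ \exp(C\varepsilon^{-p(p-1)})&\text{if }\Gamma_{SS}(N,p,q)=0,\ p=q.\end{cases}$$
   Context: Set $F_{SS}(N,p,q)=\big(p+2+\frac1q\big)(pq-1)^{-1}-\frac{N-1}{2}$. Weak solution in $(0,T)$: a pair $(u,v)\in C([0,T);(H^1(\mathbb{R}^N))^2)\cap C^1([0,T);(L^2(\mathbb{R}^N))^2)$ with $G_2(u),G_1(v)\in L^1(0,T;L^1(\mathbb{R}^N))$, $(u,v)(0)=(\varepsilon f_1,\varepsilon f_2)$, $(\partial_tu,\partial_tv)(0)=(\varepsilon g_1,\varepsilon g_2)$, such that for every $\Psi\in C_c^\infty(\mathbb{R}^N\times[0,T))$, $$\varepsilon\int_{\mathbb{R}^N}g_1\Psi(x,0)\,dx+\int_0^T\!\!\int_{\mathbb{R}^N}G_1(v)\Psi\,dx\,dt=\int_0^T\!\!\int_{\mathbb{R}^N}(-\partial_tu\,\partial_t\Psi+\nabla u\cdot\nabla\Psi)\,dx\,dt,$$ $$\varepsilon\int_{\mathbb{R}^N}g_2\Psi(x,0)\,dx+\int_0^T\!\!\int_{\mathbb{R}^N}G_2(u)\Psi\,dx\,dt=\int_0^T\!\!\int_{\mathbb{R}^N}(-\partial_tv\,\partial_t\Psi+\nabla v\cdot\nabla\Psi)\,dx\,dt.$$ *)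

theory Defs
  imports "HOL-Analysis.Analysis"
begin

section \<open>Exponents\<close>

definition F_SS :: "nat \<Rightarrow> real \<Rightarrow> real \<Rightarrow> real" where
  "F_SS N p q = (p + 2 + 1 / q) / (p * q - 1) - (real N - 1) / 2"

definition Gamma_SS :: "nat \<Rightarrow> real \<Rightarrow> real \<Rightarrow> real" where
  "Gamma_SS N p q = max (F_SS N p q) (F_SS N q p)"


section \<open>Smooth functions\<close>

text \<open>
  Derivatives are taken within \<open>S\<close>. The sets used below, the whole space and
  the half-open slab of all \<open>(x, t)\<close> with \<open>0 \<le> t < T\<close>, are convex with nonempty interior,
  so these derivatives are unique; on the slab the notion is smoothness up to and including the
  face \<open>t = 0\<close>. Values of \<open>f\<close> outside \<open>S\<close> play no role.
\<close>

primrec Ck_on :: "nat \<Rightarrow> ('a::real_normed_vector \<Rightarrow> 'b::real_normed_vector) \<Rightarrow> 'a set \<Rightarrow> bool" where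
  "Ck_on 0 f S \<longleftrightarrow> continuous_on S f"
| "Ck_on (Suc k) f S \<longleftrightarrow>
     (\<exists>f'. (\<forall>x\<in>S. (f has_derivative f' x) (at x within S)) \<and> (\<forall>v. Ck_on k (\<lambda>x. f' x v) S))"

definition Cc_infty :: "'a::real_normed_vector set \<Rightarrow> ('a \<Rightarrow> 'b::real_normed_vector) set" where
  "Cc_infty S = {f. (\<forall>k. Ck_on k f S) \<and> (\<exists>K. compact K \<and> K \<subseteq> S \<and> (\<forall>x\<in>S - K. f x = 0))}"

definition supp :: "('a::topological_space \<Rightarrow> 'b::zero) \<Rightarrow> 'a set" where
  "supp f = closure {x. f x \<noteq> 0}"

definition grad :: "(real^'n \<Rightarrow> real) \<Rightarrow> real^'n \<Rightarrow> real^'n" where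
  "grad f x = (\<chi> i. frechet_derivative f (at x) (axis i 1))"


section \<open>Function spaces\<close>

text \<open>
  Elements of Lebesgue and Sobolev spaces are represented by functions, to be read modulo
  equality almost everywhere; a function of time with values in such a space is
  a curried function \<open>u t x\<close>, where for each time \<open>t\<close> the function \<open>u t\<close> is any representative.
\<close>

definition L2 :: "(real^'n \<Rightarrow> 'b::euclidean_space) \<Rightarrow> bool" where
  "L2 f \<longleftrightarrow> f \<in> borel_measurable lebesgue \<and> integrable lebesgue (\<lambda>x. (norm (f x))\<^sup>2)"

definition L2_norm :: "(real^'n \<Rightarrow> 'b::euclidean_space) \<Rightarrow> real" where
  "L2_norm f = sqrt (\<integral>x. (norm (f x))\<^sup>2 \<partial>lebesgue)"

definition weak_gradient :: "(real^'n \<Rightarrow> real) \<Rightarrow> (real^'n \<Rightarrow> real^'n) \<Rightarrow> bool" where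
  "weak_gradient f Df \<longleftrightarrow>
     (\<forall>\<phi>\<in>Cc_infty UNIV. (\<integral>x. f x *\<^sub>R grad \<phi> x \<partial>lebesgue) = - (\<integral>x. \<phi> x *\<^sub>R Df x \<partial>lebesgue))"

text \<open>\<open>f\<close> belongs to \<open>H\<^sup>1\<close> and \<open>Df\<close> represents its weak gradient.\<close>

definition H1 :: "(real^'n \<Rightarrow> real) \<Rightarrow> (real^'n \<Rightarrow> real^'n) \<Rightarrow> bool" where
  "H1 f Df \<longleftrightarrow> L2 f \<and> L2 Df \<and> weak_gradient f Df"

definition H1_norm :: "(real^'n \<Rightarrow> real) \<Rightarrow> (real^'n \<Rightarrow> real^'n) \<Rightarrow> real" where
  "H1_norm f Df = sqrt ((L2_norm f)\<^sup>2 + (L2_norm Df)\<^sup>2)"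

text \<open>\<open>u \<in> C([0,T); H\<^sup>1)\<close>, with spatial weak gradient \<open>Du\<close>.\<close>

definition C_H1 :: "real \<Rightarrow> (real \<Rightarrow> real^'n \<Rightarrow> real) \<Rightarrow> (real \<Rightarrow> real^'n \<Rightarrow> real^'n) \<Rightarrow> bool" where
  "C_H1 T u Du \<longleftrightarrow>
     (\<forall>t\<in>{0..<T}. H1 (u t) (Du t) \<and>
        ((\<lambda>s. H1_norm (\<lambda>x. u s x - u t x) (\<lambda>x. Du s x - Du t x)) \<longlongrightarrow> 0) (at t within {0..<T}))"

text \<open>\<open>u \<in> C\<^sup>1([0,T); L\<^sup>2)\<close>, with time derivative \<open>u'\<close> (one-sided at \<open>t = 0\<close>).\<close>

definition C1_L2 :: "real \<Rightarrow> (real \<Rightarrow> real^'n \<Rightarrow> real) \<Rightarrow> (real \<Rightarrow> real^'n \<Rightarrow> real) \<Rightarrow> bool" where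
  "C1_L2 T u u' \<longleftrightarrow>
     (\<forall>t\<in>{0..<T}. L2 (u t) \<and> L2 (u' t) \<and>
        ((\<lambda>s. L2_norm (\<lambda>x. (u s x - u t x) / (s - t) - u' t x)) \<longlongrightarrow> 0) (at t within {0..<T}) \<and>
        ((\<lambda>s. L2_norm (\<lambda>x. u' s x - u' t x)) \<longlongrightarrow> 0) (at t within {0..<T}))"

text \<open>
  The Bochner space \<open>L\<^sup>1(0,T; L\<^sup>1)\<close>: strong measurability (almost everywhere limit in \<open>L\<^sup>1\<close> of
  simple \<open>L\<^sup>1\<close>-valued functions) and integrability of the norm.
\<close>

definition simple_L1 :: "(real \<Rightarrow> real^'n \<Rightarrow> real) \<Rightarrow> bool" where
  "simple_L1 S \<longleftrightarrow>
     (\<exists>(m::nat) A h. (\<forall>i<m. A i \<in> sets lebesgue \<and> integrable lebesgue (h i)) \<and>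
        S = (\<lambda>t x. \<Sum>i<m. indicator (A i) t * h i x))"

definition L1_L1 :: "real \<Rightarrow> (real \<Rightarrow> real^'n \<Rightarrow> real) \<Rightarrow> bool" where
  "L1_L1 T F \<longleftrightarrow>
     (AE t in lebesgue_on {0<..<T}. integrable lebesgue (F t)) \<and>
     (\<exists>S. (\<forall>k::nat. simple_L1 (S k)) \<and>
        (AE t in lebesgue_on {0<..<T}. (\<lambda>k. \<integral>x. \<bar>S k t x - F t x\<bar> \<partial>lebesgue) \<longlonglongrightarrow> 0)) \<and>
     integrable (lebesgue_on {0<..<T}) (\<lambda>t. \<integral>x. \<bar>F t x\<bar> \<partial>lebesgue)"

text \<open>
  Support of an almost-everywhere class on the slab: the complement, in the slab, of the union of
  all relatively open sets on which the class vanishes almost everywhere.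
\<close>

definition ess_supp :: "real \<Rightarrow> (real \<Rightarrow> real^'n \<Rightarrow> 'b::zero) \<Rightarrow> ((real^'n) \<times> real) set" where
  "ess_supp T w =
     UNIV \<times> {0..<T} -
     \<Union>{W. openin (top_of_set (UNIV \<times> {0..<T})) W \<and>
           (AE t in lebesgue_on {0..<T}. AE x in lebesgue. (x, t) \<in> W \<longrightarrow> w t x = 0)}"


section \<open>Weak solutions\<close>

text \<open>
  The integral identity for \<open>\<partial>\<^sub>t\<^sup>2 u - \<Delta> u = h\<close> with initial velocity \<open>\<epsilon> g\<close>; the arguments \<open>u'\<close>
  and \<open>Du\<close> are the time derivative and the spatial gradient of \<open>u\<close>.
\<close>

definition weak_wave_identity ::
  "real \<Rightarrow> real \<Rightarrow> (real^'n \<Rightarrow> real) \<Rightarrow> (real \<Rightarrow> real^'n \<Rightarrow> real) \<Rightarrow>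
   (real \<Rightarrow> real^'n \<Rightarrow> real) \<Rightarrow> (real \<Rightarrow> real^'n \<Rightarrow> real^'n) \<Rightarrow> bool" where
  "weak_wave_identity T \<epsilon> g h u' Du \<longleftrightarrow>
     (\<forall>\<Psi>\<in>Cc_infty (UNIV \<times> {0..<T}).
        \<epsilon> * (\<integral>x. g x * \<Psi> (x, 0) \<partial>lebesgue)
          + (\<integral>t. (\<integral>x. h t x * \<Psi> (x, t) \<partial>lebesgue) \<partial>lebesgue_on {0<..<T})
        = (\<integral>t. (\<integral>x. - u' t x * deriv (\<lambda>s. \<Psi> (x, s)) t + Du t x \<bullet> grad (\<lambda>y. \<Psi> (y, t)) x
              \<partial>lebesgue) \<partial>lebesgue_on {0<..<T}))"

definition weak_solution ::
  "(real \<Rightarrow> real) \<Rightarrow> (real \<Rightarrow> real) \<Rightarrow>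
   (real^'n \<Rightarrow> real) \<Rightarrow> (real^'n \<Rightarrow> real) \<Rightarrow> (real^'n \<Rightarrow> real) \<Rightarrow> (real^'n \<Rightarrow> real) \<Rightarrow>
   real \<Rightarrow> real \<Rightarrow> (real \<Rightarrow> real^'n \<Rightarrow> real) \<Rightarrow> (real \<Rightarrow> real^'n \<Rightarrow> real) \<Rightarrow> bool" where
  "weak_solution G1 G2 f1 g1 f2 g2 \<epsilon> T u v \<longleftrightarrow>
     0 < T \<and>
     L1_L1 T (\<lambda>t x. G2 (u t x)) \<and> L1_L1 T (\<lambda>t x. G1 (v t x)) \<and>
     (\<exists>u' v' Du Dv.
        C_H1 T u Du \<and> C_H1 T v Dv \<and> C1_L2 T u u' \<and> C1_L2 T v v' \<and>
        (AE x in lebesgue. u 0 x = \<epsilon> * f1 x) \<and> (AE x in lebesgue. v 0 x = \<epsilon> * f2 x) \<and>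
        (AE x in lebesgue. u' 0 x = \<epsilon> * g1 x) \<and> (AE x in lebesgue. v' 0 x = \<epsilon> * g2 x) \<and>
        weak_wave_identity T \<epsilon> g1 (\<lambda>t x. G1 (v t x)) u' Du \<and>
        weak_wave_identity T \<epsilon> g2 (\<lambda>t x. G2 (u t x)) v' Dv)"

end

theory Submission
  imports Defs "HOL-Real_Asymp.Real_Asymp"
begin

text \<open>The solution is tested against the plane waves $\kappa(t + \mu - x \cdot \omega)$ averaged over the unit
  sphere and multiplied by a cutoff in $t/R$. Pairing the two second-order equations with such a
  test function and integrating by parts leaves only commutator terms supported on the shell
  $R/2 \le t \le R$; Young's inequality turns them into a power of $R$ times the mass of the
  nonlinearity on that shell. The choice $\kappa = 1$ bounds the mass on the whole cone, while
  $\kappa(s) = s^{-\beta}$ gives a lower bound for the shell mass in terms of the data. In the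
  subcritical case these estimates combine to $\epsilon \le A R^{-\Gamma}$ for all $R < T$. In the
  critical case the exponent $\beta = (N-1)/2 - 1/q$ loses only a logarithm, and the weighted masses
  on dyadic cones satisfy a discrete version of $y' \ge c y^{P} (1+J)^{-k}$, which blows up in
  finite time.\<close>

subsection \<open>Continuously differentiable functions\<close>

text \<open>Put m = (N - 1) / 2 and \<tau> = t + \<mu>. Averaging phases to the power -b over the
  sphere gives a positive function of size \<tau>^(-m) (\<tau> - |x|)^(m - b) when b > m; this needs
  only a bound for spherical caps, no special functions. The shift \<mu> keeps all phases on the
  cone at least 2 and, taken large, lets the integral of the velocity beat the unsigned position
  data. Young's inequality carries a free factor that is optimised after integration, so that the
  shell mass enters linearly. The lower bound takes \<beta> = m, where the time integral of the
  weight converges; \<beta> = m - 1/q is where it diverges logarithmically. For p and q distinct the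
  critical loop runs through both equations: P = p q, k = p (q - 1) and increments at least of order
  \<epsilon>^(p q), so P - k = p yields the exponent q (p q - 1) for q <= p. For p = q the weighted
  masses of both sources are added and one use of each equation suffices: P = p, k = p - 1, P - k =
  1, which yields p (p - 1).\<close>

lemma Ck_on_imp_continuous_on: "Ck_on k f S \<Longrightarrow> continuous_on S f"
proof (cases k)
  case (Suc j)
  assume "Ck_on k f S"
  then obtain f' where "\<forall>x\<in>S. (f has_derivative f' x) (at x within S)"
    using Suc by auto
  then show ?thesis
    using has_derivative_continuous_on by blast
qed auto

lemma Ck_on_Suc_imp: "Ck_on (Suc k) f S \<Longrightarrow> Ck_on k f S"
proof (induction k arbitrary: f)
  case 0
  then show ?case using Ck_on_imp_continuous_on by fastforce
next
  case (Suc k)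
  then obtain f' where "\<forall>x\<in>S. (f has_derivative f' x) (at x within S)" "\<forall>v. Ck_on (Suc k) (\<lambda>x. f' x v) S"
    by (subst (asm) Ck_on.simps) blast
  then show ?case
    using Suc.IH by (subst Ck_on.simps) blast
qed

lemma Ck_on_subset: "Ck_on k f S \<Longrightarrow> U \<subseteq> S \<Longrightarrow> Ck_on k f U"
proof (induction k arbitrary: f)
  case 0
  then show ?case by (auto intro: continuous_on_subset)
next
  case (Suc k)
  then obtain f' where f': "\<forall>x\<in>S. (f has_derivative f' x) (at x within S)" "\<forall>v. Ck_on k (\<lambda>x. f' x v) S"
    by auto
  have "\<forall>x\<in>U. (f has_derivative f' x) (at x within U)"
    using f'(1) Suc.prems(2) has_derivative_subset by blast
  then show ?case using f' Suc by auto
qed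

lemma Ck_on_const [simp]: "Ck_on k (\<lambda>x. c) S"
proof (induction k arbitrary: c)
  case (Suc k)
  show ?case
    using Suc by (auto intro!: exI[of _ "\<lambda>x v. 0"])
qed auto

lemma Ck_on_bounded_linear: "bounded_linear f \<Longrightarrow> Ck_on k f S"
proof (cases k)
  case 0
  assume "bounded_linear f"
  then show ?thesis using 0 linear_continuous_on by auto
next
  case (Suc j)
  assume "bounded_linear f"
  then show ?thesis using Suc
    by (auto intro!: exI[of _ "\<lambda>x v. f v"] bounded_linear_imp_has_derivative)
qed

lemma Ck_on_add: "Ck_on k f S \<Longrightarrow> Ck_on k g S \<Longrightarrow> Ck_on k (\<lambda>x. f x + g x) S"
proof (induction k arbitrary: f g)
  case 0
  then show ?case by (auto intro: continuous_on_add)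
next
  case (Suc k)
  then obtain f' g' where f': "\<forall>x\<in>S. (f has_derivative f' x) (at x within S)" "\<forall>v. Ck_on k (\<lambda>x. f' x v) S"
    and g': "\<forall>x\<in>S. (g has_derivative g' x) (at x within S)" "\<forall>v. Ck_on k (\<lambda>x. g' x v) S"
    by auto
  show ?case
    using f' g' Suc.IH
    by (auto intro!: exI[of _ "\<lambda>x v. f' x v + g' x v"] has_derivative_add)
qed

lemma Ck_on_mult:
  fixes f g :: "'a::real_normed_vector \<Rightarrow> real"
  shows "Ck_on k f S \<Longrightarrow> Ck_on k g S \<Longrightarrow> Ck_on k (\<lambda>x. f x * g x) S"
proof (induction k arbitrary: f g)
  case 0
  then show ?case by (auto intro: continuous_on_mult)
next
  case (Suc k)
  then obtain f' g' where f': "\<forall>x\<in>S. (f has_derivative f' x) (at x within S)" "\<forall>v. Ck_on k (\<lambda>x. f' x v) S"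
    and g': "\<forall>x\<in>S. (g has_derivative g' x) (at x within S)" "\<forall>v. Ck_on k (\<lambda>x. g' x v) S"
    by auto
  have "Ck_on k f S" "Ck_on k g S"
    using Suc.prems Ck_on_Suc_imp by blast+
  then show ?case
    using f' g' Suc.IH
    by (auto intro!: exI[of _ "\<lambda>x v. f x * g' x v + f' x v * g x"] has_derivative_mult Ck_on_add)
qed

lemma Ck_on_minus:
  fixes f :: "'a::real_normed_vector \<Rightarrow> real"
  shows "Ck_on k f S \<Longrightarrow> Ck_on k (\<lambda>x. - f x) S"
  using Ck_on_mult[of k "\<lambda>x. -1" S f] by auto

lemma Ck_on_diff:
  fixes f g :: "'a::real_normed_vector \<Rightarrow> real"
  shows "Ck_on k f S \<Longrightarrow> Ck_on k g S \<Longrightarrow> Ck_on k (\<lambda>x. f x - g x) S"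
  using Ck_on_add[OF _ Ck_on_minus, of k f S g] by auto

lemma Ck_on_power:
  fixes f :: "'a::real_normed_vector \<Rightarrow> real"
  shows "Ck_on k f S \<Longrightarrow> Ck_on k (\<lambda>x. f x ^ n) S"
  by (induction n) (auto intro: Ck_on_mult)

lemma Ck_on_sum:
  "finite A \<Longrightarrow> (\<And>i. i \<in> A \<Longrightarrow> Ck_on k (f i) S) \<Longrightarrow> Ck_on k (\<lambda>x. \<Sum>i\<in>A. f i x) S"
  by (induction A rule: finite_induct) (auto intro: Ck_on_add)

text \<open>A real outer function keeps the chain rule scalar: the derivative of the composition in
  direction \<open>v\<close> is \<open>g' (h x) 1 * h' x v\<close>, the product of a composition
  covered by the induction hypothesis and a derivative of \<open>h\<close>.\<close>

lemma Ck_on_compose: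
  fixes g :: "real \<Rightarrow> real"
  shows "Ck_on k g A \<Longrightarrow> Ck_on k h S \<Longrightarrow> h ` S \<subseteq> A \<Longrightarrow> Ck_on k (\<lambda>x. g (h x)) S"
proof (induction k arbitrary: g)
  case 0
  then show ?case using continuous_on_compose2 by fastforce
next
  case (Suc k)
  then obtain g' h' where g': "\<forall>x\<in>A. (g has_derivative g' x) (at x within A)" "\<forall>v. Ck_on k (\<lambda>x. g' x v) A"
    and h': "\<forall>x\<in>S. (h has_derivative h' x) (at x within S)" "\<forall>v. Ck_on k (\<lambda>x. h' x v) S"
    by auto
  have hk: "Ck_on k h S"
    using Suc.prems Ck_on_Suc_imp by blast
  have 1: "((\<lambda>x. g (h x)) has_derivative (\<lambda>v. g' (h x) 1 * h' x v)) (at x within S)" if "x \<in> S" for x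
  proof -
    have "((\<lambda>x. g (h x)) has_derivative (\<lambda>v. g' (h x) (h' x v))) (at x within S)"
      using g' h' that Suc.prems(3)
      by (intro has_derivative_in_compose2[of A g g' h S x "h' x"]) auto
    moreover have g1: "g' (h x) c = g' (h x) 1 * c" for c
    proof -
      have "linear (g' (h x))"
        using g' that Suc.prems(3) by (meson has_derivative_linear image_subset_iff)
      then show ?thesis
        using linear_cmul[of "g' (h x)" c 1] by (simp add: mult.commute)
    qed
    have "(\<lambda>v. g' (h x) (h' x v)) = (\<lambda>v. g' (h x) 1 * h' x v)"
      by (intro ext) (rule g1)
    ultimately show ?thesis by metis
  qed
  have "Ck_on k (\<lambda>x. g' (h x) 1) S"
    using Suc.IH[of "\<lambda>x. g' x 1"] g'(2) hk Suc.prems(3) by auto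
  then show ?case
    using 1 h'(2) by (auto intro!: exI[of _ "\<lambda>x v. g' (h x) 1 * h' x v"] Ck_on_mult)
qed

lemma Ck_on_Suc_real:
  fixes g :: "real \<Rightarrow> real"
  assumes "\<And>x. x \<in> S \<Longrightarrow> (g has_real_derivative g' x) (at x within S)" and "Ck_on k g' S"
  shows "Ck_on (Suc k) g S"
  using assms
  by (auto simp: has_field_derivative_def intro!: exI[of _ "\<lambda>x v. g' x * v"] Ck_on_mult)

lemma Ck_on_Suc_realD:
  fixes g :: "real \<Rightarrow> real"
  assumes "Ck_on (Suc k) g UNIV"
  shows "(g has_real_derivative deriv g x) (at x)" "Ck_on k (deriv g) UNIV"
proof -
  obtain f' where f': "\<forall>x. (g has_derivative f' x) (at x)" "\<forall>v. Ck_on k (\<lambda>x. f' x v) UNIV"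
    using assms by auto
  have 1: "(g has_real_derivative f' x 1) (at x)" for x
  proof -
    have "linear (f' x)"
      using f' has_derivative_linear by blast
    then have "f' x c = f' x 1 * c" for c
      using linear_cmul[of "f' x" c 1] by (simp add: mult.commute)
    then have "f' x = (*) (f' x 1)" by (rule ext)
    then show ?thesis using f'(1) unfolding has_field_derivative_def by metis
  qed
  then have 2: "deriv g x = f' x 1" for x by (rule DERIV_imp_deriv)
  then have "deriv g = (\<lambda>x. f' x 1)" by auto
  then show "(g has_real_derivative deriv g x) (at x)" "Ck_on k (deriv g) UNIV"
    using 1 2 f'(2) by auto
qed

definition smooth :: "('a::real_normed_vector \<Rightarrow> real) \<Rightarrow> bool" where
  "smooth f \<longleftrightarrow> (\<forall>k. Ck_on k f UNIV)"

lemma smooth_deriv: "smooth g \<Longrightarrow> smooth (deriv g)"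
  and smooth_has_real_derivative: "smooth g \<Longrightarrow> (g has_real_derivative deriv g x) (at x)"
  using Ck_on_Suc_realD unfolding smooth_def by blast+

lemma smooth_const [simp]: "smooth (\<lambda>x. c)"
  and smooth_add: "smooth f \<Longrightarrow> smooth g \<Longrightarrow> smooth (\<lambda>x. f x + g x)"
  and smooth_diff: "smooth f \<Longrightarrow> smooth g \<Longrightarrow> smooth (\<lambda>x. f x - g x)"
  and smooth_mult: "smooth f \<Longrightarrow> smooth g \<Longrightarrow> smooth (\<lambda>x. f x * g x)"
  and smooth_power: "smooth f \<Longrightarrow> smooth (\<lambda>x. f x ^ n)"
  and smooth_bounded_linear: "bounded_linear f \<Longrightarrow> smooth f"
  and smooth_compose: "smooth h \<Longrightarrow> smooth f \<Longrightarrow> smooth (\<lambda>x. h (f x))"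
  unfolding smooth_def
  by (auto intro: Ck_on_add Ck_on_diff Ck_on_mult Ck_on_power Ck_on_bounded_linear Ck_on_compose)

text \<open>The inner map is vector-valued but linear, hence its own derivative: direction
  \<open>v\<close> for the composition is direction \<open>L v\<close> for \<open>f\<close>, and the
  induction runs over all \<open>f\<close>. It serves for functions of the space variable alone on
  space-time.\<close>

lemma smooth_compose_bounded_linear:
  assumes "bounded_linear L" "smooth f"
  shows "smooth (\<lambda>x. f (L x))"
proof -
  have "Ck_on k (\<lambda>x. f (L x)) UNIV" if "Ck_on k f UNIV" for k f
    using that
  proof (induction k arbitrary: f)
    case 0
    then show ?case
      using continuous_on_compose2[OF _ linear_continuous_on[OF assms(1)], of UNIV f UNIV] by simp
  next
    case (Suc k)
    then obtain f' where f': "\<forall>x. (f has_derivative f' x) (at x)" "\<forall>v. Ck_on k (\<lambda>x. f' x v) UNIV"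
      by auto
    have "((\<lambda>x. f (L x)) has_derivative (\<lambda>v. f' (L x) (L v))) (at x)" for x
      using has_derivative_compose[OF bounded_linear_imp_has_derivative[OF assms(1)] f'(1)[rule_format]] .
    then show ?case using f'(2) Suc.IH
      by (auto intro!: exI[of _ "\<lambda>x v. f' (L x) (L v)"])
  qed
  then show ?thesis using assms(2) unfolding smooth_def by auto
qed

lemma smooth_inner_self: "smooth (\<lambda>x::'a::real_inner. x \<bullet> x)"
proof -
  have "Ck_on (Suc k) (\<lambda>x::'a. x \<bullet> x) UNIV" for k
    by (auto intro!: exI[of _ "\<lambda>x v. x \<bullet> v + v \<bullet> x"] has_derivative_inner Ck_on_add
        Ck_on_bounded_linear[OF bounded_linear_inner_left] Ck_on_bounded_linear[OF bounded_linear_inner_right])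
  then show ?thesis unfolding smooth_def using Ck_on_Suc_imp by blast
qed

lemma smooth_imp_continuous_on: "smooth f \<Longrightarrow> continuous_on S f"
  unfolding smooth_def using Ck_on_imp_continuous_on continuous_on_subset by blast

section \<open>A smooth transition from 1 to 0 and the kernels built from it\<close>

definition flat :: "nat \<Rightarrow> real \<Rightarrow> real" where
  "flat n s = (if s \<le> 0 then 0 else exp (- (1 / s)) / s ^ n)"

text \<open>Dividing exp(-1/s) by every power of s gives a family that differentiation maps into its
  own span, which is what lets \<open>smooth_flat\<close> run by induction. At s = 0 the exponential
  beats every power, so both one-sided quotients tend to 0.\<close>

lemma flat_has_real_derivative:
  "(flat n has_real_derivative (flat (n + 2) s - n * flat (n + 1) s)) (at s)"
proof -
  consider "s < 0" | "s = 0" | "s > 0" by linarith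
  then show ?thesis
  proof cases
    case 1
    have "((\<lambda>_. 0) has_real_derivative 0) (at s)" by simp
    then have "(flat n has_real_derivative 0) (at s)"
      by (rule has_field_derivative_transform_within_open[of _ _ _ "{..<0}"])
         (use 1 in \<open>auto simp: flat_def\<close>)
    then show ?thesis using 1 by (simp add: flat_def)
  next
    case 2
    have "((\<lambda>y. (flat n y - flat n 0) / (y - 0)) \<longlongrightarrow> 0) (at 0)"
    proof (rule filterlim_split_at)
      have "((\<lambda>y. (0::real)) \<longlongrightarrow> 0) (at_left 0)" by simp
      then show "((\<lambda>y. (flat n y - flat n 0) / (y - 0)) \<longlongrightarrow> 0) (at_left 0)"
        by (rule Lim_transform_eventually)
           (auto simp: flat_def eventually_at_filter intro!: always_eventually)
      have "((\<lambda>y::real. exp (- (1 / y)) / y ^ n / y) \<longlongrightarrow> 0) (at_right 0)"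
        by real_asymp
      then show "((\<lambda>y. (flat n y - flat n 0) / (y - 0)) \<longlongrightarrow> 0) (at_right 0)"
        by (rule Lim_transform_eventually)
           (auto simp: flat_def eventually_at_filter intro!: always_eventually)
    qed
    then show ?thesis using 2 by (simp add: has_field_derivative_iff flat_def)
  next
    case 3
    have "((\<lambda>s. exp (- (1 / s)) / s ^ n) has_real_derivative (flat (n + 2) s - n * flat (n + 1) s)) (at s)"
    proof (cases n)
      case (Suc j)
      have a: "((\<lambda>s. exp (- (1 / s))) has_real_derivative exp (- (1 / s)) * (1 / (s * s))) (at s)"
        using 3 by (auto intro!: derivative_eq_intros)
      have b: "((\<lambda>s. s ^ n) has_real_derivative n * s ^ j) (at s)"
        using DERIV_pow[of n s] by (simp add: Suc)
      have "((\<lambda>s. exp (- (1 / s)) / s ^ n) has_real_derivative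
          (exp (- (1 / s)) * (1 / (s * s)) * s ^ n - exp (- (1 / s)) * (n * s ^ j)) / (s ^ n * s ^ n)) (at s)"
        using a b 3 by (intro DERIV_divide) auto
      moreover have "(exp (- (1 / s)) * (1 / (s * s)) * s ^ n - exp (- (1 / s)) * (n * s ^ j)) / (s ^ n * s ^ n)
          = flat (n + 2) s - n * flat (n + 1) s"
      proof -
        have "s ^ j > 0" using 3 by simp
        then show ?thesis using 3 by (simp add: flat_def Suc field_simps)
      qed
      ultimately show ?thesis by metis
    qed (use 3 in \<open>auto intro!: derivative_eq_intros simp: flat_def field_simps power2_eq_square\<close>)
    then show ?thesis
      by (rule has_field_derivative_transform_within_open[of _ _ _ "{0<..}"])
         (use 3 in \<open>auto simp: flat_def\<close>)
  qed
qed

lemma smooth_flat: "smooth (flat n)"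
proof -
  have "Ck_on k (flat n) UNIV" for k
  proof (induction k arbitrary: n)
    case 0
    then show ?case
      using DERIV_continuous_on[OF flat_has_real_derivative] by simp
  next
    case (Suc k)
    then show ?case
      by (intro Ck_on_Suc_real[OF flat_has_real_derivative] Ck_on_diff Ck_on_mult) auto
  qed
  then show ?thesis by (simp add: smooth_def)
qed

definition bump :: "real \<Rightarrow> real" where
  "bump s = flat 0 (s - 1 / 2) * flat 0 (1 - s)"

lemma smooth_affine: "smooth (\<lambda>s::real. a * s + b)"
  by (intro smooth_add smooth_const smooth_bounded_linear bounded_linear_mult_right)

lemma smooth_bump: "smooth bump"
proof -
  have "smooth (\<lambda>s. flat 0 (1 * s + (-1/2)) * flat 0 ((-1) * s + 1))"
    by (intro smooth_mult smooth_compose[OF smooth_flat] smooth_affine)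
  then show ?thesis by (simp add: bump_def[abs_def])
qed

lemma bump_nonneg: "bump s \<ge> 0"
  and bump_eq_0: "s \<le> 1 / 2 \<or> 1 \<le> s \<Longrightarrow> bump s = 0"
  and bump_pos: "1 / 2 < s \<Longrightarrow> s < 1 \<Longrightarrow> bump s > 0"
  by (auto simp: bump_def flat_def)

lemma bump_integral_pos: "integral {0..1} bump > 0"
proof -
  have c: "continuous_on {0..1} bump" using smooth_bump smooth_imp_continuous_on by blast
  have "integral {0..1} bump \<noteq> 0"
  proof
    assume "integral {0..1} bump = 0"
    then have "(bump has_integral 0) (cbox 0 1)"
      using integrable_continuous_interval[OF c] by (metis integrable_integral box_real(2))
    then have "bump (3/4) = 0"
      using has_integral_0_cbox_imp_0[of 0 1 bump "3/4"] c bump_nonneg by auto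
    then show False using bump_pos[of "3/4"] by auto
  qed
  moreover have "integral {0..1} bump \<ge> 0"
    by (intro Henstock_Kurzweil_Integration.integral_nonneg integrable_continuous_interval c bump_nonneg)
  ultimately show ?thesis by simp
qed

text \<open>Normalised primitive of \<open>bump\<close>, falling from 1 at s = 1/2 to 0 at s = 1.
  The upper limit is clamped to the unit interval; since \<open>bump\<close> vanishes outside (1/2,
  1), the derivative still has one formula on the whole line.\<close>

definition step :: "real \<Rightarrow> real" where
  "step s = 1 - integral {0..min 1 (max 0 s)} bump / integral {0..1} bump"

lemma step_has_real_derivative: "(step has_real_derivative (- bump s / integral {0..1} bump)) (at s)"
proof -
  let ?I = "\<lambda>s. integral {0..min 1 (max 0 s)} bump"
  have c: "continuous_on A bump" for A using smooth_bump smooth_imp_continuous_on by blast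
  have low: "?I t = 0" if "t \<le> 1 / 2" for t
  proof -
    have "?I t = integral {0..min 1 (max 0 t)} (\<lambda>x. 0)"
      using that by (intro Henstock_Kurzweil_Integration.integral_cong bump_eq_0) (auto simp: min_def max_def split: if_splits)
    then show ?thesis by simp
  qed
  have "(?I has_real_derivative bump s) (at s)"
  proof -
    have *: "(?I has_real_derivative bump s) (at s)" if "s \<in> {0<..<1}"
    proof -
      have "((\<lambda>u. integral {0..u} bump) has_real_derivative bump s) (at s within {0..1})"
        using that by (intro integral_has_real_derivative c) auto
      then have "((\<lambda>u. integral {0..u} bump) has_real_derivative bump s) (at s within {0<..<1})"
        using has_field_derivative_subset greaterThanLessThan_subseteq_atLeastAtMost_iff by blast
      then have "((\<lambda>u. integral {0..u} bump) has_real_derivative bump s) (at s)"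
        using that by (simp add: at_within_open[of s "{0<..<1}"])
      then show ?thesis
        by (rule has_field_derivative_transform_within_open[of _ _ _ "{0<..<1}"])
           (use that in auto)
    qed
    have "(?I has_real_derivative bump s) (at s)" if "s \<le> 0"
    proof -
      have "((\<lambda>_. 0) has_real_derivative 0) (at s)" by simp
      then have "(?I has_real_derivative 0) (at s)"
        by (rule has_field_derivative_transform_within_open[of _ _ _ "{..<1/2}"])
           (use that low in auto)
      then show ?thesis using that by (simp add: bump_eq_0)
    qed
    moreover have "(?I has_real_derivative bump s) (at s)" if "s \<ge> 1"
    proof -
      have high: "?I t = integral {0..1} bump" if "t \<ge> 1" for t
        using that by (auto simp: min_def max_def)
      show ?thesis
      proof (cases "s = 1")
        case False
        have "((\<lambda>_. integral {0..1} bump) has_real_derivative 0) (at s)" by simp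
        then have "(?I has_real_derivative 0) (at s)"
          by (rule has_field_derivative_transform_within_open[of _ _ _ "{1<..}"])
             (use that False high in auto)
        then show ?thesis using that by (simp add: bump_eq_0)
      next
        \<comment> \<open>At s = 1 neither side alone determines the two-sided derivative. The
          primitive is taken over {0..2} instead, where it agrees with the clamped one because
          \<open>bump\<close> vanishes beyond 1.\<close>
        case True
        have "((\<lambda>u. integral {0..u} bump) has_real_derivative bump s) (at s within {0..2})"
          using that True by (intro integral_has_real_derivative c) auto
        then have "((\<lambda>u. integral {0..u} bump) has_real_derivative bump s) (at s within {0<..<2})"
          using has_field_derivative_subset greaterThanLessThan_subseteq_atLeastAtMost_iff by blast
        then have D: "((\<lambda>u. integral {0..u} bump) has_real_derivative bump s) (at s)"
          using that True by (simp add: at_within_open[of 1 "{0<..<2}"])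
        have eq: "integral {0..u} bump = ?I u" if "0 < u" "u < 2" for u
        proof (cases "u \<le> 1")
          case False
          have "integral {0..u} bump = integral {0..1} bump + integral {1..u} bump"
            using False by (intro Henstock_Kurzweil_Integration.integral_combine[symmetric]
              integrable_continuous_interval c) auto
          moreover have "integral {1..u} bump = integral {1..u} (\<lambda>x. 0)"
            by (intro Henstock_Kurzweil_Integration.integral_cong) (auto simp: bump_eq_0)
          ultimately show ?thesis using False by simp
        qed (use that in auto)
        show ?thesis
        proof (rule has_field_derivative_transform_within_open[OF D, of "{0<..<2}"])
          show "s \<in> {0<..<2}" using True by simp
          show "integral {0..u} bump = ?I u" if "u \<in> {0<..<2}" for u
            using that by (intro eq) auto
        qed simp
      qed
    qed
    ultimately show ?thesis using * by fastforce
  qed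
  then show ?thesis unfolding step_def[abs_def]
    using bump_integral_pos by (auto intro!: derivative_eq_intros)
qed

lemma smooth_step: "smooth step"
proof -
  have "Ck_on k (\<lambda>s. - bump s / integral {0..1} bump) UNIV" for k
    using Ck_on_mult[of k "\<lambda>_. - 1 / integral {0..1} bump" UNIV bump] smooth_bump
    by (auto simp: smooth_def)
  then have "Ck_on (Suc k) step UNIV" for k
    using Ck_on_Suc_real[OF step_has_real_derivative] by blast
  then show ?thesis unfolding smooth_def using Ck_on_Suc_imp by blast
qed

lemma step_antimono: "s \<le> t \<Longrightarrow> step t \<le> step s"
  using step_has_real_derivative bump_nonneg bump_integral_pos
  by (intro DERIV_nonpos_imp_nonincreasing[of s t step])
     (auto intro!: divide_nonpos_pos, force)

lemma step_1: "s \<le> 1 / 2 \<Longrightarrow> step s = 1"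
proof -
  assume "s \<le> 1 / 2"
  then have "integral {0..min 1 (max 0 s)} bump = integral {0..min 1 (max 0 s)} (\<lambda>x. 0)"
    by (intro Henstock_Kurzweil_Integration.integral_cong bump_eq_0) (auto simp: min_def max_def split: if_splits)
  then show ?thesis by (simp add: step_def)
qed

lemma step_0: "1 \<le> s \<Longrightarrow> step s = 0"
  using bump_integral_pos by (simp add: step_def)

lemma step_bounds: "0 \<le> step s" "step s \<le> 1"
  using step_antimono[of s "max s 1"] step_antimono[of "min s 0" s] step_0[of "max s 1"] step_1[of "min s 0"]
  by auto

text \<open>Equal to $s^{-\beta}$ for $s \ge 1$ and to $1$ for $s \le 1/2$, so that it is smooth on the whole line
  without changing its values on the light cone.\<close>

definition kern :: "real \<Rightarrow> real \<Rightarrow> real" where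
  "kern \<beta> s = (step s + (1 - step s) * s) powr (- \<beta>)"

lemma Ck_on_powr: "Ck_on k (\<lambda>s::real. s powr b) {0<..}"
proof (induction k arbitrary: b)
  case 0
  then show ?case by (auto intro!: continuous_intros)
next
  case (Suc k)
  show ?case
    by (rule Ck_on_Suc_real[where g' = "\<lambda>s. b * s powr (b - 1)"])
       (auto intro!: Ck_on_mult Suc has_real_derivative_powr' derivative_eq_intros)
qed

lemma smooth_kern: "smooth (kern \<beta>)"
proof -
  let ?j = "\<lambda>s. step s + (1 - step s) * s"
  \<comment> \<open>\<open>powr\<close> is smooth on positive arguments only. For s > 1/2 the base
    is s plus (1 - s) \<open>step s\<close>, and the second term is nonnegative because
    \<open>step\<close> vanishes for s >= 1.\<close>
  have "?j s > 0" for s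
  proof (cases "s \<le> 1 / 2")
    case False
    have "?j s = (1 - s) * step s + s" by (simp add: algebra_simps)
    moreover have "(1 - s) * step s \<ge> 0"
      using step_bounds[of s] step_0[of s] by (cases "s \<le> 1") auto
    ultimately show ?thesis using False by linarith
  qed (simp add: step_1)
  moreover have "smooth ?j"
    by (intro smooth_add smooth_mult smooth_diff smooth_step smooth_const smooth_bounded_linear bounded_linear_ident)
  ultimately show ?thesis
    unfolding smooth_def kern_def[abs_def]
    by (auto intro!: Ck_on_compose[OF Ck_on_powr])
qed

lemma kern_eq: "s \<ge> 1 \<Longrightarrow> kern \<beta> s = s powr (- \<beta>)"
  by (simp add: kern_def step_0)

lemma deriv_kern: "s > 1 \<Longrightarrow> deriv (kern \<beta>) s = - \<beta> * s powr (- \<beta> - 1)"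
proof -
  assume s: "s > 1"
  have "((\<lambda>s. s powr (- \<beta>)) has_real_derivative (- \<beta> * s powr (- \<beta> - 1))) (at s)"
    using s by (auto intro!: derivative_eq_intros)
  then have "(kern \<beta> has_real_derivative (- \<beta> * s powr (- \<beta> - 1))) (at s)"
    by (rule has_field_derivative_transform_within_open[of _ _ _ "{1<..}"])
       (use s in \<open>auto simp: kern_eq\<close>)
  then show ?thesis by (rule DERIV_imp_deriv)
qed

subsection \<open>Averages of plane waves\<close>

lemma smooth_bounded_on_compact:
  fixes f :: "'a::real_normed_vector \<Rightarrow> real"
  assumes "smooth f" "compact K"
  obtains B where "B > 0" "\<And>x. x \<in> K \<Longrightarrow> \<bar>f x\<bar> \<le> B"
proof -
  have "bounded (f ` K)"
    using assms by (intro compact_imp_bounded compact_continuous_image smooth_imp_continuous_on)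
  then obtain B where "B > 0" "\<forall>y\<in>f ` K. norm y \<le> B"
    unfolding bounded_pos by blast
  then show thesis using that[of B] by auto
qed

text \<open>The mean value inequality is applied twice, to \<open>deriv f\<close> and to
  \<open>f\<close> minus its tangent, with \<open>B\<close> bounding the second derivative on the
  enlarged interval. Uniformity in \<open>a\<close> is the point: the bound is later integrated over
  all directions.\<close>

lemma smooth_taylor:
  fixes f :: "real \<Rightarrow> real"
  assumes "smooth f"
  obtains B where "B > 0"
    "\<And>a d. \<bar>a\<bar> \<le> A \<Longrightarrow> \<bar>d\<bar> \<le> D \<Longrightarrow> \<bar>f (a + d) - f a - deriv f a * d\<bar> \<le> B * d\<^sup>2"
proof -
  obtain B where B: "B > 0" "\<And>x. x \<in> {-(A + D)..A + D} \<Longrightarrow> \<bar>deriv (deriv f) x\<bar> \<le> B"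
    using smooth_bounded_on_compact[OF smooth_deriv[OF smooth_deriv[OF assms]] compact_Icc]
    by metis
  have "\<bar>f (a + d) - f a - deriv f a * d\<bar> \<le> B * d\<^sup>2" if "\<bar>a\<bar> \<le> A" "\<bar>d\<bar> \<le> D" for a d
  proof -
    let ?S = "{min a (a + d)..max a (a + d)}"
    have S: "?S \<subseteq> {-(A + D)..A + D}" using that by (auto simp: min_def max_def split: if_splits)
    have 1: "\<bar>deriv f x - deriv f a\<bar> \<le> B * \<bar>d\<bar>" if "x \<in> ?S" for x
    proof -
      have "norm (deriv f x - deriv f a) \<le> B * norm (x - a)"
      proof (rule field_differentiable_bound[of ?S])
        show "(deriv f has_field_derivative deriv (deriv f) z) (at z within ?S)" for z
          using smooth_has_real_derivative[OF smooth_deriv[OF assms]] has_field_derivative_at_within by blast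
      next
        fix z assume "z \<in> ?S"
        then have "z \<in> {-(A + D)..A + D}" using S by blast
        then show "norm (deriv (deriv f) z) \<le> B" using B(2) by simp
      qed (use that in auto)
      also have "\<dots> \<le> B * \<bar>d\<bar>"
        using that B(1) by (intro mult_left_mono) (auto simp: min_def max_def split: if_splits)
      finally show ?thesis by simp
    qed
    have "norm ((f (a + d) - deriv f a * (a + d)) - (f a - deriv f a * a)) \<le> B * \<bar>d\<bar> * norm (a + d - a)"
    proof (rule field_differentiable_bound[of ?S])
      show "((\<lambda>x. f x - deriv f a * x) has_field_derivative deriv f z - deriv f a) (at z within ?S)" for z
        by (rule has_field_derivative_at_within)
          (auto intro!: derivative_eq_intros smooth_has_real_derivative[OF assms])
      show "norm (deriv f z - deriv f a) \<le> B * \<bar>d\<bar>" if "z \<in> ?S" for z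
        using 1 that by auto
    qed auto
    then show ?thesis by (simp add: algebra_simps power2_eq_square abs_mult)
  qed
  with B(1) that show thesis by blast
qed

text \<open>A quadratic remainder is stronger than differentiability requires, but unlike o(|h|) it
  passes to integrals with nothing more than a constant.\<close>

lemma has_derivative_at_quadratic:
  fixes f :: "'a::real_normed_vector \<Rightarrow> real"
  assumes "bounded_linear L"
    and "\<And>h. norm h \<le> 1 \<Longrightarrow> \<bar>f (x + h) - f x - L h\<bar> \<le> C * (norm h)\<^sup>2"
  shows "(f has_derivative L) (at x)"
  unfolding has_derivative_at
proof (intro conjI assms(1))
  have "((\<lambda>h::'a. C * norm h) \<longlongrightarrow> C * norm (0::'a)) (at 0)"
    by (intro tendsto_intros)
  then have lim: "((\<lambda>h::'a. C * norm h) \<longlongrightarrow> 0) (at 0)" by simp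
  have ev: "eventually (\<lambda>h::'a. norm h < 1 \<and> h \<noteq> 0) (at 0)"
    unfolding eventually_at by (auto intro!: exI[of _ 1])
  show "(\<lambda>h. norm (f (x + h) - f x - L h) / norm h) \<midarrow>0\<rightarrow> 0"
  proof (rule Lim_null_comparison[OF _ lim])
    show "\<forall>\<^sub>F h in at 0. norm (norm (f (x + h) - f x - L h) / norm h) \<le> C * norm h"
      using ev
    proof eventually_elim
      case (elim h)
      then show ?case using assms(2)[of h]
        by (simp add: divide_simps power2_eq_square mult_ac)
    qed
  qed
qed

text \<open>The weight \<open>w\<close> is there for the sake of derivatives: differentiating the
  average in direction \<open>v\<close> multiplies \<open>w\<close> by
  \<open>snd v - fst v \<bullet> \<omega>\<close> and replaces \<open>\<kappa>\<close> by its
  derivative, so the class is closed.\<close>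

definition wave_avg :: "(real^'n) measure \<Rightarrow> (real^'n \<Rightarrow> real) \<Rightarrow> (real \<Rightarrow> real) \<Rightarrow> (real^'n) \<times> real \<Rightarrow> real"
  where "wave_avg M w \<kappa> z = (\<integral>\<omega>. w \<omega> * \<kappa> (snd z - fst z \<bullet> \<omega>) \<partial>M)"

text \<open>The wave equation and the test inequality only use that the measure is finite, Borel and
  carried by unit vectors. The geometry of the sphere enters later, through the measure of
  caps.\<close>

locale directions = finite_measure M for M :: "(real^'n) measure" +
  assumes sets_M: "sets M = sets borel"
    and norm_1: "AE \<omega> in M. norm \<omega> = 1"
begin

lemma measurable_M: "f \<in> borel_measurable borel \<Longrightarrow> f \<in> borel_measurable M"
  using measurable_cong_sets[OF sets_M refl] by blast

lemma phase_bound: "AE \<omega> in M. \<bar>s - \<xi> \<bullet> \<omega>\<bar> \<le> \<bar>s\<bar> + norm \<xi>"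
  using norm_1
proof eventually_elim
  case (elim \<omega>)
  have "\<bar>\<xi> \<bullet> \<omega>\<bar> \<le> norm \<xi> * norm \<omega>" by (rule Cauchy_Schwarz_ineq2)
  then show ?case using elim by auto
qed

lemma abs_integral_le:
  assumes "integrable M f" "AE \<omega> in M. \<bar>f \<omega>\<bar> \<le> c"
  shows "\<bar>\<integral>\<omega>. f \<omega> \<partial>M\<bar> \<le> c * measure M (space M)"
proof -
  have "\<bar>\<integral>\<omega>. f \<omega> \<partial>M\<bar> \<le> (\<integral>\<omega>. \<bar>f \<omega>\<bar> \<partial>M)"
    using integral_norm_bound[of M f] by simp
  also have "\<dots> \<le> (\<integral>\<omega>. c \<partial>M)"
    using assms by (intro integral_mono_AE) auto
  finally show ?thesis by (simp add: mult.commute)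
qed

lemma integrable_kernel:
  assumes w: "w \<in> borel_measurable borel" "AE \<omega> in M. \<bar>w \<omega>\<bar> \<le> B" and \<kappa>: "smooth \<kappa>"
  shows "integrable M (\<lambda>\<omega>. w \<omega> * \<kappa> (t - x \<bullet> \<omega>))"
proof -
  obtain K where K: "K > 0" "\<And>s. s \<in> {-(\<bar>t\<bar> + norm x)..\<bar>t\<bar> + norm x} \<Longrightarrow> \<bar>\<kappa> s\<bar> \<le> K"
    using smooth_bounded_on_compact[OF \<kappa> compact_Icc] by metis
  have m: "\<kappa> \<in> borel_measurable borel"
    using \<kappa> by (intro borel_measurable_continuous_onI smooth_imp_continuous_on)
  show ?thesis
  proof (rule integrable_const_bound[where B = "B * K"])
    show "AE \<omega> in M. norm (w \<omega> * \<kappa> (t - x \<bullet> \<omega>)) \<le> B * K"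
      using w(2) phase_bound[of t x]
    proof eventually_elim
      case (elim \<omega>)
      then have "\<bar>\<kappa> (t - x \<bullet> \<omega>)\<bar> \<le> K" by (intro K(2)) auto
      then show ?case using elim by (auto simp: abs_mult intro!: mult_mono)
    qed
    show "(\<lambda>\<omega>. w \<omega> * \<kappa> (t - x \<bullet> \<omega>)) \<in> borel_measurable M"
      by (intro measurable_M borel_measurable_times w(1) measurable_compose[OF _ m]) simp
  qed
qed

text \<open>Differentiation under the integral: the Taylor remainder of \<open>\<kappa>\<close> is
  quadratic in h uniformly over unit vectors, so integrating it over a finite measure keeps it
  quadratic.\<close>

lemma wave_avg_has_derivative:
  assumes w: "w \<in> borel_measurable borel" "AE \<omega> in M. \<bar>w \<omega>\<bar> \<le> B" and \<kappa>: "smooth \<kappa>"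
  shows "(wave_avg M w \<kappa> has_derivative
    (\<lambda>h. wave_avg M (\<lambda>\<omega>. w \<omega> * (snd h - fst h \<bullet> \<omega>)) (deriv \<kappa>) z)) (at z)"
proof -
  obtain x t where z: "z = (x, t)" by force
  define A where "A = \<bar>t\<bar> + norm x"
  \<comment> \<open>\<open>B\<close> may be negative if the measure is null, hence the maximum with
    0.\<close>
  define B' where "B' = max B 0"
  have B': "AE \<omega> in M. \<bar>w \<omega>\<bar> \<le> B'" "B' \<ge> 0"
    using w(2) by (auto simp: B'_def)
  \<comment> \<open>For |h| <= 1 the phase moves by at most 2 |h|, so increments up to 2 are enough;
    squaring this bound gives the factor 4 in the final remainder.\<close>
  obtain C where C: "C > 0"
    "\<And>a d. \<bar>a\<bar> \<le> A \<Longrightarrow> \<bar>d\<bar> \<le> 2 \<Longrightarrow> \<bar>\<kappa> (a + d) - \<kappa> a - deriv \<kappa> a * d\<bar> \<le> C * d\<^sup>2"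
    using smooth_taylor[OF \<kappa>, of A 2] by metis
  obtain K where K: "K > 0" "\<And>s. s \<in> {-A..A} \<Longrightarrow> \<bar>deriv \<kappa> s\<bar> \<le> K"
    using smooth_bounded_on_compact[OF smooth_deriv[OF \<kappa>] compact_Icc] by metis
  let ?m = "measure M (space M)"
  let ?L = "\<lambda>h. wave_avg M (\<lambda>\<omega>. w \<omega> * (snd h - fst h \<bullet> \<omega>)) (deriv \<kappa>) z"
  have nh: "\<bar>snd h\<bar> + norm (fst h) \<le> 2 * norm h" for h :: "(real^'n) \<times> real"
    using norm_fst_le[of "fst h" "snd h"] norm_snd_le[of "snd h" "fst h"] by simp
  have int: "integrable M (\<lambda>\<omega>. w \<omega> * (snd h - fst h \<bullet> \<omega>) * deriv \<kappa> (t - x \<bullet> \<omega>))" for h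
  proof (rule integrable_kernel[where B = "B' * (2 * norm h)"])
    show "AE \<omega> in M. \<bar>w \<omega> * (snd h - fst h \<bullet> \<omega>)\<bar> \<le> B' * (2 * norm h)"
      using B'(1) phase_bound[of "snd h" "fst h"]
    proof eventually_elim
      case (elim \<omega>)
      then show ?case using nh[of h] unfolding abs_mult by (intro mult_mono) auto
    qed
    show "(\<lambda>\<omega>. w \<omega> * (snd h - fst h \<bullet> \<omega>)) \<in> borel_measurable borel"
      using w(1) by measurable
  qed (rule smooth_deriv[OF \<kappa>])
  show ?thesis
  proof (rule has_derivative_at_quadratic)
    show "bounded_linear ?L"
    proof (rule bounded_linear_intro[where K = "B' * 2 * K * ?m"])
      show "?L (h + h') = ?L h + ?L h'" for h h'
      proof -
        have "?L (h + h') = (\<integral>\<omega>. w \<omega> * (snd h - fst h \<bullet> \<omega>) * deriv \<kappa> (t - x \<bullet> \<omega>)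
            + w \<omega> * (snd h' - fst h' \<bullet> \<omega>) * deriv \<kappa> (t - x \<bullet> \<omega>) \<partial>M)"
          unfolding wave_avg_def z fst_conv snd_conv
          by (intro Bochner_Integration.integral_cong refl) (simp add: inner_add_left algebra_simps)
        also have "\<dots> = ?L h + ?L h'"
          unfolding wave_avg_def z fst_conv snd_conv
          by (rule Bochner_Integration.integral_add[OF int int])
        finally show ?thesis .
      qed
      show "?L (r *\<^sub>R h) = r *\<^sub>R ?L h" for r h
      proof -
        have "?L (r *\<^sub>R h) = (\<integral>\<omega>. r * (w \<omega> * (snd h - fst h \<bullet> \<omega>) * deriv \<kappa> (t - x \<bullet> \<omega>)) \<partial>M)"
          unfolding wave_avg_def z fst_conv snd_conv
          by (intro Bochner_Integration.integral_cong refl) (simp add: algebra_simps)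
        then show ?thesis unfolding wave_avg_def z by simp
      qed
      show "norm (?L h) \<le> norm h * (B' * 2 * K * ?m)" for h
      proof -
        have "\<bar>?L h\<bar> \<le> B' * (2 * norm h) * K * ?m"
          unfolding wave_avg_def z fst_conv snd_conv
        proof (rule abs_integral_le[OF int])
          show "AE \<omega> in M. \<bar>w \<omega> * (snd h - fst h \<bullet> \<omega>) * deriv \<kappa> (t - x \<bullet> \<omega>)\<bar> \<le> B' * (2 * norm h) * K"
            using B'(1) phase_bound[of "snd h" "fst h"] phase_bound[of t x]
          proof eventually_elim
            case (elim \<omega>)
            have "\<bar>deriv \<kappa> (t - x \<bullet> \<omega>)\<bar> \<le> K"
              using elim by (intro K(2)) (auto simp: A_def)
            then show ?case using elim nh[of h] K(1) B'(2)
              unfolding abs_mult by (intro mult_mono mult_nonneg_nonneg) auto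
          qed
        qed
        then show ?thesis by (simp add: mult_ac)
      qed
    qed
    show "\<bar>wave_avg M w \<kappa> (z + h) - wave_avg M w \<kappa> z - ?L h\<bar> \<le> 4 * B' * C * ?m * (norm h)\<^sup>2"
      if "norm h \<le> 1" for h
    proof -
      let ?r = "\<lambda>\<omega>. w \<omega> * (\<kappa> ((t - x \<bullet> \<omega>) + (snd h - fst h \<bullet> \<omega>)) - \<kappa> (t - x \<bullet> \<omega>)
            - deriv \<kappa> (t - x \<bullet> \<omega>) * (snd h - fst h \<bullet> \<omega>))"
      have eq: "wave_avg M w \<kappa> (z + h) - wave_avg M w \<kappa> z - ?L h =
        (\<integral>\<omega>. ?r \<omega> \<partial>M)"
        and ir: "integrable M ?r"
      proof -
        note i = integrable_kernel[OF w \<kappa>]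
        have r: "?r = (\<lambda>\<omega>. w \<omega> * \<kappa> (t + snd h - (x + fst h) \<bullet> \<omega>) - w \<omega> * \<kappa> (t - x \<bullet> \<omega>)
          - w \<omega> * (snd h - fst h \<bullet> \<omega>) * deriv \<kappa> (t - x \<bullet> \<omega>))"
          by (auto simp: algebra_simps inner_add_left)
        show "integrable M ?r"
          unfolding r by (intro Bochner_Integration.integrable_diff i int)
        show "wave_avg M w \<kappa> (z + h) - wave_avg M w \<kappa> z - ?L h = (\<integral>\<omega>. ?r \<omega> \<partial>M)"
          unfolding r using i int
          by (simp add: wave_avg_def z Bochner_Integration.integrable_diff)
      qed
      have "AE \<omega> in M. \<bar>?r \<omega>\<bar> \<le> B' * (C * (2 * norm h)\<^sup>2)"
        using B'(1) phase_bound[of "snd h" "fst h"] phase_bound[of t x]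
      proof eventually_elim
        case (elim \<omega>)
        have d: "\<bar>snd h - fst h \<bullet> \<omega>\<bar> \<le> 2 * norm h" using elim nh[of h] by auto
        have "\<bar>\<kappa> ((t - x \<bullet> \<omega>) + (snd h - fst h \<bullet> \<omega>)) - \<kappa> (t - x \<bullet> \<omega>)
            - deriv \<kappa> (t - x \<bullet> \<omega>) * (snd h - fst h \<bullet> \<omega>)\<bar> \<le> C * (snd h - fst h \<bullet> \<omega>)\<^sup>2"
          using elim d that by (intro C(2)) (auto simp: A_def)
        also have "\<dots> \<le> C * (2 * norm h)\<^sup>2"
          using C(1) abs_le_square_iff[THEN iffD1, of "snd h - fst h \<bullet> \<omega>" "2 * norm h"] d by (intro mult_left_mono) auto
        finally show ?case
          using elim B'(2) unfolding abs_mult by (intro mult_mono) auto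
      qed
      from abs_integral_le[OF ir this] show ?thesis
        unfolding eq by (simp add: power_mult_distrib mult_ac)
    qed
  qed
qed

text \<open>The induction has to generalise \<open>w\<close>, \<open>B\<close> and
  \<open>\<kappa>\<close>, since each derivative changes all three.\<close>

lemma Ck_on_wave_avg:
  assumes "w \<in> borel_measurable borel" "AE \<omega> in M. \<bar>w \<omega>\<bar> \<le> B" "smooth \<kappa>"
  shows "Ck_on k (wave_avg M w \<kappa>) UNIV"
  using assms
proof (induction k arbitrary: w B \<kappa>)
  case 0
  have "continuous_on UNIV (wave_avg M w \<kappa>)"
    by (rule has_derivative_continuous_on, rule has_derivative_at_withinI, rule wave_avg_has_derivative[OF 0])
  then show ?case by simp
next
  case (Suc k)
  have "Ck_on k (wave_avg M (\<lambda>\<omega>. w \<omega> * (snd h - fst h \<bullet> \<omega>)) (deriv \<kappa>)) UNIV" for h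
  proof (rule Suc.IH[where B = "B * (\<bar>snd h\<bar> + norm (fst h))"])
    show "AE \<omega> in M. \<bar>w \<omega> * (snd h - fst h \<bullet> \<omega>)\<bar> \<le> B * (\<bar>snd h\<bar> + norm (fst h))"
      using Suc.prems(2) phase_bound[of "snd h" "fst h"]
    proof eventually_elim
      case (elim \<omega>)
      then show ?case unfolding abs_mult by (intro mult_mono) auto
    qed
    show "(\<lambda>\<omega>. w \<omega> * (snd h - fst h \<bullet> \<omega>)) \<in> borel_measurable borel"
      using Suc.prems(1) by measurable
  qed (rule smooth_deriv[OF Suc.prems(3)])
  then show ?case
    unfolding Ck_on.simps
    by (intro exI[of _ "\<lambda>z h. wave_avg M (\<lambda>\<omega>. w \<omega> * (snd h - fst h \<bullet> \<omega>)) (deriv \<kappa>) z"] conjI ballI allI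
        wave_avg_has_derivative[OF Suc.prems])
qed

end

subsection \<open>Square-integrable pairings\<close>

lemma continuous_imp_lebesgue_measurable:
  fixes Q :: "'a::euclidean_space \<Rightarrow> 'b::real_normed_vector"
  shows "continuous_on UNIV Q \<Longrightarrow> Q \<in> borel_measurable lebesgue"
  using borel_measurable_continuous_onI[of Q] by (simp add: measurable_completion)

lemma integrable_bounded_support:
  fixes Q :: "'a::euclidean_space \<Rightarrow> 'b::euclidean_space"
  assumes "Q \<in> borel_measurable lebesgue" "\<And>x. norm (Q x) \<le> M" "\<And>x. norm x > \<rho> \<Longrightarrow> Q x = 0"
  shows "integrable lebesgue Q"
proof (rule Bochner_Integration.integrable_bound[of lebesgue "\<lambda>x. M * indicator (cball 0 \<rho>) x"])
  show "integrable lebesgue (\<lambda>x::'a. M * indicator (cball 0 \<rho>) x)"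
    using emeasure_lborel_cball_finite[of "0::'a" \<rho>]
    by (intro integrable_mult_right integrable_real_indicator) auto
  show "AE x in lebesgue. norm (Q x) \<le> norm (M * indicator (cball 0 \<rho>) x)"
  proof (intro AE_I2)
    fix x
    have "norm (Q x) \<le> M * indicator (cball 0 \<rho>) x"
      using assms(2)[of x] assms(3)[of x] by (cases "norm x > \<rho>") auto
    then show "norm (Q x) \<le> norm (M * indicator (cball 0 \<rho>) x)" by simp
  qed
qed (use assms in auto)

lemma L2_diff:
  fixes f g :: "real^'n \<Rightarrow> 'b::euclidean_space"
  assumes "L2 f" "L2 g"
  shows "L2 (\<lambda>x. f x - g x)"
  unfolding L2_def
proof
  show m: "(\<lambda>x. f x - g x) \<in> borel_measurable lebesgue" using assms by (auto simp: L2_def)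
  show "integrable lebesgue (\<lambda>x. (norm (f x - g x))\<^sup>2)"
  proof (rule Bochner_Integration.integrable_bound[of lebesgue "\<lambda>x. 2 * (norm (f x))\<^sup>2 + 2 * (norm (g x))\<^sup>2"])
    show "integrable lebesgue (\<lambda>x. 2 * (norm (f x))\<^sup>2 + 2 * (norm (g x))\<^sup>2)"
      using assms by (auto simp: L2_def)
    show "AE x in lebesgue. norm ((norm (f x - g x))\<^sup>2) \<le> norm (2 * (norm (f x))\<^sup>2 + 2 * (norm (g x))\<^sup>2)"
    proof (intro AE_I2)
      fix x
      have "(norm (f x - g x))\<^sup>2 \<le> (norm (f x) + norm (g x))\<^sup>2"
        by (intro power_mono norm_triangle_ineq4) auto
      also have "\<dots> \<le> 2 * (norm (f x))\<^sup>2 + 2 * (norm (g x))\<^sup>2"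
        using sum_squares_bound[of "norm (f x)" "norm (g x)"] by (simp add: power2_sum)
      finally show "norm ((norm (f x - g x))\<^sup>2) \<le> norm (2 * (norm (f x))\<^sup>2 + 2 * (norm (g x))\<^sup>2)" by simp
    qed
  qed (use m in measurable)
qed

lemma L2_divide:
  fixes f :: "real^'n \<Rightarrow> real"
  shows "L2 f \<Longrightarrow> L2 (\<lambda>x. f x / c)"
  by (auto simp: L2_def power_divide)

lemma integrable_L2_mult:
  fixes f :: "real^'n \<Rightarrow> real" and Q :: "real^'n \<Rightarrow> 'b::euclidean_space"
  assumes "L2 f" "Q \<in> borel_measurable lebesgue" "\<And>x. norm (Q x) \<le> M" "\<And>x. norm x > \<rho> \<Longrightarrow> Q x = 0"
  shows "integrable lebesgue (\<lambda>x. f x *\<^sub>R Q x)"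
proof (rule Bochner_Integration.integrable_bound[of lebesgue "\<lambda>x. (norm (f x))\<^sup>2 + (norm (Q x))\<^sup>2"])
  have "integrable lebesgue (\<lambda>x. (norm (Q x))\<^sup>2)"
  proof (rule integrable_bounded_support[where M = "M\<^sup>2" and \<rho> = \<rho>])
    show "norm ((norm (Q x))\<^sup>2) \<le> M\<^sup>2" for x
      using assms(3)[of x] by (simp add: power_mono)
  qed (use assms in auto)
  then show "integrable lebesgue (\<lambda>x. (norm (f x))\<^sup>2 + (norm (Q x))\<^sup>2)"
    using assms(1) by (intro Bochner_Integration.integrable_add) (auto simp: L2_def)
  show "(\<lambda>x. f x *\<^sub>R Q x) \<in> borel_measurable lebesgue"
    using assms by (auto simp: L2_def intro!: borel_measurable_scaleR)
  show "AE x in lebesgue. norm (f x *\<^sub>R Q x) \<le> norm ((norm (f x))\<^sup>2 + (norm (Q x))\<^sup>2)"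
  proof (intro AE_I2)
    fix x
    have "\<bar>f x\<bar> * norm (Q x) \<le> \<bar>f x\<bar>\<^sup>2 + (norm (Q x))\<^sup>2"
    proof -
      have "2 * (\<bar>f x\<bar> * norm (Q x)) \<le> \<bar>f x\<bar>\<^sup>2 + (norm (Q x))\<^sup>2"
        using sum_squares_bound[of "\<bar>f x\<bar>" "norm (Q x)"] by (simp add: mult.assoc)
      moreover have "0 \<le> \<bar>f x\<bar> * norm (Q x)" by simp
      ultimately show ?thesis by linarith
    qed
    then show "norm (f x *\<^sub>R Q x) \<le> norm ((norm (f x))\<^sup>2 + (norm (Q x))\<^sup>2)" by simp
  qed
qed

lemma integrable_mult_L2:
  fixes f :: "real^'n \<Rightarrow> 'b::euclidean_space" and Q :: "real^'n \<Rightarrow> real"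
  assumes "L2 f" "Q \<in> borel_measurable lebesgue" "\<And>x. \<bar>Q x\<bar> \<le> M" "\<And>x. norm x > \<rho> \<Longrightarrow> Q x = 0"
  shows "integrable lebesgue (\<lambda>x. Q x *\<^sub>R f x)"
proof -
  have "L2 (\<lambda>x. norm (f x))" using assms(1) by (auto simp: L2_def)
  then have "integrable lebesgue (\<lambda>x. norm (f x) *\<^sub>R Q x)"
    using assms by (intro integrable_L2_mult[where M = M and \<rho> = \<rho>]) auto
  then show ?thesis
    by (rule Bochner_Integration.integrable_bound)
       (use assms in \<open>auto simp: L2_def mult.commute abs_mult\<close>)
qed

text \<open>Cauchy-Schwarz, with the L2 norm of \<open>Q\<close> estimated by its supremum times the
  root of the volume of a ball outside which it vanishes.\<close>

lemma L2_pairing_bound: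
  fixes f :: "real^'n \<Rightarrow> real" and Q :: "real^'n \<Rightarrow> real"
  assumes "L2 f" "Q \<in> borel_measurable lebesgue" "\<And>x. \<bar>Q x\<bar> \<le> M" "\<And>x. norm x > \<rho> \<Longrightarrow> Q x = 0"
  shows "\<bar>\<integral>x. f x * Q x \<partial>lebesgue\<bar> \<le> L2_norm f * (M * sqrt (measure lebesgue (cball (0::real^'n) \<rho>)))"
proof -
  let ?B = "cball (0::real^'n) \<rho>"
  have M: "M \<ge> 0" using assms(3)[of 0] by auto
  have [measurable]: "f \<in> borel_measurable lebesgue" "Q \<in> borel_measurable lebesgue"
    using assms by (auto simp: L2_def)
  have i: "integrable lebesgue (\<lambda>x. f x * Q x)"
    using integrable_L2_mult[OF assms(1,2), of M \<rho>] assms by simp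
  have i2: "integrable lebesgue (\<lambda>x. (Q x)\<^sup>2)"
  proof (rule integrable_bounded_support[where M = "M\<^sup>2" and \<rho> = \<rho>])
    show "norm ((Q x)\<^sup>2) \<le> M\<^sup>2" for x
      using assms(3)[of x] power_mono[of "\<bar>Q x\<bar>" M 2] by simp
  qed (use assms in auto)
  have "(\<integral>x. \<bar>f x * Q x\<bar> \<partial>lebesgue)\<^sup>2 \<le> (\<integral>x. (f x)\<^sup>2 \<partial>lebesgue) * (\<integral>x. (Q x)\<^sup>2 \<partial>lebesgue)"
  proof -
    have "(\<integral>\<^sup>+x. ennreal \<bar>f x\<bar> * ennreal \<bar>Q x\<bar> \<partial>lebesgue) = ennreal (\<integral>x. \<bar>f x * Q x\<bar> \<partial>lebesgue)"
      using nn_integral_eq_integral[of lebesgue "\<lambda>x. \<bar>f x * Q x\<bar>"] integrable_abs[OF i]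
      by (simp add: abs_mult ennreal_mult)
    moreover have "(\<integral>\<^sup>+x. (ennreal \<bar>f x\<bar>)\<^sup>2 \<partial>lebesgue) = ennreal (\<integral>x. (f x)\<^sup>2 \<partial>lebesgue)"
      using nn_integral_eq_integral[of lebesgue "\<lambda>x. (f x)\<^sup>2"] assms(1)
      by (simp add: L2_def ennreal_power)
    moreover have "(\<integral>\<^sup>+x. (ennreal \<bar>Q x\<bar>)\<^sup>2 \<partial>lebesgue) = ennreal (\<integral>x. (Q x)\<^sup>2 \<partial>lebesgue)"
      using nn_integral_eq_integral[of lebesgue "\<lambda>x. (Q x)\<^sup>2"] i2
      by (simp add: ennreal_power)
    moreover have "(\<integral>\<^sup>+x. ennreal \<bar>f x\<bar> * ennreal \<bar>Q x\<bar> \<partial>lebesgue)\<^sup>2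
       \<le> (\<integral>\<^sup>+x. (ennreal \<bar>f x\<bar>)\<^sup>2 \<partial>lebesgue) * (\<integral>\<^sup>+x. (ennreal \<bar>Q x\<bar>)\<^sup>2 \<partial>lebesgue)"
      by (intro Cauchy_Schwarz_nn_integral) auto
    ultimately show ?thesis
      by (simp add: ennreal_power flip: ennreal_mult)
  qed
  also have "(\<integral>x. (Q x)\<^sup>2 \<partial>lebesgue) \<le> (\<integral>x. M\<^sup>2 * indicator ?B x \<partial>lebesgue)"
  proof (intro integral_mono_AE i2 AE_I2)
    show "integrable lebesgue (\<lambda>x. M\<^sup>2 * indicator ?B x)"
      using emeasure_lborel_cball_finite[of "0::real^'n" \<rho>]
      by (intro integrable_mult_right integrable_real_indicator) auto
    show "(Q x)\<^sup>2 \<le> M\<^sup>2 * indicator ?B x" for x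
      using assms(3)[of x] assms(4)[of x] power_mono[of "\<bar>Q x\<bar>" M 2] by (cases "norm x > \<rho>") auto
  qed
  also have "\<dots> = M\<^sup>2 * measure lebesgue ?B" by simp
  finally have "(\<integral>x. \<bar>f x * Q x\<bar> \<partial>lebesgue)\<^sup>2 \<le> (\<integral>x. (f x)\<^sup>2 \<partial>lebesgue) * (M\<^sup>2 * measure lebesgue ?B)"
    by (simp add: mult_left_mono)
  then have "(\<integral>x. \<bar>f x * Q x\<bar> \<partial>lebesgue) \<le> sqrt ((\<integral>x. (f x)\<^sup>2 \<partial>lebesgue) * (M\<^sup>2 * measure lebesgue ?B))"
    by (intro real_le_rsqrt)
  also have "\<dots> = L2_norm f * (M * sqrt (measure lebesgue ?B))"
    using M by (simp add: L2_norm_def real_sqrt_mult)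
  finally show ?thesis
    by (rule order_trans[OF integral_abs_bound])
qed

text \<open>Strong L2 convergence meets uniform convergence of multipliers living on one fixed ball;
  the difference is split as \<open>(fs s - f) * Qs s + f * (Qs s - Q)\<close>. Continuity and
  differentiability in time of all pairings below are reduced to this.\<close>

lemma L2_pairing_tendsto:
  fixes f :: "real^'n \<Rightarrow> real" and Q :: "real^'n \<Rightarrow> real"
  assumes f: "L2 f" "\<forall>\<^sub>F s in F. L2 (fs s)" "((\<lambda>s. L2_norm (\<lambda>x. fs s x - f x)) \<longlongrightarrow> 0) F"
    and Q: "Q \<in> borel_measurable lebesgue" "\<And>x. \<bar>Q x\<bar> \<le> M" "\<And>x. norm x > \<rho> \<Longrightarrow> Q x = 0"
    and Qs: "\<And>s. Qs s \<in> borel_measurable lebesgue" "\<And>s x. norm x > \<rho> \<Longrightarrow> Qs s x = 0"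
      "\<forall>\<^sub>F s in F. \<forall>x. \<bar>Qs s x - Q x\<bar> \<le> e s" "(e \<longlongrightarrow> 0) F"
  shows "((\<lambda>s. \<integral>x. fs s x * Qs s x \<partial>lebesgue) \<longlongrightarrow> (\<integral>x. f x * Q x \<partial>lebesgue)) F"
proof -
  define c where "c = sqrt (measure lebesgue (cball (0::real^'n) \<rho>))"
  have "((\<lambda>s. L2_norm (\<lambda>x. fs s x - f x) * ((M + e s) * c) + L2_norm f * (e s * c)) \<longlongrightarrow>
     0 * ((M + 0) * c) + L2_norm f * (0 * c)) F"
    by (intro tendsto_intros f Qs)
  then have lim: "((\<lambda>s. L2_norm (\<lambda>x. fs s x - f x) * ((M + e s) * c) + L2_norm f * (e s * c)) \<longlongrightarrow> 0) F"
    by simp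
  have "((\<lambda>s. (\<integral>x. fs s x * Qs s x \<partial>lebesgue) - (\<integral>x. f x * Q x \<partial>lebesgue)) \<longlongrightarrow> 0) F"
  proof (rule Lim_null_comparison[OF _ lim])
    show "\<forall>\<^sub>F s in F. norm ((\<integral>x. fs s x * Qs s x \<partial>lebesgue) - (\<integral>x. f x * Q x \<partial>lebesgue))
        \<le> L2_norm (\<lambda>x. fs s x - f x) * ((M + e s) * c) + L2_norm f * (e s * c)"
      using f(2) Qs(3)
    proof eventually_elim
      case (elim s)
      have b: "\<bar>Qs s x\<bar> \<le> M + e s" for x using spec[OF elim(2), of x] Q(2)[of x] by linarith
      have d: "L2 (\<lambda>x. fs s x - f x)" using elim f by (intro L2_diff)
      have m: "(\<lambda>x. Qs s x - Q x) \<in> borel_measurable lebesgue" using Qs(1)[of s] Q(1) by simp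
      have i: "integrable lebesgue (\<lambda>x. (fs s x - f x) * Qs s x)"
        "integrable lebesgue (\<lambda>x. f x * (Qs s x - Q x))" "integrable lebesgue (\<lambda>x. f x * Q x)"
        using integrable_L2_mult[OF d Qs(1)[of s] _ Qs(2)[of _ s], of "M + e s"] b
          integrable_L2_mult[OF f(1) m, of "e s" \<rho>] elim(2) Qs(2) Q(3)
          integrable_L2_mult[OF f(1) Q(1), of M \<rho>] Q(2) by auto
      have "(\<integral>x. fs s x * Qs s x \<partial>lebesgue) =
         (\<integral>x. ((fs s x - f x) * Qs s x + f x * (Qs s x - Q x)) + f x * Q x \<partial>lebesgue)"
        by (intro Bochner_Integration.integral_cong) (auto simp: algebra_simps)
      also have "\<dots> = (\<integral>x. (fs s x - f x) * Qs s x \<partial>lebesgue) + (\<integral>x. f x * (Qs s x - Q x) \<partial>lebesgue) + (\<integral>x. f x * Q x \<partial>lebesgue)"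
        using i by simp
      finally have "\<bar>(\<integral>x. fs s x * Qs s x \<partial>lebesgue) - (\<integral>x. f x * Q x \<partial>lebesgue)\<bar> \<le>
         \<bar>\<integral>x. (fs s x - f x) * Qs s x \<partial>lebesgue\<bar> + \<bar>\<integral>x. f x * (Qs s x - Q x) \<partial>lebesgue\<bar>"
        by simp
      also have "\<dots> \<le> L2_norm (\<lambda>x. fs s x - f x) * ((M + e s) * c) + L2_norm f * (e s * c)"
        unfolding c_def
        by (intro add_mono L2_pairing_bound d f(1) m Qs(1) b) (use Qs(2) Q(3) elim(2) in auto)
      finally show ?case by simp
    qed
  qed
  then show ?thesis by (simp add: LIM_zero_iff)
qed

subsection \<open>Time derivatives of pairings\<close>

text \<open>Fixing the direction keeps iterated derivatives scalar functions, in the same form as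
  the clauses of \<open>Ck_on\<close>.\<close>

definition dird :: "'a::real_normed_vector \<Rightarrow> ('a \<Rightarrow> real) \<Rightarrow> 'a \<Rightarrow> real" where
  "dird v f z = frechet_derivative f (at z) v"

lemma smooth_has_derivative: "smooth f \<Longrightarrow> (f has_derivative (\<lambda>v. dird v f z)) (at z)"
  and smooth_dird: "smooth f \<Longrightarrow> smooth (dird v f)"
proof -
  assume f: "smooth f"
  have *: "(f has_derivative (\<lambda>v. dird v f z)) (at z) \<and> Ck_on k (dird v f) UNIV" for k z
  proof -
    have "Ck_on (Suc k) f UNIV" using f by (auto simp: smooth_def)
    then obtain f' where f': "\<forall>x. (f has_derivative f' x) (at x)" "\<forall>v. Ck_on k (\<lambda>x. f' x v) UNIV"
      by auto
    have "f' x = (\<lambda>v. dird v f x)" for x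
      using frechet_derivative_at[OF f'(1)[rule_format]] by (auto simp: dird_def)
    then show ?thesis using f' by (metis (no_types, lifting) ext)
  qed
  show "(f has_derivative (\<lambda>v. dird v f z)) (at z)" using * by blast
  show "smooth (dird v f)" using * unfolding smooth_def by blast
qed

lemma dird_eq: "(f has_derivative f') (at z) \<Longrightarrow> dird v f z = f' v"
  unfolding dird_def using frechet_derivative_at by metis

lemma dird_cong_open:
  assumes "smooth f" "open S" "z \<in> S" "\<And>y. y \<in> S \<Longrightarrow> f y = g y"
  shows "dird v f z = dird v g z"
  using has_derivative_transform_within_open[OF smooth_has_derivative[OF assms(1)] assms(2,3,4)]
  by (simp add: dird_eq)

text \<open>Nothing is asked at negative times, so a smooth slab function is bounded only on time
  intervals {0..T}. This fits test functions on the half-open time interval, which must vanish near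
  T but not near 0.\<close>

definition slab :: "real \<Rightarrow> real \<Rightarrow> ('a::real_normed_vector \<times> real \<Rightarrow> real) \<Rightarrow> bool" where
  "slab \<rho> R Q \<longleftrightarrow> (\<forall>x t. norm x > \<rho> \<or> t > R \<longrightarrow> Q (x, t) = 0)"

lemma slabD: "slab \<rho> R Q \<Longrightarrow> norm x > \<rho> \<Longrightarrow> Q (x, t) = 0" "slab \<rho> R Q \<Longrightarrow> t > R \<Longrightarrow> Q (x, t) = 0"
  by (auto simp: slab_def)

lemma slab_dird:
  assumes "smooth Q" "slab \<rho> R Q"
  shows "slab \<rho> R (dird v Q)"
  unfolding slab_def
proof (intro allI impI)
  fix x :: 'a and t assume *: "norm x > \<rho> \<or> t > R"
  let ?S = "{z::'a \<times> real. norm (fst z) > \<rho>} \<union> {z. snd z > R}"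
  have "open ?S"
    by (intro open_Un open_Collect_less continuous_intros)
  then have "dird v Q (x, t) = dird v (\<lambda>z. 0) (x, t)"
    using * assms(2) by (intro dird_cong_open[OF assms(1)]) (auto simp: slab_def)
  then show "dird v Q (x, t) = 0" by (simp add: dird_eq[of "\<lambda>z. 0" "\<lambda>z. 0"])
qed

abbreviation "dt \<equiv> dird (0, 1)"
abbreviation "dx i \<equiv> dird (axis i 1, 0)"

definition wave_op :: "((real^'n) \<times> real \<Rightarrow> real) \<Rightarrow> (real^'n) \<times> real \<Rightarrow> real" where
  "wave_op \<Psi> z = dt (dt \<Psi>) z - (\<Sum>i\<in>UNIV. dx i (dx i \<Psi>) z)"

lemma smooth_time_derivative:
  assumes "smooth Q"
  shows "((\<lambda>s. Q (x, s)) has_real_derivative dt Q (x, t)) (at t)"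
proof -
  have D: "((\<lambda>s. Q (x, s)) has_derivative (\<lambda>s. dird (0, s) Q (x, t))) (at t)"
    by (rule has_derivative_compose[OF _ smooth_has_derivative[OF assms]]) (auto intro!: derivative_eq_intros)
  have lin: "dird (0, s) Q (x, t) = dt Q (x, t) * s" for s
  proof -
    have "linear (\<lambda>v. dird v Q (x, t))"
      using smooth_has_derivative[OF assms] has_derivative_linear by blast
    from linear_cmul[OF this, of s "(0, 1)"] show ?thesis by (simp add: mult.commute)
  qed
  show ?thesis unfolding has_field_derivative_def by (rule has_derivative_eq_rhs[OF D]) (rule ext, rule lin)
qed

lemma smooth_space_derivative:
  assumes "smooth Q"
  shows "((\<lambda>y. Q (y, t)) has_derivative (\<lambda>v. dird (v, 0) Q (x, t))) (at x)"
  by (rule has_derivative_compose[OF _ smooth_has_derivative[OF assms]]) (auto intro!: derivative_eq_intros)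

lemma smooth_slice: "smooth Q \<Longrightarrow> smooth (\<lambda>x. Q (x, t))"
proof -
  have "Ck_on k (\<lambda>x. Q (x, t)) UNIV" if "smooth Q" for k Q
    using that
  proof (induction k arbitrary: Q)
    case 0
    then show ?case
      by (auto intro!: continuous_on_compose2[OF smooth_imp_continuous_on[of Q UNIV]] continuous_intros)
  next
    case (Suc k)
    then show ?case
      unfolding Ck_on.simps
      by (intro exI[of _ "\<lambda>x v. dird (v, 0) Q (x, t)"] conjI ballI allI)
        (auto intro: smooth_space_derivative smooth_dird)
  qed
  then show "smooth Q \<Longrightarrow> smooth (\<lambda>x. Q (x, t))" unfolding smooth_def[of "\<lambda>x. Q (x, t)"] by blast
qed

lemma slab_slice_measurable:
  fixes Q :: "'a::euclidean_space \<times> real \<Rightarrow> real"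
  shows "smooth Q \<Longrightarrow> (\<lambda>x. Q (x, t)) \<in> borel_measurable lebesgue"
  by (intro continuous_imp_lebesgue_measurable smooth_imp_continuous_on smooth_slice)

lemma slab_bounded:
  fixes Q :: "'a::euclidean_space \<times> real \<Rightarrow> real"
  assumes "smooth Q" "slab \<rho> R Q"
  obtains M where "M > 0" "\<And>x t. t \<in> {0..T} \<Longrightarrow> \<bar>Q (x, t)\<bar> \<le> M"
proof -
  have "compact (cball (0::'a) \<rho> \<times> {0..T})" by (intro compact_Times compact_cball compact_Icc)
  then have "bounded (Q ` (cball 0 \<rho> \<times> {0..T}))"
    by (intro compact_imp_bounded compact_continuous_image smooth_imp_continuous_on assms)
  then obtain M where M: "M > 0" "\<forall>y\<in>Q ` (cball 0 \<rho> \<times> {0..T}). norm y \<le> M"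
    unfolding bounded_pos by blast
  have "\<bar>Q (x, t)\<bar> \<le> M" if "t \<in> {0..T}" for x t
    using that M slabD(1)[OF assms(2), of x t] by (cases "norm x > \<rho>") auto
  then show thesis using M(1) that by blast
qed

text \<open>Both bounds are uniform in \<open>x\<close>, as \<open>L2_pairing_tendsto\<close>
  demands. The second, divided by |s - t|, says that the time difference quotient of
  \<open>Q\<close> converges uniformly to \<open>dt Q\<close>.\<close>

lemma slab_lipschitz:
  fixes Q :: "'a::euclidean_space \<times> real \<Rightarrow> real"
  assumes "smooth Q" "slab \<rho> R Q"
  obtains C where "C > 0" "\<And>x s t. s \<in> {0..T} \<Longrightarrow> t \<in> {0..T} \<Longrightarrow> \<bar>Q (x, s) - Q (x, t)\<bar> \<le> C * \<bar>s - t\<bar>"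
    "\<And>x s t. s \<in> {0..T} \<Longrightarrow> t \<in> {0..T} \<Longrightarrow> \<bar>Q (x, s) - Q (x, t) - dt Q (x, t) * (s - t)\<bar> \<le> C * (s - t)\<^sup>2"
proof -
  have lip: "\<exists>C>0. \<forall>x. \<forall>s\<in>{0..T}. \<forall>t\<in>{0..T}. \<bar>Q (x, s) - Q (x, t)\<bar> \<le> C * \<bar>s - t\<bar>"
    if Q: "smooth Q" "slab \<rho> R Q" for Q :: "'a \<times> real \<Rightarrow> real"
  proof -
    obtain C where C: "C > 0" "\<And>x t. t \<in> {0..T} \<Longrightarrow> \<bar>dt Q (x, t)\<bar> \<le> C"
      by (rule slab_bounded[OF smooth_dird slab_dird, OF Q(1) Q, of T]) blast
    have "norm (Q (x, s) - Q (x, t)) \<le> C * norm (s - t)" if "s \<in> {0..T}" "t \<in> {0..T}" for x s t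
    proof (rule field_differentiable_bound[of "{0..T}" _ "\<lambda>s. dt Q (x, s)"])
      show "((\<lambda>s. Q (x, s)) has_field_derivative dt Q (x, r)) (at r within {0..T})" for r
        by (rule has_field_derivative_at_within[OF smooth_time_derivative[OF Q(1)]])
    qed (use that C(2) in auto)
    then show ?thesis using C(1) by auto
  qed
  obtain C1 where C1: "C1 > 0" "\<And>x s t. s \<in> {0..T} \<Longrightarrow> t \<in> {0..T} \<Longrightarrow> \<bar>Q (x, s) - Q (x, t)\<bar> \<le> C1 * \<bar>s - t\<bar>"
    using lip[OF assms] by auto
  obtain C2 where C2: "C2 > 0" "\<And>x s t. s \<in> {0..T} \<Longrightarrow> t \<in> {0..T} \<Longrightarrow> \<bar>dt Q (x, s) - dt Q (x, t)\<bar> \<le> C2 * \<bar>s - t\<bar>"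
  proof -
    obtain C2 where "C2 > 0" "\<forall>x. \<forall>s\<in>{0..T}. \<forall>t\<in>{0..T}. \<bar>dt Q (x, s) - dt Q (x, t)\<bar> \<le> C2 * \<bar>s - t\<bar>"
      using lip[OF smooth_dird[OF assms(1)] slab_dird[OF assms]] by blast
    then show thesis by (intro that[of C2]) blast+
  qed
  have q: "\<bar>Q (x, s) - Q (x, t) - dt Q (x, t) * (s - t)\<bar> \<le> C2 * (s - t)\<^sup>2" if "s \<in> {0..T}" "t \<in> {0..T}" for x s t
  proof -
    let ?S = "{min s t..max s t}"
    have "norm ((Q (x, s) - dt Q (x, t) * s) - (Q (x, t) - dt Q (x, t) * t)) \<le> C2 * \<bar>s - t\<bar> * norm (s - t)"
    proof (rule field_differentiable_bound[of ?S _ "\<lambda>r. dt Q (x, r) - dt Q (x, t)"])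
      show "((\<lambda>r. Q (x, r) - dt Q (x, t) * r) has_field_derivative dt Q (x, r) - dt Q (x, t)) (at r within ?S)" for r
        by (rule has_field_derivative_at_within)
          (auto intro!: derivative_eq_intros smooth_time_derivative[OF assms(1)])
      show "norm (dt Q (x, r) - dt Q (x, t)) \<le> C2 * \<bar>s - t\<bar>" if r: "r \<in> ?S" for r
      proof -
        have "\<bar>dt Q (x, r) - dt Q (x, t)\<bar> \<le> C2 * \<bar>r - t\<bar>"
          using r \<open>s \<in> {0..T}\<close> \<open>t \<in> {0..T}\<close> by (intro C2(2)) (auto simp: min_def max_def split: if_splits)
        also have "\<dots> \<le> C2 * \<bar>s - t\<bar>"
          using r C2(1) by (intro mult_left_mono) (auto simp: min_def max_def split: if_splits)
        finally show ?thesis by simp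
      qed
    qed auto
    moreover have "(Q (x, s) - dt Q (x, t) * s) - (Q (x, t) - dt Q (x, t) * t) = Q (x, s) - Q (x, t) - dt Q (x, t) * (s - t)"
      by (simp add: algebra_simps)
    moreover have "C2 * \<bar>s - t\<bar> * norm (s - t) = C2 * (s - t)\<^sup>2"
      using power2_abs[of "s - t"] by (simp add: power2_eq_square)
    ultimately show ?thesis by (metis real_norm_def)
  qed
  show thesis
  proof (rule that[of "max C1 C2"])
    show "max C1 C2 > 0" using C1(1) by simp
    fix x s t assume st: "s \<in> {0..T}" "t \<in> {0..T}"
    show "\<bar>Q (x, s) - Q (x, t)\<bar> \<le> max C1 C2 * \<bar>s - t\<bar>"
      using C1(2)[OF st, of x] mult_right_mono[of C1 "max C1 C2" "\<bar>s - t\<bar>"] by simp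
    show "\<bar>Q (x, s) - Q (x, t) - dt Q (x, t) * (s - t)\<bar> \<le> max C1 C2 * (s - t)\<^sup>2"
      using q[OF st, of x] mult_right_mono[of C2 "max C1 C2" "(s - t)\<^sup>2"] by simp
  qed
qed

text \<open>The part of time continuity that \<open>u\<close> (through \<open>C_H1\<close>) and its
  time derivative (through \<open>C1_L2\<close>) share, so that one continuity lemma serves
  both.\<close>

definition C_L2 :: "real \<Rightarrow> (real \<Rightarrow> real^'n \<Rightarrow> real) \<Rightarrow> bool" where
  "C_L2 T w \<longleftrightarrow> (\<forall>t\<in>{0..<T}. L2 (w t) \<and>
      ((\<lambda>s. L2_norm (\<lambda>x. w s x - w t x)) \<longlongrightarrow> 0) (at t within {0..<T}))"

lemma C_H1_imp_C_L2:
  assumes "C_H1 T u Du"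
  shows "C_L2 T u"
  unfolding C_L2_def
proof (intro ballI conjI)
  fix t assume t: "t \<in> {0..<T}"
  show "L2 (u t)" using assms t by (auto simp: C_H1_def H1_def)
  have lim: "((\<lambda>s. H1_norm (\<lambda>x. u s x - u t x) (\<lambda>x. Du s x - Du t x)) \<longlongrightarrow> 0) (at t within {0..<T})"
    using assms t by (auto simp: C_H1_def)
  have "norm (L2_norm (\<lambda>x. u s x - u t x)) \<le> H1_norm (\<lambda>x. u s x - u t x) (\<lambda>x. Du s x - Du t x)" for s
    by (simp add: H1_norm_def L2_norm_def)
  then show "((\<lambda>s. L2_norm (\<lambda>x. u s x - u t x)) \<longlongrightarrow> 0) (at t within {0..<T})"
    by (intro Lim_null_comparison[OF _ lim]) auto
qed

lemma eventually_within: "\<forall>\<^sub>F s in at t within S. s \<in> S \<and> s \<noteq> t"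
  by (simp add: eventually_at_filter)

lemma pairing_continuous:
  fixes w :: "real \<Rightarrow> real^'n \<Rightarrow> real"
  assumes w: "C_L2 T w" and Q: "smooth Q" "slab \<rho> R Q"
  shows "continuous_on {0..<T} (\<lambda>t. \<integral>x. w t x * Q (x, t) \<partial>lebesgue)"
  unfolding continuous_on_def
proof
  fix t assume t: "t \<in> {0..<T}"
  obtain M where M: "M > 0" "\<And>x t. t \<in> {0..T} \<Longrightarrow> \<bar>Q (x, t)\<bar> \<le> M"
    by (rule slab_bounded[OF Q, of T]) blast
  obtain C where C: "C > 0" "\<And>x s t. s \<in> {0..T} \<Longrightarrow> t \<in> {0..T} \<Longrightarrow> \<bar>Q (x, s) - Q (x, t)\<bar> \<le> C * \<bar>s - t\<bar>"
    by (rule slab_lipschitz[OF Q, of T]) blast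
  have w': "\<And>s. s \<in> {0..<T} \<Longrightarrow> L2 (w s)" using w by (auto simp: C_L2_def)
  show "((\<lambda>t. \<integral>x. w t x * Q (x, t) \<partial>lebesgue) \<longlongrightarrow> (\<integral>x. w t x * Q (x, t) \<partial>lebesgue)) (at t within {0..<T})"
  proof (rule L2_pairing_tendsto[where M = M and \<rho> = \<rho> and e = "\<lambda>s. C * \<bar>s - t\<bar>"])
    show "\<forall>\<^sub>F s in at t within {0..<T}. L2 (w s)"
      by (rule eventually_mono[OF eventually_within]) (blast intro: w')
    show "((\<lambda>s. L2_norm (\<lambda>x. w s x - w t x)) \<longlongrightarrow> 0) (at t within {0..<T})"
      using w t by (auto simp: C_L2_def)
    show "\<forall>\<^sub>F s in at t within {0..<T}. \<forall>x. \<bar>Q (x, s) - Q (x, t)\<bar> \<le> C * \<bar>s - t\<bar>"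
      by (rule eventually_mono[OF eventually_within]) (use t in \<open>auto intro!: C(2)\<close>)
    have "((\<lambda>s. C * \<bar>s - t\<bar>) \<longlongrightarrow> C * \<bar>t - t\<bar>) (at t within {0..<T})"
      by (intro tendsto_intros)
    then show "((\<lambda>s. C * \<bar>s - t\<bar>) \<longlongrightarrow> 0) (at t within {0..<T})" by simp
    show "L2 (w t)" using t by (rule w')
    show "\<bar>Q (x, t)\<bar> \<le> M" for x using t by (intro M(2)) auto
  qed (fact slabD(1)[OF Q(2)] slab_slice_measurable[OF Q(1)])+
qed

text \<open>Product rule for L2-valued functions: the difference quotient is that of
  \<open>u\<close> paired with \<open>Q\<close> at the new time, plus \<open>u\<close> at the old
  time paired with that of \<open>Q\<close>. The derivative is one-sided at t = 0.\<close>

lemma pairing_derivative: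
  fixes u :: "real \<Rightarrow> real^'n \<Rightarrow> real"
  assumes u: "C_L2 T u" "C1_L2 T u u'" and Q: "smooth Q" "slab \<rho> R Q" and t: "t \<in> {0..<T}"
  shows "((\<lambda>t. \<integral>x. u t x * Q (x, t) \<partial>lebesgue) has_real_derivative
    (\<integral>x. u' t x * Q (x, t) \<partial>lebesgue) + (\<integral>x. u t x * dt Q (x, t) \<partial>lebesgue)) (at t within {0..<T})"
  unfolding has_field_derivative_iff
proof -
  let ?F = "at t within {0..<T}"
  obtain M where M: "M > 0" "\<And>x t. t \<in> {0..T} \<Longrightarrow> \<bar>Q (x, t)\<bar> \<le> M"
    by (rule slab_bounded[OF Q, of T]) blast
  obtain M' where M': "M' > 0" "\<And>x t. t \<in> {0..T} \<Longrightarrow> \<bar>dt Q (x, t)\<bar> \<le> M'"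
    by (rule slab_bounded[OF smooth_dird slab_dird, OF Q(1) Q, of T]) blast
  obtain C where C: "C > 0" "\<And>x s t. s \<in> {0..T} \<Longrightarrow> t \<in> {0..T} \<Longrightarrow> \<bar>Q (x, s) - Q (x, t)\<bar> \<le> C * \<bar>s - t\<bar>"
    "\<And>x s t. s \<in> {0..T} \<Longrightarrow> t \<in> {0..T} \<Longrightarrow> \<bar>Q (x, s) - Q (x, t) - dt Q (x, t) * (s - t)\<bar> \<le> C * (s - t)\<^sup>2"
    by (rule slab_lipschitz[OF Q, of T]) blast
  have L: "\<And>s. s \<in> {0..<T} \<Longrightarrow> L2 (u s)" "\<And>s. s \<in> {0..<T} \<Longrightarrow> L2 (u' s)"
    using u by (auto simp: C_L2_def C1_L2_def)
  have "((\<lambda>s. C * \<bar>s - t\<bar>) \<longlongrightarrow> C * \<bar>t - t\<bar>) ?F" by (intro tendsto_intros)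
  then have e0: "((\<lambda>s. C * \<bar>s - t\<bar>) \<longlongrightarrow> 0) ?F" by simp
  have 1: "((\<lambda>s. \<integral>x. (u s x - u t x) / (s - t) * Q (x, s) \<partial>lebesgue) \<longlongrightarrow> (\<integral>x. u' t x * Q (x, t) \<partial>lebesgue)) ?F"
  proof (rule L2_pairing_tendsto[where M = M and \<rho> = \<rho> and e = "\<lambda>s. C * \<bar>s - t\<bar>"])
    show "\<forall>\<^sub>F s in ?F. L2 (\<lambda>x. (u s x - u t x) / (s - t))"
      by (rule eventually_mono[OF eventually_within]) (use t in \<open>auto intro!: L2_divide L2_diff L\<close>)
    show "((\<lambda>s. L2_norm (\<lambda>x. (u s x - u t x) / (s - t) - u' t x)) \<longlongrightarrow> 0) ?F"
      using u t by (auto simp: C1_L2_def)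
    show "\<forall>\<^sub>F s in ?F. \<forall>x. \<bar>Q (x, s) - Q (x, t)\<bar> \<le> C * \<bar>s - t\<bar>"
      by (rule eventually_mono[OF eventually_within]) (use t in \<open>auto intro!: C(2)\<close>)
    show "L2 (u' t)" using t by (rule L)
    show "\<bar>Q (x, t)\<bar> \<le> M" for x using t by (intro M(2)) auto
  qed (fact slabD(1)[OF Q(2)] slab_slice_measurable[OF Q(1)] e0)+
  have 2: "((\<lambda>s. \<integral>x. u t x * ((Q (x, s) - Q (x, t)) / (s - t)) \<partial>lebesgue) \<longlongrightarrow> (\<integral>x. u t x * dt Q (x, t) \<partial>lebesgue)) ?F"
  proof (rule L2_pairing_tendsto[where M = M' and \<rho> = \<rho> and e = "\<lambda>s. C * \<bar>s - t\<bar>"])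
    show "((\<lambda>s. L2_norm (\<lambda>x. u t x - u t x)) \<longlongrightarrow> 0) ?F" by (simp add: L2_norm_def)
    show "\<forall>\<^sub>F s in ?F. \<forall>x. \<bar>(Q (x, s) - Q (x, t)) / (s - t) - dt Q (x, t)\<bar> \<le> C * \<bar>s - t\<bar>"
      using eventually_within
    proof eventually_elim
      case (elim s)
      show ?case
      proof
        fix x
        have "\<bar>(Q (x, s) - Q (x, t)) / (s - t) - dt Q (x, t)\<bar>
          = \<bar>Q (x, s) - Q (x, t) - dt Q (x, t) * (s - t)\<bar> / \<bar>s - t\<bar>"
          using elim by (simp add: divide_simps flip: abs_divide)
        also have "\<dots> \<le> C * (s - t)\<^sup>2 / \<bar>s - t\<bar>"
          using elim t by (intro divide_right_mono C(3)) auto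
        also have "\<dots> = C * \<bar>s - t\<bar>"
          using elim by (simp add: divide_simps power2_eq_square flip: abs_mult)
        finally show "\<bar>(Q (x, s) - Q (x, t)) / (s - t) - dt Q (x, t)\<bar> \<le> C * \<bar>s - t\<bar>" .
      qed
    qed
    show "(\<lambda>x. (Q (x, s) - Q (x, t)) / (s - t)) \<in> borel_measurable lebesgue" for s
      using slab_slice_measurable[OF Q(1)] by (intro borel_measurable_divide borel_measurable_diff) auto
    show "L2 (u t)" using t by (rule L)
    show "\<forall>\<^sub>F s in ?F. L2 (u t)" using \<open>L2 (u t)\<close> by simp
    show "\<bar>dt Q (x, t)\<bar> \<le> M'" for x using t by (intro M'(2)) auto
    show "norm x > \<rho> \<Longrightarrow> (Q (x, s) - Q (x, t)) / (s - t) = 0" for s x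
      using slabD(1)[OF Q(2)] by simp
  qed (fact slabD(1)[OF slab_dird[OF Q]] slab_slice_measurable[OF smooth_dird[OF Q(1)]] e0)+
  have "\<forall>\<^sub>F s in ?F. (\<integral>x. (u s x - u t x) / (s - t) * Q (x, s) \<partial>lebesgue) + (\<integral>x. u t x * ((Q (x, s) - Q (x, t)) / (s - t)) \<partial>lebesgue)
     = ((\<integral>x. u s x * Q (x, s) \<partial>lebesgue) - (\<integral>x. u t x * Q (x, t) \<partial>lebesgue)) / (s - t)"
    using eventually_within
  proof eventually_elim
    case (elim s)
    have i: "integrable lebesgue (\<lambda>x. u r x * Q (x, r'))" if "r \<in> {0..<T}" "r' \<in> {0..<T}" for r r'
      using integrable_L2_mult[OF L(1) slab_slice_measurable[OF Q(1)], of r r' M \<rho>] that M slabD(1)[OF Q(2)]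
      by auto
    have a: "(\<lambda>x. (u s x - u t x) / (s - t) * Q (x, s)) = (\<lambda>x. (u s x * Q (x, s) - u t x * Q (x, s)) / (s - t))"
      "(\<lambda>x. u t x * ((Q (x, s) - Q (x, t)) / (s - t))) = (\<lambda>x. (u t x * Q (x, s) - u t x * Q (x, t)) / (s - t))"
      by (auto simp: algebra_simps)
    show ?case
      unfolding a using elim t i by (simp add: add_divide_distrib[symmetric])
  qed
  from Lim_transform_eventually[OF tendsto_add[OF 1 2] this]
  show "((\<lambda>s. ((\<integral>x. u s x * Q (x, s) \<partial>lebesgue) - (\<integral>x. u t x * Q (x, t) \<partial>lebesgue)) / (s - t)) \<longlongrightarrow>
    (\<integral>x. u' t x * Q (x, t) \<partial>lebesgue) + (\<integral>x. u t x * dt Q (x, t) \<partial>lebesgue)) ?F" .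
qed

subsection \<open>The very weak formulation\<close>

lemma smooth_sum: "finite A \<Longrightarrow> (\<And>i. i \<in> A \<Longrightarrow> smooth (f i)) \<Longrightarrow> smooth (\<lambda>x. \<Sum>i\<in>A. f i x)"
  unfolding smooth_def by (blast intro: Ck_on_sum)

lemma smooth_wave_op: "smooth \<Psi> \<Longrightarrow> smooth (wave_op \<Psi>)"
  unfolding wave_op_def[abs_def]
  by (intro smooth_diff smooth_sum smooth_dird) auto

lemma slab_wave_op: "smooth \<Psi> \<Longrightarrow> slab \<rho> R \<Psi> \<Longrightarrow> slab \<rho> R (wave_op \<Psi>)"
proof -
  assume a: "smooth \<Psi>" "slab \<rho> R \<Psi>"
  have "slab \<rho> R (dird v (dird v \<Psi>))" for v
    by (intro slab_dird smooth_dird a)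
  then show ?thesis unfolding slab_def wave_op_def by simp
qed

text \<open>The weak formulation integrates over (0, T) in the Lebesgue sense, the fundamental
  theorem over compact intervals in the gauge sense. A function continuous on [0, T) may misbehave
  at T; vanishing beyond R < T removes this.\<close>

lemma integral_on_open_time:
  fixes k :: "real \<Rightarrow> real"
  assumes "continuous_on {0..<T} k" "\<And>t. t > R \<Longrightarrow> k t = 0" "0 < R" "R < T"
  shows "integrable (lebesgue_on {0<..<T}) k"
    and "integral\<^sup>L (lebesgue_on {0<..<T}) k = integral {0..R} k"
proof -
  have c: "continuous_on {0..R} k"
    using assms by (auto intro: continuous_on_subset)
  then have "set_integrable lebesgue {0..R} k" by (rule absolutely_integrable_continuous_real)
  then have "set_integrable lebesgue {0<..R} k" by (rule set_integrable_subset) auto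
  then have i: "integrable (lebesgue_on {0<..R}) k"
    by (simp add: set_integrable_def integrable_restrict_space)
  have eq: "(\<lambda>t. if t \<in> {0<..<T} then k t else 0) = (\<lambda>t. if t \<in> {0<..R} then k t else 0)"
    using assms(2,4) by fastforce
  show "integrable (lebesgue_on {0<..<T}) k"
    using i eq Lebesgue_Measure.integrable_restrict_UNIV[of "{0<..<T}" k]
      Lebesgue_Measure.integrable_restrict_UNIV[of "{0<..R}" k] by simp
  have "integral\<^sup>L (lebesgue_on {0<..<T}) k = integral\<^sup>L (lebesgue_on {0<..R}) k"
    using eq Lebesgue_Measure.integral_restrict_UNIV[of "{0<..<T}" k]
      Lebesgue_Measure.integral_restrict_UNIV[of "{0<..R}" k] by simp
  also have "\<dots> = integral {0<..R} k" using i by (intro lebesgue_integral_eq_integral) auto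
  also have "\<dots> = integral {0..R} k"
    by (rule integral_spike_set; rule negligible_subset[OF negligible_sing[of 0]]; auto)
  finally show "integral\<^sup>L (lebesgue_on {0<..<T}) k = integral {0..R} k" .
qed

lemma smooth_in_Cc_infty_slab:
  fixes \<Psi> :: "(real^'n) \<times> real \<Rightarrow> real"
  assumes "smooth \<Psi>" "slab \<rho> R \<Psi>" "R < T"
  shows "\<Psi> \<in> Cc_infty (UNIV \<times> {0..<T})"
proof -
  have "compact (cball (0::real^'n) \<rho> \<times> {0..R})"
    by (intro compact_Times compact_cball compact_Icc)
  moreover have "cball (0::real^'n) \<rho> \<times> {0..R} \<subseteq> UNIV \<times> {0..<T}" using assms(3) by auto
  moreover have "\<forall>z \<in> (UNIV \<times> {0..<T}) - (cball (0::real^'n) \<rho> \<times> {0..R}). \<Psi> z = 0"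
  proof
    fix z assume z: "z \<in> (UNIV \<times> {0..<T}) - (cball (0::real^'n) \<rho> \<times> {0..R})"
    obtain x t where "z = (x, t)" by (cases z)
    then show "\<Psi> z = 0"
      using z slabD(1)[OF assms(2), of x t] slabD(2)[OF assms(2), of t x] by (cases "norm x > \<rho>") auto
  qed
  ultimately show ?thesis
    using assms(1) unfolding Cc_infty_def smooth_def by (blast intro: Ck_on_subset)
qed

lemma smooth_slice_in_Cc_infty:
  fixes Q :: "(real^'n) \<times> real \<Rightarrow> real"
  assumes "smooth Q" "slab \<rho> R Q"
  shows "(\<lambda>x. Q (x, t)) \<in> Cc_infty UNIV"
proof -
  have "\<forall>x \<in> UNIV - cball (0::real^'n) \<rho>. Q (x, t) = 0"
    using assms(2) by (auto simp: slab_def)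
  then show ?thesis
    using smooth_slice[OF assms(1), of t] unfolding Cc_infty_def smooth_def
    using compact_cball by blast
qed

lemma grad_slice:
  assumes "smooth Q"
  shows "grad (\<lambda>y. Q (y, t)) x = (\<chi> i. dx i Q (x, t))"
  unfolding grad_def frechet_derivative_at[OF smooth_space_derivative[OF assms], symmetric] ..

lemma slice_integrable:
  fixes w :: "real^'n \<Rightarrow> real"
  assumes "L2 w" "smooth Q" "slab \<rho> R Q" "t \<ge> 0"
  shows "integrable lebesgue (\<lambda>x. w x * Q (x, t))"
proof -
  obtain M where M: "M > 0" "\<And>x s. s \<in> {0..t} \<Longrightarrow> \<bar>Q (x, s)\<bar> \<le> M"
    by (rule slab_bounded[OF assms(2,3), of t]) blast
  have "integrable lebesgue (\<lambda>x. w x *\<^sub>R Q (x, t))"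
    using M(2)[of t] assms(4) slabD(1)[OF assms(3)]
    by (intro integrable_L2_mult[where M = M and \<rho> = \<rho>] assms(1) slab_slice_measurable[OF assms(2)]) auto
  then show ?thesis by simp
qed

text \<open>The weak gradient identity is vector-valued and holds one derivative of its test
  function. It is applied to each \<open>dx i Q\<close>, the component in direction \<open>i\<close>
  is read off, and the components are summed.\<close>

lemma spatial_integration_by_parts:
  fixes w :: "real^'n \<Rightarrow> real"
  assumes w: "H1 w Dw" and Q: "smooth Q" "slab \<rho> R Q" and t: "t \<ge> 0"
  shows "(\<integral>x. Dw x \<bullet> grad (\<lambda>y. Q (y, t)) x \<partial>lebesgue) = - (\<integral>x. w x * (\<Sum>i\<in>UNIV. dx i (dx i Q) (x, t)) \<partial>lebesgue)"
    and "integrable lebesgue (\<lambda>x. Dw x \<bullet> grad (\<lambda>y. Q (y, t)) x)"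
proof -
  have w': "L2 w" "L2 Dw" "weak_gradient w Dw" using w by (auto simp: H1_def)
  have sm: "smooth (dx i Q)" "slab \<rho> R (dx i Q)" "smooth (dx i (dx j Q))" "slab \<rho> R (dx i (dx j Q))" for i j
    by (intro slab_dird smooth_dird Q)+
  have comp: "(\<integral>x. w x * dx j (dx i Q) (x, t) \<partial>lebesgue) = - (\<integral>x. dx i Q (x, t) * Dw x $ j \<partial>lebesgue)"
    and ic: "integrable lebesgue (\<lambda>x. dx i Q (x, t) * Dw x $ j)" for i j
  proof -
    let ?q = "\<lambda>y. dx i Q (y, t)"
    have id: "(\<integral>x. w x *\<^sub>R grad ?q x \<partial>lebesgue) = - (\<integral>x. ?q x *\<^sub>R Dw x \<partial>lebesgue)"
      using w'(3) smooth_slice_in_Cc_infty[OF sm(1,2)] unfolding weak_gradient_def by blast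
    obtain M where M: "M > 0" "\<And>x s. s \<in> {0..t} \<Longrightarrow> \<bar>dx i Q (x, s)\<bar> \<le> M"
      by (rule slab_bounded[OF sm(1,2), of t]) blast
    have i1: "integrable lebesgue (\<lambda>x. ?q x *\<^sub>R Dw x)"
      by (rule integrable_mult_L2[where M = M and \<rho> = \<rho>])
        (use M t w' slabD(1)[OF sm(2)] slab_slice_measurable[OF sm(1)] in auto)
    have i2: "integrable lebesgue (\<lambda>x. w x *\<^sub>R grad ?q x)"
    proof -
      have "integrable lebesgue (\<lambda>x. \<Sum>k\<in>UNIV. (w x * dx k (dx i Q) (x, t)) *\<^sub>R axis k (1::real))"
        by (intro Bochner_Integration.integrable_sum integrable_scaleR_left slice_integrable[OF w'(1) sm(3,4) t])
      moreover have "(\<Sum>k\<in>UNIV. (w x * dx k (dx i Q) (x, t)) *\<^sub>R axis k (1::real)) = w x *\<^sub>R grad ?q x" for x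
        unfolding grad_slice[OF sm(1)]
        by (simp add: vec_eq_iff axis_def if_distrib cong: if_cong)
      ultimately show ?thesis by simp
    qed
    have "(\<integral>x. w x * dx j (dx i Q) (x, t) \<partial>lebesgue) = (\<integral>x. (w x *\<^sub>R grad ?q x) \<bullet> axis j 1 \<partial>lebesgue)"
      by (simp add: grad_slice[OF sm(1)] inner_axis)
    also have "\<dots> = - (\<integral>x. ?q x *\<^sub>R Dw x \<partial>lebesgue) \<bullet> axis j 1"
      using i2 id by (subst integral_inner_left) auto
    also have "\<dots> = - (\<integral>x. (?q x *\<^sub>R Dw x) \<bullet> axis j 1 \<partial>lebesgue)"
      using i1 by (subst integral_inner_left) auto
    finally show "(\<integral>x. w x * dx j (dx i Q) (x, t) \<partial>lebesgue) = - (\<integral>x. dx i Q (x, t) * Dw x $ j \<partial>lebesgue)"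
      by (simp add: inner_axis)
    have "integrable lebesgue (\<lambda>x. (?q x *\<^sub>R Dw x) \<bullet> axis j 1)"
      using i1 by (intro integrable_inner_left) auto
    then show "integrable lebesgue (\<lambda>x. dx i Q (x, t) * Dw x $ j)" by (simp add: inner_axis)
  qed
  have g: "Dw x \<bullet> grad (\<lambda>y. Q (y, t)) x = (\<Sum>i\<in>UNIV. dx i Q (x, t) * Dw x $ i)" for x
    unfolding grad_slice[OF Q(1)] by (simp add: inner_vec_def mult.commute)
  show "integrable lebesgue (\<lambda>x. Dw x \<bullet> grad (\<lambda>y. Q (y, t)) x)"
    unfolding g by (intro Bochner_Integration.integrable_sum ic)
  have "(\<integral>x. w x * (\<Sum>i\<in>UNIV. dx i (dx i Q) (x, t)) \<partial>lebesgue) = (\<Sum>i\<in>UNIV. \<integral>x. w x * dx i (dx i Q) (x, t) \<partial>lebesgue)"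
    unfolding sum_distrib_left
    by (intro Bochner_Integration.integral_sum slice_integrable[OF w'(1) sm(3,4) t])
  then show "(\<integral>x. Dw x \<bullet> grad (\<lambda>y. Q (y, t)) x \<partial>lebesgue) = - (\<integral>x. w x * (\<Sum>i\<in>UNIV. dx i (dx i Q) (x, t)) \<partial>lebesgue)"
    unfolding g comp by (subst Bochner_Integration.integral_sum) (auto intro: ic simp: sum_negf)
qed

text \<open>The weak form has one derivative on each factor. A further integration by parts in time
  and in space puts both on \<open>\<Psi>\<close>, so that only values of \<open>u\<close> remain,
  and these are what the nonlinearity controls. The boundary term at t = 0 carries the initial
  position.\<close>

lemma very_weak_identity:
  fixes u :: "real \<Rightarrow> real^'n \<Rightarrow> real"
  assumes u: "C_H1 T u Du" "C1_L2 T u u'" and u0: "AE x in lebesgue. u 0 x = \<epsilon> * f x"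
    and f: "f \<in> borel_measurable lebesgue"
    and weak: "weak_wave_identity T \<epsilon> g h u' Du"
    and R: "0 < R" "R < T" and \<Psi>: "smooth \<Psi>" "slab \<rho> R \<Psi>"
  shows "\<epsilon> * (\<integral>x. g x * \<Psi> (x, 0) \<partial>lebesgue) + (\<integral>t. (\<integral>x. h t x * \<Psi> (x, t) \<partial>lebesgue) \<partial>lebesgue_on {0<..<T})
    = \<epsilon> * (\<integral>x. f x * dt \<Psi> (x, 0) \<partial>lebesgue)
      + (\<integral>t. (\<integral>x. u t x * wave_op \<Psi> (x, t) \<partial>lebesgue) \<partial>lebesgue_on {0<..<T})"
    and "integrable (lebesgue_on {0<..<T}) (\<lambda>t. \<integral>x. u t x * wave_op \<Psi> (x, t) \<partial>lebesgue)"
proof -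
  define P where "P = dt \<Psi>"
  have P: "smooth P" "slab \<rho> R P" and dP: "smooth (dt P)" "slab \<rho> R (dt P)"
    and W: "smooth (wave_op \<Psi>)" "slab \<rho> R (wave_op \<Psi>)"
    unfolding P_def by (intro smooth_dird slab_dird smooth_wave_op slab_wave_op \<Psi>)+
  have cu: "C_L2 T u" using u(1) by (rule C_H1_imp_C_L2)
  have cu': "C_L2 T u'" using u(2) by (auto simp: C_L2_def C1_L2_def)
  have L: "\<And>s. s \<in> {0..<T} \<Longrightarrow> L2 (u s)" "\<And>s. s \<in> {0..<T} \<Longrightarrow> L2 (u' s)"
    using cu cu' by (auto simp: C_L2_def)
  define H where "H t = (\<integral>x. u t x * P (x, t) \<partial>lebesgue)" for t
  define H' where "H' t = (\<integral>x. u' t x * P (x, t) \<partial>lebesgue) + (\<integral>x. u t x * dt P (x, t) \<partial>lebesgue)" for t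
  define m where "m t = (\<integral>x. u t x * wave_op \<Psi> (x, t) \<partial>lebesgue)" for t
  have cont: "continuous_on {0..<T} H'" "continuous_on {0..<T} m"
    unfolding H'_def m_def
    by (intro continuous_on_add pairing_continuous[OF cu' P] pairing_continuous[OF cu dP] pairing_continuous[OF cu W])+
  have zero: "H' t = 0" "m t = 0" if "t > R" for t
    using that P(2) dP(2) W(2) by (simp_all add: H'_def m_def slab_def)
  note mi = integral_on_open_time[OF cont(2) zero(2) R] and Hi = integral_on_open_time[OF cont(1) zero(1) R]
  from mi(1) show "integrable (lebesgue_on {0<..<T}) (\<lambda>t. \<integral>x. u t x * wave_op \<Psi> (x, t) \<partial>lebesgue)"
    by (simp add: m_def)
  \<comment> \<open>A slab function is known to vanish only for t > R, so the end point must lie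
    strictly between R and T.\<close>
  let ?b = "(R + T) / 2"
  have "(H' has_integral H ?b - H 0) {0..?b}"
  proof (rule fundamental_theorem_of_calculus)
    show "(H has_vector_derivative H' t) (at t within {0..?b})" if "t \<in> {0..?b}" for t
    proof -
      have "(H has_real_derivative H' t) (at t within {0..<T})"
        unfolding H_def H'_def by (rule pairing_derivative[OF cu u(2) P]) (use that R in auto)
      then have "(H has_real_derivative H' t) (at t within {0..?b})"
        by (rule has_field_derivative_subset) (use R in auto)
      then show ?thesis by (simp add: has_real_derivative_iff_has_vector_derivative)
    qed
  qed (use R in auto)
  moreover have "H ?b = 0" using P(2) R by (simp add: H_def slab_def)
  ultimately have "(H' has_integral - H 0) {0..?b}" by simp
  moreover have "integral {0..?b} H' = integral {0..R} H'"
  proof -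
    have "integral {0..?b} H' = integral {0..R} H' + integral {R..?b} H'"
      using R by (intro Henstock_Kurzweil_Integration.integral_combine[symmetric] integrable_continuous_interval
          continuous_on_subset[OF cont(1)]) auto
    moreover have "integral {R..?b} H' = integral {R..?b} (\<lambda>t. 0)"
      by (rule integral_spike[of "{R}"]) (use zero in auto)
    ultimately show ?thesis by simp
  qed
  ultimately have H0: "integral\<^sup>L (lebesgue_on {0<..<T}) H' = - H 0"
    using Hi(2) by (simp add: integral_unique)
  have "H 0 = (\<integral>x. \<epsilon> * (f x * P (x, 0)) \<partial>lebesgue)"
    unfolding H_def
  proof (rule integral_cong_AE)
    have "u 0 \<in> borel_measurable lebesgue" using L(1)[of 0] R by (auto simp: L2_def)
    then show "(\<lambda>x. u 0 x * P (x, 0)) \<in> borel_measurable lebesgue"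
      "(\<lambda>x. \<epsilon> * (f x * P (x, 0))) \<in> borel_measurable lebesgue"
      using f slab_slice_measurable[OF P(1), of 0] by auto
    show "AE x in lebesgue. u 0 x * P (x, 0) = \<epsilon> * (f x * P (x, 0))"
      using u0 by eventually_elim simp
  qed
  then have H00: "H 0 = \<epsilon> * (\<integral>x. f x * dt \<Psi> (x, 0) \<partial>lebesgue)" by (simp add: P_def)
  have inner: "(\<integral>x. - u' t x * deriv (\<lambda>s. \<Psi> (x, s)) t + Du t x \<bullet> grad (\<lambda>y. \<Psi> (y, t)) x \<partial>lebesgue) = m t - H' t"
    if t: "t \<in> {0<..<T}" for t
  proof -
    have h1: "H1 (u t) (Du t)" using u(1) t by (auto simp: C_H1_def)
    have t': "t \<in> {0..<T}" "t \<ge> 0" using t by auto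
    have d: "deriv (\<lambda>s. \<Psi> (x, s)) t = P (x, t)" for x
      unfolding P_def by (rule DERIV_imp_deriv[OF smooth_time_derivative[OF \<Psi>(1)]])
    note i = slice_integrable[OF L(2)[OF t'(1)] P t'(2)] slice_integrable[OF L(1)[OF t'(1)] dP t'(2)]
    have i3: "integrable lebesgue (\<lambda>x. u t x * (\<Sum>i\<in>UNIV. dx i (dx i \<Psi>) (x, t)))"
      unfolding sum_distrib_left
      by (intro Bochner_Integration.integrable_sum slice_integrable[OF L(1)[OF t'(1)] _ _ t'(2), where \<rho> = \<rho> and R = R]
        smooth_dird slab_dird \<Psi>)
    have "m t = (\<integral>x. u t x * dt P (x, t) \<partial>lebesgue) - (\<integral>x. u t x * (\<Sum>i\<in>UNIV. dx i (dx i \<Psi>) (x, t)) \<partial>lebesgue)"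
      unfolding m_def wave_op_def right_diff_distrib P_def
      by (rule Bochner_Integration.integral_diff) (use i i3 in \<open>simp_all add: P_def\<close>)
    moreover have "(\<integral>x. - u' t x * P (x, t) + Du t x \<bullet> grad (\<lambda>y. \<Psi> (y, t)) x \<partial>lebesgue)
      = - (\<integral>x. u' t x * P (x, t) \<partial>lebesgue) + (\<integral>x. Du t x \<bullet> grad (\<lambda>y. \<Psi> (y, t)) x \<partial>lebesgue)"
      using i spatial_integration_by_parts(2)[OF h1 \<Psi> t'(2)]
      by (subst Bochner_Integration.integral_add) auto
    ultimately show ?thesis
      unfolding d spatial_integration_by_parts(1)[OF h1 \<Psi> t'(2)] H'_def by simp
  qed
  have "\<epsilon> * (\<integral>x. g x * \<Psi> (x, 0) \<partial>lebesgue) + (\<integral>t. (\<integral>x. h t x * \<Psi> (x, t) \<partial>lebesgue) \<partial>lebesgue_on {0<..<T})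
    = (\<integral>t. m t - H' t \<partial>lebesgue_on {0<..<T})"
    unfolding bspec[OF weak[unfolded weak_wave_identity_def] smooth_in_Cc_infty_slab[OF \<Psi> R(2)]]
    by (rule Bochner_Integration.integral_cong[OF refl], rule inner) simp
  also have "\<dots> = integral\<^sup>L (lebesgue_on {0<..<T}) m + H 0"
    using mi(1) Hi(1) H0 by simp
  finally show "\<epsilon> * (\<integral>x. g x * \<Psi> (x, 0) \<partial>lebesgue) + (\<integral>t. (\<integral>x. h t x * \<Psi> (x, t) \<partial>lebesgue) \<partial>lebesgue_on {0<..<T})
    = \<epsilon> * (\<integral>x. f x * dt \<Psi> (x, 0) \<partial>lebesgue)
      + (\<integral>t. (\<integral>x. u t x * wave_op \<Psi> (x, t) \<partial>lebesgue) \<partial>lebesgue_on {0<..<T})"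
    using H00 by (simp add: m_def[abs_def])
qed

subsection \<open>Scaling and integrability\<close>

text \<open>The constants are not sharp: either y <= \<theta> x^(q - 1) and the first term alone
  dominates, or solving for x shows that the second one does.\<close>

lemma young_scaled:
  fixes x y q \<theta> :: real
  assumes "0 \<le> x" "0 \<le> y" "1 < q" "0 < \<theta>"
  shows "x * y \<le> \<theta> * x powr q + \<theta> powr (- 1 / (q - 1)) * y powr (q / (q - 1))"
proof (cases "x = 0 \<or> y = 0")
  case False
  then have xy: "x > 0" "y > 0" using assms by auto
  show ?thesis
  proof (cases "y \<le> \<theta> * x powr (q - 1)")
    case True
    have "x * y \<le> x * (\<theta> * x powr (q - 1))" using True xy by (intro mult_left_mono) auto
    also have "\<dots> = \<theta> * x powr q" using xy by (simp add: powr_diff)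
    finally show ?thesis using assms by (simp add: add_increasing2)
  next
    case False
    then have "x powr (q - 1) \<le> y / \<theta>" using assms by (simp add: field_simps)
    then have "(x powr (q - 1)) powr (1 / (q - 1)) \<le> (y / \<theta>) powr (1 / (q - 1))"
      using assms by (intro powr_mono2) auto
    then have "x \<le> (y / \<theta>) powr (1 / (q - 1))" using xy assms by (simp add: powr_powr)
    also have "\<dots> = \<theta> powr (- 1 / (q - 1)) * y powr (1 / (q - 1))"
      using xy assms by (simp add: powr_divide powr_minus_divide)
    finally have "x * y \<le> \<theta> powr (- 1 / (q - 1)) * y powr (1 / (q - 1)) * y"
      using xy by (intro mult_right_mono) auto
    also have "\<dots> = \<theta> powr (- 1 / (q - 1)) * y powr (q / (q - 1))"
    proof -
      have "q / (q - 1) = 1 / (q - 1) + 1" using assms by (simp add: field_simps)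
      then show ?thesis using xy by (simp add: powr_add)
    qed
    finally show ?thesis using assms by (simp add: add_increasing)
  qed
qed (use assms in auto)

text \<open>Evaluating at the balance point of the two terms turns a one-parameter family of bounds
  into a single power inequality. It is linear in \<open>U\<close>, which later becomes the mass on
  a shell.\<close>

lemma optimise_scaling:
  fixes X U K q :: real
  assumes "0 \<le> X" "0 \<le> U" "0 < K" "1 < q"
    and le: "\<And>\<theta>. 0 < \<theta> \<Longrightarrow> X \<le> \<theta> * U + \<theta> powr (- 1 / (q - 1)) * K"
  shows "X powr q \<le> 2 powr q * K powr (q - 1) * U"
proof (cases "U = 0")
  case True
  \<comment> \<open>With U = 0 there is no balance point; letting \<theta> tend to infinity forces X
    = 0.\<close>
  have lim: "((\<lambda>\<theta>. \<theta> powr (- 1 / (q - 1)) * K) \<longlongrightarrow> 0 * K) at_top"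
    using assms by (intro tendsto_mult tendsto_const tendsto_neg_powr filterlim_ident) auto
  have "X \<le> 0 * K"
    by (rule tendsto_lowerbound[OF lim eventually_mono[OF eventually_gt_at_top[of 0]]])
      (use le True in auto)
  then show ?thesis using assms True by simp
next
  case False
  \<comment> \<open>Chosen so that both terms equal K^(1 - 1/q) U^(1/q).\<close>
  define \<theta> where "\<theta> = (K / U) powr ((q - 1) / q)"
  have U: "U > 0" using False assms by simp
  have "\<theta> > 0" using assms U by (simp add: \<theta>_def)
  have 1: "\<theta> * U = K powr (1 - 1 / q) * U powr (1 / q)"
  proof -
    have e: "(q - 1) / q = 1 - 1 / q" using assms by (simp add: field_simps)
    have "\<theta> * U = K powr (1 - 1 / q) / U powr (1 - 1 / q) * U powr 1"
      using assms U by (simp add: \<theta>_def e powr_divide)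
    also have "\<dots> = K powr (1 - 1 / q) * (U powr 1 / U powr (1 - 1 / q))" by simp
    also have "U powr 1 / U powr (1 - 1 / q) = U powr (1 / q)"
      using powr_diff[of U 1 "1 - 1 / q"] by simp
    finally show ?thesis .
  qed
  have 2: "\<theta> powr (- 1 / (q - 1)) * K = K powr (1 - 1 / q) * U powr (1 / q)"
  proof -
    have e: "(q - 1) / q * (- 1 / (q - 1)) = - (1 / q)" using assms by (simp add: field_simps)
    have "\<theta> powr (- 1 / (q - 1)) * K = (K / U) powr (- (1 / q)) * K powr 1"
      using assms by (simp add: \<theta>_def powr_powr e)
    also have "\<dots> = (U powr (1 / q) / K powr (1 / q)) * K powr 1"
      using assms U by (simp add: powr_minus powr_divide inverse_eq_divide)
    also have "\<dots> = (K powr 1 / K powr (1 / q)) * U powr (1 / q)" by simp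
    also have "K powr 1 / K powr (1 / q) = K powr (1 - 1 / q)"
      using powr_diff[of K 1 "1 / q"] by simp
    finally show ?thesis .
  qed
  have "X \<le> 2 * (K powr (1 - 1 / q) * U powr (1 / q))"
    using le[OF \<open>\<theta> > 0\<close>] unfolding 1 2 by (simp add: mult.commute)
  then have "X powr q \<le> (2 * (K powr (1 - 1 / q) * U powr (1 / q))) powr q"
    using assms by (intro powr_mono2) auto
  also have "\<dots> = 2 powr q * (K powr ((1 - 1 / q) * q) * U powr (1 / q * q))"
    using assms U by (simp add: powr_mult powr_powr)
  also have "\<dots> = 2 powr q * K powr (q - 1) * U"
  proof -
    have "(1 - 1 / q) * q = q - 1" "1 / q * q = 1" using assms by (auto simp: field_simps)
    then show ?thesis using U by simp
  qed
  finally show ?thesis .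
qed

section \<open>Space-time integrals against bounded weights\<close>

definition spacetime_integral ::
  "real \<Rightarrow> (real \<Rightarrow> real^'n \<Rightarrow> real) \<Rightarrow> ((real^'n) \<times> real \<Rightarrow> real) \<Rightarrow> real" where
  "spacetime_integral T F w = (\<integral>t. (\<integral>x. F t x * w (x, t) \<partial>lebesgue) \<partial>lebesgue_on {0<..<T})"

definition bounded_weight :: "('a::topological_space \<Rightarrow> real) \<Rightarrow> bool" where
  "bounded_weight w \<longleftrightarrow> w \<in> borel_measurable borel \<and> (\<exists>B. \<forall>z. \<bar>w z\<bar> \<le> B)"

lemma bounded_weight_slice_measurable:
  fixes w :: "(real^'n) \<times> real \<Rightarrow> real"
  assumes "w \<in> borel_measurable borel"
  shows "(\<lambda>x. w (x, t)) \<in> borel_measurable lebesgue"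
proof -
  have "(\<lambda>x. (x, t)) \<in> borel \<rightarrow>\<^sub>M (borel :: ((real^'n) \<times> real) measure)"
    by (intro borel_measurable_continuous_onI continuous_intros)
  then have "(\<lambda>x. w (x, t)) \<in> borel_measurable borel"
    using assms by (rule measurable_compose)
  then show ?thesis by (simp add: measurable_completion)
qed

lemma integrable_mult_bounded_weight:
  fixes w :: "(real^'n) \<times> real \<Rightarrow> real"
  assumes "integrable lebesgue f" "bounded_weight w"
  shows "integrable lebesgue (\<lambda>x. f x * w (x, t))"
proof -
  obtain B where B: "\<And>z. \<bar>w z\<bar> \<le> B" and m: "w \<in> borel_measurable borel"
    using assms(2) by (auto simp: bounded_weight_def)
  show ?thesis
  proof (rule Bochner_Integration.integrable_bound[of lebesgue "\<lambda>x. B * \<bar>f x\<bar>"])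
    show "integrable lebesgue (\<lambda>x. B * \<bar>f x\<bar>)" using assms(1) by simp
    show "AE x in lebesgue. norm (f x * w (x, t)) \<le> norm (B * \<bar>f x\<bar>)"
    proof (intro AE_I2)
      fix x
      have "\<bar>f x\<bar> * \<bar>w (x, t)\<bar> \<le> \<bar>f x\<bar> * B" by (intro mult_left_mono B) auto
      then show "norm (f x * w (x, t)) \<le> norm (B * \<bar>f x\<bar>)"
        using B[of "(x, t)"] by (simp add: abs_mult mult.commute)
    qed
  qed (use assms(1) bounded_weight_slice_measurable[OF m] in auto)
qed

lemma sigma_finite_lebesgue: "sigma_finite_measure (lebesgue :: 'a::euclidean_space measure)"
proof -
  obtain A :: "'a set set" where A: "countable A" "A \<subseteq> sets lborel" "\<Union>A = space lborel" "\<forall>a\<in>A. emeasure lborel a \<noteq> \<infinity>"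
    using lborel.sigma_finite_countable by blast
  then show ?thesis
    by unfold_locales (intro exI[of _ A], auto)
qed

lemma swapped_weight_measurable:
  fixes w :: "(real^'n) \<times> real \<Rightarrow> real"
  assumes "w \<in> borel_measurable borel"
  shows "(\<lambda>(t, x). w (x, t)) \<in> borel_measurable (lebesgue \<Otimes>\<^sub>M lebesgue)"
proof -
  have id: "(\<lambda>x::'a. x) \<in> lebesgue \<rightarrow>\<^sub>M borel" for x :: "'a::euclidean_space"
    by (intro measurable_completion) simp
  have "(\<lambda>z. (snd z, fst z)) \<in> lebesgue \<Otimes>\<^sub>M lebesgue \<rightarrow>\<^sub>M (borel \<Otimes>\<^sub>M borel :: ((real^'n) \<times> real) measure)"
    by (intro measurable_Pair measurable_compose[OF measurable_snd id] measurable_compose[OF measurable_fst id])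
  then have "(\<lambda>z. w (snd z, fst z)) \<in> borel_measurable (lebesgue \<Otimes>\<^sub>M lebesgue)"
    using assms unfolding borel_prod by (rule measurable_compose)
  then show ?thesis by (simp add: case_prod_beta)
qed

lemma simple_L1_slice_measurable:
  fixes w :: "(real^'n) \<times> real \<Rightarrow> real"
  assumes "simple_L1 S" "w \<in> borel_measurable borel"
  shows "(\<lambda>t. \<integral>x. S t x * w (x, t) \<partial>lebesgue) \<in> borel_measurable lebesgue"
proof -
  obtain m A h where A: "\<And>i. i < (m::nat) \<Longrightarrow> A i \<in> sets lebesgue \<and> integrable lebesgue (h i)"
    and S: "S = (\<lambda>t x. \<Sum>i<m. indicator (A i) t * h i x)"
    using assms(1) unfolding simple_L1_def by blast
  interpret sigma_finite_measure "lebesgue :: (real^'n) measure" by (rule sigma_finite_lebesgue)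
  have 1: "(\<lambda>z. w (snd z, fst z)) \<in> borel_measurable (lebesgue \<Otimes>\<^sub>M lebesgue)"
    using swapped_weight_measurable[OF assms(2)] by (simp add: case_prod_beta)
  have 2: "(\<lambda>z. indicator (A i) (fst z) * h i (snd z)) \<in> borel_measurable (lebesgue \<Otimes>\<^sub>M lebesgue)" if "i < m" for i
  proof -
    have [measurable]: "A i \<in> sets lebesgue" "h i \<in> borel_measurable lebesgue" using A[OF that] by auto
    show ?thesis by measurable
  qed
  have "(\<lambda>z. (\<Sum>i<m. indicator (A i) (fst z) * h i (snd z)) * w (snd z, fst z)) \<in> borel_measurable (lebesgue \<Otimes>\<^sub>M lebesgue)"
    by (intro borel_measurable_times borel_measurable_sum 1 2) auto
  then show ?thesis
    unfolding S by (intro borel_measurable_lebesgue_integral) (simp add: case_prod_beta)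
qed

lemma L1_L1_AE_integrable: "L1_L1 T F \<Longrightarrow> AE t in lebesgue_on {0<..<T}. integrable lebesgue (F t)"
  by (simp add: L1_L1_def)

text \<open>The source is measurable as an L1-valued map of time, which says nothing about joint
  measurability of the chosen representatives. Measurability in t of the paired integral comes from
  the simple approximants, whose integrands are jointly measurable; a bounded weight carries their
  L1 limit over.\<close>

lemma L1_L1_slice_integrable:
  fixes w :: "(real^'n) \<times> real \<Rightarrow> real"
  assumes F: "L1_L1 T F" and w: "bounded_weight w"
  shows "integrable (lebesgue_on {0<..<T}) (\<lambda>t. \<integral>x. F t x * w (x, t) \<partial>lebesgue)"
proof -
  obtain B where B: "\<And>z. \<bar>w z\<bar> \<le> B" and m: "w \<in> borel_measurable borel"
    using w by (auto simp: bounded_weight_def)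
  have B0: "B \<ge> 0" using B[of undefined] by linarith
  obtain S where S: "\<And>k::nat. simple_L1 (S k)"
    and lim: "AE t in lebesgue_on {0<..<T}. (\<lambda>k. \<integral>x. \<bar>S k t x - F t x\<bar> \<partial>lebesgue) \<longlonglongrightarrow> 0"
    using F unfolding L1_L1_def by blast
  let ?I = "\<lambda>t. \<integral>x. F t x * w (x, t) \<partial>lebesgue" and ?Ik = "\<lambda>k t. \<integral>x. S k t x * w (x, t) \<partial>lebesgue"
  have Si: "integrable lebesgue (S k t)" for k t
  proof -
    obtain m A h where A: "\<And>i. i < (m::nat) \<Longrightarrow> A i \<in> sets lebesgue \<and> integrable lebesgue (h i)"
      and Sk: "S k = (\<lambda>t x. \<Sum>i<m. indicator (A i) t * h i x)"
      using S[of k] unfolding simple_L1_def by blast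
    show ?thesis
      unfolding Sk by (intro Bochner_Integration.integrable_sum integrable_mult_right) (use A in auto)
  qed
  have bnd: "\<bar>?Ik k t - ?I t\<bar> \<le> B * (\<integral>x. \<bar>S k t x - F t x\<bar> \<partial>lebesgue)" if Ft: "integrable lebesgue (F t)" for k t
  proof -
    have "?Ik k t - ?I t = (\<integral>x. (S k t x - F t x) * w (x, t) \<partial>lebesgue)"
      unfolding left_diff_distrib
      by (intro Bochner_Integration.integral_diff[symmetric] integrable_mult_bounded_weight Si Ft w)
    also have "\<bar>\<dots>\<bar> \<le> (\<integral>x. \<bar>(S k t x - F t x) * w (x, t)\<bar> \<partial>lebesgue)" by (rule integral_abs_bound)
    also have "\<dots> \<le> (\<integral>x. B * \<bar>S k t x - F t x\<bar> \<partial>lebesgue)"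
    proof (rule integral_mono_AE)
      show "integrable lebesgue (\<lambda>x. \<bar>(S k t x - F t x) * w (x, t)\<bar>)"
        by (intro integrable_abs integrable_mult_bounded_weight w Bochner_Integration.integrable_diff Si Ft)
      show "integrable lebesgue (\<lambda>x. B * \<bar>S k t x - F t x\<bar>)"
        by (intro integrable_mult_right integrable_abs Bochner_Integration.integrable_diff Si Ft)
      show "AE x in lebesgue. \<bar>(S k t x - F t x) * w (x, t)\<bar> \<le> B * \<bar>S k t x - F t x\<bar>"
      proof (intro AE_I2)
        fix x
        have "\<bar>w (x, t)\<bar> * \<bar>S k t x - F t x\<bar> \<le> B * \<bar>S k t x - F t x\<bar>" by (intro mult_right_mono B) auto
        then show "\<bar>(S k t x - F t x) * w (x, t)\<bar> \<le> B * \<bar>S k t x - F t x\<bar>" by (simp add: abs_mult mult.commute)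
      qed
    qed
    finally show ?thesis by simp
  qed
  have conv: "AE t in lebesgue_on {0<..<T}. (\<lambda>k. ?Ik k t) \<longlonglongrightarrow> ?I t"
    using lim L1_L1_AE_integrable[OF F]
  proof eventually_elim
    case (elim t)
    have "(\<lambda>k. B * (\<integral>x. \<bar>S k t x - F t x\<bar> \<partial>lebesgue)) \<longlonglongrightarrow> B * 0"
      using elim by (intro tendsto_intros)
    then have z: "(\<lambda>k. B * (\<integral>x. \<bar>S k t x - F t x\<bar> \<partial>lebesgue)) \<longlonglongrightarrow> 0" by simp
    have "(\<lambda>k. ?Ik k t - ?I t) \<longlonglongrightarrow> 0"
      by (rule Lim_null_comparison[OF _ z]) (use bnd elim in \<open>auto intro!: always_eventually\<close>)
    then show ?case by (simp add: LIM_zero_iff)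
  qed
  have meas: "?I \<in> borel_measurable (lebesgue_on {0<..<T})"
  proof -
    \<comment> \<open>\<open>lim\<close> is measurable in t whether or not the sequence converges.
      It differs from the wanted integral only on a null set, which a complete measure
      ignores.\<close>
    let ?J = "\<lambda>t. if t \<in> {0<..<T} then lim (\<lambda>k. ?Ik k t) else 0"
    have lm: "(\<lambda>t. lim (\<lambda>k. ?Ik k t)) \<in> borel_measurable lebesgue"
      by (rule borel_measurable_lim_metric) (rule simple_L1_slice_measurable[OF S m])
    have "?J \<in> borel_measurable lebesgue"
      by (intro measurable_If_set lm) auto
    moreover have "AE t in lebesgue. ?J t = (if t \<in> {0<..<T} then ?I t else 0)"
    proof -
      have "AE t in lebesgue. t \<in> {0<..<T} \<longrightarrow> (\<lambda>k. ?Ik k t) \<longlonglongrightarrow> ?I t"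
        using conv by (subst (asm) AE_restrict_space_iff) auto
      then show ?thesis by eventually_elim (auto simp: limI)
    qed
    ultimately have "(\<lambda>t. if t \<in> {0<..<T} then ?I t else 0) \<in> borel_measurable lebesgue"
      by (rule borel_measurable_AE)
    then have "(\<lambda>t. if t \<in> {0<..<T} then ?I t else 0) \<in> borel_measurable (lebesgue_on {0<..<T})"
      by (rule measurable_restrict_space1)
    then show ?thesis
      by (rule measurable_cong[THEN iffD1, rotated]) auto
  qed
  show ?thesis
  proof (rule Bochner_Integration.integrable_bound[OF _ meas])
    show "integrable (lebesgue_on {0<..<T}) (\<lambda>t. B * (\<integral>x. \<bar>F t x\<bar> \<partial>lebesgue))"
      using F by (simp add: L1_L1_def)
    show "AE t in lebesgue_on {0<..<T}. norm (?I t) \<le> norm (B * (\<integral>x. \<bar>F t x\<bar> \<partial>lebesgue))"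
      using L1_L1_AE_integrable[OF F]
    proof eventually_elim
      case (elim t)
      have "\<bar>?I t\<bar> \<le> (\<integral>x. \<bar>F t x * w (x, t)\<bar> \<partial>lebesgue)" by (rule integral_abs_bound)
      also have "\<dots> \<le> (\<integral>x. B * \<bar>F t x\<bar> \<partial>lebesgue)"
      proof (rule integral_mono_AE)
        show "integrable lebesgue (\<lambda>x. \<bar>F t x * w (x, t)\<bar>)"
          by (intro integrable_abs integrable_mult_bounded_weight w elim)
        show "integrable lebesgue (\<lambda>x. B * \<bar>F t x\<bar>)" using elim by simp
        show "AE x in lebesgue. \<bar>F t x * w (x, t)\<bar> \<le> B * \<bar>F t x\<bar>"
        proof (intro AE_I2)
          fix x
          have "\<bar>w (x, t)\<bar> * \<bar>F t x\<bar> \<le> B * \<bar>F t x\<bar>" by (intro mult_right_mono B) auto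
          then show "\<bar>F t x * w (x, t)\<bar> \<le> B * \<bar>F t x\<bar>" by (simp add: abs_mult mult.commute)
        qed
      qed
      finally show ?case using B0 by simp
    qed
  qed
qed

lemma spacetime_integral_mono:
  assumes F: "L1_L1 T F" and w: "bounded_weight w" "bounded_weight w'"
    and le: "AE t in lebesgue_on {0<..<T}. AE x in lebesgue. F t x * w (x, t) \<le> F t x * w' (x, t)"
  shows "spacetime_integral T F w \<le> spacetime_integral T F w'"
  unfolding spacetime_integral_def
proof (rule integral_mono_AE)
  show "AE t in lebesgue_on {0<..<T}. (\<integral>x. F t x * w (x, t) \<partial>lebesgue) \<le> (\<integral>x. F t x * w' (x, t) \<partial>lebesgue)"
    using L1_L1_AE_integrable[OF F] le
    by eventually_elim (intro integral_mono_AE integrable_mult_bounded_weight w)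
qed (intro L1_L1_slice_integrable F w)+

lemma bounded_weight_add: "bounded_weight w \<Longrightarrow> bounded_weight w' \<Longrightarrow> bounded_weight (\<lambda>z. w z + w' z)"
  unfolding bounded_weight_def
  by (auto, metis abs_triangle_ineq add_mono order_trans)

lemma bounded_weight_cmult: "bounded_weight w \<Longrightarrow> bounded_weight (\<lambda>z. c * w z)"
  unfolding bounded_weight_def
  by (auto simp: abs_mult intro!: exI[of _ "\<bar>c\<bar> * _"] mult_left_mono)

lemma spacetime_integral_add:
  assumes F: "L1_L1 T F" and w: "bounded_weight w" "bounded_weight w'"
  shows "spacetime_integral T F (\<lambda>z. w z + w' z) = spacetime_integral T F w + spacetime_integral T F w'"
proof -
  have "spacetime_integral T F (\<lambda>z. w z + w' z)
    = (\<integral>t. (\<integral>x. F t x * w (x, t) \<partial>lebesgue) + (\<integral>x. F t x * w' (x, t) \<partial>lebesgue) \<partial>lebesgue_on {0<..<T})"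
    unfolding spacetime_integral_def
  proof (rule integral_cong_AE)
    show "AE t in lebesgue_on {0<..<T}. (\<integral>x. F t x * (w (x, t) + w' (x, t)) \<partial>lebesgue)
      = (\<integral>x. F t x * w (x, t) \<partial>lebesgue) + (\<integral>x. F t x * w' (x, t) \<partial>lebesgue)"
      using L1_L1_AE_integrable[OF F] unfolding distrib_left
      by eventually_elim (intro Bochner_Integration.integral_add integrable_mult_bounded_weight w)
  qed (use L1_L1_slice_integrable[OF F] w bounded_weight_add[OF w] in auto)
  then show ?thesis
    unfolding spacetime_integral_def using L1_L1_slice_integrable[OF F] w by simp
qed

lemma spacetime_integral_cmult:
  "spacetime_integral T F (\<lambda>z. c * w z) = c * spacetime_integral T F w"
proof -
  have "(\<lambda>t. \<integral>x. F t x * (c * w (x, t)) \<partial>lebesgue) = (\<lambda>t. c * (\<integral>x. F t x * w (x, t) \<partial>lebesgue))"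
    unfolding mult.left_commute[of _ c] by simp
  then show ?thesis unfolding spacetime_integral_def by simp
qed

lemma spacetime_integral_nonneg:
  assumes "\<And>t x. 0 \<le> F t x * w (x, t)"
  shows "0 \<le> spacetime_integral T F w"
  unfolding spacetime_integral_def by (intro Bochner_Integration.integral_nonneg assms)

text \<open>The time-independent ball is treated as one more source, so that the remainder of
  Young's inequality can be written as a \<open>spacetime_integral\<close> too.\<close>

lemma L1_L1_indicator: "L1_L1 T (\<lambda>t. indicator (cball (0::real^'n) \<rho>))"
proof -
  have i: "integrable lebesgue (indicator (cball (0::real^'n) \<rho>) :: _ \<Rightarrow> real)"
    using emeasure_lborel_cball_finite[of "0::real^'n" \<rho>] by (intro integrable_real_indicator) auto
  have "simple_L1 (\<lambda>t. indicator (cball (0::real^'n) \<rho>))"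
    unfolding simple_L1_def
    by (intro exI[of _ 1] exI[of _ "\<lambda>_. UNIV"] exI[of _ "\<lambda>_. indicator (cball (0::real^'n) \<rho>)"]) (use i in auto)
  moreover have "integrable (lebesgue_on {0<..<T}) (\<lambda>t. c)" for c :: real
    by (intro finite_measure.integrable_const finite_measure_lebesgue_on) simp
  ultimately show ?thesis
    unfolding L1_L1_def using i
    by (auto intro!: exI[of _ "\<lambda>_ t. indicator (cball (0::real^'n) \<rho>)"])
qed

subsection \<open>Cutoffs\<close>

definition cutoff :: "nat \<Rightarrow> real \<Rightarrow> real \<Rightarrow> real" where
  "cutoff n R t = step (t / R) ^ n"

lemma smooth_cutoff: "smooth (cutoff n R)"
proof -
  have "smooth (\<lambda>t. step ((1 / R) * t + 0) ^ n)"
    by (intro smooth_power smooth_compose[OF smooth_step] smooth_affine)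
  then show ?thesis by (simp add: cutoff_def[abs_def])
qed

lemma cutoff_bounds: "0 \<le> cutoff n R t" "cutoff n R t \<le> 1"
  using step_bounds by (auto simp: cutoff_def power_le_one)

lemma cutoff_eq_1: "R > 0 \<Longrightarrow> t \<le> R / 2 \<Longrightarrow> cutoff n R t = 1"
  by (simp add: cutoff_def step_1 field_simps)

lemma cutoff_eq_0: "R > 0 \<Longrightarrow> n > 0 \<Longrightarrow> R \<le> t \<Longrightarrow> cutoff n R t = 0"
  by (simp add: cutoff_def step_0)

lemma deriv_cong_open:
  fixes f g :: "real \<Rightarrow> real"
  assumes "open S" "t \<in> S" "\<And>y. y \<in> S \<Longrightarrow> f y = g y"
  shows "deriv f t = deriv g t"
  by (rule deriv_cong_ev) (use assms in \<open>auto simp: eventually_nhds\<close>)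

lemma cutoff_locally_constant:
  assumes "R > 0" "n > 0" "t < R / 2 \<or> R < t"
  shows "deriv (cutoff n R) t = 0" "deriv (deriv (cutoff n R)) t = 0"
proof -
  have "\<exists>S c. open S \<and> t \<in> S \<and> (\<forall>y\<in>S. cutoff n R y = c)"
    using assms(3)
  proof
    assume "t < R / 2"
    then show ?thesis
      using assms by (intro exI[of _ "{..<R / 2}"] exI[of _ 1]) (auto simp: cutoff_eq_1)
  next
    assume "R < t"
    then show ?thesis
      using assms by (intro exI[of _ "{R<..}"] exI[of _ 0]) (auto simp: cutoff_eq_0)
  qed
  then obtain S c where S: "open S" "t \<in> S" "\<And>y. y \<in> S \<Longrightarrow> cutoff n R y = c" by blast
  have 1: "deriv (cutoff n R) y = 0" if "y \<in> S" for y
    using deriv_cong_open[OF S(1) that S(3)] by simp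
  then show "deriv (cutoff n R) t = 0" using S(2) by simp
  show "deriv (deriv (cutoff n R)) t = 0"
    using deriv_cong_open[OF S(1,2) 1] by simp
qed

lemma deriv_cutoff:
  "deriv (cutoff n R) t = n * step (t / R) ^ (n - 1) * deriv step (t / R) / R"
  "deriv (deriv (cutoff n R)) t =
     (n * (n - 1 :: nat) * step (t / R) ^ (n - 2) * (deriv step (t / R))\<^sup>2
       + n * step (t / R) ^ (n - 1) * deriv (deriv step) (t / R)) / R\<^sup>2"
proof -
  have s: "((\<lambda>t. g (t / R)) has_real_derivative deriv g (t / R) / R) (at t)" if "smooth g" for g t
  proof -
    have "((\<lambda>t. t / R) has_real_derivative 1 / R) (at t)" by (rule DERIV_cdivide[OF DERIV_ident])
    from DERIV_chain2[OF smooth_has_real_derivative[OF that] this] show ?thesis by simp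
  qed
  have p: "((\<lambda>t. step (t / R) ^ k) has_real_derivative k * step (t / R) ^ (k - 1) * (deriv step (t / R) / R)) (at t)" for k t
    using DERIV_power[OF s[OF smooth_step], of k t] by (simp add: mult_ac)
  have 1: "deriv (cutoff n R) t = n * step (t / R) ^ (n - 1) * deriv step (t / R) / R" for t
    unfolding cutoff_def[abs_def] using DERIV_imp_deriv[OF p] by simp
  then show "deriv (cutoff n R) t = n * step (t / R) ^ (n - 1) * deriv step (t / R) / R" .
  have "((\<lambda>t. n * step (t / R) ^ (n - 1) * deriv step (t / R) / R) has_real_derivative
     (n * ((n - 1 :: nat) * step (t / R) ^ (n - 1 - 1) * (deriv step (t / R) / R)) * deriv step (t / R)
      + deriv (deriv step) (t / R) / R * (n * step (t / R) ^ (n - 1))) / R) (at t)"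
    by (intro DERIV_cdivide DERIV_mult DERIV_cmult p s smooth_deriv smooth_step)
  moreover have "deriv (cutoff n R) = (\<lambda>t. n * step (t / R) ^ (n - 1) * deriv step (t / R) / R)"
    by (rule ext) (rule 1)
  moreover have "n - 1 - 1 = n - 2" by simp
  ultimately show "deriv (deriv (cutoff n R)) t =
     (n * (n - 1 :: nat) * step (t / R) ^ (n - 2) * (deriv step (t / R))\<^sup>2
       + n * step (t / R) ^ (n - 1) * deriv (deriv step) (t / R)) / R\<^sup>2"
    by (simp add: DERIV_imp_deriv power2_eq_square add_divide_distrib mult_ac)
qed

text \<open>Two derivatives lower the power of \<open>step\<close> by at most two. The hypothesis on
  \<open>n\<close> says n - 2 >= n / s, and since 0 <= step <= 1 the power n - 2 is then at most the
  power n / s, which is \<open>cutoff\<close> to the power 1 / s. The factors of R come from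
  scaling, so \<open>C\<close> is the same for all R.\<close>

lemma cutoff_derivative_bounds:
  fixes s :: real
  assumes "s > 1" "real n * (1 - 1 / s) \<ge> 2"
  obtains C where "C > 0"
    "\<And>R t. R > 0 \<Longrightarrow> \<bar>deriv (cutoff n R) t\<bar> \<le> C / R * cutoff n R t powr (1 / s)"
    "\<And>R t. R > 0 \<Longrightarrow> \<bar>deriv (deriv (cutoff n R)) t\<bar> \<le> C / R\<^sup>2 * cutoff n R t powr (1 / s)"
proof -
  have n2: "real n - 2 \<ge> n / s" using assms by (simp add: algebra_simps)
  have n0: "n > 0" using assms by (cases "n = 0") auto
  then have "real n / s > 0" using assms(1) by simp
  then have n3: "n > 2" using n2 by linarith
  obtain B where B: "B > 0" "\<And>x. x \<in> {0..1} \<Longrightarrow> \<bar>deriv step x\<bar> \<le> B"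
    using smooth_bounded_on_compact[OF smooth_deriv[OF smooth_step] compact_Icc] by metis
  obtain B' where B': "B' > 0" "\<And>x. x \<in> {0..1} \<Longrightarrow> \<bar>deriv (deriv step) x\<bar> \<le> B'"
    using smooth_bounded_on_compact[OF smooth_deriv[OF smooth_deriv[OF smooth_step]] compact_Icc] by metis
  define C where "C = n * B + n * n * B\<^sup>2 + n * B'"
  have C0: "C > 0" using n0 B B' by (auto simp: C_def intro!: add_pos_pos)
  have key: "step x ^ (n - 2) \<le> (step x ^ n) powr (1 / s)" "step x ^ (n - 1) \<le> (step x ^ n) powr (1 / s)" for x
  proof -
    show *: "step x ^ (n - 2) \<le> (step x ^ n) powr (1 / s)"
    proof (cases "step x = 0")
      case False
      then have "step x > 0" using step_bounds(1)[of x] by simp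
      then have "step x ^ (n - 2) = step x powr (real n - 2)"
        using n3 by (simp add: powr_realpow[symmetric] of_nat_diff)
      also have "\<dots> \<le> step x powr (n / s)"
        using \<open>step x > 0\<close> step_bounds(2)[of x] n2 by (intro powr_mono') auto
      also have "\<dots> = (step x ^ n) powr (1 / s)"
        using \<open>step x > 0\<close> by (simp add: powr_realpow[symmetric] powr_powr)
      finally show ?thesis .
    qed (use n3 in \<open>simp add: power_0_left\<close>)
    have "step x ^ (n - 1) \<le> step x ^ (n - 2)"
      using step_bounds[of x] by (intro power_decreasing) auto
    then show "step x ^ (n - 1) \<le> (step x ^ n) powr (1 / s)" using * by simp
  qed
  have 1: "\<bar>deriv (cutoff n R) t\<bar> \<le> C / R * cutoff n R t powr (1 / s)"
    and 2: "\<bar>deriv (deriv (cutoff n R)) t\<bar> \<le> C / R\<^sup>2 * cutoff n R t powr (1 / s)" if R: "R > 0" for R t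
  proof -
    let ?P = "cutoff n R t powr (1 / s)"
    have "\<bar>deriv (cutoff n R) t\<bar> \<le> C / R * ?P \<and> \<bar>deriv (deriv (cutoff n R)) t\<bar> \<le> C / R\<^sup>2 * ?P"
    proof (cases "t / R \<in> {0..1}")
      case True
      have k: "step (t / R) ^ (n - 2) \<le> ?P" "step (t / R) ^ (n - 1) \<le> ?P"
        using key by (auto simp: cutoff_def)
      have s0: "0 \<le> step (t / R) ^ k" for k using step_bounds by simp
      have "\<bar>deriv (cutoff n R) t\<bar> = n * (step (t / R) ^ (n - 1) * \<bar>deriv step (t / R)\<bar>) / R"
        using R s0 by (simp add: deriv_cutoff abs_mult)
      also have "\<dots> \<le> n * (?P * B) / R"
        using R k B(2)[OF True] s0 by (intro divide_right_mono mult_left_mono mult_mono) auto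
      also have "\<dots> \<le> C / R * ?P"
      proof -
        have "n * B * ?P \<le> C * ?P" unfolding C_def using B B' by (intro mult_right_mono) auto
        then show ?thesis using R by (simp add: field_simps)
      qed
      finally have a: "\<bar>deriv (cutoff n R) t\<bar> \<le> C / R * ?P" .
      have "\<bar>deriv (deriv (cutoff n R)) t\<bar> \<le> (\<bar>n * (n - 1 :: nat) * step (t / R) ^ (n - 2) * (deriv step (t / R))\<^sup>2\<bar>
         + \<bar>n * step (t / R) ^ (n - 1) * deriv (deriv step) (t / R)\<bar>) / R\<^sup>2"
        unfolding deriv_cutoff abs_divide abs_power2 by (intro divide_right_mono abs_triangle_ineq) simp
      also have "\<dots> = (n * (n - 1 :: nat) * (step (t / R) ^ (n - 2) * \<bar>deriv step (t / R)\<bar>\<^sup>2)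
         + n * (step (t / R) ^ (n - 1) * \<bar>deriv (deriv step) (t / R)\<bar>)) / R\<^sup>2"
        using s0 by (simp add: abs_mult)
      also have "\<dots> \<le> (n * n * (?P * B\<^sup>2) + n * (?P * B')) / R\<^sup>2"
        using R k B(2)[OF True] B'(2)[OF True] s0
        by (intro divide_right_mono add_mono mult_mono power_mono) (auto intro!: mult_left_mono)
      also have "\<dots> \<le> C / R\<^sup>2 * ?P"
      proof -
        have "(n * n * B\<^sup>2 + n * B') * ?P \<le> C * ?P" unfolding C_def using B B' by (intro mult_right_mono) auto
        from divide_right_mono[OF this, of "R\<^sup>2"] show ?thesis by (simp add: algebra_simps)
      qed
      finally show ?thesis using a by simp
    next
      case False
      then have "t < R / 2 \<or> R < t" using R by (auto simp: field_simps)
      from cutoff_locally_constant[OF R n0 this] show ?thesis using R C0 by simp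
    qed
    then show "\<bar>deriv (cutoff n R) t\<bar> \<le> C / R * ?P" "\<bar>deriv (deriv (cutoff n R)) t\<bar> \<le> C / R\<^sup>2 * ?P" by auto
  qed
  from C0 1 2 show thesis by (rule that)
qed

section \<open>Product rules and the commutator of the wave operator with a cutoff\<close>

lemma dird_mult:
  assumes "smooth f" "smooth g"
  shows "dird v (\<lambda>z. f z * g z) = (\<lambda>z. f z * dird v g z + dird v f z * g z)"
proof (rule ext)
  fix z
  have "((\<lambda>z. f z * g z) has_derivative (\<lambda>v. f z * dird v g z + dird v f z * g z)) (at z)"
    by (rule has_derivative_mult[OF smooth_has_derivative[OF assms(1)] smooth_has_derivative[OF assms(2)]])
  then show "dird v (\<lambda>z. f z * g z) z = f z * dird v g z + dird v f z * g z" by (rule dird_eq)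
qed

lemma dird_add:
  assumes "smooth f" "smooth g"
  shows "dird v (\<lambda>z. f z + g z) = (\<lambda>z. dird v f z + dird v g z)"
proof (rule ext)
  fix z
  have "((\<lambda>z. f z + g z) has_derivative (\<lambda>v. dird v f z + dird v g z)) (at z)"
    by (rule has_derivative_add[OF smooth_has_derivative[OF assms(1)] smooth_has_derivative[OF assms(2)]])
  then show "dird v (\<lambda>z. f z + g z) z = dird v f z + dird v g z" by (rule dird_eq)
qed

lemma smooth_time: "smooth \<psi> \<Longrightarrow> smooth (\<lambda>z::'a::real_normed_vector \<times> real. \<psi> (snd z))"
  by (rule smooth_compose[OF _ smooth_bounded_linear[OF bounded_linear_snd]])

lemma dird_time:
  assumes "smooth \<psi>"
  shows "dird v (\<lambda>z::'a::real_normed_vector \<times> real. \<psi> (snd z)) = (\<lambda>z. deriv \<psi> (snd z) * snd v)"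
proof (rule ext)
  fix z :: "'a \<times> real"
  have "((\<lambda>z::'a \<times> real. \<psi> (snd z)) has_derivative (\<lambda>v. deriv \<psi> (snd z) * snd v)) (at z)"
    by (rule has_derivative_compose[OF _ smooth_has_real_derivative[OF assms, unfolded has_field_derivative_def]])
      (auto intro!: derivative_eq_intros)
  then show "dird v (\<lambda>z. \<psi> (snd z)) z = deriv \<psi> (snd z) * snd v" by (rule dird_eq)
qed

lemma wave_op_cong_open:
  assumes "smooth f" "open S" "z \<in> S" "\<And>y. y \<in> S \<Longrightarrow> f y = g y"
  shows "wave_op f z = wave_op g z"
proof -
  have "dird v (dird v f) z = dird v (dird v g) z" for v
    by (rule dird_cong_open[OF smooth_dird[OF assms(1)] assms(2,3)])
      (rule dird_cong_open[OF assms(1,2) _ assms(4)])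
  then show ?thesis by (simp add: wave_op_def)
qed

text \<open>The first two terms are the commutator of the wave operator with multiplication by a
  function of time; for a solution \<open>\<phi>\<close> of the wave equation nothing else
  survives.\<close>

lemma wave_op_time_mult:
  fixes \<phi> :: "(real^'n) \<times> real \<Rightarrow> real"
  assumes \<psi>: "smooth \<psi>" and \<phi>: "smooth \<phi>"
  shows "wave_op (\<lambda>z. \<psi> (snd z) * \<phi> z) z =
    deriv (deriv \<psi>) (snd z) * \<phi> z + 2 * deriv \<psi> (snd z) * dt \<phi> z + \<psi> (snd z) * wave_op \<phi> z"
proof -
  note s = smooth_time[OF \<psi>] smooth_time[OF smooth_deriv[OF \<psi>]] smooth_dird[OF \<phi>]
  have t: "dt (dt (\<lambda>z. \<psi> (snd z) * \<phi> z)) z =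
    deriv (deriv \<psi>) (snd z) * \<phi> z + 2 * deriv \<psi> (snd z) * dt \<phi> z + \<psi> (snd z) * dt (dt \<phi>) z"
  proof -
    have "dt (\<lambda>z. \<psi> (snd z) * \<phi> z) = (\<lambda>z. \<psi> (snd z) * dt \<phi> z + deriv \<psi> (snd z) * \<phi> z)"
      by (simp add: dird_mult[OF s(1) \<phi>] dird_time[OF \<psi>])
    then show ?thesis
      by (simp add: dird_add[OF smooth_mult[OF s(1,3)] smooth_mult[OF s(2) \<phi>]] dird_time[OF \<psi>]
        dird_time[OF smooth_deriv[OF \<psi>]] dird_mult[OF s(1,3)] dird_mult[OF s(2) \<phi>])
  qed
  have x: "dx i (dx i (\<lambda>z. \<psi> (snd z) * \<phi> z)) z = \<psi> (snd z) * dx i (dx i \<phi>) z" for i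
    by (simp add: dird_mult[OF s(1) \<phi>] dird_time[OF \<psi>] dird_mult[OF s(1,3)])
  show ?thesis
    unfolding wave_op_def t x by (simp add: sum_distrib_left algebra_simps)
qed

context directions
begin

abbreviation "avg \<equiv> wave_avg M (\<lambda>_. 1)"

lemma dird_wave_avg:
  assumes "w \<in> borel_measurable borel" "AE \<omega> in M. \<bar>w \<omega>\<bar> \<le> B" "smooth \<kappa>"
  shows "dird v (wave_avg M w \<kappa>) = wave_avg M (\<lambda>\<omega>. w \<omega> * (snd v - fst v \<bullet> \<omega>)) (deriv \<kappa>)"
  by (rule ext) (rule dird_eq[OF wave_avg_has_derivative[OF assms]])

lemma smooth_avg: "smooth \<kappa> \<Longrightarrow> smooth (avg \<kappa>)"
  unfolding smooth_def[of "avg \<kappa>"] by (intro allI Ck_on_wave_avg[where B = 1]) auto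

lemma dt_avg: "smooth \<kappa> \<Longrightarrow> dt (avg \<kappa>) = avg (deriv \<kappa>)"
  by (subst dird_wave_avg[where B = 1]) auto

text \<open>Each plane wave is a solution because the squares of the components of a unit vector sum
  to 1, and averaging keeps this.\<close>

lemma wave_op_avg:
  assumes "smooth \<kappa>"
  shows "wave_op (avg \<kappa>) z = 0"
proof -
  have \<kappa>': "smooth (deriv \<kappa>)" "smooth (deriv (deriv \<kappa>))" using assms by (auto intro: smooth_deriv)
  have ab: "AE \<omega> in M. \<bar>\<omega> $ i\<bar> \<le> 1" for i
    using norm_1 by eventually_elim (metis component_le_norm_cart)
  have c: "(\<lambda>\<omega>::real^'n. \<omega> $ i) \<in> borel_measurable borel" for i
    by (intro borel_measurable_continuous_onI continuous_intros)
  have x: "dx i (dx i (avg \<kappa>)) = wave_avg M (\<lambda>\<omega>. (\<omega> $ i)\<^sup>2) (deriv (deriv \<kappa>))" for i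
  proof -
    have "dx i (avg \<kappa>) = wave_avg M (\<lambda>\<omega>. - (\<omega> $ i)) (deriv \<kappa>)"
      using assms by (subst dird_wave_avg[where B = 1]) (auto simp: inner_axis')
    then show ?thesis
      using \<kappa>' ab[of i] c[of i] by (simp add: dird_wave_avg[where B = 1] inner_axis' power2_eq_square)
  qed
  have ab2: "AE \<omega> in M. \<bar>(\<omega> $ i)\<^sup>2\<bar> \<le> 1" for i
    using ab[of i] by eventually_elim (simp add: abs_square_le_1)
  obtain y t where z: "z = (y, t)" by force
  have "(\<Sum>i\<in>UNIV. dx i (dx i (avg \<kappa>)) z) = (\<integral>\<omega>. (\<Sum>i\<in>UNIV. (\<omega> $ i)\<^sup>2 * deriv (deriv \<kappa>) (t - y \<bullet> \<omega>)) \<partial>M)"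
    unfolding x wave_avg_def z fst_conv snd_conv
    by (rule Bochner_Integration.integral_sum[symmetric])
      (intro integrable_kernel[OF _ ab2 \<kappa>'(2)] borel_measurable_power c)
  also have "\<dots> = avg (deriv (deriv \<kappa>)) z"
    unfolding wave_avg_def z fst_conv snd_conv
  proof (rule integral_cong_AE)
    show "AE \<omega> in M. (\<Sum>i\<in>UNIV. (\<omega> $ i)\<^sup>2 * deriv (deriv \<kappa>) (t - y \<bullet> \<omega>)) = 1 * deriv (deriv \<kappa>) (t - y \<bullet> \<omega>)"
      using norm_1
    proof eventually_elim
      case (elim \<omega>)
      then have "(\<Sum>i\<in>UNIV. (\<omega> $ i)\<^sup>2) = 1" by (simp add: norm_eq_1 inner_vec_def power2_eq_square)
      then show ?case by (simp flip: sum_distrib_right)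
    qed
    have i: "integrable M (\<lambda>\<omega>. (\<omega> $ i)\<^sup>2 * deriv (deriv \<kappa>) (t - y \<bullet> \<omega>))" for i
      by (intro integrable_kernel[OF _ ab2 \<kappa>'(2)] borel_measurable_power c)
    show "(\<lambda>\<omega>. \<Sum>i\<in>UNIV. (\<omega> $ i)\<^sup>2 * deriv (deriv \<kappa>) (t - y \<bullet> \<omega>)) \<in> borel_measurable M"
      by (intro borel_measurable_sum borel_measurable_integrable i)
    have "integrable M (\<lambda>\<omega>. 1 * deriv (deriv \<kappa>) (t - y \<bullet> \<omega>))"
      by (intro integrable_kernel[OF _ _ \<kappa>'(2), where B = 1]) auto
    then show "(\<lambda>\<omega>. 1 * deriv (deriv \<kappa>) (t - y \<bullet> \<omega>)) \<in> borel_measurable M" by simp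
  qed
  finally show ?thesis
    unfolding wave_op_def using dt_avg[OF assms] dt_avg[OF \<kappa>'(1)] by simp
qed

text \<open>The second factor makes the support compact. With $\rho$ large it equals $1$ on the part of the
  light cone where the solution lives, so it contributes no commutator terms there.\<close>

definition test_fun :: "nat \<Rightarrow> real \<Rightarrow> real \<Rightarrow> (real \<Rightarrow> real) \<Rightarrow> (real^'n) \<times> real \<Rightarrow> real" where
  "test_fun n R \<rho> \<kappa> z = cutoff n R (snd z) * (step ((fst z \<bullet> fst z) / \<rho>\<^sup>2) * avg \<kappa> z)"

lemma smooth_test_fun:
  assumes "smooth \<kappa>"
  shows "smooth (test_fun n R \<rho> \<kappa>)"
proof -
  have "smooth (\<lambda>z::(real^'n) \<times> real. (1 / \<rho>\<^sup>2) * (fst z \<bullet> fst z))"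
    by (intro smooth_mult smooth_const smooth_compose_bounded_linear[OF bounded_linear_fst smooth_inner_self])
  then have "smooth (\<lambda>z::(real^'n) \<times> real. step ((fst z \<bullet> fst z) / \<rho>\<^sup>2))"
    using smooth_compose[OF smooth_step] by simp
  then show ?thesis
    unfolding test_fun_def[abs_def]
    by (rule smooth_mult[OF smooth_time[OF smooth_cutoff] smooth_mult[OF _ smooth_avg[OF assms]]])
qed

lemma slab_test_fun:
  assumes "R > 0" "n > 0" "\<rho> > 0"
  shows "slab \<rho> R (test_fun n R \<rho> \<kappa>)"
  unfolding slab_def
proof (intro allI impI)
  fix x :: "real^'n" and t assume "norm x > \<rho> \<or> t > R"
  then show "test_fun n R \<rho> \<kappa> (x, t) = 0"
  proof
    assume "norm x > \<rho>"
    then have "\<rho>\<^sup>2 \<le> x \<bullet> x"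
      using assms(3) power_mono[of \<rho> "norm x" 2] by (simp add: power2_norm_eq_inner)
    then show ?thesis using assms(3) by (simp add: test_fun_def step_0)
  qed (use assms in \<open>simp add: test_fun_def cutoff_eq_0\<close>)
qed

lemma space_cutoff_eq_1:
  assumes "\<rho> > 0" "2 * norm x \<le> \<rho>"
  shows "step ((x \<bullet> x) / \<rho>\<^sup>2) = 1"
proof (rule step_1)
  have "(2 * norm x)\<^sup>2 \<le> \<rho>\<^sup>2" using assms by (intro power_mono) auto
  then have "4 * (x \<bullet> x) \<le> \<rho>\<^sup>2" by (simp add: power_mult_distrib power2_norm_eq_inner)
  then have "2 * (x \<bullet> x) \<le> \<rho>\<^sup>2" using inner_ge_zero[of x] by linarith
  then show "(x \<bullet> x) / \<rho>\<^sup>2 \<le> 1 / 2" using assms by (simp add: divide_simps)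
qed

text \<open>On the open set |x| < \<rho> / 2 the spatial cutoff is identically 1, so the test
  function and the plain product agree there together with their derivatives, and only the
  commutator in time is left.\<close>

lemma test_fun_near:
  assumes "\<rho> > 0" "2 * norm x < \<rho>" "smooth \<kappa>"
  shows "test_fun n R \<rho> \<kappa> (x, t) = cutoff n R t * avg \<kappa> (x, t)"
    and "wave_op (test_fun n R \<rho> \<kappa>) (x, t) =
      deriv (deriv (cutoff n R)) t * avg \<kappa> (x, t) + 2 * deriv (cutoff n R) t * avg (deriv \<kappa>) (x, t)"
    and "dt (test_fun n R \<rho> \<kappa>) (x, t) = cutoff n R t * avg (deriv \<kappa>) (x, t) + deriv (cutoff n R) t * avg \<kappa> (x, t)"
proof -
  let ?S = "{z::(real^'n) \<times> real. 2 * norm (fst z) < \<rho>}"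
  have S: "open ?S" "(x, t) \<in> ?S"
    using assms by (auto intro!: open_Collect_less continuous_intros)
  have eq: "test_fun n R \<rho> \<kappa> y = cutoff n R (snd y) * avg \<kappa> y" if "y \<in> ?S" for y
    using that space_cutoff_eq_1[OF assms(1), of "fst y"] by (simp add: test_fun_def)
  show "test_fun n R \<rho> \<kappa> (x, t) = cutoff n R t * avg \<kappa> (x, t)" using eq S by simp
  show "wave_op (test_fun n R \<rho> \<kappa>) (x, t) =
      deriv (deriv (cutoff n R)) t * avg \<kappa> (x, t) + 2 * deriv (cutoff n R) t * avg (deriv \<kappa>) (x, t)"
    using wave_op_cong_open[OF smooth_test_fun[OF assms(3)] S eq]
    by (simp add: wave_op_time_mult[OF smooth_cutoff smooth_avg[OF assms(3)]] wave_op_avg[OF assms(3)] dt_avg[OF assms(3)])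
  show "dt (test_fun n R \<rho> \<kappa>) (x, t) = cutoff n R t * avg (deriv \<kappa>) (x, t) + deriv (cutoff n R) t * avg \<kappa> (x, t)"
    using dird_cong_open[OF smooth_test_fun[OF assms(3)] S eq]
    by (simp add: dird_mult[OF smooth_time[OF smooth_cutoff] smooth_avg[OF assms(3)]] dird_time[OF smooth_cutoff] dt_avg[OF assms(3)])
qed

end

subsection \<open>The test inequality\<close>

text \<open>Negative times down to -r belong to this set as well; truncating it at t <= R leaves a
  compact set.\<close>

definition cone :: "real \<Rightarrow> ((real^'n) \<times> real) set" where
  "cone r = {z. norm (fst z) \<le> r + snd z}"

definition shell :: "real \<Rightarrow> ((real^'n) \<times> real) set" where
  "shell R = {z. R / 2 \<le> snd z \<and> snd z \<le> R}"

lemma sets_cone [measurable]: "cone r \<in> sets borel"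
  unfolding cone_def by (intro borel_closed closed_Collect_le continuous_intros)

lemma sets_shell [measurable]: "shell R \<in> sets borel"
proof -
  have "closed {z::(real^'n) \<times> real. R / 2 \<le> snd z}" "closed {z::(real^'n) \<times> real. snd z \<le> R}"
    by (intro closed_Collect_le continuous_intros)+
  moreover have "shell R = {z::(real^'n) \<times> real. R / 2 \<le> snd z} \<inter> {z. snd z \<le> R}"
    by (auto simp: shell_def)
  ultimately show ?thesis by (metis borel_closed closed_Int)
qed

lemma bounded_weight_on_compact:
  fixes g :: "'a::{second_countable_topology, t2_space} \<Rightarrow> real"
  assumes "A \<in> sets borel" "A \<subseteq> K" "compact K" "continuous_on UNIV g"
  shows "bounded_weight (\<lambda>z. indicator A z * g z)"
  unfolding bounded_weight_def
proof
  have "g \<in> borel_measurable borel" using assms(4) by (rule borel_measurable_continuous_onI)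
  then show "(\<lambda>z. indicator A z * g z) \<in> borel_measurable borel" using assms(1) by measurable
  have "bounded (g ` K)"
    using assms by (intro compact_imp_bounded compact_continuous_image continuous_on_subset[OF assms(4)]) auto
  then obtain B where B: "B > 0" "\<forall>y\<in>g ` K. norm y \<le> B"
    unfolding bounded_pos by blast
  have "\<bar>indicator A z * g z\<bar> \<le> B" for z
    using B assms(2) by (cases "z \<in> A") auto
  then show "\<exists>B. \<forall>z. \<bar>indicator A z * g z\<bar> \<le> B" by blast
qed

lemma bounded_weight_cone:
  fixes g :: "(real^'n) \<times> real \<Rightarrow> real"
  assumes "continuous_on UNIV g"
  shows "bounded_weight (\<lambda>z. indicator (cone r \<inter> {z. snd z \<le> R}) z * g z)"
proof (rule bounded_weight_on_compact[OF _ _ _ assms])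
  show "compact (cball (0::real^'n) (r + R) \<times> {-r..R})"
    by (intro compact_Times compact_cball compact_Icc)
  show "cone r \<inter> {z. snd z \<le> R} \<subseteq> cball (0::real^'n) (r + R) \<times> {-r..R}"
  proof
    fix z :: "(real^'n) \<times> real" assume "z \<in> cone r \<inter> {z. snd z \<le> R}"
    then show "z \<in> cball (0::real^'n) (r + R) \<times> {-r..R}"
      using norm_ge_zero[of "fst z"] by (cases z) (auto simp: cone_def simp del: norm_ge_zero)
  qed
  have "closed {z::(real^'n) \<times> real. snd z \<le> R}" by (intro closed_Collect_le continuous_intros)
  then show "cone r \<inter> {z::(real^'n) \<times> real. snd z \<le> R} \<in> sets borel" by (intro sets.Int sets_cone borel_closed)
qed

lemma bounded_weight_indicator:
  assumes "bounded_weight w" "A \<in> sets borel"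
  shows "bounded_weight (\<lambda>z. indicator A z * w z)"
proof -
  obtain B where B: "\<And>z. \<bar>w z\<bar> \<le> B" and m: "w \<in> borel_measurable borel"
    using assms(1) by (auto simp: bounded_weight_def)
  have "\<bar>indicator A z * w z\<bar> \<le> B" for z
    using B[of z] by (cases "z \<in> A") auto
  moreover have "(\<lambda>z. indicator A z * w z) \<in> borel_measurable borel" using m assms(2) by measurable
  ultimately show ?thesis unfolding bounded_weight_def by blast
qed

lemma bounded_weight_shell_cutoff: "bounded_weight (\<lambda>z::(real^'n) \<times> real. indicator (shell R) z * cutoff n R (snd z))"
proof (rule bounded_weight_indicator[OF _ sets_shell])
  have "(\<lambda>z::(real^'n) \<times> real. cutoff n R (snd z)) \<in> borel_measurable borel"
    by (intro borel_measurable_continuous_onI smooth_imp_continuous_on smooth_time smooth_cutoff)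
  then show "bounded_weight (\<lambda>z::(real^'n) \<times> real. cutoff n R (snd z))"
    unfolding bounded_weight_def using cutoff_bounds by (auto intro!: exI[of _ 1])
qed

context directions
begin

text \<open>The indicator takes over from the spatial cutoff of \<open>test_fun\<close>: the source
  vanishes outside the cone, and cutting there makes the weight bounded for every smooth
  \<open>\<kappa>\<close> without a choice of \<rho>.\<close>

definition cone_weight :: "real \<Rightarrow> nat \<Rightarrow> real \<Rightarrow> (real \<Rightarrow> real) \<Rightarrow> (real^'n) \<times> real \<Rightarrow> real" where
  "cone_weight r n R \<kappa> z = indicator (cone r) z * (cutoff n R (snd z) * avg \<kappa> z)"

lemma bounded_weight_cone_weight:
  assumes "smooth \<kappa>" "R > 0" "n > 0"
  shows "bounded_weight (cone_weight r n R \<kappa>)"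
proof -
  have "continuous_on UNIV (\<lambda>z. cutoff n R (snd z) * avg \<kappa> z)"
    by (rule smooth_imp_continuous_on[OF smooth_mult[OF smooth_time[OF smooth_cutoff] smooth_avg[OF assms(1)]]])
  from bounded_weight_cone[OF this, of r R]
  have "bounded_weight (\<lambda>z. indicator (cone r \<inter> {z. snd z \<le> R}) z * (cutoff n R (snd z) * avg \<kappa> z))" .
  moreover have "(\<lambda>z. indicator (cone r \<inter> {z. snd z \<le> R}) z * (cutoff n R (snd z) * avg \<kappa> z)) = cone_weight r n R \<kappa>"
  proof (rule ext)
    fix z :: "(real^'n) \<times> real"
    show "indicator (cone r \<inter> {z. snd z \<le> R}) z * (cutoff n R (snd z) * avg \<kappa> z) = cone_weight r n R \<kappa> z"
      using cutoff_eq_0[OF assms(2,3), of "snd z"] by (auto simp: cone_weight_def indicator_def)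
  qed
  ultimately show ?thesis by (simp only:)
qed

text \<open>What bounds the wave operator of the test function once \<open>cutoff\<close> to the
  power 1 / q has been split off. \<open>C\<close> is the constant of the cutoff derivatives, and
  the factor 2 comes from the mixed term of the product rule.\<close>

definition derivative_weight :: "real \<Rightarrow> real \<Rightarrow> (real \<Rightarrow> real) \<Rightarrow> (real^'n) \<times> real \<Rightarrow> real" where
  "derivative_weight C R \<kappa> z = C / R\<^sup>2 * \<bar>avg \<kappa> z\<bar> + 2 * (C / R) * \<bar>avg (deriv \<kappa>) z\<bar>"

lemma bounded_weight_derivative_weight:
  assumes "smooth \<kappa>" "s > 0" "C > 0" "R > 0"
  shows "bounded_weight (\<lambda>z. indicator (cone r \<inter> shell R) z * derivative_weight C R \<kappa> z powr s)"
proof -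
  have c: "continuous_on UNIV (avg \<kappa>)" "continuous_on UNIV (avg (deriv \<kappa>))"
    by (intro smooth_imp_continuous_on smooth_avg smooth_deriv assms)+
  have "continuous_on UNIV (\<lambda>z. derivative_weight C R \<kappa> z powr s)"
    unfolding derivative_weight_def
    using assms by (intro continuous_on_powr' continuous_intros c) (auto intro!: add_nonneg_nonneg)
  from bounded_weight_indicator[OF bounded_weight_cone[OF this, of r R] sets_shell[of R]]
  have "bounded_weight (\<lambda>z. indicator (shell R) z * (indicator (cone r \<inter> {z. snd z \<le> R}) z * derivative_weight C R \<kappa> z powr s))" .
  moreover have "(\<lambda>z. indicator (shell R) z * (indicator (cone r \<inter> {z. snd z \<le> R}) z * derivative_weight C R \<kappa> z powr s))
    = (\<lambda>z. indicator (cone r \<inter> shell R) z * derivative_weight C R \<kappa> z powr s)"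
    by (rule ext) (auto simp: indicator_def shell_def)
  ultimately show ?thesis by simp
qed

text \<open>The equation enters here: \<open>very_weak_identity\<close> for \<open>test_fun\<close>,
  rewritten by means of the support conditions. At t = 0 the cutoff equals 1 and has vanishing
  derivative, so the data meet the bare averages.\<close>

lemma test_identity:
  fixes u h :: "real \<Rightarrow> real^'n \<Rightarrow> real"
  assumes u: "C_H1 T u Du" "C1_L2 T u u'" and u0: "AE x in lebesgue. u 0 x = \<epsilon> * f x"
    and weak: "weak_wave_identity T \<epsilon> g h u' Du"
    and fg: "f \<in> borel_measurable lebesgue" "\<And>x. norm x > r \<Longrightarrow> f x = 0" "\<And>x. norm x > r \<Longrightarrow> g x = 0"
    and h: "L1_L1 T h" "AE t in lebesgue_on {0<..<T}. AE x in lebesgue. norm x > r + t \<longrightarrow> h t x = 0"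
    and R: "0 < R" "R < T" and n: "n > 0" and r: "0 \<le> r" and \<kappa>: "smooth \<kappa>"
  defines "\<Psi> \<equiv> test_fun n R (2 * (r + R) + 1) \<kappa>"
  shows "\<epsilon> * ((\<integral>x. g x * avg \<kappa> (x, 0) \<partial>lebesgue) - (\<integral>x. f x * avg (deriv \<kappa>) (x, 0) \<partial>lebesgue))
      + spacetime_integral T h (cone_weight r n R \<kappa>)
    = (\<integral>t. (\<integral>x. u t x * wave_op \<Psi> (x, t) \<partial>lebesgue) \<partial>lebesgue_on {0<..<T})"
    and "integrable (lebesgue_on {0<..<T}) (\<lambda>t. \<integral>x. u t x * wave_op \<Psi> (x, t) \<partial>lebesgue)"
proof -
  \<comment> \<open>Up to time R the cone lies in |x| <= r + R; this value puts it strictly inside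
    |x| < \<rho> / 2.\<close>
  define \<rho> where "\<rho> = 2 * (r + R) + 1"
  have \<rho>: "\<rho> > 0" "\<And>x::real^'n. norm x \<le> r + R \<Longrightarrow> 2 * norm x < \<rho>" using r R by (auto simp: \<rho>_def)
  have \<Psi>': "\<Psi> = test_fun n R \<rho> \<kappa>" by (simp add: \<Psi>_def \<rho>_def)
  have \<Psi>: "smooth \<Psi>" "slab \<rho> R \<Psi>"
    unfolding \<Psi>' by (rule smooth_test_fun[OF \<kappa>], rule slab_test_fun[OF R(1) n \<rho>(1)])
  note near = test_fun_near[OF \<rho>(1) _ \<kappa>, of _ n R, folded \<rho>_def]
  note id = very_weak_identity[OF u u0 fg(1) weak R \<Psi>]
  show "integrable (lebesgue_on {0<..<T}) (\<lambda>t. \<integral>x. u t x * wave_op \<Psi> (x, t) \<partial>lebesgue)" by (rule id(2))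
  have 1: "(\<integral>x. g x * \<Psi> (x, 0) \<partial>lebesgue) = (\<integral>x. g x * avg \<kappa> (x, 0) \<partial>lebesgue)"
  proof (rule Bochner_Integration.integral_cong[OF refl])
    fix x
    show "g x * \<Psi> (x, 0) = g x * avg \<kappa> (x, 0)"
    proof (cases "norm x > r")
      case False
      then have "2 * norm x < \<rho>" using R by (intro \<rho>(2)) auto
      then show ?thesis using near(1)[of x 0] R by (simp add: \<Psi>' cutoff_eq_1)
    qed (simp add: fg)
  qed
  have 2: "(\<integral>x. f x * dt \<Psi> (x, 0) \<partial>lebesgue) = (\<integral>x. f x * avg (deriv \<kappa>) (x, 0) \<partial>lebesgue)"
  proof (rule Bochner_Integration.integral_cong[OF refl])
    fix x
    show "f x * dt \<Psi> (x, 0) = f x * avg (deriv \<kappa>) (x, 0)"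
    proof (cases "norm x > r")
      case False
      then have "2 * norm x < \<rho>" using R by (intro \<rho>(2)) auto
      then show ?thesis using near(3)[of x 0] R cutoff_locally_constant(1)[OF R(1) n, of 0]
        by (simp add: \<Psi>' cutoff_eq_1)
    qed (simp add: fg)
  qed
  have 3: "(\<integral>t. (\<integral>x. h t x * \<Psi> (x, t) \<partial>lebesgue) \<partial>lebesgue_on {0<..<T}) = spacetime_integral T h (cone_weight r n R \<kappa>)"
  proof -
    \<comment> \<open>\<open>\<Psi>\<close> is known to be bounded on nonnegative times only,
      whereas a bounded weight must be bounded everywhere. The indicator repairs this without
      changing the integral over (0, T).\<close>
    let ?w = "\<lambda>z::(real^'n) \<times> real. indicator {z. 0 \<le> snd z} z * \<Psi> z"
    have cl: "closed {z::(real^'n) \<times> real. 0 \<le> snd z}" by (intro closed_Collect_le continuous_intros)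
    have bw: "bounded_weight ?w"
    proof -
      obtain B where B: "B > 0" "\<And>x t. t \<in> {0..R} \<Longrightarrow> \<bar>\<Psi> (x, t)\<bar> \<le> B"
        by (rule slab_bounded[OF \<Psi>, of R]) blast
      have "\<bar>?w z\<bar> \<le> B" for z
      proof (cases z)
        case (Pair x t)
        then show ?thesis
          using B(1) B(2)[of t x] slabD(2)[OF \<Psi>(2), of t x] by (cases "t > R"; cases "0 \<le> t") auto
      qed
      moreover have "?w \<in> borel_measurable borel"
        using borel_closed[OF cl] borel_measurable_continuous_onI[OF smooth_imp_continuous_on[OF \<Psi>(1)]] by measurable
      ultimately show ?thesis unfolding bounded_weight_def by blast
    qed
    have cw: "bounded_weight (cone_weight r n R \<kappa>)" using \<kappa> R n by (intro bounded_weight_cone_weight) auto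
    have "(\<integral>t. (\<integral>x. h t x * \<Psi> (x, t) \<partial>lebesgue) \<partial>lebesgue_on {0<..<T}) = spacetime_integral T h ?w"
      unfolding spacetime_integral_def by (rule Bochner_Integration.integral_cong[OF refl]) simp
    also have "\<dots> = spacetime_integral T h (cone_weight r n R \<kappa>)"
      unfolding spacetime_integral_def
    proof (rule integral_cong_AE)
      show "AE t in lebesgue_on {0<..<T}. (\<integral>x. h t x * ?w (x, t) \<partial>lebesgue) = (\<integral>x. h t x * cone_weight r n R \<kappa> (x, t) \<partial>lebesgue)"
        using h(2) L1_L1_AE_integrable[OF h(1)] AE_space
      proof eventually_elim
        case (elim t)
        then have t: "0 < t" by simp
        show ?case
        proof (rule integral_cong_AE)
          show "AE x in lebesgue. h t x * ?w (x, t) = h t x * cone_weight r n R \<kappa> (x, t)"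
            using elim(1)
          proof eventually_elim
            case (elim x)
            show ?case
            proof (cases "norm x > r + t")
              case False
              then have c: "(x, t) \<in> cone r" by (simp add: cone_def)
              show ?thesis
              proof (cases "t > R")
                case True
                then show ?thesis using slabD(2)[OF \<Psi>(2) True, of x] cutoff_eq_0[OF R(1) n, of t]
                  by (simp add: cone_weight_def)
              next
                case False
                then have "2 * norm x < \<rho>" using \<open>\<not> norm x > r + t\<close> by (intro \<rho>(2)) auto
                then show ?thesis using near(1)[of x t] t c by (simp add: \<Psi>' cone_weight_def)
              qed
            qed (use elim in simp)
          qed
        qed (use elim(2) integrable_mult_bounded_weight bw cw in \<open>auto intro!: borel_measurable_integrable\<close>)
      qed
    qed (use L1_L1_slice_integrable[OF h(1)] bw cw in \<open>auto intro!: borel_measurable_integrable\<close>)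
    finally show ?thesis .
  qed
  from id(1) show "\<epsilon> * ((\<integral>x. g x * avg \<kappa> (x, 0) \<partial>lebesgue) - (\<integral>x. f x * avg (deriv \<kappa>) (x, 0) \<partial>lebesgue))
      + spacetime_integral T h (cone_weight r n R \<kappa>)
    = (\<integral>t. (\<integral>x. u t x * wave_op \<Psi> (x, t) \<partial>lebesgue) \<partial>lebesgue_on {0<..<T})"
    unfolding 1 2 3 by (simp add: right_diff_distrib)
qed

text \<open>The factor \<open>cutoff\<close> to the power 1 / q is given to \<open>u\<close>: raised
  to the power q it yields |u|^q times \<open>cutoff\<close>, which \<open>F\<close> divided by
  \<open>b\<close> dominates. Young's inequality then leaves \<open>derivative_weight\<close> alone
  in the second term.\<close>

lemma test_inequality_scaled:
  fixes u h F :: "real \<Rightarrow> real^'n \<Rightarrow> real"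
  assumes u: "C_H1 T u Du" "C1_L2 T u u'" and u0: "AE x in lebesgue. u 0 x = \<epsilon> * f x"
    and weak: "weak_wave_identity T \<epsilon> g h u' Du"
    and fg: "f \<in> borel_measurable lebesgue" "\<And>x. norm x > r \<Longrightarrow> f x = 0" "\<And>x. norm x > r \<Longrightarrow> g x = 0"
    and h: "L1_L1 T h"
    and vanish: "AE t in lebesgue_on {0<..<T}. AE x in lebesgue. norm x > r + t \<longrightarrow> u t x = 0 \<and> h t x = 0"
    and F: "L1_L1 T F" "\<And>t x. b * \<bar>u t x\<bar> powr q \<le> F t x" "b > 0" "q > 1"
    and C: "C > 0" "\<And>t. \<bar>deriv (cutoff n R) t\<bar> \<le> C / R * cutoff n R t powr (1 / q)"
      "\<And>t. \<bar>deriv (deriv (cutoff n R)) t\<bar> \<le> C / R\<^sup>2 * cutoff n R t powr (1 / q)"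
    and R: "0 < R" "R < T" and n: "n > 0" and r: "0 \<le> r" and \<kappa>: "smooth \<kappa>" and \<theta>: "\<theta> > 0"
  shows "\<epsilon> * ((\<integral>x. g x * avg \<kappa> (x, 0) \<partial>lebesgue) - (\<integral>x. f x * avg (deriv \<kappa>) (x, 0) \<partial>lebesgue))
      + spacetime_integral T h (cone_weight r n R \<kappa>)
    \<le> \<theta> * (spacetime_integral T F (\<lambda>z. indicator (shell R) z * cutoff n R (snd z)) / b)
      + \<theta> powr (- 1 / (q - 1)) * spacetime_integral T (\<lambda>t. indicator (cball 0 (r + R)))
          (\<lambda>z. indicator (cone r \<inter> shell R) z * derivative_weight C R \<kappa> z powr (q / (q - 1)))"
proof -
  define \<rho> where "\<rho> = 2 * (r + R) + 1"
  define \<Psi> where "\<Psi> = test_fun n R \<rho> \<kappa>"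
  have \<rho>: "\<rho> > 0" "\<And>x::real^'n. norm x \<le> r + R \<Longrightarrow> 2 * norm x < \<rho>" using r R by (auto simp: \<rho>_def)
  have \<Psi>: "smooth \<Psi>" "slab \<rho> R \<Psi>"
    unfolding \<Psi>_def by (rule smooth_test_fun[OF \<kappa>], rule slab_test_fun[OF R(1) n \<rho>(1)])
  have hv: "AE t in lebesgue_on {0<..<T}. AE x in lebesgue. norm x > r + t \<longrightarrow> h t x = 0"
    using vanish
  proof eventually_elim
    case (elim t)
    then show ?case by eventually_elim simp
  qed
  note id = test_identity[OF u u0 weak fg h hv R n r \<kappa>, folded \<rho>_def, folded \<Psi>_def]
  let ?B = "\<lambda>t::real. indicator (cball (0::real^'n) (r + R)) :: _ \<Rightarrow> real"
  let ?c = "\<theta> powr (- 1 / (q - 1))"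
  let ?w1 = "\<lambda>z::(real^'n) \<times> real. \<theta> / b * (indicator (shell R) z * cutoff n R (snd z))"
  let ?w2 = "\<lambda>z. ?c * (indicator (cone r \<inter> shell R) z * derivative_weight C R \<kappa> z powr (q / (q - 1)))"
  have Bi: "AE t in lebesgue_on {0<..<T}. integrable lebesgue (?B t)"
    by (rule L1_L1_AE_integrable[OF L1_L1_indicator])
  have bw1: "bounded_weight ?w1" by (intro bounded_weight_cmult bounded_weight_shell_cutoff)
  have bw2: "bounded_weight ?w2"
    using F(4) C(1) R by (intro bounded_weight_cmult bounded_weight_derivative_weight \<kappa>) auto
  have F0: "F t x \<ge> 0" for t x using F(2)[of t x] F(3) by (meson mult_nonneg_nonneg order_trans less_imp_le powr_ge_zero)
  \<comment> \<open>Outside the cone or the shell the left side is 0, because the solution vanishes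
    or the cutoff is locally constant, and the right side is nonnegative. Young's inequality is used
    only at points of both.\<close>
  have pw: "u t x * wave_op \<Psi> (x, t) \<le> F t x * ?w1 (x, t) + ?B t x * ?w2 (x, t)"
    if v: "norm x > r + t \<longrightarrow> u t x = 0" for x t
  proof -
    have nn: "0 \<le> F t x * ?w1 (x, t)" "0 \<le> ?B t x * ?w2 (x, t)"
      using F0[of t x] \<theta> F(3) cutoff_bounds by (auto intro!: mult_nonneg_nonneg)
    show ?thesis
    proof (cases "norm x > r + t \<or> t > R \<or> t < R / 2")
      case True
      have "u t x * wave_op \<Psi> (x, t) = 0"
      proof (cases "norm x > r + t \<or> t > R")
        case True
        then show ?thesis using v slabD(2)[OF slab_wave_op[OF \<Psi>], of t x] by auto
      next
        case False
        then have "2 * norm x < \<rho>" by (intro \<rho>(2)) auto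
        then show ?thesis
          using test_fun_near(2)[OF \<rho>(1) _ \<kappa>] cutoff_locally_constant[OF R(1) n, of t] True False
          by (simp add: \<Psi>_def)
      qed
      then show ?thesis using nn by linarith
    next
      case False
      then have "2 * norm x < \<rho>" by (intro \<rho>(2)) auto
      have inB: "x \<in> cball 0 (r + R)" "(x, t) \<in> cone r" "(x, t) \<in> shell R"
        using False by (auto simp: cone_def shell_def)
      let ?k = "cutoff n R t powr (1 / q)"
      let ?Z = "derivative_weight C R \<kappa> (x, t)"
      have Z0: "?Z \<ge> 0" using C(1) R by (auto simp: derivative_weight_def intro!: add_nonneg_nonneg)
      have "\<bar>wave_op \<Psi> (x, t)\<bar> \<le> \<bar>deriv (deriv (cutoff n R)) t\<bar> * \<bar>avg \<kappa> (x, t)\<bar> + 2 * \<bar>deriv (cutoff n R) t\<bar> * \<bar>avg (deriv \<kappa>) (x, t)\<bar>"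
        unfolding \<Psi>_def test_fun_near(2)[OF \<rho>(1) \<open>2 * norm x < \<rho>\<close> \<kappa>]
        by (rule order_trans[OF abs_triangle_ineq]) (simp add: abs_mult)
      also have "\<dots> \<le> (C / R\<^sup>2 * ?k) * \<bar>avg \<kappa> (x, t)\<bar> + 2 * (C / R * ?k) * \<bar>avg (deriv \<kappa>) (x, t)\<bar>"
        by (intro add_mono mult_right_mono mult_left_mono C(2,3)) auto
      also have "\<dots> = ?k * ?Z" by (simp add: derivative_weight_def algebra_simps)
      finally have wb: "\<bar>wave_op \<Psi> (x, t)\<bar> \<le> ?k * ?Z" .
      have "u t x * wave_op \<Psi> (x, t) \<le> \<bar>u t x\<bar> * \<bar>wave_op \<Psi> (x, t)\<bar>"
        using abs_ge_self[of "u t x * wave_op \<Psi> (x, t)"] by (simp add: abs_mult)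
      also have "\<dots> \<le> \<bar>u t x\<bar> * (?k * ?Z)" by (intro mult_left_mono wb) auto
      also have "\<dots> = (\<bar>u t x\<bar> * ?k) * ?Z" by simp
      also have "\<dots> \<le> \<theta> * (\<bar>u t x\<bar> * ?k) powr q + ?c * ?Z powr (q / (q - 1))"
        by (rule young_scaled) (use F(4) \<theta> Z0 in auto)
      also have "(\<bar>u t x\<bar> * ?k) powr q = \<bar>u t x\<bar> powr q * cutoff n R t"
        using F(4) cutoff_bounds(1)[of n R t] by (simp add: powr_mult powr_powr)
      also have "\<theta> * (\<bar>u t x\<bar> powr q * cutoff n R t) \<le> \<theta> * (F t x / b * cutoff n R t)"
        using F(2)[of t x] F(3) \<theta> cutoff_bounds(1)[of n R t]
        by (intro mult_left_mono mult_right_mono) (auto simp: field_simps)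
      finally show ?thesis using inB by (simp add: mult_ac)
    qed
  qed
  have L: "\<And>s. s \<in> {0..<T} \<Longrightarrow> L2 (u s)" using C_H1_imp_C_L2[OF u(1)] by (auto simp: C_L2_def)
  have "(\<integral>t. (\<integral>x. u t x * wave_op \<Psi> (x, t) \<partial>lebesgue) \<partial>lebesgue_on {0<..<T})
    \<le> (\<integral>t. (\<integral>x. F t x * ?w1 (x, t) \<partial>lebesgue) + (\<integral>x. ?B t x * ?w2 (x, t) \<partial>lebesgue) \<partial>lebesgue_on {0<..<T})"
  proof (rule integral_mono_AE[OF id(2)])
    show "integrable (lebesgue_on {0<..<T}) (\<lambda>t. (\<integral>x. F t x * ?w1 (x, t) \<partial>lebesgue) + (\<integral>x. ?B t x * ?w2 (x, t) \<partial>lebesgue))"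
      by (intro Bochner_Integration.integrable_add L1_L1_slice_integrable[OF F(1) bw1] L1_L1_slice_integrable[OF L1_L1_indicator bw2])
    show "AE t in lebesgue_on {0<..<T}. (\<integral>x. u t x * wave_op \<Psi> (x, t) \<partial>lebesgue)
      \<le> (\<integral>x. F t x * ?w1 (x, t) \<partial>lebesgue) + (\<integral>x. ?B t x * ?w2 (x, t) \<partial>lebesgue)"
      using vanish L1_L1_AE_integrable[OF F(1)] Bi AE_space
    proof eventually_elim
      case (elim t)
      have t: "t \<in> {0..<T}" "t \<ge> 0" using elim(4) by auto
      have i: "integrable lebesgue (\<lambda>x. F t x * ?w1 (x, t))" "integrable lebesgue (\<lambda>x. ?B t x * ?w2 (x, t))"
        by (rule integrable_mult_bounded_weight[OF elim(2) bw1], rule integrable_mult_bounded_weight[OF elim(3) bw2])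
      have "(\<integral>x. u t x * wave_op \<Psi> (x, t) \<partial>lebesgue) \<le> (\<integral>x. F t x * ?w1 (x, t) + ?B t x * ?w2 (x, t) \<partial>lebesgue)"
      proof (rule integral_mono_AE)
        show "integrable lebesgue (\<lambda>x. u t x * wave_op \<Psi> (x, t))"
          by (rule slice_integrable[OF L[OF t(1)] smooth_wave_op[OF \<Psi>(1)] slab_wave_op[OF \<Psi>] t(2)])
        show "integrable lebesgue (\<lambda>x. F t x * ?w1 (x, t) + ?B t x * ?w2 (x, t))"
          by (rule Bochner_Integration.integrable_add[OF i])
        show "AE x in lebesgue. u t x * wave_op \<Psi> (x, t) \<le> F t x * ?w1 (x, t) + ?B t x * ?w2 (x, t)"
          using elim(1)
        proof eventually_elim
          case (elim x)
          then show ?case by (intro pw) blast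
        qed
      qed
      also have "\<dots> = (\<integral>x. F t x * ?w1 (x, t) \<partial>lebesgue) + (\<integral>x. ?B t x * ?w2 (x, t) \<partial>lebesgue)"
        by (rule Bochner_Integration.integral_add[OF i])
      finally show ?case .
    qed
  qed
  also have "\<dots> = spacetime_integral T F ?w1 + spacetime_integral T ?B ?w2"
    unfolding spacetime_integral_def
    by (rule Bochner_Integration.integral_add[OF L1_L1_slice_integrable[OF F(1) bw1] L1_L1_slice_integrable[OF L1_L1_indicator bw2]])
  finally have le: "(\<integral>t. (\<integral>x. u t x * wave_op \<Psi> (x, t) \<partial>lebesgue) \<partial>lebesgue_on {0<..<T})
    \<le> spacetime_integral T F ?w1 + spacetime_integral T ?B ?w2" .
  have eq1: "spacetime_integral T F ?w1 = \<theta> * (spacetime_integral T F (\<lambda>z. indicator (shell R) z * cutoff n R (snd z)) / b)"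
    by (subst spacetime_integral_cmult) simp
  have eq2: "spacetime_integral T ?B ?w2 = ?c * spacetime_integral T ?B
      (\<lambda>z. indicator (cone r \<inter> shell R) z * derivative_weight C R \<kappa> z powr (q / (q - 1)))"
    by (rule spacetime_integral_cmult)
  show ?thesis
    using le by (simp only: id(1) eq1 eq2)
qed

text \<open>The scaling parameter is optimised only now, after integration, so that a single value
  of it serves all points.\<close>

lemma test_inequality:
  fixes u h F :: "real \<Rightarrow> real^'n \<Rightarrow> real"
  assumes u: "C_H1 T u Du" "C1_L2 T u u'" and u0: "AE x in lebesgue. u 0 x = \<epsilon> * f x"
    and weak: "weak_wave_identity T \<epsilon> g h u' Du"
    and fg: "f \<in> borel_measurable lebesgue" "\<And>x. norm x > r \<Longrightarrow> f x = 0" "\<And>x. norm x > r \<Longrightarrow> g x = 0"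
    and h: "L1_L1 T h"
    and vanish: "AE t in lebesgue_on {0<..<T}. AE x in lebesgue. norm x > r + t \<longrightarrow> u t x = 0 \<and> h t x = 0"
    and F: "L1_L1 T F" "\<And>t x. b * \<bar>u t x\<bar> powr q \<le> F t x" "b > 0" "q > 1"
    and C: "C > 0" "\<And>t. \<bar>deriv (cutoff n R) t\<bar> \<le> C / R * cutoff n R t powr (1 / q)"
      "\<And>t. \<bar>deriv (deriv (cutoff n R)) t\<bar> \<le> C / R\<^sup>2 * cutoff n R t powr (1 / q)"
    and R: "0 < R" "R < T" and n: "n > 0" and r: "0 \<le> r" and \<kappa>: "smooth \<kappa>"
    and K: "K > 0" "spacetime_integral T (\<lambda>t. indicator (cball 0 (r + R)))
          (\<lambda>z. indicator (cone r \<inter> shell R) z * derivative_weight C R \<kappa> z powr (q / (q - 1))) \<le> K"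
    and nonneg: "0 \<le> \<epsilon> * ((\<integral>x. g x * avg \<kappa> (x, 0) \<partial>lebesgue) - (\<integral>x. f x * avg (deriv \<kappa>) (x, 0) \<partial>lebesgue))
      + spacetime_integral T h (cone_weight r n R \<kappa>)" (is "0 \<le> ?X")
  shows "?X powr q \<le> 2 powr q * K powr (q - 1) / b * spacetime_integral T F (\<lambda>z. indicator (shell R) z * cutoff n R (snd z))"
proof -
  let ?U = "spacetime_integral T F (\<lambda>z. indicator (shell R) z * cutoff n R (snd z))"
  have F0: "F t x \<ge> 0" for t x using F(2)[of t x] F(3) by (meson mult_nonneg_nonneg order_trans less_imp_le powr_ge_zero)
  have "?X powr q \<le> 2 powr q * K powr (q - 1) * (?U / b)"
  proof (rule optimise_scaling[OF nonneg _ K(1) F(4)])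
    show "0 \<le> ?U / b"
      using F(3) F0 cutoff_bounds by (intro divide_nonneg_pos spacetime_integral_nonneg mult_nonneg_nonneg) auto
    fix \<theta> :: real assume \<theta>: "\<theta> > 0"
    have "?X \<le> \<theta> * (?U / b) + \<theta> powr (- 1 / (q - 1)) * spacetime_integral T (\<lambda>t. indicator (cball 0 (r + R)))
          (\<lambda>z. indicator (cone r \<inter> shell R) z * derivative_weight C R \<kappa> z powr (q / (q - 1)))"
      by (rule test_inequality_scaled[OF u u0 weak fg h vanish F C R n r \<kappa> \<theta>])
    also have "\<dots> \<le> \<theta> * (?U / b) + \<theta> powr (- 1 / (q - 1)) * K"
      by (intro add_left_mono mult_left_mono K(2)) simp
    finally show "?X \<le> \<theta> * (?U / b) + \<theta> powr (- 1 / (q - 1)) * K" .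
  qed
  then show ?thesis by simp
qed

end

subsection \<open>Spherical caps\<close>

text \<open>The cone measure of the unit ball; up to a constant factor this is the surface measure.\<close>

definition sphere_measure :: "(real^'n) measure" where
  "sphere_measure = distr (restrict_space lborel (ball 0 1)) borel sgn"

lemma sgn_measurable: "(sgn :: real^'n \<Rightarrow> _) \<in> borel_measurable (restrict_space lborel (ball 0 1))"
proof -
  have "(\<lambda>x::real^'n. x /\<^sub>R norm x) \<in> borel_measurable borel" by measurable
  then have "(sgn :: real^'n \<Rightarrow> _) \<in> borel_measurable borel" by (simp add: sgn_div_norm[abs_def])
  then show ?thesis by (intro measurable_restrict_space1) simp
qed

lemma emeasure_sphere_measure:
  assumes "A \<in> sets borel"
  shows "emeasure sphere_measure A = emeasure lborel {y \<in> ball (0::real^'n) 1. sgn y \<in> A}"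
proof -
  have "emeasure sphere_measure A = emeasure (restrict_space lborel (ball 0 1)) (sgn -` A \<inter> ball (0::real^'n) 1)"
    using emeasure_distr[OF sgn_measurable assms] by (simp add: sphere_measure_def space_restrict_space)
  also have "\<dots> = emeasure lborel (sgn -` A \<inter> ball (0::real^'n) 1)"
    by (intro emeasure_restrict_space) auto
  also have "sgn -` A \<inter> ball (0::real^'n) 1 = {y \<in> ball 0 1. sgn y \<in> A}" by auto
  finally show ?thesis .
qed

lemma directions_sphere_measure: "directions (sphere_measure :: (real^'n) measure)"
proof (intro directions.intro directions_axioms.intro)
  have "emeasure (sphere_measure :: (real^'n) measure) UNIV = emeasure lborel (ball (0::real^'n) 1)"
    by (subst emeasure_sphere_measure) (auto intro!: arg_cong2[where f = emeasure])
  then have "emeasure (sphere_measure :: (real^'n) measure) (space sphere_measure) \<noteq> \<infinity>"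
    using emeasure_lborel_ball_finite[of "0::real^'n" 1] by (simp add: sphere_measure_def)
  then show "finite_measure (sphere_measure :: (real^'n) measure)" by (rule finite_measureI)
  show "sets (sphere_measure :: (real^'n) measure) = sets borel" by (simp add: sphere_measure_def)
  have "AE y in restrict_space lborel (ball (0::real^'n) 1). y \<noteq> 0"
  proof (subst AE_restrict_space_iff)
    have "AE y in lborel. y \<noteq> (0::real^'n)" by (rule AE_lborel_singleton)
    then show "AE y in lborel. y \<in> ball (0::real^'n) 1 \<longrightarrow> y \<noteq> 0" by eventually_elim simp
  qed simp
  then have "AE y in restrict_space lborel (ball (0::real^'n) 1). norm (sgn y) = 1"
    by eventually_elim (simp add: norm_sgn)
  then show "AE \<omega> in (sphere_measure :: (real^'n) measure). norm \<omega> = 1"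
    unfolding sphere_measure_def by (subst AE_distr_iff) (use sgn_measurable in auto)
qed

lemma sphere_measure_pos: "0 < measure (sphere_measure :: (real^'n) measure) (space sphere_measure)"
proof -
  have "emeasure (sphere_measure :: (real^'n) measure) UNIV = emeasure lborel (ball (0::real^'n) 1)"
    by (subst emeasure_sphere_measure) (auto intro!: arg_cong2[where f = emeasure])
  then have "measure (sphere_measure :: (real^'n) measure) UNIV = measure lborel (ball (0::real^'n) 1)"
    by (simp add: measure_def)
  then show ?thesis
    using content_ball_pos[of 1 "0::real^'n"] by (simp add: sphere_measure_def)
qed

(* The part of the unit ball that projects to a cap of radius \<delta> lies within \<delta> of a unit segment. *)
lemma sphere_measure_cap:
  obtains A where "A > 0"
    "\<And>e h. norm (e::real^'n) = 1 \<Longrightarrow> 0 < h \<Longrightarrow> measure sphere_measure {\<omega>. 1 - \<omega> \<bullet> e \<le> h} \<le> A * h powr ((real CARD('n) - 1) / 2)"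
proof -
  interpret directions "sphere_measure :: (real^'n) measure" by (rule directions_sphere_measure)
  let ?N = "real CARD('n)"
  let ?m = "(?N - 1) / 2"
  define c where "c = measure lborel (ball (0::real^'n) 1)"
  have c0: "c > 0" using content_ball_pos[of 1 "0::real^'n"] by (simp add: c_def)
  define A where "A = 3 * 2 ^ CARD('n) * c * 2 powr ?m"
  have A0: "A > 0" using c0 by (simp add: A_def)
  have N1: "CARD('n) \<ge> 1" by (simp add: Suc_leI)
  have vol: "measure lborel (cball (a::real^'n) r) = c * r ^ CARD('n)" if "r \<ge> 0" for a r
    using that content_cball[of r a] content_ball[of 1 "0::real^'n"] by (simp add: c_def)
  have "measure sphere_measure {\<omega>. 1 - \<omega> \<bullet> e \<le> h} \<le> A * h powr ?m" if e: "norm (e::real^'n) = 1" and h: "0 < h" for e h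
  proof -
    let ?S = "{\<omega>::real^'n. 1 - \<omega> \<bullet> e \<le> h}"
    have S: "?S \<in> sets borel" by (intro borel_closed closed_Collect_le continuous_intros)
    have "measure sphere_measure ?S = measure lborel {y \<in> ball (0::real^'n) 1. sgn y \<in> ?S}"
      by (simp add: measure_def emeasure_sphere_measure[OF S])
    also have "\<dots> \<le> A * h powr ?m"
    \<comment> \<open>For h >= 2 the power of h is at least 1 and the volume of the whole ball is a
      sufficient bound. For h < 2 the radius \<delta> below stays at most 2.\<close>
    proof (cases "h \<ge> 2")
      case True
      have "measure lborel {y \<in> ball (0::real^'n) 1. sgn y \<in> ?S} \<le> c"
        unfolding c_def
      proof (rule measure_mono_fmeasurable)
        have "(\<lambda>y::real^'n. y /\<^sub>R norm y) \<in> borel_measurable borel" by measurable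
        then have [measurable]: "(sgn :: real^'n \<Rightarrow> _) \<in> borel_measurable borel" by (simp add: sgn_div_norm[abs_def])
        show "{y \<in> ball (0::real^'n) 1. sgn y \<in> ?S} \<in> sets lborel" using S by measurable
        show "ball (0::real^'n) 1 \<in> fmeasurable lborel"
          using emeasure_lborel_ball_finite[of "0::real^'n" 1] by (intro fmeasurableI) auto
      qed auto
      also have "\<dots> \<le> A * h powr ?m"
      proof -
        have "1 \<le> h powr ?m" using True N1 by (intro ge_one_powr_ge_zero) auto
        moreover have "c \<le> A"
        proof -
          have "1 \<le> (2::real) powr ?m" using N1 by (intro ge_one_powr_ge_zero) auto
          moreover have "1 \<le> (2::real) ^ CARD('n)" by simp
          ultimately have "1 * c \<le> (3 * 2 ^ CARD('n) * 2 powr ?m) * c"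
            using c0 mult_mono[of 1 "2 ^ CARD('n)" 1 "2 powr ?m::real"] by (intro mult_right_mono) auto
          then show ?thesis by (simp add: A_def mult_ac)
        qed
        ultimately show ?thesis using c0 A0 mult_mono[of c A 1 "h powr ?m"] by simp
      qed
      finally show ?thesis .
    next
      case False
      \<comment> \<open>For unit vectors |sgn y - e|^2 = 2 - 2 (sgn y, e), so a cap of height h lies
        within \<delta> of its pole.\<close>
      define \<delta> where "\<delta> = sqrt (2 * h)"
      have \<delta>: "0 < \<delta>" "\<delta> \<le> 2" "\<delta>\<^sup>2 = 2 * h"
        using h False by (auto simp: \<delta>_def intro!: real_le_lsqrt)
      define k where "k = nat \<lfloor>1 / \<delta>\<rfloor>"
      \<comment> \<open>Centres are spaced \<delta> apart along the segment from 0 to e: y is within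
        \<delta> of |y| e, which is within \<delta> of one of the centres.\<close>
      have sub: "{y \<in> ball (0::real^'n) 1. sgn y \<in> ?S} \<subseteq> (\<Union>i\<le>k. cball ((i * \<delta>) *\<^sub>R e) (2 * \<delta>))"
      proof
        fix y assume "y \<in> {y \<in> ball (0::real^'n) 1. sgn y \<in> ?S}"
        then have y: "norm y < 1" "1 - sgn y \<bullet> e \<le> h" by auto
        have near: "norm (y - norm y *\<^sub>R e) \<le> \<delta>"
        proof (cases "y = 0")
          case False
          have "(norm (sgn y - e))\<^sup>2 = 2 - 2 * (sgn y \<bullet> e)"
          proof -
            have "sgn y \<bullet> sgn y = 1" "e \<bullet> e = 1"
              using False e by (auto simp: norm_sgn simp flip: power2_norm_eq_inner)
            then show ?thesis by (simp add: power2_norm_eq_inner inner_diff_left inner_diff_right inner_commute)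
          qed
          then have "(norm (sgn y - e))\<^sup>2 \<le> \<delta>\<^sup>2" using y \<delta>(3) by linarith
          then have d: "norm (sgn y - e) \<le> \<delta>" by (rule power2_le_imp_le) (use \<delta>(1) in simp)
          have "y - norm y *\<^sub>R e = norm y *\<^sub>R (sgn y - e)"
            using False by (simp add: sgn_div_norm scaleR_right_diff_distrib)
          then have "norm (y - norm y *\<^sub>R e) = norm y * norm (sgn y - e)" by simp
          also have "\<dots> \<le> 1 * \<delta>" using y d \<delta>(1) by (intro mult_mono) auto
          finally show ?thesis by simp
        qed (use \<delta> in auto)
        define i where "i = nat \<lfloor>norm y / \<delta>\<rfloor>"
        have "norm y / \<delta> \<le> 1 / \<delta>" using y \<delta> by (intro divide_right_mono) auto
        then have "i \<le> k" unfolding i_def k_def by (intro nat_mono floor_mono)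
        have "real i = of_int \<lfloor>norm y / \<delta>\<rfloor>"
          using \<delta>(1) by (simp add: i_def)
        then have "real i \<le> norm y / \<delta>" "norm y / \<delta> \<le> real i + 1"
          using of_int_floor_le[of "norm y / \<delta>"] real_of_int_floor_add_one_ge[of "norm y / \<delta>"] by auto
        then have "\<bar>norm y - i * \<delta>\<bar> \<le> \<delta>" using \<delta>(1) by (auto simp: field_simps abs_le_iff)
        have "norm (y - (i * \<delta>) *\<^sub>R e) \<le> norm (y - norm y *\<^sub>R e) + norm ((norm y - i * \<delta>) *\<^sub>R e)"
          using norm_triangle_ineq[of "y - norm y *\<^sub>R e" "(norm y - i * \<delta>) *\<^sub>R e"] by (simp add: scaleR_left_diff_distrib)
        also have "\<dots> \<le> 2 * \<delta>" using near \<open>\<bar>norm y - i * \<delta>\<bar> \<le> \<delta>\<close> e by simp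
        finally show "y \<in> (\<Union>i\<le>k. cball ((i * \<delta>) *\<^sub>R e) (2 * \<delta>))"
          using \<open>i \<le> k\<close> by (auto simp: dist_norm norm_minus_commute)
      qed
      have "measure lborel {y \<in> ball (0::real^'n) 1. sgn y \<in> ?S} \<le> measure lborel (\<Union>i\<le>k. cball ((i * \<delta>) *\<^sub>R e) (2 * \<delta>))"
      proof (rule measure_mono_fmeasurable[OF sub])
        have "(\<lambda>y::real^'n. y /\<^sub>R norm y) \<in> borel_measurable borel" by measurable
        then have [measurable]: "(sgn :: real^'n \<Rightarrow> _) \<in> borel_measurable borel" by (simp add: sgn_div_norm[abs_def])
        show "{y \<in> ball (0::real^'n) 1. sgn y \<in> ?S} \<in> sets lborel" using S by measurable
        show "(\<Union>i\<le>k. cball ((i * \<delta>) *\<^sub>R e) (2 * \<delta>)) \<in> fmeasurable lborel"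
          using emeasure_lborel_cball_finite by (intro fmeasurable.finite_UN fmeasurableI) auto
      qed
      also have "\<dots> \<le> (\<Sum>i\<le>k. measure lborel (cball ((i * \<delta>) *\<^sub>R e) (2 * \<delta>)))"
        using emeasure_lborel_cball_finite by (intro measure_UNION_le) auto
      also have "\<dots> = (real k + 1) * (c * (2 * \<delta>) ^ CARD('n))" using \<delta> by (simp add: vol)
      \<comment> \<open>About 1 / \<delta> balls of volume of order \<delta>^N leave \<delta>^(N -
        1), that is h to the power (N - 1) / 2. The 3 absorbs the extra ball through 1 <= 2 /
        \<delta>.\<close>
      also have "\<dots> \<le> (3 / \<delta>) * (c * (2 * \<delta>) ^ CARD('n))"
      proof (rule mult_right_mono)
        have "real k \<le> 1 / \<delta>" using \<delta>(1) by (simp add: k_def)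
        moreover have "1 \<le> 2 / \<delta>" using \<delta> by simp
        ultimately show "real k + 1 \<le> 3 / \<delta>" by (simp add: field_simps)
      qed (use c0 \<delta> in auto)
      also have "\<dots> = 3 * 2 ^ CARD('n) * c * \<delta> powr (?N - 1)"
        using \<delta>(1) by (simp add: power_mult_distrib powr_diff powr_realpow)
      also have "\<delta> powr (?N - 1) = (2 * h) powr ?m"
      proof -
        have "\<delta> = (2 * h) powr (1 / 2)" using h by (simp add: \<delta>_def powr_half_sqrt)
        then show ?thesis by (simp add: powr_powr)
      qed
      also have "3 * 2 ^ CARD('n) * c * (2 * h) powr ?m = A * h powr ?m"
        using h by (simp add: A_def powr_mult)
      finally show ?thesis .
    qed
    finally show ?thesis .
  qed
  with A0 that show thesis by blast
qed

(* Dyadic decomposition in the size of tau - x . omega relative to its minimum tau - |x|. *)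
lemma sphere_kernel_bound:
  fixes b :: real
  assumes b: "b > (real CARD('n) - 1) / 2"
  obtains A where "A > 0"
    "\<And>(x::real^'n) \<tau>. norm x < \<tau> \<Longrightarrow> (\<integral>\<omega>. (\<tau> - x \<bullet> \<omega>) powr - b \<partial>sphere_measure)
      \<le> A * \<tau> powr (- ((real CARD('n) - 1) / 2)) * (\<tau> - norm x) powr ((real CARD('n) - 1) / 2 - b)"
proof -
  interpret directions "sphere_measure :: (real^'n) measure" by (rule directions_sphere_measure)
  let ?M = "sphere_measure :: (real^'n) measure"
  let ?m = "(real CARD('n) - 1) / 2"
  have m0: "?m \<ge> 0" by simp
  obtain A0 where A0: "A0 > 0" "\<And>e h. norm (e::real^'n) = 1 \<Longrightarrow> 0 < h \<Longrightarrow> measure ?M {\<omega>. 1 - \<omega> \<bullet> e \<le> h} \<le> A0 * h powr ?m"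
    using sphere_measure_cap by blast
  \<comment> \<open>Ratio of the bounds for consecutive dyadic scales; b > m makes it less than 1,
    so the sum over scales is bounded whatever their number.\<close>
  define s where "s = 2 powr (?m - b)"
  have s: "0 < s" "s < 1" using b by (auto simp: s_def powr_less_one)
  define tot where "tot = measure ?M (space ?M)"
  have tot: "tot > 0" using sphere_measure_pos by (simp add: tot_def)
  define A where "A = 2 powr b * tot + 2 powr b * A0 * 2 powr ?m * (1 / (1 - s))"
  have sp: "space ?M = UNIV" by (simp add: sphere_measure_def)
  have b0: "b > 0" using b m0 by linarith
  have bound: "(\<integral>\<omega>. (\<tau> - x \<bullet> \<omega>) powr - b \<partial>?M) \<le> A * \<tau> powr (- ?m) * (\<tau> - norm x) powr (?m - b)"
    if x: "norm x < \<tau>" for x :: "real^'n" and \<tau>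
  proof -
    define d where "d = \<tau> - norm x"
    have \<tau>: "\<tau> > 0" using x norm_ge_zero[of x] by linarith
    have d: "0 < d" "d \<le> \<tau>" using x by (auto simp: d_def)
    show ?thesis
    \<comment> \<open>For |x| <= \<tau> / 2 every phase is at least \<tau> / 2, and since m - b is
      negative \<tau>^(m - b) is at most (\<tau> - |x|)^(m - b).\<close>
    proof (cases "norm x \<le> \<tau> / 2")
      case True
      have "(\<integral>\<omega>. (\<tau> - x \<bullet> \<omega>) powr - b \<partial>?M) \<le> (\<integral>\<omega>. (\<tau> / 2) powr - b \<partial>?M)"
      proof (rule integral_mono_AE')
        show "AE \<omega> in ?M. (\<tau> - x \<bullet> \<omega>) powr - b \<le> (\<tau> / 2) powr - b"
          using norm_1
        proof eventually_elim
          case (elim \<omega>)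
          have "x \<bullet> \<omega> \<le> norm x" using norm_cauchy_schwarz[of x \<omega>] elim by simp
          then show ?case using True \<tau> b0 by (intro powr_mono2') auto
        qed
      qed auto
      also have "\<dots> = tot * (2 powr b * (\<tau> powr - ?m * \<tau> powr (?m - b)))"
      proof -
        have "\<tau> powr - b = \<tau> powr - ?m * \<tau> powr (?m - b)" by (simp flip: powr_add)
        moreover have "(\<tau> / 2) powr - b = 2 powr b * \<tau> powr - b"
          using \<tau> by (simp add: powr_divide powr_minus_divide)
        ultimately show ?thesis by (simp add: tot_def)
      qed
      also have "\<dots> \<le> tot * (2 powr b * (\<tau> powr - ?m * d powr (?m - b)))"
        using tot d b \<tau> by (intro mult_left_mono powr_mono2') auto
      also have "\<dots> = (2 powr b * tot) * (\<tau> powr - ?m * d powr (?m - b))" by simp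
      also have "\<dots> \<le> A * (\<tau> powr - ?m * d powr (?m - b))"
        using s A0 by (intro mult_right_mono) (auto simp: A_def)
      finally show ?thesis by (simp add: d_def mult_ac)
    next
      case False
      then have nx: "norm x > \<tau> / 2" "x \<noteq> 0" using \<tau> by auto
      define e where "e = sgn x"
      have e: "norm e = 1" "x = norm x *\<^sub>R e" using nx by (auto simp: e_def norm_sgn sgn_div_norm)
      \<comment> \<open>The phase is d plus |x| times the height 1 - (\<omega>, e); since |x| >
        \<tau> / 2 the second summand is at least \<open>g\<close>.\<close>
      define g where "g \<omega> = \<tau> / 2 * (1 - \<omega> \<bullet> e)" for \<omega>
      obtain J where J: "\<tau> / d < 2 ^ J" using real_arch_pow[of 2 "\<tau> / d"] by auto
      have J': "\<tau> < 2 ^ J * d" using J d by (simp add: field_simps)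
      let ?c = "\<lambda>j::nat. 2 powr b * (2 ^ j * d) powr - b"
      let ?A = "\<lambda>j::nat. {\<omega>. g \<omega> \<le> 2 ^ j * d}"
      have AS: "?A j \<in> sets ?M" for j
        unfolding sets_M g_def by (intro borel_closed closed_Collect_le continuous_intros)
      have pw: "(\<tau> - x \<bullet> \<omega>) powr - b \<le> (\<Sum>j\<le>J. ?c j * indicator (?A j) \<omega>)" if w: "norm \<omega> = 1" for \<omega>
      proof -
        have we: "\<omega> \<bullet> e \<le> 1" "- 1 \<le> \<omega> \<bullet> e"
          using Cauchy_Schwarz_ineq2[of \<omega> e] w e by (auto simp: abs_le_iff)
        have "\<tau> - x \<bullet> \<omega> = d + norm x * (1 - \<omega> \<bullet> e)"
          by (subst e(2)) (simp add: d_def algebra_simps inner_commute)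
        moreover have "norm x * (1 - \<omega> \<bullet> e) \<ge> g \<omega>" unfolding g_def using nx we by (intro mult_right_mono) auto
        ultimately have lo: "d + g \<omega> \<le> \<tau> - x \<bullet> \<omega>" by simp
        have g0: "g \<omega> \<ge> 0" "g \<omega> \<le> \<tau>"
          using we \<tau> mult_left_mono[of "1 - \<omega> \<bullet> e" 2 "\<tau> / 2"] by (auto simp: g_def)
        have ex: "g \<omega> \<le> 2 ^ J * d" using g0 J' by simp
        \<comment> \<open>By minimality \<open>g \<omega>\<close> exceeds half of 2^j d (for j = 0
          the summand d does the job), so the phase is at least 2^j d / 2 while \<omega> lies in the
          cap of scale 2^j d.\<close>
        define j where "j = (LEAST j. g \<omega> \<le> 2 ^ j * d)"
        have j: "g \<omega> \<le> 2 ^ j * d" "j \<le> J"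
          unfolding j_def using ex by (auto intro: LeastI Least_le)
        have "(2 ^ j * d) / 2 \<le> d + g \<omega>"
        proof (cases j)
          case (Suc i)
          then have "\<not> g \<omega> \<le> 2 ^ i * d" using not_less_Least[of i "\<lambda>j. g \<omega> \<le> 2 ^ j * d"] by (simp add: j_def)
          then show ?thesis using Suc d by simp
        qed (use d g0 in auto)
        then have "(\<tau> - x \<bullet> \<omega>) powr - b \<le> ((2 ^ j * d) / 2) powr - b"
          using lo d b0 by (intro powr_mono2') auto
        also have "\<dots> = ?c j * indicator (?A j) \<omega>"
          using d j by (simp add: powr_divide powr_minus_divide)
        also have "\<dots> \<le> (\<Sum>j\<le>J. ?c j * indicator (?A j) \<omega>)"
          using j by (intro member_le_sum) auto
        finally show ?thesis .
      qed
      have cap: "measure ?M (?A j) \<le> A0 * (2 * (2 ^ j * d) / \<tau>) powr ?m" for j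
      proof -
        have "?A j = {\<omega>. 1 - \<omega> \<bullet> e \<le> 2 * (2 ^ j * d) / \<tau>}" using \<tau> by (auto simp: g_def field_simps)
        then show ?thesis using A0(2)[OF e(1), of "2 * (2 ^ j * d) / \<tau>"] d \<tau> by simp
      qed
      have "(\<integral>\<omega>. (\<tau> - x \<bullet> \<omega>) powr - b \<partial>?M) \<le> (\<integral>\<omega>. (\<Sum>j\<le>J. ?c j * indicator (?A j) \<omega>) \<partial>?M)"
      proof (rule integral_mono_AE')
        show "integrable ?M (\<lambda>\<omega>. \<Sum>j\<le>J. ?c j * indicator (?A j) \<omega>)"
          using AS by (intro Bochner_Integration.integrable_sum integrable_mult_right integrable_real_indicator)
            (auto simp: emeasure_eq_measure)
        show "AE \<omega> in ?M. (\<tau> - x \<bullet> \<omega>) powr - b \<le> (\<Sum>j\<le>J. ?c j * indicator (?A j) \<omega>)"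
          using norm_1 by eventually_elim (rule pw)
      qed (auto intro!: AE_I2 sum_nonneg)
      also have "\<dots> = (\<Sum>j\<le>J. ?c j * measure ?M (?A j))"
        using AS by (subst Bochner_Integration.integral_sum)
          (auto simp: emeasure_eq_measure sp intro!: integrable_mult_right integrable_real_indicator)
      also have "\<dots> \<le> (\<Sum>j\<le>J. ?c j * (A0 * (2 * (2 ^ j * d) / \<tau>) powr ?m))"
        by (intro sum_mono mult_left_mono cap) auto
      also have "\<dots> = (\<Sum>j\<le>J. (2 powr b * A0 * 2 powr ?m * (\<tau> powr - ?m * d powr (?m - b))) * s ^ j)"
      proof (rule sum.cong[OF refl])
        fix j
        have "(2::real) ^ j = 2 powr real j" by (simp add: powr_realpow)
        then have p: "(2 ^ j * d) powr z = 2 powr (j * z) * d powr z" for z :: real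
          using d by (simp add: powr_mult powr_powr)
        have "s ^ j = 2 powr ((?m - b) * j)" by (simp add: s_def powr_realpow[symmetric] powr_powr)
        also have "\<dots> = 2 powr (j * - b) * 2 powr (j * ?m)"
          unfolding powr_add[symmetric] by (simp add: algebra_simps)
        finally have sj: "s ^ j = 2 powr (j * - b) * 2 powr (j * ?m)" .
        have dj: "d powr (?m - b) = d powr - b * d powr ?m"
          unfolding powr_add[symmetric] by simp
        have "(2 * (2 ^ j * d) / \<tau>) powr ?m = 2 powr ?m * (2 powr (j * ?m) * d powr ?m) * \<tau> powr - ?m"
        proof -
          have "(2 * (2 ^ j * d) / \<tau>) powr ?m = (2 * (2 ^ j * d)) powr ?m / \<tau> powr ?m"
            by (simp only: powr_divide)
          also have "(2 * (2 ^ j * d)) powr ?m = 2 powr ?m * (2 ^ j * d) powr ?m"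
            by (simp only: powr_mult)
          also have "(2 ^ j * d) powr ?m = 2 powr (j * ?m) * d powr ?m" by (rule p)
          finally have eq: "(2 * (2 ^ j * d) / \<tau>) powr ?m = 2 powr ?m * (2 powr (j * ?m) * d powr ?m) / \<tau> powr ?m" .
          show ?thesis unfolding eq powr_minus_divide by simp
        qed
        then show "?c j * (A0 * (2 * (2 ^ j * d) / \<tau>) powr ?m)
          = (2 powr b * A0 * 2 powr ?m * (\<tau> powr - ?m * d powr (?m - b))) * s ^ j"
          unfolding p sj dj by simp
      qed
      also have "\<dots> = (2 powr b * A0 * 2 powr ?m * (\<tau> powr - ?m * d powr (?m - b))) * (\<Sum>j\<le>J. s ^ j)"
        by (simp add: sum_distrib_left)
      also have "\<dots> \<le> (2 powr b * A0 * 2 powr ?m * (\<tau> powr - ?m * d powr (?m - b))) * (1 / (1 - s))"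
      proof (rule mult_left_mono)
        have "(\<Sum>j\<le>J. s ^ j) \<le> (\<Sum>j. s ^ j)"
          using s by (intro sum_le_suminf summable_geometric) auto
        then show "(\<Sum>j\<le>J. s ^ j) \<le> 1 / (1 - s)" using s by (simp add: suminf_geometric)
      qed (use A0 in auto)
      also have "\<dots> = (2 powr b * A0 * 2 powr ?m * (1 / (1 - s))) * (\<tau> powr - ?m * d powr (?m - b))" by simp
      also have "\<dots> \<le> A * (\<tau> powr - ?m * d powr (?m - b))"
        using tot by (intro mult_right_mono) (auto simp: A_def)
      finally show ?thesis by (simp add: d_def mult_ac)
    qed
  qed
  have "A > 0" using s tot A0 by (auto simp: A_def intro!: add_pos_nonneg)
  with bound that show thesis by blast
qed

subsection \<open>Sphere potentials and weight bounds\<close>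

interpretation sph: directions "sphere_measure :: (real^'n) measure"
  by (rule directions_sphere_measure)

text \<open>With \<open>\<mu> \<ge> r + 2\<close> every phase on the cone is at least 2 after the
  shift, in the range where \<open>kern\<close> is a pure power.\<close>

definition shifted_kern :: "real \<Rightarrow> real \<Rightarrow> real \<Rightarrow> real" where
  "shifted_kern \<beta> \<mu> s = kern \<beta> (s + \<mu>)"

lemma smooth_shifted_kern: "smooth (shifted_kern \<beta> \<mu>)"
proof -
  have "smooth (\<lambda>s. kern \<beta> (1 * s + \<mu>))" by (rule smooth_compose[OF smooth_kern smooth_affine])
  then show ?thesis by (simp add: shifted_kern_def[abs_def])
qed

lemma deriv_shifted_kern:
  assumes "s + \<mu> > 1"
  shows "deriv (shifted_kern \<beta> \<mu>) s = - \<beta> * (s + \<mu>) powr (- (\<beta> + 1))"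
proof -
  have "((\<lambda>s. s + \<mu>) has_real_derivative 1) (at s)" by (auto intro!: derivative_eq_intros)
  from DERIV_chain2[OF smooth_has_real_derivative[OF smooth_kern] this]
  have "deriv (shifted_kern \<beta> \<mu>) s = deriv (kern \<beta>) (s + \<mu>)"
    unfolding shifted_kern_def[abs_def] by (intro DERIV_imp_deriv) simp
  then show ?thesis using assms by (simp add: deriv_kern)
qed

definition sphere_potential :: "real \<Rightarrow> real^'n \<Rightarrow> real \<Rightarrow> real" where
  "sphere_potential \<beta> x \<tau> = (\<integral>\<omega>. (\<tau> - x \<bullet> \<omega>) powr (- \<beta>) \<partial>sphere_measure)"

lemma sphere_phase:
  fixes x :: "real^'n"
  shows "AE \<omega> in sphere_measure. \<tau> - norm x \<le> \<tau> - x \<bullet> \<omega> \<and> \<tau> - x \<bullet> \<omega> \<le> \<tau> + norm x"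
  using sph.norm_1
proof eventually_elim
  case (elim \<omega>)
  then show ?case using Cauchy_Schwarz_ineq2[of x \<omega>] by (auto simp: abs_le_iff)
qed

lemma sphere_potential_measurable:
  "(\<lambda>\<omega>::real^'n. (\<tau> - x \<bullet> \<omega>) powr b) \<in> borel_measurable sphere_measure"
  by (intro sph.measurable_M) measurable

lemma sphere_potential_integrable:
  fixes x :: "real^'n"
  assumes "1 \<le> \<tau> - norm x"
  shows "integrable sphere_measure (\<lambda>\<omega>. (\<tau> - x \<bullet> \<omega>) powr b)"
proof (rule sph.integrable_const_bound[OF _ sphere_potential_measurable, where B = "(\<tau> + norm x) powr \<bar>b\<bar>"])
  show "AE \<omega> in sphere_measure. norm ((\<tau> - x \<bullet> \<omega>) powr b) \<le> (\<tau> + norm x) powr \<bar>b\<bar>"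
    using sphere_phase[of \<tau> x]
  proof eventually_elim
    case (elim \<omega>)
    have "(\<tau> - x \<bullet> \<omega>) powr b \<le> (\<tau> - x \<bullet> \<omega>) powr \<bar>b\<bar>" using elim assms by (intro powr_mono) auto
    also have "\<dots> \<le> (\<tau> + norm x) powr \<bar>b\<bar>" using elim assms by (intro powr_mono2) auto
    finally show ?case by simp
  qed
qed

lemma avg_shifted_kern:
  fixes x :: "real^'n"
  assumes "norm x \<le> r + t" "\<mu> \<ge> r + 2"
  shows "sph.avg (shifted_kern \<beta> \<mu>) (x, t) = sphere_potential \<beta> x (t + \<mu>)"
    and "sph.avg (deriv (shifted_kern \<beta> \<mu>)) (x, t) = - \<beta> * sphere_potential (\<beta> + 1) x (t + \<mu>)"
proof -
  have ph: "AE \<omega> in sphere_measure. t - x \<bullet> \<omega> + \<mu> \<ge> 2"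
    using sphere_phase[of "t + \<mu>" x] by eventually_elim (use assms in auto)
  have m: "(\<lambda>\<omega>. \<kappa> (t - x \<bullet> \<omega>)) \<in> borel_measurable sphere_measure" if "smooth \<kappa>" for \<kappa>
    using borel_measurable_integrable[OF sph.integrable_kernel[OF _ _ that, of "\<lambda>_. 1" 1 t x]] by simp
  show "sph.avg (shifted_kern \<beta> \<mu>) (x, t) = sphere_potential \<beta> x (t + \<mu>)"
    unfolding wave_avg_def sphere_potential_def fst_conv snd_conv mult_1
  proof (rule integral_cong_AE[OF m[OF smooth_shifted_kern] sphere_potential_measurable])
    show "AE \<omega> in sphere_measure. shifted_kern \<beta> \<mu> (t - x \<bullet> \<omega>) = (t + \<mu> - x \<bullet> \<omega>) powr - \<beta>"
      using ph by eventually_elim (simp add: shifted_kern_def kern_eq algebra_simps)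
  qed
  have "sph.avg (deriv (shifted_kern \<beta> \<mu>)) (x, t) = (\<integral>\<omega>. - \<beta> * (t + \<mu> - x \<bullet> \<omega>) powr (- (\<beta> + 1)) \<partial>sphere_measure)"
    unfolding wave_avg_def fst_conv snd_conv mult_1
  proof (rule integral_cong_AE[OF m[OF smooth_deriv[OF smooth_shifted_kern]]])
    show "(\<lambda>\<omega>. - \<beta> * (t + \<mu> - x \<bullet> \<omega>) powr (- (\<beta> + 1))) \<in> borel_measurable sphere_measure"
      by (intro borel_measurable_times borel_measurable_const sphere_potential_measurable)
    show "AE \<omega> in sphere_measure. deriv (shifted_kern \<beta> \<mu>) (t - x \<bullet> \<omega>) = - \<beta> * (t + \<mu> - x \<bullet> \<omega>) powr (- (\<beta> + 1))"
      using ph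
    proof eventually_elim
      case (elim \<omega>)
      then show ?case by (subst deriv_shifted_kern) (auto simp: algebra_simps)
    qed
  qed
  also have "\<dots> = - \<beta> * sphere_potential (\<beta> + 1) x (t + \<mu>)"
    unfolding sphere_potential_def by (rule integral_mult_right_zero)
  finally show "sph.avg (deriv (shifted_kern \<beta> \<mu>)) (x, t) = - \<beta> * sphere_potential (\<beta> + 1) x (t + \<mu>)" .
qed

lemma sphere_potential_nonneg: "0 \<le> sphere_potential \<beta> x \<tau>"
  unfolding sphere_potential_def by (intro Bochner_Integration.integral_nonneg) auto

text \<open>All phases are at most 2 \<tau>. One power of decay can therefore be traded for a factor
  \<tau>, and the second-order commutator term with its R^(-2) is absorbed into the first-order
  one.\<close>

lemma sphere_potential_step:
  fixes x :: "real^'n"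
  assumes "1 \<le> \<tau> - norm x"
  shows "sphere_potential \<beta> x \<tau> \<le> 2 * \<tau> * sphere_potential (\<beta> + 1) x \<tau>"
proof -
  have "sphere_potential \<beta> x \<tau> \<le> (\<integral>\<omega>. 2 * \<tau> * (\<tau> - x \<bullet> \<omega>) powr (- (\<beta> + 1)) \<partial>sphere_measure)"
    unfolding sphere_potential_def
  proof (rule integral_mono_AE)
    show "AE \<omega> in sphere_measure. (\<tau> - x \<bullet> \<omega>) powr - \<beta> \<le> 2 * \<tau> * (\<tau> - x \<bullet> \<omega>) powr (- (\<beta> + 1))"
      using sphere_phase[of \<tau> x]
    proof eventually_elim
      case (elim \<omega>)
      then have pos: "\<tau> - x \<bullet> \<omega> > 0" "\<tau> - x \<bullet> \<omega> \<le> 2 * \<tau>" using assms by auto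
      have "(\<tau> - x \<bullet> \<omega>) powr - \<beta> = (\<tau> - x \<bullet> \<omega>) powr 1 * (\<tau> - x \<bullet> \<omega>) powr (- (\<beta> + 1))"
        unfolding powr_add[symmetric] by simp
      also have "\<dots> \<le> 2 * \<tau> * (\<tau> - x \<bullet> \<omega>) powr (- (\<beta> + 1))"
        using pos by (intro mult_right_mono) auto
      finally show ?case .
    qed
  qed (use assms in \<open>auto intro!: sphere_potential_integrable integrable_mult_right\<close>)
  then show ?thesis by (simp add: sphere_potential_def)
qed

text \<open>Again because phases are at most 2 \<tau>. This lower bound serves to insert the kernel
  into an unweighted shell mass.\<close>

lemma sphere_potential_lower:
  fixes x :: "real^'n"
  assumes "1 \<le> \<tau> - norm x" "\<beta> \<ge> 0"
  shows "measure (sphere_measure :: (real^'n) measure) (space sphere_measure) * (2 * \<tau>) powr (- \<beta>) \<le> sphere_potential \<beta> x \<tau>"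
proof -
  have "(\<integral>\<omega>. (2 * \<tau>) powr (- \<beta>) \<partial>(sphere_measure :: (real^'n) measure)) \<le> sphere_potential \<beta> x \<tau>"
    unfolding sphere_potential_def
  proof (rule integral_mono_AE)
    show "AE \<omega> in sphere_measure. (2 * \<tau>) powr (- \<beta>) \<le> (\<tau> - x \<bullet> \<omega>) powr - \<beta>"
      using sphere_phase[of \<tau> x]
    proof eventually_elim
      case (elim \<omega>)
      then show ?case using assms by (intro powr_mono2') auto
    qed
  qed (use assms in \<open>auto intro!: sphere_potential_integrable\<close>)
  then show ?thesis by simp
qed

text \<open>Exchanging the order puts the time integral inside. For the kernel weights, at fixed x,
  it is a one-dimensional integral of a power of t + \<mu> - |x|, and x then contributes only the
  volume of the ball.\<close>

lemma spacetime_integral_le_Tonelli: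
  fixes w :: "(real^'n) \<times> real \<Rightarrow> real"
  assumes w: "bounded_weight w" "\<And>z. 0 \<le> w z" and G: "0 \<le> G"
    and le: "\<And>x. norm x \<le> \<rho> \<Longrightarrow> (\<integral>\<^sup>+t. indicator {0<..} t * ennreal (w (x, t)) \<partial>lborel) \<le> ennreal G"
  shows "spacetime_integral T (\<lambda>t. indicator (cball 0 \<rho>)) w \<le> measure lborel (cball (0::real^'n) \<rho>) * G"
proof -
  let ?B = "cball (0::real^'n) \<rho>"
  have m [measurable]: "w \<in> borel_measurable borel" using w(1) by (simp add: bounded_weight_def)
  have ib: "integrable lebesgue (indicator ?B :: _ \<Rightarrow> real)"
    using emeasure_lborel_cball_finite[of "0::real^'n" \<rho>] by (intro integrable_real_indicator) auto
  let ?I = "\<lambda>t. \<integral>x. indicator ?B x * w (x, t) \<partial>lebesgue"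
  have mp2: "(\<lambda>(x, t). ennreal (indicator ?B x) * (indicator {0<..} t * ennreal (w (x, t)))) \<in> borel_measurable (lborel \<Otimes>\<^sub>M lborel)"
  proof -
    have [measurable]: "?B \<times> UNIV \<in> sets (borel :: ((real^'n) \<times> real) measure)"
      by (intro borel_closed closed_Times) auto
    have [measurable]: "UNIV \<times> {0<..} \<in> sets (borel :: ((real^'n) \<times> real) measure)"
      by (intro borel_open open_Times) auto
    have "(\<lambda>z. ennreal (indicator (?B \<times> UNIV) z) * (indicator (UNIV \<times> {0<..}) z * ennreal (w z))) \<in> borel_measurable borel"
      by measurable
    moreover have "(\<lambda>(x, t). ennreal (indicator ?B x) * (indicator {0<..} t * ennreal (w (x, t))))
      = (\<lambda>z. ennreal (indicator (?B \<times> UNIV) z) * (indicator (UNIV \<times> {0<..}) z * ennreal (w z)))"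
      by (auto simp: fun_eq_iff indicator_def)
    ultimately show ?thesis by (simp add: lborel_prod)
  qed
  have "ennreal (spacetime_integral T (\<lambda>t. indicator ?B) w) = (\<integral>\<^sup>+t. ennreal (?I t) \<partial>lebesgue_on {0<..<T})"
    unfolding spacetime_integral_def
    by (rule nn_integral_eq_integral[symmetric, OF L1_L1_slice_integrable[OF L1_L1_indicator w(1)]])
      (auto intro!: AE_I2 Bochner_Integration.integral_nonneg mult_nonneg_nonneg w(2))
  also have "\<dots> = (\<integral>\<^sup>+t. ennreal (?I t) * indicator {0<..<T} t \<partial>lebesgue)"
    by (intro nn_integral_restrict_space) auto
  also have "\<dots> \<le> (\<integral>\<^sup>+t. (\<integral>\<^sup>+x. ennreal (indicator ?B x) * (indicator {0<..} t * ennreal (w (x, t))) \<partial>lborel) \<partial>lebesgue)"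
  proof (rule nn_integral_mono)
    fix t :: real
    have "ennreal (?I t) = (\<integral>\<^sup>+x. ennreal (indicator ?B x * w (x, t)) \<partial>lebesgue)"
      by (rule nn_integral_eq_integral[symmetric, OF integrable_mult_bounded_weight[OF ib w(1)]])
        (auto intro!: AE_I2 mult_nonneg_nonneg w(2))
    also have "\<dots> = (\<integral>\<^sup>+x. ennreal (indicator ?B x * w (x, t)) \<partial>lborel)"
      by (rule nn_integral_completion)
    also have "\<dots> = (\<integral>\<^sup>+x. ennreal (indicator ?B x) * ennreal (w (x, t)) \<partial>lborel)"
      by (simp add: ennreal_mult w(2))
    finally have eq: "ennreal (?I t) = (\<integral>\<^sup>+x. ennreal (indicator ?B x) * ennreal (w (x, t)) \<partial>lborel)" .
    show "ennreal (?I t) * indicator {0<..<T} t \<le> (\<integral>\<^sup>+x. ennreal (indicator ?B x) * (indicator {0<..} t * ennreal (w (x, t))) \<partial>lborel)"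
      unfolding eq by (cases "t \<in> {0<..<T}") auto
  qed
  also have "\<dots> = (\<integral>\<^sup>+t. (\<integral>\<^sup>+x. ennreal (indicator ?B x) * (indicator {0<..} t * ennreal (w (x, t))) \<partial>lborel) \<partial>lborel)"
    by (rule nn_integral_completion)
  also have "\<dots> = (\<integral>\<^sup>+x. (\<integral>\<^sup>+t. ennreal (indicator ?B x) * (indicator {0<..} t * ennreal (w (x, t))) \<partial>lborel) \<partial>lborel)"
    by (rule lborel_pair.Fubini'[OF mp2])
  also have "\<dots> \<le> (\<integral>\<^sup>+x. ennreal G * indicator ?B x \<partial>lborel)"
  proof (rule nn_integral_mono)
    fix x :: "real^'n"
    have "(\<lambda>t::real. (x, t)) \<in> borel_measurable borel" by (intro borel_measurable_continuous_onI continuous_intros)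
    then have "(\<lambda>t. w (x, t)) \<in> borel_measurable borel" using m by (rule measurable_compose)
    then have "(\<integral>\<^sup>+t. ennreal (indicator ?B x) * (indicator {0<..} t * ennreal (w (x, t))) \<partial>lborel)
      = ennreal (indicator ?B x) * (\<integral>\<^sup>+t. indicator {0<..} t * ennreal (w (x, t)) \<partial>lborel)"
      by (intro nn_integral_cmult) measurable
    also have "\<dots> \<le> ennreal G * indicator ?B x"
      using le[of x] by (cases "x \<in> ?B") auto
    finally show "(\<integral>\<^sup>+t. ennreal (indicator ?B x) * (indicator {0<..} t * ennreal (w (x, t))) \<partial>lborel) \<le> ennreal G * indicator ?B x" .
  qed
  also have "\<dots> = ennreal G * emeasure lborel ?B"
    by (subst nn_integral_cmult_indicator) auto
  also have "\<dots> = ennreal (measure lborel ?B * G)"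
    using emeasure_lborel_cball_finite[of "0::real^'n" \<rho>] G
    by (simp add: emeasure_eq_ennreal_measure ennreal_mult mult.commute)
  finally show ?thesis using G by simp
qed

text \<open>The origin of the logarithm in the critical case: \<sigma> = 1 is the borderline
  exponent.\<close>

lemma nn_integral_powr_le:
  fixes \<sigma> S :: real
  assumes "\<sigma> \<ge> 1" "S \<ge> 1"
  shows "(\<integral>\<^sup>+s. ennreal (s powr (- \<sigma>)) * indicator {1..S} s \<partial>lborel) \<le> ennreal (if \<sigma> = 1 then ln S else 1 / (\<sigma> - 1))"
proof (cases "\<sigma> = 1")
  case True
  have "(\<integral>\<^sup>+s. ennreal (s powr (- 1)) * indicator {1..S} s \<partial>lborel) = ennreal (ln S - ln 1)"
    by (rule nn_integral_FTC_Icc) (use assms in \<open>auto intro!: derivative_eq_intros simp: powr_minus_divide\<close>)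
  then show ?thesis using True by simp
next
  case False
  have "(\<integral>\<^sup>+s. ennreal (s powr (- \<sigma>)) * indicator {1..S} s \<partial>lborel)
    = ennreal (S powr (1 - \<sigma>) / (1 - \<sigma>) - 1 powr (1 - \<sigma>) / (1 - \<sigma>))"
    by (rule nn_integral_FTC_Icc) (use assms False in \<open>auto intro!: derivative_eq_intros\<close>)
  also have "\<dots> \<le> ennreal (1 / (\<sigma> - 1))"
  proof (rule ennreal_leI)
    have "S powr (1 - \<sigma>) / (1 - \<sigma>) \<le> 0" using assms False by (intro divide_nonneg_neg) auto
    moreover have "- (1 / (1 - \<sigma>)) = 1 / (\<sigma> - 1)" using False by (simp add: field_simps)
    ultimately show "S powr (1 - \<sigma>) / (1 - \<sigma>) - 1 powr (1 - \<sigma>) / (1 - \<sigma>) \<le> 1 / (\<sigma> - 1)" by simp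
  qed
  finally show ?thesis using False by simp
qed

lemma cball_volume_le:
  assumes "0 \<le> r" "1 \<le> R"
  shows "measure lborel (cball (0::real^'n) (r + R)) \<le> measure lborel (cball (0::real^'n) 1) * (r + 1) powr real CARD('n) * R powr real CARD('n)"
proof -
  have vol: "measure lborel (cball (0::real^'n) \<rho>) = measure lborel (cball (0::real^'n) 1) * \<rho> ^ CARD('n)" if "\<rho> \<ge> 0" for \<rho>
    using that content_cball[of \<rho> "0::real^'n"] content_cball[of 1 "0::real^'n"] by simp
  have "r + R \<le> (r + 1) * R"
    using assms mult_left_mono[of 1 R r] by (simp add: algebra_simps)
  then have "(r + R) ^ CARD('n) \<le> ((r + 1) * R) ^ CARD('n)" using assms by (intro power_mono) auto
  also have "\<dots> = (r + 1) powr real CARD('n) * R powr real CARD('n)"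
    using assms by (simp add: power_mult_distrib powr_realpow)
  finally have "(r + R) ^ CARD('n) \<le> (r + 1) powr real CARD('n) * R powr real CARD('n)" .
  then have "measure lborel (cball (0::real^'n) 1) * (r + R) ^ CARD('n)
    \<le> measure lborel (cball (0::real^'n) 1) * ((r + 1) powr real CARD('n) * R powr real CARD('n))"
    by (intro mult_left_mono) auto
  moreover have "measure lborel (cball (0::real^'n) (r + R)) = measure lborel (cball (0::real^'n) 1) * (r + R) ^ CARD('n)"
    using assms by (intro vol) simp
  ultimately show ?thesis by (simp only: mult.assoc)
qed

text \<open>A constant average leaves C R^(-2) up to a factor; raised to the power s, over a region
  of size R^N in space and R in time, this gives the exponent N + 1 - 2 s.\<close>

lemma weight_bound_const:
  fixes s C r :: real
  assumes "s > 0" "C > 0" "0 \<le> r"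
  obtains A where "A > 0" "\<And>T R. 1 \<le> R \<Longrightarrow>
    spacetime_integral T (\<lambda>t. indicator (cball (0::real^'n) (r + R)))
      (\<lambda>z. indicator (cone r \<inter> shell R) z * sph.derivative_weight C R (\<lambda>_. 1) z powr s)
    \<le> A * R powr (real CARD('n) + 1 - 2 * s)"
proof -
  let ?tot = "measure (sphere_measure :: (real^'n) measure) (space sphere_measure)"
  let ?V = "measure lborel (cball (0::real^'n) 1) * (r + 1) powr real CARD('n)"
  define A where "A = ?V * (C * ?tot) powr s + 1"
  have V: "?V \<ge> 0" by simp
  have "spacetime_integral T (\<lambda>t. indicator (cball (0::real^'n) (r + R)))
      (\<lambda>z. indicator (cone r \<inter> shell R) z * sph.derivative_weight C R (\<lambda>_. 1) z powr s)
    \<le> A * R powr (real CARD('n) + 1 - 2 * s)" if R: "1 \<le> R" for T R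
  proof -
    have Z: "sph.derivative_weight C R (\<lambda>_. 1) z = C * ?tot / R\<^sup>2" for z :: "(real^'n) \<times> real"
      by (simp add: sph.derivative_weight_def wave_avg_def)
    have Zs: "(C * ?tot / R\<^sup>2) powr s = (C * ?tot) powr s * R powr (- (2 * s))"
    proof -
      have "R\<^sup>2 = R powr 2" using R by simp
      then show ?thesis by (simp add: powr_divide powr_powr powr_minus_divide)
    qed
    let ?G = "(C * ?tot) powr s * R powr (- (2 * s)) * R"
    have "spacetime_integral T (\<lambda>t. indicator (cball (0::real^'n) (r + R)))
        (\<lambda>z. indicator (cone r \<inter> shell R) z * sph.derivative_weight C R (\<lambda>_. 1) z powr s)
      \<le> measure lborel (cball (0::real^'n) (r + R)) * ?G"
    proof (rule spacetime_integral_le_Tonelli)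
      show "bounded_weight (\<lambda>z::(real^'n) \<times> real. indicator (cone r \<inter> shell R) z * sph.derivative_weight C R (\<lambda>_. 1) z powr s)"
        using assms R by (intro sph.bounded_weight_derivative_weight) auto
      fix x :: "real^'n"
      have "(\<integral>\<^sup>+t. indicator {0<..} t * ennreal (indicator (cone r \<inter> shell R) (x, t) * sph.derivative_weight C R (\<lambda>_. 1) (x, t) powr s) \<partial>lborel)
        \<le> (\<integral>\<^sup>+t. ennreal ((C * ?tot) powr s * R powr (- (2 * s))) * indicator {0..R} t \<partial>lborel)"
        unfolding Z Zs by (intro nn_integral_mono) (auto simp: indicator_def shell_def)
      also have "\<dots> = ennreal ?G"
        using R by (subst nn_integral_cmult_indicator) (auto simp: ennreal_mult)
      finally show "(\<integral>\<^sup>+t. indicator {0<..} t * ennreal (indicator (cone r \<inter> shell R) (x, t) * sph.derivative_weight C R (\<lambda>_. 1) (x, t) powr s) \<partial>lborel) \<le> ennreal ?G" .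
    qed (use R in auto)
    also have "\<dots> \<le> (?V * R powr real CARD('n)) * ?G"
      using cball_volume_le[OF assms(3) R, where 'n = 'n] R by (intro mult_right_mono) auto
    also have "\<dots> = (?V * (C * ?tot) powr s) * R powr (real CARD('n) + 1 - 2 * s)"
      using R by (simp add: powr_add powr_diff powr_minus_divide)
    also have "\<dots> \<le> A * R powr (real CARD('n) + 1 - 2 * s)"
      by (intro mult_right_mono) (auto simp: A_def)
    finally show ?thesis .
  qed
  moreover have "A > 0" using V by (simp add: A_def add_nonneg_pos)
  ultimately show thesis by (intro that)
qed

text \<open>On the shell the derivative weight is at most of order R^(-1 - m) (\<tau> - |x|)^(m -
  \<beta> - 1), where \<tau> = t + \<mu>. After the power s and the time integral at fixed x, the
  second factor contributes O(1), or log R if (\<beta> + 1 - m) s = 1, and x contributes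
  R^N.\<close>

lemma weight_bound_kern:
  fixes s C r \<mu> \<beta> :: real
  defines "m \<equiv> (real CARD('n::finite) - 1) / 2"
  assumes s: "s > 0" and C: "C > 0" and r: "0 \<le> r" and \<mu>: "\<mu> \<ge> r + 2" and \<beta>: "\<beta> \<ge> 0" "\<beta> + 1 > m" "(\<beta> + 1 - m) * s \<ge> 1"
  obtains A where "A > 0" "\<And>T R. 1 \<le> R \<Longrightarrow>
    spacetime_integral T (\<lambda>t. indicator (cball (0::real^'n) (r + R)))
      (\<lambda>z. indicator (cone r \<inter> shell R) z * sph.derivative_weight C R (shifted_kern \<beta> \<mu>) z powr s)
    \<le> A * R powr (real CARD('n) - s - m * s) * (if (\<beta> + 1 - m) * s = 1 then 1 + ln R else 1)"
proof -
  let ?V = "measure lborel (cball (0::real^'n) 1) * (r + 1) powr real CARD('n)"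
  let ?\<sigma> = "(\<beta> + 1 - m) * s"
  have m0: "m \<ge> 0" by (simp add: m_def)
  obtain A0 where A0: "A0 > 0" "\<And>(x::real^'n) \<tau>. norm x < \<tau> \<Longrightarrow>
      sphere_potential (\<beta> + 1) x \<tau> \<le> A0 * \<tau> powr (- m) * (\<tau> - norm x) powr (m - (\<beta> + 1))"
    using sphere_kernel_bound[where 'n = 'n, of "\<beta> + 1"] \<beta>(2) unfolding m_def sphere_potential_def by blast
  define D where "D = C * (2 * (1 + \<mu>) + 2 * \<beta>) * A0 * 2 powr m"
  have D: "D > 0" using C A0 \<mu> r \<beta> by (auto simp: D_def intro!: mult_pos_pos add_pos_nonneg)
  define L where "L = (if ?\<sigma> = 1 then ln (1 + \<mu>) + 1 else 1 / (?\<sigma> - 1))"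
  have L: "L > 0" using \<beta>(3) \<mu> r by (auto simp: L_def intro!: add_nonneg_pos)
  define A where "A = ?V * D powr s * L + 1"
  have V: "?V \<ge> 0" by simp
  have "spacetime_integral T (\<lambda>t. indicator (cball (0::real^'n) (r + R)))
      (\<lambda>z. indicator (cone r \<inter> shell R) z * sph.derivative_weight C R (shifted_kern \<beta> \<mu>) z powr s)
    \<le> A * R powr (real CARD('n) - s - m * s) * (if ?\<sigma> = 1 then 1 + ln R else 1)" if R: "1 \<le> R" for T R
  proof -
    let ?ell = "if ?\<sigma> = 1 then 1 + ln R else 1"
    have ell: "?ell \<ge> 1" using R by simp
    let ?P = "D powr s * R powr (- s - m * s)"
    let ?G = "?P * (L * ?ell)"
    let ?w = "\<lambda>z::(real^'n) \<times> real. indicator (cone r \<inter> shell R) z * sph.derivative_weight C R (shifted_kern \<beta> \<mu>) z powr s"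
    have pw: "?w (x, t) \<le> ?P * ((t + \<mu> - norm x) powr (- ?\<sigma>) * indicator {1..R + \<mu>} (t + \<mu> - norm x))" for x t
    proof (cases "(x, t) \<in> cone r \<inter> shell R")
      case True
      define \<tau> where "\<tau> = t + \<mu>"
      have x: "norm x \<le> r + t" and t: "R / 2 \<le> t" "t \<le> R" using True by (auto simp: cone_def shell_def)
      have d: "2 \<le> \<tau> - norm x" using x \<mu> by (simp add: \<tau>_def)
      have \<tau>: "R / 2 \<le> \<tau>" "\<tau> \<le> (1 + \<mu>) * R" "\<tau> \<le> R + \<mu>"
      proof -
        have "\<mu> \<le> \<mu> * R" using mult_left_mono[of 1 R \<mu>] \<mu> r R by simp
        then show "R / 2 \<le> \<tau>" "\<tau> \<le> (1 + \<mu>) * R" "\<tau> \<le> R + \<mu>"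
          using t \<mu> r R \<open>\<mu> \<le> \<mu> * R\<close> unfolding \<tau>_def distrib_right mult_1 by linarith+
      qed
      let ?p = "sphere_potential (\<beta> + 1) x \<tau>"
      have p0: "?p \<ge> 0" by (rule sphere_potential_nonneg)
      have "sph.derivative_weight C R (shifted_kern \<beta> \<mu>) (x, t) = C / R\<^sup>2 * sphere_potential \<beta> x \<tau> + 2 * (C / R) * (\<beta> * ?p)"
        using avg_shifted_kern[OF x \<mu>, of \<beta>] sphere_potential_nonneg[of \<beta> x \<tau>] p0 \<beta>(1)
        by (simp add: sph.derivative_weight_def \<tau>_def abs_mult)
      also have "\<dots> \<le> C / R\<^sup>2 * (2 * ((1 + \<mu>) * R) * ?p) + 2 * (C / R) * (\<beta> * ?p)"
      proof (intro add_right_mono mult_left_mono)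
        have "sphere_potential \<beta> x \<tau> \<le> 2 * \<tau> * ?p" using d by (intro sphere_potential_step) auto
        also have "\<dots> \<le> 2 * ((1 + \<mu>) * R) * ?p" using \<tau> p0 by (intro mult_right_mono mult_left_mono) auto
        finally show "sphere_potential \<beta> x \<tau> \<le> 2 * ((1 + \<mu>) * R) * ?p" .
      qed (use C in auto)
      also have "\<dots> = C * (2 * (1 + \<mu>) + 2 * \<beta>) / R * ?p"
        using R by (simp add: field_simps power2_eq_square)
      also have "\<dots> \<le> C * (2 * (1 + \<mu>) + 2 * \<beta>) / R * (A0 * (2 powr m * R powr (- m)) * (\<tau> - norm x) powr (m - (\<beta> + 1)))"
      proof (intro mult_left_mono)
        have "?p \<le> A0 * \<tau> powr (- m) * (\<tau> - norm x) powr (m - (\<beta> + 1))" using d by (intro A0) auto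
        also have "\<dots> \<le> A0 * (2 powr m * R powr (- m)) * (\<tau> - norm x) powr (m - (\<beta> + 1))"
        proof (intro mult_right_mono mult_left_mono)
          have "\<tau> powr (- m) \<le> (R / 2) powr (- m)" using \<tau> R m0 by (intro powr_mono2') auto
          then show "\<tau> powr (- m) \<le> 2 powr m * R powr (- m)" by (simp add: powr_divide powr_minus_divide)
        qed (use A0 in auto)
        finally show "?p \<le> A0 * (2 powr m * R powr (- m)) * (\<tau> - norm x) powr (m - (\<beta> + 1))" .
        show "0 \<le> C * (2 * (1 + \<mu>) + 2 * \<beta>) / R" using C \<mu> r \<beta> R by simp
      qed
      also have "\<dots> = D * R powr (- 1 - m) * (\<tau> - norm x) powr (m - (\<beta> + 1))"
      proof -
        have "R powr (- 1 - m) = R powr (- m) / R"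
        proof -
          have "- 1 - m = - m - 1" by simp
          then have "R powr (- 1 - m) = R powr (- m - 1)" by (simp only:)
          then show ?thesis using R powr_diff[of R "- m" 1] by simp
        qed
        then show ?thesis by (simp add: D_def)
      qed
      finally have Z: "sph.derivative_weight C R (shifted_kern \<beta> \<mu>) (x, t) \<le> D * R powr (- 1 - m) * (\<tau> - norm x) powr (m - (\<beta> + 1))" .
      have Z0: "0 \<le> sph.derivative_weight C R (shifted_kern \<beta> \<mu>) (x, t)"
        using C R by (auto simp: sph.derivative_weight_def intro!: add_nonneg_nonneg)
      have "sph.derivative_weight C R (shifted_kern \<beta> \<mu>) (x, t) powr s \<le> (D * R powr (- 1 - m) * (\<tau> - norm x) powr (m - (\<beta> + 1))) powr s"
        using Z Z0 s by (intro powr_mono2) auto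
      also have "\<dots> = D powr s * R powr ((- 1 - m) * s) * (\<tau> - norm x) powr ((m - (\<beta> + 1)) * s)"
        by (simp add: powr_mult powr_powr)
      also have "\<dots> = ?P * (\<tau> - norm x) powr (- ?\<sigma>)"
      proof -
        have "(- 1 - m) * s = - s - m * s" "(m - (\<beta> + 1)) * s = - ?\<sigma>" by (simp_all add: algebra_simps)
        then show ?thesis by simp
      qed
      finally have fin: "sph.derivative_weight C R (shifted_kern \<beta> \<mu>) (x, t) powr s \<le> ?P * (\<tau> - norm x) powr (- ?\<sigma>)" .
      have "\<tau> - norm x \<in> {1..R + \<mu>}" using d \<tau>(3) norm_ge_zero[of x] by (simp del: norm_ge_zero)
      then show ?thesis using fin True by (simp add: \<tau>_def)
    qed auto
    have "spacetime_integral T (\<lambda>t. indicator (cball (0::real^'n) (r + R))) ?w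
      \<le> measure lborel (cball (0::real^'n) (r + R)) * ?G"
    proof (rule spacetime_integral_le_Tonelli)
      show "bounded_weight ?w"
        using s C R by (intro sph.bounded_weight_derivative_weight smooth_shifted_kern) auto
      show "0 \<le> ?G" using L ell by (intro mult_nonneg_nonneg) auto
      fix x :: "real^'n"
      let ?k = "\<lambda>s. ennreal (s powr (- ?\<sigma>)) * indicator {1..R + \<mu>} s"
      have "(\<integral>\<^sup>+t. indicator {0<..} t * ennreal (?w (x, t)) \<partial>lborel) \<le> (\<integral>\<^sup>+t. ennreal ?P * ?k (\<mu> - norm x + t) \<partial>lborel)"
      proof (rule nn_integral_mono)
        fix t
        have "indicator {0<..} t * ennreal (?w (x, t)) \<le> ennreal (?w (x, t))" by (auto simp: indicator_def)
        also have "\<dots> \<le> ennreal (?P * ((t + \<mu> - norm x) powr (- ?\<sigma>) * indicator {1..R + \<mu>} (t + \<mu> - norm x)))"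
          by (intro ennreal_leI pw)
        also have "\<dots> = ennreal ?P * ?k (\<mu> - norm x + t)"
          by (auto simp: ennreal_mult indicator_def algebra_simps)
        finally show "indicator {0<..} t * ennreal (?w (x, t)) \<le> ennreal ?P * ?k (\<mu> - norm x + t)" .
      qed
      also have "\<dots> = ennreal ?P * (\<integral>\<^sup>+t. ?k (\<mu> - norm x + t) \<partial>lborel)"
        by (rule nn_integral_cmult) measurable
      also have "(\<integral>\<^sup>+t. ?k (\<mu> - norm x + t) \<partial>lborel) = (\<integral>\<^sup>+t. ?k t \<partial>lborel)"
        using nn_integral_real_affine[of ?k 1 "\<mu> - norm x"] by simp
      also have "\<dots> \<le> ennreal (if ?\<sigma> = 1 then ln (R + \<mu>) else 1 / (?\<sigma> - 1))"
        using R \<mu> r by (intro nn_integral_powr_le \<beta>(3)) auto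
      also have "\<dots> \<le> ennreal (L * ?ell)"
      proof (intro ennreal_leI)
        show "(if ?\<sigma> = 1 then ln (R + \<mu>) else 1 / (?\<sigma> - 1)) \<le> L * ?ell"
        proof (cases "?\<sigma> = 1")
          case True
          have "R + \<mu> \<le> (1 + \<mu>) * R" using R \<mu> r mult_left_mono[of 1 R \<mu>] by (simp add: algebra_simps)
          then have "ln (R + \<mu>) \<le> ln ((1 + \<mu>) * R)" using R \<mu> r by (subst ln_le_cancel_iff) auto
          also have "\<dots> = ln (1 + \<mu>) + ln R" using R \<mu> r by (simp add: ln_mult)
          also have "\<dots> \<le> (ln (1 + \<mu>) + 1) * (1 + ln R)"
            using R \<mu> r mult_nonneg_nonneg[of "ln (1 + \<mu>)" "ln R"] by (simp add: algebra_simps)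
          finally show ?thesis using True by (simp add: L_def)
        qed (simp add: L_def)
      qed
      finally show "(\<integral>\<^sup>+t. indicator {0<..} t * ennreal (?w (x, t)) \<partial>lborel) \<le> ennreal ?G"
        using L ell by (simp add: ennreal_mult mult_left_mono)
    qed auto
    also have "\<dots> \<le> (?V * R powr real CARD('n)) * ?G"
      using cball_volume_le[OF r R, where 'n = 'n] L ell by (intro mult_right_mono mult_nonneg_nonneg) auto
    also have "\<dots> = (?V * D powr s * L) * R powr (real CARD('n) - s - m * s) * ?ell"
    proof -
      have "R powr (real CARD('n) - s - m * s) = R powr real CARD('n) * R powr (- s - m * s)"
        unfolding powr_add[symmetric] by (simp add: algebra_simps)
      then show ?thesis by simp
    qed
    also have "\<dots> \<le> A * R powr (real CARD('n) - s - m * s) * ?ell"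
      using ell by (intro mult_right_mono) (auto simp: A_def)
    finally show ?thesis .
  qed
  moreover have "A > 0" using V L by (simp add: A_def add_nonneg_pos)
  ultimately show thesis by (intro that)
qed

subsection \<open>Real inequalities behind the blow-up\<close>

lemma powr_le_of_powr_le:
  fixes x y a :: real
  assumes "x powr a \<le> y" "a > 0" "x \<ge> 0"
  shows "x \<le> y powr (1 / a)"
proof -
  have "(x powr a) powr (1 / a) \<le> y powr (1 / a)"
    using assms by (intro powr_mono2) auto
  then show ?thesis using assms by (simp add: powr_powr)
qed

lemma powr_le_powr_iterate:
  fixes x y c a b :: real
  assumes "x powr a \<le> c * y" "0 \<le> x" "0 \<le> c" "0 \<le> y" "b \<ge> 0"
  shows "x powr (a * b) \<le> c powr b * y powr b"
proof -
  have "(x powr a) powr b \<le> (c * y) powr b" using assms by (intro powr_mono2) auto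
  then show ?thesis by (simp add: powr_powr powr_mult)
qed

(* Discrete form of y' >= s^(-k) y^P: compare y^(1-P) at successive indices. *)
lemma discrete_blowup:
  fixes P k C :: real
  assumes P: "P > 1" and k: "0 \<le> k" "k < P" and C: "C > 0"
  obtains A where "A > 0"
    "\<And>(S::nat \<Rightarrow> real) D \<delta> h. \<delta> > 0 \<Longrightarrow> h > 0 \<Longrightarrow> S 0 \<ge> 0 \<Longrightarrow>
      (\<And>J. 1 \<le> J \<Longrightarrow> J \<le> 2 * h \<Longrightarrow> S (J - 1) + D J \<le> S J) \<Longrightarrow>
      (\<And>J. 1 \<le> J \<Longrightarrow> J \<le> 2 * h \<Longrightarrow> S J powr P \<le> C * (1 + real J) powr k * D J) \<Longrightarrow>
      (\<And>J. 1 \<le> J \<Longrightarrow> J \<le> 2 * h \<Longrightarrow> \<delta> \<le> C * D J) \<Longrightarrow>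
      real h \<le> A * \<delta> powr (- ((P - 1) / (P - k)))"
proof -
  define B where "B = C powr (P - 1) * C * 3 powr k / (P - 1)"
  have B: "B > 0" using C P by (simp add: B_def)
  define A where "A = B powr (1 / (P - k))"
  have main: "real h \<le> A * \<delta> powr (- ((P - 1) / (P - k)))"
    if \<delta>: "\<delta> > 0" and h: "h > 0" and S0: "S 0 \<ge> 0"
      and inc: "\<And>J. 1 \<le> J \<Longrightarrow> J \<le> 2 * h \<Longrightarrow> S (J - 1) + D J \<le> S J"
      and pw: "\<And>J. 1 \<le> J \<Longrightarrow> J \<le> 2 * h \<Longrightarrow> S J powr P \<le> C * (1 + real J) powr k * D J"
      and lo: "\<And>J. 1 \<le> J \<Longrightarrow> J \<le> 2 * h \<Longrightarrow> \<delta> \<le> C * D J"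
    for S :: "nat \<Rightarrow> real" and D \<delta> h
  proof -
    \<comment> \<open>The uniform lower bound on the increments gives linear growth. It supplies the
      size at index h, from which the blow-up is run up to 2 h.\<close>
    have lin: "J * (\<delta> / C) \<le> S J" if "J \<le> 2 * h" for J
      using that
    proof (induction J)
      case (Suc J)
      have "\<delta> / C \<le> D (Suc J)" using lo[of "Suc J"] Suc.prems C by (simp add: field_simps)
      moreover have "S J + D (Suc J) \<le> S (Suc J)" using inc[of "Suc J"] Suc.prems by simp
      ultimately show ?case using Suc by (simp add: algebra_simps)
    qed (use S0 in simp)
    have pos: "S J > 0" if "1 \<le> J" "J \<le> 2 * h" for J
    proof -
      have "0 < J * (\<delta> / C)" using that \<delta> C by simp
      then show ?thesis using lin[OF that(2)] by linarith
    qed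
    \<comment> \<open>Mean value theorem for y^(1 - P): at the intermediate point the slope is at
      least as steep as at the right end, where the power hypothesis applies. As J stays below 2 h,
      the factor (1 + J)^k is replaced by its largest value.\<close>
    have step: "(P - 1) / (C * (1 + real (2 * h)) powr k) \<le> S J powr (1 - P) - S (Suc J) powr (1 - P)"
      if J: "1 \<le> J" "Suc J \<le> 2 * h" for J
    proof -
      have x: "S J > 0" "S (Suc J) > 0" using pos J by auto
      have d: "S J + D (Suc J) \<le> S (Suc J)" using inc[of "Suc J"] J by simp
      have D0: "D (Suc J) > 0" using lo[of "Suc J"] J \<delta> C by (simp add: zero_less_mult_iff) (smt (verit) zero_less_mult_iff)
      obtain z where z: "S J < z" "z < S (Suc J)"
        "S (Suc J) powr (1 - P) - S J powr (1 - P) = (S (Suc J) - S J) * ((1 - P) * z powr (1 - P - 1))"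
      proof -
        have "\<exists>z>S J. z < S (Suc J) \<and>
          S (Suc J) powr (1 - P) - S J powr (1 - P) = (S (Suc J) - S J) * ((1 - P) * z powr (1 - P - 1))"
        proof (rule MVT2)
          show "S J < S (Suc J)" using d D0 by linarith
          show "((\<lambda>y. y powr (1 - P)) has_real_derivative (1 - P) * y powr (1 - P - 1)) (at y)" if "S J \<le> y" for y
            using that x(1) by (intro has_real_derivative_powr) linarith
        qed
        then show thesis using that by blast
      qed
      have "S (Suc J) powr (- P) \<le> z powr (- P)"
        using z x P by (intro powr_mono2') auto
      have "(P - 1) / (C * (1 + real (2 * h)) powr k) \<le> (P - 1) * (D (Suc J) * S (Suc J) powr (- P))"
      proof -
        have "S (Suc J) powr P \<le> C * (1 + real (Suc J)) powr k * D (Suc J)" using pw[of "Suc J"] J by simp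
        also have "\<dots> \<le> C * (1 + real (2 * h)) powr k * D (Suc J)"
          using C D0 k J by (intro mult_right_mono mult_left_mono powr_mono2) auto
        finally have "S (Suc J) powr P \<le> C * (1 + real (2 * h)) powr k * D (Suc J)" .
        then have "1 / (C * (1 + real (2 * h)) powr k) \<le> D (Suc J) / S (Suc J) powr P"
          using C x by (simp add: field_simps)
        from mult_left_mono[OF this, of "P - 1"] show ?thesis using P by (simp add: powr_minus_divide)
      qed
      also have "\<dots> \<le> (P - 1) * ((S (Suc J) - S J) * z powr (- P))"
        using P d D0 \<open>S (Suc J) powr (- P) \<le> z powr (- P)\<close> by (intro mult_left_mono mult_mono) auto
      also have "\<dots> = S J powr (1 - P) - S (Suc J) powr (1 - P)"
        using z(3) by (simp add: algebra_simps)
      finally show ?thesis .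
    qed
    have tel: "real i * ((P - 1) / (C * (1 + real (2 * h)) powr k)) \<le> S h powr (1 - P) - S (h + i) powr (1 - P)"
      if "i \<le> h" for i
      using that
    proof (induction i)
      case (Suc i)
      let ?d = "(P - 1) / (C * (1 + real (2 * h)) powr k)"
      have "real (Suc i) * ?d = real i * ?d + ?d" by (simp only: of_nat_Suc distrib_right mult_1 add.commute)
      moreover have "?d \<le> S (h + i) powr (1 - P) - S (h + Suc i) powr (1 - P)"
        using step[of "h + i"] h Suc.prems by simp
      moreover have "real i * ?d \<le> S h powr (1 - P) - S (h + i) powr (1 - P)"
        using Suc by simp
      ultimately show ?case by linarith
    qed simp
    \<comment> \<open>h decrements of this size cannot exceed the initial value, the final one being
      nonnegative. Inserting the linear bound for S h will give h^(P - k) <= B \<delta>^(1 -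
      P).\<close>
    have "real h * ((P - 1) / (C * (1 + real (2 * h)) powr k)) \<le> S h powr (1 - P)"
      using tel[of h] powr_ge_zero[of "S (h + h)" "1 - P"] by linarith
    also have "\<dots> \<le> (real h * (\<delta> / C)) powr (1 - P)"
      using lin[of h] P \<delta> C h by (intro powr_mono2') auto
    also have "\<dots> = real h powr (1 - P) * (\<delta> powr (1 - P) * C powr (P - 1))"
    proof -
      have "C powr (1 - P) = 1 / C powr (P - 1)" using powr_minus_divide[of C "P - 1"] by simp
      then show ?thesis by (simp add: powr_mult powr_divide)
    qed
    finally have 1: "real h * ((P - 1) / (C * (1 + real (2 * h)) powr k)) \<le> real h powr (1 - P) * (\<delta> powr (1 - P) * C powr (P - 1))" .
    have "(1 + real (2 * h)) powr k \<le> (3 * real h) powr k"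
      using h k by (intro powr_mono2) auto
    then have le3: "(1 + real (2 * h)) powr k \<le> 3 powr k * real h powr k" by (simp add: powr_mult)
    have "real h * ((P - 1) / (C * (3 powr k * real h powr k))) \<le> real h * ((P - 1) / (C * (1 + real (2 * h)) powr k))"
      using C P h le3 by (intro mult_left_mono divide_left_mono mult_pos_pos) auto
    then have 2: "real h * ((P - 1) / (C * (3 powr k * real h powr k))) \<le> real h powr (1 - P) * (\<delta> powr (1 - P) * C powr (P - 1))"
      using 1 by linarith
    have hp: "real h powr (P - k) = real h * real h powr (P - 1) / real h powr k"
    proof -
      have "real h powr (P - k) = real h powr (1 + (P - 1) - k)" by simp
      also have "\<dots> = real h powr 1 * real h powr (P - 1) / real h powr k" unfolding powr_diff powr_add ..
      finally show ?thesis using h by simp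
    qed
    have hm: "real h powr (1 - P) * real h powr (P - 1) = 1" using h by (simp flip: powr_add)
    have "real h powr (P - k) * ((P - 1) / (C * 3 powr k)) = (real h * ((P - 1) / (C * (3 powr k * real h powr k)))) * real h powr (P - 1)"
      unfolding hp by (simp add: mult_ac)
    also have "\<dots> \<le> (real h powr (1 - P) * (\<delta> powr (1 - P) * C powr (P - 1))) * real h powr (P - 1)"
      using 2 by (intro mult_right_mono) auto
    also have "\<dots> = \<delta> powr (1 - P) * C powr (P - 1)"
      using hm by (simp add: mult_ac)
    finally have "real h powr (P - k) \<le> B * \<delta> powr (1 - P)"
      using P C by (simp add: B_def field_simps)
    then have "real h \<le> (B * \<delta> powr (1 - P)) powr (1 / (P - k))"
      using k by (intro powr_le_of_powr_le) auto
    also have "\<dots> = A * \<delta> powr (- ((P - 1) / (P - k)))"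
    proof -
      have "(1 - P) * (1 / (P - k)) = - ((P - 1) / (P - k))" using k by (simp add: field_simps)
      then show ?thesis by (simp add: powr_mult powr_powr A_def)
    qed
    finally show ?thesis .
  qed
  have "A > 0" using B by (simp add: A_def)
  then show thesis by (rule that) (rule main, assumption+)
qed

text \<open>The dyadic index runs up to 2 h, and 2^(2 h) = 4^h. The first integer h above A E
  contradicts the hypothesis, so T <= 4^h <= exp(2 h), and E >= 1 absorbs the rounding.\<close>

lemma exp_bound_of_dyadic_bound:
  fixes M E A T :: real
  assumes "\<And>h::nat. h > 0 \<Longrightarrow> 4 ^ h < T \<Longrightarrow> real h \<le> A * E" "A > 0" "E \<ge> 1"
  shows "T \<le> exp (2 * (A + 1) * E)"
proof -
  define h where "h = nat \<lfloor>A * E\<rfloor> + 1"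
  have AE: "A * E \<ge> 0" using assms by simp
  have "real h > A * E" unfolding h_def using AE by (simp add: of_nat_nat) linarith
  then have "\<not> 4 ^ h < T" using assms(1)[of h] by (auto simp: h_def)
  then have "T \<le> 4 ^ h" by simp
  also have "(4::real) ^ h \<le> exp 2 ^ h"
  proof (rule power_mono)
    have "(2::real) \<le> exp 1" using exp_ge_add_one_self[of 1] by simp
    then have "(2::real) * 2 \<le> exp 1 * exp 1" by (intro mult_mono) auto
    then show "(4::real) \<le> exp 2" by (simp flip: exp_add)
  qed simp
  also have "\<dots> = exp (2 * real h)" by (simp add: exp_of_nat_mult mult.commute)
  also have "\<dots> \<le> exp (2 * (A + 1) * E)"
  proof -
    have "real h \<le> A * E + 1" using AE by (simp add: h_def of_nat_nat)
    also have "\<dots> \<le> (A + 1) * E" using assms(3) by (simp add: algebra_simps)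
    finally have "2 * real h \<le> 2 * ((A + 1) * E)" by simp
    then show ?thesis by (simp only: exp_le_cancel_iff mult.assoc)
  qed
  finally show ?thesis .
qed

lemma subcritical_exponent:
  fixes N p q :: real
  assumes "p > 1" "q > 1"
  defines "m \<equiv> (N - 1) / 2"
  shows "(((q - 1) * N - q - m * q) * (p * q - 1) + ((N + 1) * (p * q - 1) - 2 * p * q - 2 * q)) / (q * (p * q - 1))
    = - ((p + 2 + 1 / q) / (p * q - 1) - (N - 1) / 2)"
proof -
  have "p * q > 1" using assms by (simp add: less_1_mult)
  then show ?thesis
    unfolding m_def using assms by (simp add: divide_simps) (simp add: algebra_simps)
qed

text \<open>\<open>U\<close>, \<open>V\<close> stand for cone masses and \<open>Us\<close>,
  \<open>Vs\<close> for shell masses of the sources generated by u and v. Going once around the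
  system bounds U^(p q) by a power of R times U, hence U^(p q - 1) by a power of R, while the data
  bound U from below. The exponents combine to minus \<open>F_SS\<close>.\<close>

lemma subcritical_estimate:
  fixes p q c N :: real
  assumes pq: "p > 1" "q > 1" and c: "c > 0"
  defines "m \<equiv> (N - 1) / 2"
  obtains A where "A > 0"
    "\<And>R \<epsilon> U Us V Vs. R \<ge> 1 \<Longrightarrow> \<epsilon> > 0 \<Longrightarrow> U \<ge> 0 \<Longrightarrow> Us \<ge> 0 \<Longrightarrow> V \<ge> 0 \<Longrightarrow> Vs \<ge> 0 \<Longrightarrow>
      U powr p \<le> c * R powr ((N + 1) * (p - 1) - 2 * p) * Vs \<Longrightarrow>
      V powr q \<le> c * R powr ((N + 1) * (q - 1) - 2 * q) * Us \<Longrightarrow>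
      Us \<le> c * U \<Longrightarrow> Vs \<le> c * V \<Longrightarrow>
      \<epsilon> powr q \<le> c * R powr ((q - 1) * N - q - m * q) * Us \<Longrightarrow>
      \<epsilon> \<le> A * R powr (- ((p + 2 + 1 / q) / (p * q - 1) - (N - 1) / 2))"
proof -
  have pq1: "p * q > 1" using pq by (simp add: less_1_mult)
  let ?e = "(q - 1) * N - q - m * q"
  let ?E = "(N + 1) * (p * q - 1) - 2 * p * q - 2 * q"
  define B where "B = (c * c) powr (p * q - 1) * (c powr q * (c powr q * c * c))"
  have B: "B > 0" using c by (simp add: B_def)
  define A where "A = B powr (1 / (q * (p * q - 1)))"
  have "\<epsilon> \<le> A * R powr (- ((p + 2 + 1 / q) / (p * q - 1) - (N - 1) / 2))"
    if R: "R \<ge> 1" and \<epsilon>: "\<epsilon> > 0" and nn: "U \<ge> 0" "Us \<ge> 0" "V \<ge> 0" "Vs \<ge> 0"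
      and h1: "U powr p \<le> c * R powr ((N + 1) * (p - 1) - 2 * p) * Vs"
      and h2: "V powr q \<le> c * R powr ((N + 1) * (q - 1) - 2 * q) * Us"
      and h3: "Us \<le> c * U" "Vs \<le> c * V" and h4: "\<epsilon> powr q \<le> c * R powr ?e * Us"
    for R \<epsilon> U Us V Vs
  proof -
    have "\<epsilon> powr q > 0" using \<epsilon> by simp
    \<comment> \<open>The data term makes both masses positive, so that U^(p q) <= ... U may be
      divided by U.\<close>
    then have Us: "Us > 0" using h4 nn(2) by (cases "Us = 0") auto
    then have U: "U > 0" using h3(1) nn(1) by (cases "U = 0") auto
    have "U powr (p * q) \<le> (c * R powr ((N + 1) * (p - 1) - 2 * p)) powr q * Vs powr q"
      using h1 nn c pq by (intro powr_le_powr_iterate) auto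
    also have "\<dots> \<le> (c * R powr ((N + 1) * (p - 1) - 2 * p)) powr q * (c * V) powr q"
      using h3 nn pq by (intro mult_left_mono powr_mono2) auto
    also have "\<dots> = c powr q * R powr (((N + 1) * (p - 1) - 2 * p) * q) * (c powr q * V powr q)"
      by (simp add: powr_mult powr_powr)
    also have "\<dots> \<le> c powr q * R powr (((N + 1) * (p - 1) - 2 * p) * q) * (c powr q * (c * R powr ((N + 1) * (q - 1) - 2 * q) * Us))"
      by (intro mult_left_mono h2) auto
    also have "\<dots> \<le> c powr q * R powr (((N + 1) * (p - 1) - 2 * p) * q) * (c powr q * (c * R powr ((N + 1) * (q - 1) - 2 * q) * (c * U)))"
      using c by (intro mult_left_mono h3(1)) auto
    also have "\<dots> = (c powr q * (c powr q * c * c)) * (R powr (((N + 1) * (p - 1) - 2 * p) * q) * R powr ((N + 1) * (q - 1) - 2 * q)) * U"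
      by simp
    also have "R powr (((N + 1) * (p - 1) - 2 * p) * q) * R powr ((N + 1) * (q - 1) - 2 * q) = R powr ?E"
      unfolding powr_add[symmetric] by (rule arg_cong[where f = "\<lambda>z. R powr z"]) (simp add: algebra_simps)
    finally have "U powr (p * q) \<le> (c powr q * (c powr q * c * c)) * R powr ?E * U" .
    then have UU: "U powr (p * q - 1) \<le> (c powr q * (c powr q * c * c)) * R powr ?E"
      using U by (simp add: powr_diff field_simps)
    have "\<epsilon> powr q \<le> c * R powr ?e * (c * U)"
      using h4 h3(1) c by (meson mult_left_mono mult_nonneg_nonneg order_trans powr_ge_zero less_imp_le)
    then have "\<epsilon> powr q \<le> (c * c * R powr ?e) * U" by (simp add: mult_ac)
    then have "\<epsilon> powr (q * (p * q - 1)) \<le> (c * c * R powr ?e) powr (p * q - 1) * U powr (p * q - 1)"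
      using nn c pq1 \<epsilon> by (intro powr_le_powr_iterate) auto
    also have "\<dots> \<le> (c * c * R powr ?e) powr (p * q - 1) * ((c powr q * (c powr q * c * c)) * R powr ?E)"
      by (intro mult_left_mono UU) auto
    also have "\<dots> = (c * c) powr (p * q - 1) * (c powr q * (c powr q * c * c)) * (R powr (?e * (p * q - 1)) * R powr ?E)"
      by (simp add: powr_mult powr_powr)
    also have "\<dots> = B * R powr (?e * (p * q - 1) + ?E)"
      by (simp add: B_def powr_add)
    finally have "\<epsilon> \<le> (B * R powr (?e * (p * q - 1) + ?E)) powr (1 / (q * (p * q - 1)))"
      using pq pq1 \<epsilon> by (intro powr_le_of_powr_le) auto
    also have "\<dots> = A * R powr ((?e * (p * q - 1) + ?E) / (q * (p * q - 1)))"
      by (simp add: powr_mult powr_powr A_def)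
    also have "(?e * (p * q - 1) + ?E) / (q * (p * q - 1)) = - ((p + 2 + 1 / q) / (p * q - 1) - (N - 1) / 2)"
      unfolding m_def by (rule subcritical_exponent[OF pq])
    finally show ?thesis .
  qed
  moreover have "A > 0" using B by (simp add: A_def)
  ultimately show thesis by (intro that)
qed

text \<open>\<open>W\<close>, \<open>Ws\<close> are the masses weighted by the kernel with \<beta> =
  m - 1/q, on cone and shell, of the source in the first equation. Along W, Us, U, Vs, Ws the
  exponents of R add up to 0 by criticality, which leaves only L = 1 + log R. The same chain started
  from \<epsilon> has no logarithm.\<close>

lemma critical_estimate:
  fixes p q c N :: real
  assumes pq: "p > 1" "q > 1" and c: "c > 0"
    and crit: "(p + 2 + 1 / q) / (p * q - 1) - (N - 1) / 2 = 0"
  defines "m \<equiv> (N - 1) / 2"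
  obtains A where "A > 0"
    "\<And>R \<epsilon> L U Us Vs W Ws. R \<ge> 1 \<Longrightarrow> L \<ge> 1 \<Longrightarrow> \<epsilon> > 0 \<Longrightarrow> U \<ge> 0 \<Longrightarrow> Us \<ge> 0 \<Longrightarrow> Vs \<ge> 0 \<Longrightarrow> W \<ge> 0 \<Longrightarrow> Ws \<ge> 0 \<Longrightarrow>
      U powr p \<le> c * R powr ((N + 1) * (p - 1) - 2 * p) * Vs \<Longrightarrow>
      Us \<le> c * U \<Longrightarrow> Vs \<le> c * R powr (m - 1 / q) * Ws \<Longrightarrow>
      \<epsilon> powr q \<le> c * R powr ((q - 1) * N - q - m * q) * Us \<Longrightarrow>
      W powr q \<le> c * R powr ((q - 1) * N - q - m * q) * L powr (q - 1) * Us \<Longrightarrow>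
      W powr (p * q) \<le> A * L powr (p * (q - 1)) * Ws \<and> \<epsilon> powr (p * q) \<le> A * Ws"
proof -
  have pq1: "p * q > 1" using pq by (simp add: less_1_mult)
  let ?e = "(q - 1) * N - q - m * q"
  have ex: "?e * p + ((N + 1) * (p - 1) - 2 * p) + (m - 1 / q) = 0"
  proof -
    have "p + 2 + 1 / q = m * (p * q - 1)" using crit pq1 by (simp add: m_def field_simps)
    moreover have N: "N = 2 * m + 1" by (simp add: m_def field_simps)
    ultimately show ?thesis unfolding N by (simp add: algebra_simps)
  qed
  define A where "A = c powr p * (c powr p * c * c)"
  have main: "X powr (p * q) \<le> A * L powr (p * (q - 1)) * Ws"
    if R: "R \<ge> 1" and L: "L \<ge> 0" and X: "X \<ge> 0" and nn: "U \<ge> 0" "Us \<ge> 0" "Vs \<ge> 0" "Ws \<ge> 0"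
      and h1: "U powr p \<le> c * R powr ((N + 1) * (p - 1) - 2 * p) * Vs"
      and h3: "Us \<le> c * U" and h4: "Vs \<le> c * R powr (m - 1 / q) * Ws"
      and h5: "X powr q \<le> c * R powr ?e * L powr (q - 1) * Us"
    for R X L U Us Vs Ws
  proof -
    have "X powr (q * p) \<le> (c * R powr ?e * L powr (q - 1)) powr p * Us powr p"
      using h5 X nn c pq by (intro powr_le_powr_iterate) auto
    also have "\<dots> \<le> (c * R powr ?e * L powr (q - 1)) powr p * (c * U) powr p"
      using h3 nn pq by (intro mult_left_mono powr_mono2) auto
    also have "\<dots> = c powr p * R powr (?e * p) * L powr ((q - 1) * p) * (c powr p * U powr p)"
      by (simp add: powr_mult powr_powr)
    also have "\<dots> \<le> c powr p * R powr (?e * p) * L powr ((q - 1) * p) * (c powr p * (c * R powr ((N + 1) * (p - 1) - 2 * p) * Vs))"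
      by (intro mult_left_mono h1) auto
    also have "\<dots> \<le> c powr p * R powr (?e * p) * L powr ((q - 1) * p) * (c powr p * (c * R powr ((N + 1) * (p - 1) - 2 * p) * (c * R powr (m - 1 / q) * Ws)))"
      using c by (intro mult_left_mono h4) auto
    also have "\<dots> = A * L powr ((q - 1) * p) * (R powr (?e * p) * R powr ((N + 1) * (p - 1) - 2 * p) * R powr (m - 1 / q)) * Ws"
      by (simp add: A_def)
    also have "R powr (?e * p) * R powr ((N + 1) * (p - 1) - 2 * p) * R powr (m - 1 / q) = 1"
      unfolding powr_add[symmetric] ex using R by simp
    finally show ?thesis by (simp add: mult.commute[of q p] mult.commute[of "q - 1" p])
  qed
  have A: "A > 0" using c by (simp add: A_def)
  show thesis
  proof (rule that[OF A])
    fix R \<epsilon> L U Us Vs W Ws :: real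
    assume a: "R \<ge> 1" "L \<ge> 1" "\<epsilon> > 0" "U \<ge> 0" "Us \<ge> 0" "Vs \<ge> 0" "W \<ge> 0" "Ws \<ge> 0"
      "U powr p \<le> c * R powr ((N + 1) * (p - 1) - 2 * p) * Vs" "Us \<le> c * U" "Vs \<le> c * R powr (m - 1 / q) * Ws"
      "\<epsilon> powr q \<le> c * R powr ?e * Us" "W powr q \<le> c * R powr ?e * L powr (q - 1) * Us"
    show "W powr (p * q) \<le> A * L powr (p * (q - 1)) * Ws \<and> \<epsilon> powr (p * q) \<le> A * Ws"
      using main[of R L W U Us Vs Ws] main[of R 1 \<epsilon> U Us Vs Ws] a by simp
  qed
qed

text \<open>With p = q each weighted cone mass is bounded by the shell part of the other after one
  use of one equation, without passing through the unweighted cone mass; the powers drop to p and p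
  - 1. Neither closes on its own, hence the sum.\<close>

lemma critical_estimate_diagonal:
  fixes p c N :: real
  assumes p: "p > 1" and c: "c > 0"
    and crit: "(p + 2 + 1 / p) / (p * p - 1) - (N - 1) / 2 = 0"
  defines "m \<equiv> (N - 1) / 2"
  obtains A where "A > 0"
    "\<And>R \<epsilon> L Us Vs Wu Wv Wus Wvs. R \<ge> 1 \<Longrightarrow> L \<ge> 1 \<Longrightarrow> \<epsilon> > 0 \<Longrightarrow> Us \<ge> 0 \<Longrightarrow> Vs \<ge> 0 \<Longrightarrow> Wu \<ge> 0 \<Longrightarrow> Wv \<ge> 0 \<Longrightarrow> Wus \<ge> 0 \<Longrightarrow> Wvs \<ge> 0 \<Longrightarrow>
      Us \<le> c * R powr (m - 1 / p) * Wus \<Longrightarrow> Vs \<le> c * R powr (m - 1 / p) * Wvs \<Longrightarrow>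
      \<epsilon> powr p \<le> c * R powr ((p - 1) * N - p - m * p) * Us \<Longrightarrow>
      Wv powr p \<le> c * R powr ((p - 1) * N - p - m * p) * L powr (p - 1) * Us \<Longrightarrow>
      Wu powr p \<le> c * R powr ((p - 1) * N - p - m * p) * L powr (p - 1) * Vs \<Longrightarrow>
      (Wu + Wv) powr p \<le> A * L powr (p - 1) * (Wus + Wvs) \<and> \<epsilon> powr p \<le> A * (Wus + Wvs)"
proof -
  let ?e = "(p - 1) * N - p - m * p"
  have ex: "?e + (m - 1 / p) = 0"
  proof -
    have pp: "p * p > 1" using p by (simp add: less_1_mult)
    have "p + 2 + 1 / p = (N - 1) / 2 * (p * p - 1)" using crit pp by (simp add: field_simps)
    \<comment> \<open>For equal exponents both sides of the critical relation contain the factor p +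
      1. Cancelling it gives 1 + 1/p = m (p - 1), under which already a single step is scale
      invariant.\<close>
    then have "(p + 1) * (p + 1) = (N - 1) / 2 * (p - 1) * p * (p + 1)" using p by (simp add: field_simps)
    then have "p + 1 = (N - 1) / 2 * (p - 1) * p" using p by (metis add_pos_pos less_irrefl less_trans mult_right_cancel zero_less_one)
    then have "1 + 1 / p = m * (p - 1)" using p by (simp add: m_def field_simps)
    moreover have N: "N = 2 * m + 1" by (simp add: m_def field_simps)
    ultimately show ?thesis unfolding N by (simp add: algebra_simps)
  qed
  have main: "X powr p \<le> c * c * L powr (p - 1) * Ys"
    if R: "R \<ge> 1" and h: "Y \<le> c * R powr (m - 1 / p) * Ys" "X powr p \<le> c * R powr ?e * L powr (p - 1) * Y" for R X L Y Ys
  proof -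
    have "X powr p \<le> c * R powr ?e * L powr (p - 1) * (c * R powr (m - 1 / p) * Ys)"
      using h c by (meson mult_left_mono mult_nonneg_nonneg order_trans powr_ge_zero less_imp_le)
    also have "\<dots> = c * c * L powr (p - 1) * (R powr ?e * R powr (m - 1 / p)) * Ys" by simp
    also have "R powr ?e * R powr (m - 1 / p) = 1"
      unfolding powr_add[symmetric] ex using R by simp
    finally show ?thesis by simp
  qed
  define A where "A = 2 powr p * (c * c)"
  have A: "A > 0" using c by (simp add: A_def)
  have A1: "c * c \<le> A"
    using c p mult_right_mono[OF ge_one_powr_ge_zero[of 2 p], of "c * c"] by (simp add: A_def)
  show thesis
  proof (rule that[OF A])
    fix R \<epsilon> L Us Vs Wu Wv Wus Wvs :: real
    assume a: "R \<ge> 1" "L \<ge> 1" "\<epsilon> > 0" "Us \<ge> 0" "Vs \<ge> 0" "Wu \<ge> 0" "Wv \<ge> 0" "Wus \<ge> 0" "Wvs \<ge> 0"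
      "Us \<le> c * R powr (m - 1 / p) * Wus" "Vs \<le> c * R powr (m - 1 / p) * Wvs"
      "\<epsilon> powr p \<le> c * R powr ?e * Us"
      "Wv powr p \<le> c * R powr ?e * L powr (p - 1) * Us"
      "Wu powr p \<le> c * R powr ?e * L powr (p - 1) * Vs"
    have 1: "Wv powr p \<le> c * c * L powr (p - 1) * Wus" by (rule main[OF a(1,10,13)])
    have 2: "Wu powr p \<le> c * c * L powr (p - 1) * Wvs" by (rule main[OF a(1,11,14)])
    have 3: "\<epsilon> powr p \<le> c * c * Wus" using main[OF a(1,10), of \<epsilon> 1] a(12) by simp
    have "(Wu + Wv) powr p \<le> (2 * max Wu Wv) powr p" using a p by (intro powr_mono2) auto
    also have "\<dots> = 2 powr p * (max Wu Wv) powr p" by (rule powr_mult)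
    also have "\<dots> \<le> 2 powr p * (Wu powr p + Wv powr p)"
      by (intro mult_left_mono) (auto simp: max_def)
    also have "\<dots> \<le> 2 powr p * (c * c * L powr (p - 1) * Wvs + c * c * L powr (p - 1) * Wus)"
      by (intro mult_left_mono add_mono 1 2) auto
    also have "\<dots> = A * L powr (p - 1) * (Wus + Wvs)" by (simp add: A_def algebra_simps)
    finally have 4: "(Wu + Wv) powr p \<le> A * L powr (p - 1) * (Wus + Wvs)" .
    have "\<epsilon> powr p \<le> A * (Wus + Wvs)"
      using 3 A1 a(8,9) mult_mono[of "c * c" A Wus "Wus + Wvs"] A by linarith
    with 4 show "(Wu + Wv) powr p \<le> A * L powr (p - 1) * (Wus + Wvs) \<and> \<epsilon> powr p \<le> A * (Wus + Wvs)" ..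
  qed
qed

subsection \<open>Estimates for a single equation\<close>

lemma integrable_continuous_support:
  fixes Q :: "real^'n \<Rightarrow> real"
  assumes "continuous_on UNIV Q" "\<And>x. norm x > r \<Longrightarrow> Q x = 0"
  shows "integrable lebesgue Q"
proof -
  have "bounded (Q ` cball 0 r)"
    by (intro compact_imp_bounded compact_continuous_image continuous_on_subset[OF assms(1)] compact_cball) auto
  then obtain M where M: "M > 0" "\<forall>y\<in>Q ` cball 0 r. norm y \<le> M"
    unfolding bounded_pos by blast
  have "norm (Q x) \<le> M" for x
    using M assms(2)[of x] by (cases "norm x > r") auto
  then show ?thesis
    by (rule integrable_bounded_support[OF continuous_imp_lebesgue_measurable[OF assms(1)] _ assms(2)])
qed

lemma avg_slice_continuous: "smooth \<kappa> \<Longrightarrow> continuous_on UNIV (\<lambda>x. sph.avg \<kappa> (x, t))"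
  by (rule smooth_imp_continuous_on[OF smooth_slice[OF sph.smooth_avg]])

text \<open>As \<mu> grows the kernel becomes nearly constant on the ball of radius r, while its
  derivative is smaller by a factor 1 / \<mu>. Divided by \<mu>^(-\<beta>), the functional tends to
  a positive multiple of the integral of g, even though g may change sign and f is
  arbitrary.\<close>

lemma data_functional_pos:
  fixes f g :: "real^'n \<Rightarrow> real"
  assumes f: "continuous_on UNIV f" "\<And>x. norm x > r \<Longrightarrow> f x = 0"
    and g: "continuous_on UNIV g" "\<And>x. norm x > r \<Longrightarrow> g x = 0" "(\<integral>x. g x \<partial>lebesgue) > 0"
    and r: "r \<ge> 0" and \<beta>: "\<beta> \<ge> 0"
  obtains \<mu> where "\<mu> \<ge> r + 2"
    "0 < (\<integral>x. g x * sph.avg (shifted_kern \<beta> \<mu>) (x, 0) \<partial>lebesgue) - (\<integral>x. f x * sph.avg (deriv (shifted_kern \<beta> \<mu>)) (x, 0) \<partial>lebesgue)"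
proof -
  let ?tot = "measure (sphere_measure :: (real^'n) measure) (space sphere_measure)"
  have tot: "?tot > 0" by (rule sphere_measure_pos)
  define I where "I = (\<integral>x. g x \<partial>lebesgue)"
  define G where "G = (\<integral>x. \<bar>g x\<bar> \<partial>lebesgue)"
  define F where "F = (\<integral>x. \<bar>f x\<bar> \<partial>lebesgue)"
  have ig: "integrable lebesgue g" by (rule integrable_continuous_support[OF g(1,2)])
  have jf: "integrable lebesgue f" by (rule integrable_continuous_support[OF f])
  \<comment> \<open>Relative to \<mu>^(-\<beta>), these are the extreme values of the kernel on the
    ball; the f term gains 1 / (\<mu> - r) from its extra power.\<close>
  let ?a = "\<lambda>\<mu>. (1 - r / \<mu>) powr (- \<beta>)" and ?b = "\<lambda>\<mu>. (1 + r / \<mu>) powr (- \<beta>)"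
  have r0: "((\<lambda>\<mu>. r / \<mu>) \<longlongrightarrow> 0) at_top" "((\<lambda>\<mu>. 1 / (\<mu> - r)) \<longlongrightarrow> 0) at_top" by real_asymp+
  have "((\<lambda>\<mu>. I - (?a \<mu> - ?b \<mu>) * G - \<beta> * (?a \<mu> * (1 / (\<mu> - r))) * F) \<longlongrightarrow>
      I - ((1 - 0) powr (- \<beta>) - (1 + 0) powr (- \<beta>)) * G - \<beta> * ((1 - 0) powr (- \<beta>) * 0) * F) at_top"
    by (intro tendsto_intros r0) auto
  then have "((\<lambda>\<mu>. I - (?a \<mu> - ?b \<mu>) * G - \<beta> * (?a \<mu> * (1 / (\<mu> - r))) * F) \<longlongrightarrow> I) at_top" by simp
  then have "\<forall>\<^sub>F \<mu> in at_top. 0 < I - (?a \<mu> - ?b \<mu>) * G - \<beta> * (?a \<mu> * (1 / (\<mu> - r))) * F"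
    using g(3) by (intro order_tendstoD(1)) (auto simp: I_def)
  then have "\<forall>\<^sub>F \<mu> in at_top. r + 2 \<le> \<mu> \<and> 0 < I - (?a \<mu> - ?b \<mu>) * G - \<beta> * (?a \<mu> * (1 / (\<mu> - r))) * F"
    using eventually_ge_at_top[of "r + 2"] by eventually_elim simp
  then obtain \<mu> where \<mu>: "r + 2 \<le> \<mu>" and pos: "0 < I - (?a \<mu> - ?b \<mu>) * G - \<beta> * (?a \<mu> * (1 / (\<mu> - r))) * F"
    using eventually_happens'[OF trivial_limit_at_top_linorder] by blast
  have \<mu>0: "\<mu> > 0" "\<mu> > r" using \<mu> r by auto
  have pb: "?tot * (\<mu> + r) powr (- b) \<le> sphere_potential b x \<mu>" "sphere_potential b x \<mu> \<le> ?tot * (\<mu> - r) powr (- b)"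
    if x: "norm x \<le> r" and b: "b \<ge> 0" for x :: "real^'n" and b
  proof -
    have i: "integrable sphere_measure (\<lambda>\<omega>. (\<mu> - x \<bullet> \<omega>) powr - b)"
      using x \<mu> by (intro sphere_potential_integrable) auto
    have "(\<integral>\<omega>. (\<mu> + r) powr (- b) \<partial>(sphere_measure :: (real^'n) measure)) \<le> sphere_potential b x \<mu>"
      unfolding sphere_potential_def
    proof (rule integral_mono_AE[OF _ i])
      show "AE \<omega> in sphere_measure. (\<mu> + r) powr (- b) \<le> (\<mu> - x \<bullet> \<omega>) powr - b"
        using sphere_phase[of \<mu> x] by eventually_elim (use x b \<mu> in \<open>auto intro!: powr_mono2'\<close>)
    qed simp
    then show "?tot * (\<mu> + r) powr (- b) \<le> sphere_potential b x \<mu>" by simp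
    have "sphere_potential b x \<mu> \<le> (\<integral>\<omega>. (\<mu> - r) powr (- b) \<partial>(sphere_measure :: (real^'n) measure))"
      unfolding sphere_potential_def
    proof (rule integral_mono_AE[OF i])
      show "AE \<omega> in sphere_measure. (\<mu> - x \<bullet> \<omega>) powr - b \<le> (\<mu> - r) powr (- b)"
        using sphere_phase[of \<mu> x] by eventually_elim (use x b \<mu>0 in \<open>auto intro!: powr_mono2'\<close>)
    qed simp
    then show "sphere_potential b x \<mu> \<le> ?tot * (\<mu> - r) powr (- b)" by simp
  qed
  let ?\<kappa> = "shifted_kern \<beta> \<mu>"
  have sm: "smooth ?\<kappa>" "smooth (deriv ?\<kappa>)" by (intro smooth_shifted_kern smooth_deriv)+
  have i1: "integrable lebesgue (\<lambda>x. g x * sph.avg ?\<kappa> (x, 0))" "integrable lebesgue (\<lambda>x. f x * sph.avg (deriv ?\<kappa>) (x, 0))"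
    by (rule integrable_continuous_support[where r = r];
        use f g in \<open>auto intro!: continuous_on_mult avg_slice_continuous sm\<close>)+
  have pa: "(\<mu> - r) powr (- b) = \<mu> powr (- b) * (1 - r / \<mu>) powr (- b)" "(\<mu> + r) powr (- b) = \<mu> powr (- b) * (1 + r / \<mu>) powr (- b)" for b
  proof -
    have e: "\<mu> - r = \<mu> * (1 - r / \<mu>)" "\<mu> + r = \<mu> * (1 + r / \<mu>)" using \<mu>0 by (auto simp: field_simps)
    show "(\<mu> - r) powr (- b) = \<mu> powr (- b) * (1 - r / \<mu>) powr (- b)" by (subst e(1)) (rule powr_mult)
    show "(\<mu> + r) powr (- b) = \<mu> powr (- b) * (1 + r / \<mu>) powr (- b)" by (subst e(2)) (rule powr_mult)
  qed
  let ?m = "?tot * \<mu> powr (- \<beta>)"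
  have ab: "?b \<mu> \<le> 1" "1 \<le> ?a \<mu>"
  proof -
    have "(1 + r / \<mu>) powr (- \<beta>) \<le> 1 powr (- \<beta>)" using r \<mu>0 \<beta> by (intro powr_mono2') auto
    then show "?b \<mu> \<le> 1" by simp
    have "1 powr (- \<beta>) \<le> (1 - r / \<mu>) powr (- \<beta>)" using r \<mu>0 \<beta> by (intro powr_mono2') (auto simp: field_simps)
    then show "1 \<le> ?a \<mu>" by simp
  qed
  have A: "?m * (I - (?a \<mu> - ?b \<mu>) * G) \<le> (\<integral>x. g x * sph.avg ?\<kappa> (x, 0) \<partial>lebesgue)"
  proof -
    have "?m * (I - (?a \<mu> - ?b \<mu>) * G) = (\<integral>x. ?m * (g x - (?a \<mu> - ?b \<mu>) * \<bar>g x\<bar>) \<partial>lebesgue)"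
      using ig by (simp add: I_def G_def)
    also have "\<dots> \<le> (\<integral>x. g x * sph.avg ?\<kappa> (x, 0) \<partial>lebesgue)"
    proof (rule integral_mono_AE[OF _ i1(1)])
      show "integrable lebesgue (\<lambda>x. ?m * (g x - (?a \<mu> - ?b \<mu>) * \<bar>g x\<bar>))"
        using ig by (intro integrable_mult_right Bochner_Integration.integrable_diff integrable_abs)
      show "AE x in lebesgue. ?m * (g x - (?a \<mu> - ?b \<mu>) * \<bar>g x\<bar>) \<le> g x * sph.avg ?\<kappa> (x, 0)"
      proof (intro AE_I2)
        fix x
        show "?m * (g x - (?a \<mu> - ?b \<mu>) * \<bar>g x\<bar>) \<le> g x * sph.avg ?\<kappa> (x, 0)"
        proof (cases "norm x > r")
          case False
          then have x: "norm x \<le> r" by simp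
          have av: "sph.avg ?\<kappa> (x, 0) = sphere_potential \<beta> x \<mu>" using avg_shifted_kern(1)[of x r 0 \<mu> \<beta>] x \<mu> by simp
          have p: "?m * ?b \<mu> \<le> sphere_potential \<beta> x \<mu>" "sphere_potential \<beta> x \<mu> \<le> ?m * ?a \<mu>"
            using pb[OF x \<beta>] unfolding pa by (simp_all add: mult_ac)
          have m: "?m * ?b \<mu> \<le> ?m * 1" "?m * 1 \<le> ?m * ?a \<mu>"
            using ab tot by (intro mult_left_mono; simp)+
          \<comment> \<open>Since \<open>?b\<close> <= 1 <= \<open>?a\<close>, the comparison value
            \<open>?m\<close> lies between the same bounds as the potential, so their distance is at
            most the gap.\<close>
          have "\<bar>sphere_potential \<beta> x \<mu> - ?m\<bar> \<le> ?m * (?a \<mu> - ?b \<mu>)"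
            using p m by (simp add: abs_le_iff right_diff_distrib)
          then have "\<bar>g x\<bar> * \<bar>sphere_potential \<beta> x \<mu> - ?m\<bar> \<le> \<bar>g x\<bar> * (?m * (?a \<mu> - ?b \<mu>))"
            by (intro mult_left_mono) auto
          moreover have "- (g x * (sphere_potential \<beta> x \<mu> - ?m)) \<le> \<bar>g x\<bar> * \<bar>sphere_potential \<beta> x \<mu> - ?m\<bar>"
            unfolding abs_mult[symmetric] by (rule abs_ge_minus_self)
          ultimately have "- (g x * (sphere_potential \<beta> x \<mu> - ?m)) \<le> \<bar>g x\<bar> * (?m * (?a \<mu> - ?b \<mu>))"
            by linarith
          then show ?thesis unfolding av by (simp add: algebra_simps)
        qed (simp add: g)
      qed
    qed
    finally show ?thesis .
  qed
  have B: "(\<integral>x. f x * sph.avg (deriv ?\<kappa>) (x, 0) \<partial>lebesgue) \<le> ?m * (\<beta> * (?a \<mu> * (1 / (\<mu> - r))) * F)"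
  proof -
    have "(\<integral>x. f x * sph.avg (deriv ?\<kappa>) (x, 0) \<partial>lebesgue) \<le> (\<integral>x. ?m * (\<beta> * (?a \<mu> * (1 / (\<mu> - r)))) * \<bar>f x\<bar> \<partial>lebesgue)"
    proof (rule integral_mono_AE[OF i1(2)])
      show "integrable lebesgue (\<lambda>x. ?m * (\<beta> * (?a \<mu> * (1 / (\<mu> - r)))) * \<bar>f x\<bar>)"
        using jf by (intro integrable_mult_right integrable_abs)
      show "AE x in lebesgue. f x * sph.avg (deriv ?\<kappa>) (x, 0) \<le> ?m * (\<beta> * (?a \<mu> * (1 / (\<mu> - r)))) * \<bar>f x\<bar>"
      proof (intro AE_I2)
        fix x
        show "f x * sph.avg (deriv ?\<kappa>) (x, 0) \<le> ?m * (\<beta> * (?a \<mu> * (1 / (\<mu> - r)))) * \<bar>f x\<bar>"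
        proof (cases "norm x > r")
          case False
          then have x: "norm x \<le> r" by simp
          have av: "sph.avg (deriv ?\<kappa>) (x, 0) = - \<beta> * sphere_potential (\<beta> + 1) x \<mu>"
            using avg_shifted_kern(2)[of x r 0 \<mu> \<beta>] x \<mu> by simp
          have "(\<mu> - r) powr (- (\<beta> + 1)) = (\<mu> - r) powr (- \<beta>) * (1 / (\<mu> - r))"
          proof -
            have "- (\<beta> + 1) = - \<beta> - 1" by simp
            then have "(\<mu> - r) powr (- (\<beta> + 1)) = (\<mu> - r) powr (- \<beta> - 1)" by (simp only:)
            then show ?thesis using \<mu>0 powr_diff[of "\<mu> - r" "- \<beta>" 1] by simp
          qed
          then have "sphere_potential (\<beta> + 1) x \<mu> \<le> ?m * (?a \<mu> * (1 / (\<mu> - r)))"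
            using pb(2)[OF x, of "\<beta> + 1"] \<beta> unfolding pa(1)[of \<beta>] by (simp add: mult_ac)
          then have "\<beta> * sphere_potential (\<beta> + 1) x \<mu> \<le> \<beta> * (?m * (?a \<mu> * (1 / (\<mu> - r))))"
            by (rule mult_left_mono[OF _ \<beta>])
          then have "\<bar>f x\<bar> * (\<beta> * sphere_potential (\<beta> + 1) x \<mu>) \<le> \<bar>f x\<bar> * (\<beta> * (?m * (?a \<mu> * (1 / (\<mu> - r)))))"
            by (rule mult_left_mono[OF _ abs_ge_zero])
          moreover have "f x * sph.avg (deriv ?\<kappa>) (x, 0) \<le> \<bar>f x\<bar> * (\<beta> * sphere_potential (\<beta> + 1) x \<mu>)"
          proof -
            have "f x * sph.avg (deriv ?\<kappa>) (x, 0) = (- f x) * (\<beta> * sphere_potential (\<beta> + 1) x \<mu>)" unfolding av by simp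
            also have "\<dots> \<le> \<bar>f x\<bar> * (\<beta> * sphere_potential (\<beta> + 1) x \<mu>)"
              by (intro mult_right_mono mult_nonneg_nonneg \<beta> sphere_potential_nonneg abs_ge_minus_self)
            finally show ?thesis .
          qed
          ultimately show ?thesis by (simp add: mult_ac)
        qed (simp add: f)
      qed
    qed
    also have "\<dots> = ?m * (\<beta> * (?a \<mu> * (1 / (\<mu> - r))) * F)" by (simp add: F_def)
    finally show ?thesis .
  qed
  have "0 < ?m * (I - (?a \<mu> - ?b \<mu>) * G - \<beta> * (?a \<mu> * (1 / (\<mu> - r))) * F)"
    using tot \<mu>0 pos by (intro mult_pos_pos) auto
  then have "0 < (\<integral>x. g x * sph.avg ?\<kappa> (x, 0) \<partial>lebesgue) - (\<integral>x. f x * sph.avg (deriv ?\<kappa>) (x, 0) \<partial>lebesgue)"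
    using A B by (simp add: right_diff_distrib)
  with \<mu> show thesis by (rule that)
qed

text \<open>One of the two coupled equations: \<open>h\<close> is its source, and \<open>F\<close> is the source that \<open>u\<close> generates
  in the other equation.\<close>

definition wave_half ::
  "real \<Rightarrow> real \<Rightarrow> real \<Rightarrow> (real^'n \<Rightarrow> real) \<Rightarrow> (real^'n \<Rightarrow> real) \<Rightarrow> real \<Rightarrow> real \<Rightarrow>
   (real \<Rightarrow> real^'n \<Rightarrow> real) \<Rightarrow> (real \<Rightarrow> real^'n \<Rightarrow> real) \<Rightarrow> (real \<Rightarrow> real^'n \<Rightarrow> real) \<Rightarrow> bool" where
  "wave_half T \<epsilon> r f g b q u h F \<longleftrightarrow>
     (\<exists>u' Du. C_H1 T u Du \<and> C1_L2 T u u' \<and> (AE x in lebesgue. u 0 x = \<epsilon> * f x) \<and> weak_wave_identity T \<epsilon> g h u' Du) \<and>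
     L1_L1 T h \<and> L1_L1 T F \<and>
     (AE t in lebesgue_on {0<..<T}. AE x in lebesgue. norm x > r + t \<longrightarrow> u t x = 0 \<and> h t x = 0) \<and>
     (\<forall>t x. b * \<bar>u t x\<bar> powr q \<le> F t x) \<and> (\<forall>t x. 0 \<le> h t x)"

text \<open>The cone is not imposed on the weight: the sources in question vanish outside it almost
  everywhere. This is the form in which Young's inequality delivers the mass.\<close>

definition shell_mass :: "nat \<Rightarrow> real \<Rightarrow> real \<Rightarrow> (real \<Rightarrow> real^'n \<Rightarrow> real) \<Rightarrow> real" where
  "shell_mass n T R F = spacetime_integral T F (\<lambda>z. indicator (shell R) z * cutoff n R (snd z))"

abbreviation cone_mass :: "real \<Rightarrow> nat \<Rightarrow> real \<Rightarrow> real \<Rightarrow> (real \<Rightarrow> real) \<Rightarrow> (real \<Rightarrow> real^'n \<Rightarrow> real) \<Rightarrow> real" where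
  "cone_mass r n T R \<kappa> F \<equiv> spacetime_integral T F (sph.cone_weight r n R \<kappa>)"

lemma shell_mass_nonneg: "(\<And>t x. 0 \<le> F t x) \<Longrightarrow> 0 \<le> shell_mass n T R F"
  unfolding shell_mass_def using cutoff_bounds by (intro spacetime_integral_nonneg mult_nonneg_nonneg) auto

lemma cone_weight_nonneg:
  fixes z :: "(real^'n) \<times> real"
  assumes "\<And>z::(real^'n) \<times> real. z \<in> cone r \<Longrightarrow> 0 \<le> sph.avg \<kappa> z"
  shows "0 \<le> sph.cone_weight r n R \<kappa> z"
  using assms[of z] cutoff_bounds(1)[of n R "snd z"]
  by (cases "z \<in> cone r") (auto simp: sph.cone_weight_def)

lemma cone_mass_nonneg:
  fixes F :: "real \<Rightarrow> real^'n \<Rightarrow> real"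
  assumes "\<And>t x. 0 \<le> F t x" "\<And>z::(real^'n) \<times> real. z \<in> cone r \<Longrightarrow> 0 \<le> sph.avg \<kappa> z"
  shows "0 \<le> cone_mass r n T R \<kappa> F"
  by (intro spacetime_integral_nonneg mult_nonneg_nonneg assms(1)) (rule cone_weight_nonneg[OF assms(2)])

lemma avg_const_nonneg: "0 \<le> sph.avg (\<lambda>_. 1) z"
  by (simp add: wave_avg_def)

lemma avg_kern_nonneg: "\<mu> \<ge> r + 2 \<Longrightarrow> z \<in> cone r \<Longrightarrow> 0 \<le> sph.avg (shifted_kern \<beta> \<mu>) z"
  using avg_shifted_kern(1)[of "fst z" r "snd z" \<mu> \<beta>] sphere_potential_nonneg[of \<beta> "fst z" "snd z + \<mu>"]
  by (simp add: cone_def)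

text \<open>The cutoff is an $n$-th power with $n (1 - 1/q) \ge 2$, so that its first two derivatives are
  controlled by its power $1/q$, as Young's inequality requires.\<close>

locale wave_data =
  fixes f g :: "real^'n \<Rightarrow> real" and r b q :: real and n :: nat
  assumes f: "continuous_on UNIV f" "\<And>x. norm x > r \<Longrightarrow> f x = 0"
    and g: "continuous_on UNIV g" "\<And>x. norm x > r \<Longrightarrow> g x = 0" "(\<integral>x. g x \<partial>lebesgue) > 0"
    and r: "0 \<le> r" and b: "b > 0" and q: "q > 1" and n: "real n * (1 - 1 / q) \<ge> 2"
begin

lemma n0: "n > 0" using n by (cases "n = 0") auto

definition cutoff_bound :: "real \<Rightarrow> bool" where
  "cutoff_bound C \<longleftrightarrow> C > 0 \<and> (\<forall>R>0. \<forall>t. \<bar>deriv (cutoff n R) t\<bar> \<le> C / R * cutoff n R t powr (1 / q) \<and>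
    \<bar>deriv (deriv (cutoff n R)) t\<bar> \<le> C / R\<^sup>2 * cutoff n R t powr (1 / q))"

lemma cutoff_bound_exists: "\<exists>C. cutoff_bound C"
  by (rule cutoff_derivative_bounds[OF q n]) (auto simp: cutoff_bound_def)

lemma test_inequality_data:
  fixes \<kappa> :: "real \<Rightarrow> real"
  assumes C: "cutoff_bound C"
    and \<kappa>: "smooth \<kappa>" "\<And>z. z \<in> cone r \<Longrightarrow> 0 \<le> sph.avg \<kappa> (z :: (real^'n) \<times> real)"
    and I: "0 \<le> (\<integral>x. g x * sph.avg \<kappa> (x, 0) \<partial>lebesgue) - (\<integral>x. f x * sph.avg (deriv \<kappa>) (x, 0) \<partial>lebesgue)" (is "0 \<le> ?I")
    and w: "wave_half T \<epsilon> r f g b q u h F" and \<epsilon>: "\<epsilon> > 0" and R: "1 \<le> R" "R < T"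
    and K: "K > 0" "spacetime_integral T (\<lambda>t. indicator (cball (0::real^'n) (r + R)))
        (\<lambda>z. indicator (cone r \<inter> shell R) z * sph.derivative_weight C R \<kappa> z powr (q / (q - 1))) \<le> K"
  shows "(\<epsilon> * ?I + cone_mass r n T R \<kappa> h) powr q \<le> 2 powr q * K powr (q - 1) / b * shell_mass n T R F"
proof -
  obtain u' Du where u: "C_H1 T u Du" "C1_L2 T u u'" "AE x in lebesgue. u 0 x = \<epsilon> * f x" "weak_wave_identity T \<epsilon> g h u' Du"
    and h: "L1_L1 T h" and F: "L1_L1 T F"
    and van: "AE t in lebesgue_on {0<..<T}. AE x in lebesgue. norm x > r + t \<longrightarrow> u t x = 0 \<and> h t x = 0"
    and Fu: "\<And>t x. b * \<bar>u t x\<bar> powr q \<le> F t x" and h0: "\<And>t x. 0 \<le> h t x"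
    using w unfolding wave_half_def by blast
  have R0: "0 < R" using R by simp
  have C': "C > 0" "\<And>t. \<bar>deriv (cutoff n R) t\<bar> \<le> C / R * cutoff n R t powr (1 / q)"
    "\<And>t. \<bar>deriv (deriv (cutoff n R)) t\<bar> \<le> C / R\<^sup>2 * cutoff n R t powr (1 / q)"
    using C R0 unfolding cutoff_bound_def by blast+
  have "0 \<le> \<epsilon> * ?I + cone_mass r n T R \<kappa> h"
    using \<epsilon> I cone_mass_nonneg[OF h0 \<kappa>(2)] by (intro add_nonneg_nonneg mult_nonneg_nonneg) auto
  from sph.test_inequality[OF u continuous_imp_lebesgue_measurable[OF f(1)] f(2) g(2) h van F Fu b q C' R0 R(2) n0 r \<kappa>(1) K this]
  show ?thesis by (simp add: shell_mass_def)
qed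

lemma const_estimate:
  obtains c where "c > 0"
    "\<And>T \<epsilon> u h F R. wave_half T \<epsilon> r f g b q u h F \<Longrightarrow> \<epsilon> > 0 \<Longrightarrow> 1 \<le> R \<Longrightarrow> R < T \<Longrightarrow>
      cone_mass r n T R (\<lambda>_. 1) h powr q \<le> c * R powr ((real CARD('n) + 1) * (q - 1) - 2 * q) * shell_mass n T R F"
proof -
  let ?s = "q / (q - 1)"
  have avg: "sph.avg (\<lambda>_. 1) (x, 0) = measure (sphere_measure :: (real^'n) measure) (space sphere_measure)" "sph.avg (deriv (\<lambda>_. 1)) (x, 0) = 0" for x :: "real^'n"
    by (simp_all add: wave_avg_def)
  have I: "0 \<le> (\<integral>x. g x * sph.avg (\<lambda>_. 1) (x, 0) \<partial>lebesgue) - (\<integral>x. f x * sph.avg (deriv (\<lambda>_. 1)) (x, 0) \<partial>lebesgue)" (is "0 \<le> ?I")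
    unfolding avg using g(3) by simp
  obtain C where C: "cutoff_bound C" using cutoff_bound_exists ..
  then have C0: "C > 0" by (simp add: cutoff_bound_def)
  note main = test_inequality_data[OF C smooth_const avg_const_nonneg I]
  have s: "?s > 0" using q by simp
  obtain A where A: "A > 0" and K: "\<And>T R. 1 \<le> R \<Longrightarrow>
    spacetime_integral T (\<lambda>t. indicator (cball (0::real^'n) (r + R)))
      (\<lambda>z. indicator (cone r \<inter> shell R) z * sph.derivative_weight C R (\<lambda>_. 1) z powr ?s)
    \<le> A * R powr (real CARD('n) + 1 - 2 * ?s)"
    by (rule weight_bound_const[OF s C0 r]) blast
  define c where "c = 2 powr q * A powr (q - 1) / b"
  show thesis
  proof (rule that)
    show "c > 0" using A b by (simp add: c_def)
    fix T \<epsilon> R :: real and u h F :: "real \<Rightarrow> real^'n \<Rightarrow> real"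
    assume w: "wave_half T \<epsilon> r f g b q u h F" "\<epsilon> > 0" "1 \<le> R" "R < T"
    have h0: "0 \<le> h t x" for t x using w(1) by (simp add: wave_half_def)
    have J: "0 \<le> cone_mass r n T R (\<lambda>_. 1) h" by (rule cone_mass_nonneg[OF h0 avg_const_nonneg])
    have "cone_mass r n T R (\<lambda>_. 1) h powr q \<le> (\<epsilon> * ?I + cone_mass r n T R (\<lambda>_. 1) h) powr q"
      using J I w(2) q by (intro powr_mono2) auto
    also have "\<dots> \<le> 2 powr q * (A * R powr (real CARD('n) + 1 - 2 * ?s)) powr (q - 1) / b * shell_mass n T R F"
      using A w(3) by (intro main[OF w] K) auto
    also have "(A * R powr (real CARD('n) + 1 - 2 * ?s)) powr (q - 1) = A powr (q - 1) * R powr ((real CARD('n) + 1) * (q - 1) - 2 * q)"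
    proof -
      have "(real CARD('n) + 1 - 2 * ?s) * (q - 1) = (real CARD('n) + 1) * (q - 1) - 2 * q"
        using q by (simp add: field_simps)
      then show ?thesis by (simp add: powr_mult powr_powr)
    qed
    finally show "cone_mass r n T R (\<lambda>_. 1) h powr q \<le> c * R powr ((real CARD('n) + 1) * (q - 1) - 2 * q) * shell_mass n T R F"
      by (simp add: c_def mult_ac)
  qed
qed

text \<open>Both bounds come from one inequality for the q-th power of \<epsilon> I plus the cone
  mass, I being the positive data functional: each summand is kept in turn and the other, being
  nonnegative, dropped.\<close>

lemma kern_estimate:
  fixes \<beta> :: real
  defines "m \<equiv> (real CARD('n) - 1) / 2"
  assumes \<beta>: "\<beta> \<ge> 0" "\<beta> + 1 > m" "(\<beta> + 1 - m) * (q / (q - 1)) \<ge> 1"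
  obtains \<mu> c where "\<mu> \<ge> r + 2" "c > 0"
    "\<And>T \<epsilon> u h F R. wave_half T \<epsilon> r f g b q u h F \<Longrightarrow> \<epsilon> > 0 \<Longrightarrow> 1 \<le> R \<Longrightarrow> R < T \<Longrightarrow>
      cone_mass r n T R (shifted_kern \<beta> \<mu>) h powr q
        \<le> c * R powr ((q - 1) * real CARD('n) - q - m * q) * (if (\<beta> + 1 - m) * (q / (q - 1)) = 1 then 1 + ln R else 1) powr (q - 1) * shell_mass n T R F"
    "\<And>T \<epsilon> u h F R. wave_half T \<epsilon> r f g b q u h F \<Longrightarrow> \<epsilon> > 0 \<Longrightarrow> 1 \<le> R \<Longrightarrow> R < T \<Longrightarrow>
      \<epsilon> powr q \<le> c * R powr ((q - 1) * real CARD('n) - q - m * q) * (if (\<beta> + 1 - m) * (q / (q - 1)) = 1 then 1 + ln R else 1) powr (q - 1) * shell_mass n T R F"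
proof -
  let ?s = "q / (q - 1)"
  let ?N = "real CARD('n)"
  obtain \<mu> where \<mu>: "\<mu> \<ge> r + 2"
    and I: "0 < (\<integral>x. g x * sph.avg (shifted_kern \<beta> \<mu>) (x, 0) \<partial>lebesgue) - (\<integral>x. f x * sph.avg (deriv (shifted_kern \<beta> \<mu>)) (x, 0) \<partial>lebesgue)" (is "0 < ?I")
    by (rule data_functional_pos[OF f g r \<beta>(1)]) blast
  let ?\<kappa> = "shifted_kern \<beta> \<mu>"
  obtain C where C: "cutoff_bound C" using cutoff_bound_exists ..
  then have C0: "C > 0" by (simp add: cutoff_bound_def)
  note main = test_inequality_data[OF C smooth_shifted_kern _ less_imp_le[OF I]]
  have s: "?s > 0" using q by simp
  let ?ell = "\<lambda>R. if (\<beta> + 1 - m) * ?s = 1 then 1 + ln R else 1"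
  obtain A where A: "A > 0" and K: "\<And>T R. 1 \<le> R \<Longrightarrow>
    spacetime_integral T (\<lambda>t. indicator (cball (0::real^'n) (r + R)))
      (\<lambda>z. indicator (cone r \<inter> shell R) z * sph.derivative_weight C R ?\<kappa> z powr ?s)
    \<le> A * R powr (?N - ?s - m * ?s) * ?ell R"
    by (rule weight_bound_kern[where 'n = 'n, OF s C0 r \<mu> \<beta>[unfolded m_def], folded m_def]) blast
  define c0 where "c0 = 2 powr q * A powr (q - 1) / b"
  have c0: "c0 > 0" using A b by (simp add: c0_def)
  \<comment> \<open>One constant for both bounds; isolating \<epsilon> costs a division by the q-th
    power of the data functional.\<close>
  define c where "c = c0 * (1 + 1 / ?I powr q)"
  have c: "c > 0" "c0 \<le> c" "c0 / ?I powr q \<le> c" using c0 I by (auto simp: c_def field_simps intro!: mult_pos_pos add_pos_pos)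
  have X: "(\<epsilon> * ?I + cone_mass r n T R ?\<kappa> h) powr q \<le> c0 * R powr ((q - 1) * ?N - q - m * q) * ?ell R powr (q - 1) * shell_mass n T R F"
    if w: "wave_half T \<epsilon> r f g b q u h F" "\<epsilon> > 0" "1 \<le> R" "R < T" for T \<epsilon> R :: real and u h F :: "real \<Rightarrow> real^'n \<Rightarrow> real"
  proof -
    have ell: "?ell R \<ge> 1" using w(3) by simp
    have "(\<epsilon> * ?I + cone_mass r n T R ?\<kappa> h) powr q
      \<le> 2 powr q * (A * R powr (?N - ?s - m * ?s) * ?ell R) powr (q - 1) / b * shell_mass n T R F"
    proof (rule main[OF _ w])
      show "0 < A * R powr (?N - ?s - m * ?s) * ?ell R" using A w(3) ell by (intro mult_pos_pos) auto
    qed (rule avg_kern_nonneg[OF \<mu>], assumption, rule K[OF w(3)])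
    also have "(A * R powr (?N - ?s - m * ?s) * ?ell R) powr (q - 1) = A powr (q - 1) * R powr ((q - 1) * ?N - q - m * q) * ?ell R powr (q - 1)"
    proof -
      have "?s * (q - 1) = q" using q by simp
      moreover have "(?N - ?s - m * ?s) * (q - 1) = (q - 1) * ?N - ?s * (q - 1) - m * (?s * (q - 1))"
      proof -
        have "(?N - z - m * z) * (q - 1) = (q - 1) * ?N - z * (q - 1) - m * (z * (q - 1))" for z
          by (simp add: algebra_simps)
        then show ?thesis .
      qed
      ultimately have "(?N - ?s - m * ?s) * (q - 1) = (q - 1) * ?N - q - m * q" by (simp only:)
      then show ?thesis by (simp only: powr_mult powr_powr)
    qed
    finally show ?thesis by (simp add: c0_def mult_ac)
  qed
  show thesis
  proof (rule that[OF \<mu> c(1)])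
    fix T \<epsilon> R :: real and u h F :: "real \<Rightarrow> real^'n \<Rightarrow> real"
    assume w: "wave_half T \<epsilon> r f g b q u h F" "\<epsilon> > 0" "1 \<le> R" "R < T"
    have h0: "0 \<le> h t x" and F0: "0 \<le> F t x" for t x
    proof -
      show "0 \<le> h t x" using w(1) by (simp add: wave_half_def)
      have "b * \<bar>u t x\<bar> powr q \<le> F t x" using w(1) by (simp add: wave_half_def)
      moreover have "0 \<le> b * \<bar>u t x\<bar> powr q" using b by simp
      ultimately show "0 \<le> F t x" by linarith
    qed
    have J: "0 \<le> cone_mass r n T R ?\<kappa> h" by (rule cone_mass_nonneg[OF h0 avg_kern_nonneg[OF \<mu>]])
    let ?Y = "R powr ((q - 1) * ?N - q - m * q) * ?ell R powr (q - 1) * shell_mass n T R F"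
    have Y: "0 \<le> ?Y" using shell_mass_nonneg[OF F0] by (intro mult_nonneg_nonneg) auto
    have "cone_mass r n T R ?\<kappa> h powr q \<le> (\<epsilon> * ?I + cone_mass r n T R ?\<kappa> h) powr q"
      using J I w(2) q by (intro powr_mono2) auto
    also have "\<dots> \<le> c0 * ?Y" using X[OF w] by (simp only: mult.assoc)
    also have "\<dots> \<le> c * ?Y" using c Y by (intro mult_right_mono) auto
    finally show "cone_mass r n T R ?\<kappa> h powr q \<le> c * R powr ((q - 1) * ?N - q - m * q) * ?ell R powr (q - 1) * shell_mass n T R F"
      by (simp only: mult.assoc)
    have "\<epsilon> powr q * ?I powr q = (\<epsilon> * ?I) powr q" by (rule powr_mult[symmetric])
    also have "\<dots> \<le> (\<epsilon> * ?I + cone_mass r n T R ?\<kappa> h) powr q"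
      using J I w(2) q by (intro powr_mono2) auto
    also have "\<dots> \<le> c0 * ?Y" using X[OF w] by (simp only: mult.assoc)
    finally have "\<epsilon> powr q \<le> c0 / ?I powr q * ?Y" using I by (simp add: field_simps)
    also have "\<dots> \<le> c * ?Y" using c Y by (intro mult_right_mono) auto
    finally show "\<epsilon> powr q \<le> c * R powr ((q - 1) * ?N - q - m * q) * ?ell R powr (q - 1) * shell_mass n T R F"
      by (simp only: mult.assoc)
  qed
qed

end

subsection \<open>Cone and shell masses\<close>

lemma shell_mass_le_cone_mass:
  fixes F :: "real \<Rightarrow> real^'n \<Rightarrow> real"
  assumes F: "L1_L1 T F" "\<And>t x. 0 \<le> F t x"
    and van: "AE t in lebesgue_on {0<..<T}. AE x in lebesgue. norm x > r + t \<longrightarrow> F t x = 0"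
    and R: "R > 0" and n: "n > 0"
  shows "shell_mass n T R F \<le> 1 / measure (sphere_measure :: (real^'n) measure) (space sphere_measure) * cone_mass r n T R (\<lambda>_. 1) F"
proof -
  let ?tot = "measure (sphere_measure :: (real^'n) measure) (space sphere_measure)"
  have tot: "?tot > 0" by (rule sphere_measure_pos)
  have "shell_mass n T R F \<le> spacetime_integral T F (\<lambda>z. 1 / ?tot * sph.cone_weight r n R (\<lambda>_. 1) z)"
    unfolding shell_mass_def
  proof (rule spacetime_integral_mono[OF F(1) bounded_weight_shell_cutoff])
    show "bounded_weight (\<lambda>z. 1 / ?tot * sph.cone_weight r n R (\<lambda>_. 1) z)"
      using R n by (intro bounded_weight_cmult sph.bounded_weight_cone_weight) auto
    show "AE t in lebesgue_on {0<..<T}. AE x in lebesgue. F t x * (indicator (shell R) (x, t) * cutoff n R (snd (x, t)))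
        \<le> F t x * (1 / ?tot * sph.cone_weight r n R (\<lambda>_. 1) (x, t))"
      using van
    proof eventually_elim
      case (elim t)
      then show ?case
      proof eventually_elim
        case (elim x)
        show ?case
        proof (cases "norm x > r + t")
          case False
          then have "1 / ?tot * sph.cone_weight r n R (\<lambda>_. 1) (x, t) = cutoff n R t"
            using tot by (simp add: sph.cone_weight_def cone_def wave_avg_def)
          moreover have "indicator (shell R) (x, t) * cutoff n R (snd (x, t)) \<le> cutoff n R t"
            using cutoff_bounds by (auto simp: indicator_def)
          ultimately show ?thesis using F(2)[of t x] by (simp add: mult_left_mono)
        qed (use elim in simp)
      qed
    qed
  qed
  then show ?thesis unfolding spacetime_integral_cmult .
qed

definition shell_kern_mass ::
  "real \<Rightarrow> nat \<Rightarrow> real \<Rightarrow> real \<Rightarrow> (real \<Rightarrow> real) \<Rightarrow> (real \<Rightarrow> real^'n \<Rightarrow> real) \<Rightarrow> real" where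
  "shell_kern_mass r n T R \<kappa> F = spacetime_integral T F (\<lambda>z. indicator (shell R) z * sph.cone_weight r n R \<kappa> z)"

lemma shell_kern_mass_nonneg:
  fixes F :: "real \<Rightarrow> real^'n \<Rightarrow> real"
  assumes "\<And>t x. 0 \<le> F t x" "\<And>z::(real^'n) \<times> real. z \<in> cone r \<Longrightarrow> 0 \<le> sph.avg \<kappa> z"
  shows "0 \<le> shell_kern_mass r n T R \<kappa> F"
  unfolding shell_kern_mass_def
proof (intro spacetime_integral_nonneg mult_nonneg_nonneg assms(1))
  show "0 \<le> sph.cone_weight r n R \<kappa> (x, t)" for x :: "real^'n" and t
    by (rule cone_weight_nonneg[OF assms(2)])
qed simp

text \<open>On the shell t + \<mu> <= (1 + \<mu>) R, so on the cone the kernel average is at least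
  of order R^(-\<gamma>), and inserting it costs a factor R^\<gamma>.\<close>

lemma shell_mass_le_kern:
  fixes F :: "real \<Rightarrow> real^'n \<Rightarrow> real"
  assumes F: "L1_L1 T F" "\<And>t x. 0 \<le> F t x"
    and van: "AE t in lebesgue_on {0<..<T}. AE x in lebesgue. norm x > r + t \<longrightarrow> F t x = 0"
    and R: "R \<ge> 1" and n: "n > 0" and r: "0 \<le> r" and \<mu>: "\<mu> \<ge> r + 2" and \<gamma>: "\<gamma> \<ge> 0"
  shows "shell_mass n T R F \<le> (2 * (1 + \<mu>)) powr \<gamma> / measure (sphere_measure :: (real^'n) measure) (space sphere_measure)
    * R powr \<gamma> * shell_kern_mass r n T R (shifted_kern \<gamma> \<mu>) F"
proof -
  let ?tot = "measure (sphere_measure :: (real^'n) measure) (space sphere_measure)"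
  let ?\<kappa> = "shifted_kern \<gamma> \<mu>"
  let ?c = "(2 * (1 + \<mu>)) powr \<gamma> / ?tot * R powr \<gamma>"
  have tot: "?tot > 0" by (rule sphere_measure_pos)
  have "shell_mass n T R F \<le> spacetime_integral T F (\<lambda>z. ?c * (indicator (shell R) z * sph.cone_weight r n R ?\<kappa> z))"
    unfolding shell_mass_def
  proof (rule spacetime_integral_mono[OF F(1) bounded_weight_shell_cutoff])
    show "bounded_weight (\<lambda>z. ?c * (indicator (shell R) z * sph.cone_weight r n R ?\<kappa> z))"
      using R n by (intro bounded_weight_cmult bounded_weight_indicator sph.bounded_weight_cone_weight smooth_shifted_kern) auto
    show "AE t in lebesgue_on {0<..<T}. AE x in lebesgue. F t x * (indicator (shell R) (x, t) * cutoff n R (snd (x, t)))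
        \<le> F t x * (?c * (indicator (shell R) (x, t) * sph.cone_weight r n R ?\<kappa> (x, t)))"
      using van
    proof eventually_elim
      case (elim t)
      then show ?case
      proof eventually_elim
        case (elim x)
        show ?case
        proof (cases "norm x > r + t \<or> (x, t) \<notin> shell R")
          case False
          then have x: "norm x \<le> r + t" "(x, t) \<in> shell R" by auto
          then have t: "R / 2 \<le> t" "t \<le> R" by (auto simp: shell_def)
          let ?\<tau> = "t + \<mu>"
          have "\<mu> \<le> \<mu> * R" using mult_left_mono[of 1 R \<mu>] \<mu> r R by simp
          then have \<tau>: "2 * ?\<tau> \<le> 2 * (1 + \<mu>) * R" using t(2) by (simp add: distrib_right distrib_left)
          have d: "1 \<le> ?\<tau> - norm x" using x \<mu> by simp
          have \<tau>0: "2 * ?\<tau> > 0" using t(1) R \<mu> r by simp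
          have "1 = (2 * (1 + \<mu>) * R) powr \<gamma> * (2 * (1 + \<mu>) * R) powr (- \<gamma>)"
            using \<mu> r R by (simp flip: powr_add)
          also have "\<dots> \<le> (2 * (1 + \<mu>) * R) powr \<gamma> * (2 * ?\<tau>) powr (- \<gamma>)"
            using \<tau> \<tau>0 \<gamma> by (intro mult_left_mono powr_mono2') auto
          also have "\<dots> = ?c * (?tot * (2 * ?\<tau>) powr (- \<gamma>))"
            using tot by (simp add: powr_mult)
          also have "\<dots> \<le> ?c * sphere_potential \<gamma> x ?\<tau>"
            using tot by (intro mult_left_mono sphere_potential_lower[OF d \<gamma>]) auto
          also have "sphere_potential \<gamma> x ?\<tau> = sph.avg ?\<kappa> (x, t)"
            using avg_shifted_kern(1)[OF x(1) \<mu>] by simp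
          finally have one: "1 \<le> ?c * sph.avg ?\<kappa> (x, t)" .
          have "cutoff n R t * 1 \<le> cutoff n R t * (?c * sph.avg ?\<kappa> (x, t))"
            by (intro mult_left_mono one cutoff_bounds)
          then have "cutoff n R t \<le> ?c * (cutoff n R t * sph.avg ?\<kappa> (x, t))" by (simp add: mult_ac)
          then have "F t x * cutoff n R t \<le> F t x * (?c * (cutoff n R t * sph.avg ?\<kappa> (x, t)))"
            by (intro mult_left_mono F(2))
          then show ?thesis using x by (simp add: sph.cone_weight_def cone_def)
        qed (use elim in auto)
      qed
    qed
  qed
  then show ?thesis unfolding spacetime_integral_cmult shell_kern_mass_def .
qed

text \<open>The shell at 2 R starts at t = R, where the cutoff at R has reached 0, and for t < R the
  cutoff at 2 R is still 1. The two weights on the left thus never overlap and stay below the one on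
  the right. This is the increment inequality of the dyadic sequence.\<close>

lemma cone_mass_step:
  fixes F :: "real \<Rightarrow> real^'n \<Rightarrow> real"
  assumes F: "L1_L1 T F" "\<And>t x. 0 \<le> F t x"
    and R: "R > 0" and n: "n > 0" and \<kappa>: "smooth \<kappa>" "\<And>z::(real^'n) \<times> real. z \<in> cone r \<Longrightarrow> 0 \<le> sph.avg \<kappa> z"
  shows "cone_mass r n T R \<kappa> F + shell_kern_mass r n T (2 * R) \<kappa> F \<le> cone_mass r n T (2 * R) \<kappa> F"
proof -
  have bw: "bounded_weight (sph.cone_weight r n R \<kappa>)" "bounded_weight (sph.cone_weight r n (2 * R) \<kappa>)"
    "bounded_weight (\<lambda>z::(real^'n) \<times> real. indicator (shell (2 * R)) z * sph.cone_weight r n (2 * R) \<kappa> z)"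
    using R n \<kappa> by (auto intro!: bounded_weight_indicator sph.bounded_weight_cone_weight)
  have "cone_mass r n T R \<kappa> F + shell_kern_mass r n T (2 * R) \<kappa> F
    = spacetime_integral T F (\<lambda>z. sph.cone_weight r n R \<kappa> z + indicator (shell (2 * R)) z * sph.cone_weight r n (2 * R) \<kappa> z)"
    unfolding shell_kern_mass_def by (rule spacetime_integral_add[OF F(1) bw(1,3), symmetric])
  also have "\<dots> \<le> cone_mass r n T (2 * R) \<kappa> F"
  proof (rule spacetime_integral_mono[OF F(1) bounded_weight_add[OF bw(1,3)] bw(2)])
    have "sph.cone_weight r n R \<kappa> z + indicator (shell (2 * R)) z * sph.cone_weight r n (2 * R) \<kappa> z \<le> sph.cone_weight r n (2 * R) \<kappa> z"
      for z :: "(real^'n) \<times> real"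
    proof (cases "z \<in> cone r")
      case True
      have a: "0 \<le> sph.avg \<kappa> z" using \<kappa>(2) True .
      have "cutoff n R (snd z) + indicator (shell (2 * R)) z * cutoff n (2 * R) (snd z) \<le> cutoff n (2 * R) (snd z)"
      proof (cases "snd z < R")
        case True
        then have "cutoff n (2 * R) (snd z) = 1" "z \<notin> shell (2 * R)" using R by (auto simp: cutoff_eq_1 shell_def)
        then show ?thesis using cutoff_bounds(2) by simp
      next
        case False
        then have "cutoff n R (snd z) = 0" using R n by (intro cutoff_eq_0) auto
        then show ?thesis using cutoff_bounds(1)[of n "2 * R" "snd z"] by (auto simp: indicator_def)
      qed
      from mult_right_mono[OF this a] show ?thesis using True by (simp add: sph.cone_weight_def distrib_right mult.assoc)
    qed (simp add: sph.cone_weight_def)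
    then show "AE t in lebesgue_on {0<..<T}. AE x in lebesgue.
        F t x * (sph.cone_weight r n R \<kappa> (x, t) + indicator (shell (2 * R)) (x, t) * sph.cone_weight r n (2 * R) \<kappa> (x, t))
        \<le> F t x * sph.cone_weight r n (2 * R) \<kappa> (x, t)"
      by (intro AE_I2 mult_left_mono F(2))
  qed
  finally show ?thesis .
qed

text \<open>The essential support removes a possibly uncountable family of open sets, and null sets
  can be united only countably often. A countable subfamily with the same union is extracted, so
  that the quantifier over it moves inside both almost-everywhere statements.\<close>

lemma ess_supp_vanish:
  fixes w :: "real \<Rightarrow> real^'n \<Rightarrow> 'b::zero"
  assumes "ess_supp T w \<subseteq> {(x, t). 0 \<le> t \<and> t < T \<and> norm x \<le> r + t}"
  shows "AE t in lebesgue_on {0<..<T}. AE x in lebesgue. norm x > r + t \<longrightarrow> w t x = 0"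
proof -
  let ?P = "\<lambda>W t. AE x in lebesgue. (x, t) \<in> W \<longrightarrow> w t x = 0"
  let ?W = "{W. openin (top_of_set (UNIV \<times> {0..<T})) W \<and> (AE t in lebesgue_on {0..<T}. ?P W t)}"
  obtain V where V: "V \<subseteq> ?W" "countable V" "\<Union>V = \<Union>?W"
    using Lindelof_openin[of ?W "UNIV \<times> {0..<T}"] by blast
  have "AE t in lebesgue_on {0..<T}. \<forall>W\<in>V. ?P W t"
    using V by (subst AE_ball_countable) auto
  then have "AE t in lebesgue. t \<in> {0..<T} \<longrightarrow> (\<forall>W\<in>V. ?P W t)"
    by (subst (asm) AE_restrict_space_iff) auto
  then have "AE t in lebesgue. t \<in> {0<..<T} \<longrightarrow> (AE x in lebesgue. norm x > r + t \<longrightarrow> w t x = 0)"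
  proof eventually_elim
    case (elim t)
    show ?case
    proof
      assume t: "t \<in> {0<..<T}"
      then have "\<forall>W\<in>V. ?P W t" using elim by auto
      then have "AE x in lebesgue. \<forall>W\<in>V. (x, t) \<in> W \<longrightarrow> w t x = 0"
        using V(2) by (subst AE_ball_countable) auto
      then show "AE x in lebesgue. norm x > r + t \<longrightarrow> w t x = 0"
      proof eventually_elim
        case (elim x)
        show ?case
        proof
          assume x: "norm x > r + t"
          have "(x, t) \<notin> ess_supp T w" using assms x by auto
          then have "(x, t) \<in> \<Union>?W" using t unfolding ess_supp_def by auto
          then show "w t x = 0" using elim V(3) by blast
        qed
      qed
    qed
  qed
  then show ?thesis by (subst AE_restrict_space_iff) auto
qed

text \<open>\<open>G1 0 = 0\<close> and \<open>G2 0 = 0\<close> turn the support condition on the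
  pair into one on both sources. From here on the nonlinearities appear only through their lower
  bounds and supports.\<close>

lemma wave_half_of_weak_solution:
  assumes w: "weak_solution G1 G2 f1 g1 f2 g2 \<epsilon> T u v"
    and supp: "ess_supp T (\<lambda>t x. (u t x, v t x)) \<subseteq> {(x, t). 0 \<le> t \<and> t < T \<and> norm x \<le> r + t}"
    and ab: "a > 0" "b > 0" and G0: "G1 0 = 0" "G2 0 = 0"
    and G: "\<And>s. G1 s \<ge> a * \<bar>s\<bar> powr p" "\<And>s. G2 s \<ge> b * \<bar>s\<bar> powr q"
  shows "wave_half T \<epsilon> r f1 g1 b q u (\<lambda>t x. G1 (v t x)) (\<lambda>t x. G2 (u t x))"
    and "wave_half T \<epsilon> r f2 g2 a p v (\<lambda>t x. G2 (u t x)) (\<lambda>t x. G1 (v t x))"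
proof -
  have van: "AE t in lebesgue_on {0<..<T}. AE x in lebesgue. norm x > r + t \<longrightarrow> u t x = 0 \<and> G1 (v t x) = 0"
    "AE t in lebesgue_on {0<..<T}. AE x in lebesgue. norm x > r + t \<longrightarrow> v t x = 0 \<and> G2 (u t x) = 0"
  proof -
    have *: "AE t in lebesgue_on {0<..<T}. AE x in lebesgue. norm x > r + t \<longrightarrow> (u t x, v t x) = 0"
      by (rule ess_supp_vanish[OF supp])
    show "AE t in lebesgue_on {0<..<T}. AE x in lebesgue. norm x > r + t \<longrightarrow> u t x = 0 \<and> G1 (v t x) = 0"
      using *
    proof eventually_elim
      case (elim t)
      then show ?case by eventually_elim (auto simp: G0 zero_prod_def)
    qed
    show "AE t in lebesgue_on {0<..<T}. AE x in lebesgue. norm x > r + t \<longrightarrow> v t x = 0 \<and> G2 (u t x) = 0"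
      using *
    proof eventually_elim
      case (elim t)
      then show ?case by eventually_elim (auto simp: G0 zero_prod_def)
    qed
  qed
  have nn: "0 \<le> G1 s" "0 \<le> G2 s" for s
    using G[of s] ab by (meson mult_nonneg_nonneg order_trans less_imp_le powr_ge_zero)+
  show "wave_half T \<epsilon> r f1 g1 b q u (\<lambda>t x. G1 (v t x)) (\<lambda>t x. G2 (u t x))"
    and "wave_half T \<epsilon> r f2 g2 a p v (\<lambda>t x. G2 (u t x)) (\<lambda>t x. G1 (v t x))"
    using w van nn G unfolding weak_solution_def wave_half_def by blast+
qed

subsection \<open>Lifespan bounds\<close>

text \<open>Estimates at radius R are available only for R < T, so the indices are restricted to 2^J
  < T; the condition 4^h < T admits all J <= 2 h.\<close>

lemma dyadic_lifespan:
  fixes P k A :: real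
  assumes P: "P > 1" and k: "0 \<le> k" "k < P" and A: "A > 0"
  obtains C where "C > 0"
    "\<And>T \<delta> (S::nat \<Rightarrow> real) D. 0 < \<delta> \<Longrightarrow> \<delta> \<le> 1 \<Longrightarrow> 0 \<le> S 0 \<Longrightarrow>
      (\<And>J. 1 \<le> J \<Longrightarrow> 2 ^ J < T \<Longrightarrow> S (J - 1) + D J \<le> S J) \<Longrightarrow>
      (\<And>J. 1 \<le> J \<Longrightarrow> 2 ^ J < T \<Longrightarrow> S J powr P \<le> A * (1 + real J) powr k * D J) \<Longrightarrow>
      (\<And>J. 1 \<le> J \<Longrightarrow> 2 ^ J < T \<Longrightarrow> \<delta> \<le> A * D J) \<Longrightarrow>
      T \<le> exp (C * \<delta> powr (- ((P - 1) / (P - k))))"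
proof -
  obtain B where B: "B > 0" and main: "\<And>(S::nat \<Rightarrow> real) D \<delta> h. \<delta> > 0 \<Longrightarrow> h > 0 \<Longrightarrow> S 0 \<ge> 0 \<Longrightarrow>
      (\<And>J. 1 \<le> J \<Longrightarrow> J \<le> 2 * h \<Longrightarrow> S (J - 1) + D J \<le> S J) \<Longrightarrow>
      (\<And>J. 1 \<le> J \<Longrightarrow> J \<le> 2 * h \<Longrightarrow> S J powr P \<le> A * (1 + real J) powr k * D J) \<Longrightarrow>
      (\<And>J. 1 \<le> J \<Longrightarrow> J \<le> 2 * h \<Longrightarrow> \<delta> \<le> A * D J) \<Longrightarrow>
      real h \<le> B * \<delta> powr (- ((P - 1) / (P - k)))"
    by (rule discrete_blowup[OF P k A]) blast
  show thesis
  proof (rule that)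
    show "2 * (B + 1) > 0" using B by simp
    fix T \<delta> :: real and S D :: "nat \<Rightarrow> real"
    assume \<delta>: "0 < \<delta>" "\<delta> \<le> 1" and S0: "0 \<le> S 0"
      and h1: "\<And>J. 1 \<le> J \<Longrightarrow> 2 ^ J < T \<Longrightarrow> S (J - 1) + D J \<le> S J"
      and h2: "\<And>J. 1 \<le> J \<Longrightarrow> 2 ^ J < T \<Longrightarrow> S J powr P \<le> A * (1 + real J) powr k * D J"
      and h3: "\<And>J. 1 \<le> J \<Longrightarrow> 2 ^ J < T \<Longrightarrow> \<delta> \<le> A * D J"
    let ?E = "\<delta> powr (- ((P - 1) / (P - k)))"
    show "T \<le> exp (2 * (B + 1) * ?E)"
    proof (rule exp_bound_of_dyadic_bound[OF _ B])
      have "1 powr (- ((P - 1) / (P - k))) \<le> ?E"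
        using \<delta> P k by (intro powr_mono2') auto
      then show "1 \<le> ?E" by simp
      fix h :: nat assume h: "h > 0" "4 ^ h < T"
      have J: "2 ^ J < T" if "J \<le> 2 * h" for J
      proof -
        have "(2::real) ^ J \<le> 2 ^ (2 * h)" using that by (intro power_increasing) auto
        also have "\<dots> = 4 ^ h" by (simp add: power_mult)
        finally show ?thesis using h by simp
      qed
      show "real h \<le> B * ?E"
        by (rule main[where S = S and D = D]) (use \<delta> h S0 J in \<open>auto intro: h1[simplified] h2[simplified] h3[simplified]\<close>)
    qed
  qed
qed

text \<open>R = T / 2 is admissible once T > 2. For T <= 2 the bound holds because \<epsilon> <= 1
  makes the right side at least 2.\<close>

lemma lifespan_of_decay:
  fixes \<Gamma> A \<epsilon> T :: real
  assumes \<Gamma>: "\<Gamma> > 0" and A: "A > 0" and \<epsilon>: "0 < \<epsilon>" "\<epsilon> \<le> 1"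
    and decay: "\<And>R. 1 \<le> R \<Longrightarrow> R < T \<Longrightarrow> \<epsilon> \<le> A * R powr (- \<Gamma>)"
  shows "T \<le> 2 * (1 + A powr (1 / \<Gamma>)) * \<epsilon> powr (- inverse \<Gamma>)"
proof (cases "T \<le> 2")
  case True
  have "1 powr (- inverse \<Gamma>) \<le> \<epsilon> powr (- inverse \<Gamma>)" using \<epsilon> \<Gamma> by (intro powr_mono2') auto
  then have "2 * 1 \<le> 2 * (1 + A powr (1 / \<Gamma>)) * \<epsilon> powr (- inverse \<Gamma>)"
    by (intro mult_mono) auto
  then show ?thesis using True by simp
next
  case False
  then have T: "T / 2 \<ge> 1" "T / 2 < T" by auto
  have "\<epsilon> \<le> A * (T / 2) powr (- \<Gamma>)" by (rule decay[OF T])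
  then have "(T / 2) powr \<Gamma> \<le> A / \<epsilon>"
    using T \<epsilon> by (simp add: powr_minus_divide field_simps)
  then have "T / 2 \<le> (A / \<epsilon>) powr (1 / \<Gamma>)" using T \<Gamma> by (intro powr_le_of_powr_le) auto
  also have "\<dots> = A powr (1 / \<Gamma>) * \<epsilon> powr (- inverse \<Gamma>)"
    by (simp add: powr_divide powr_minus_divide inverse_eq_divide)
  also have "\<dots> \<le> (1 + A powr (1 / \<Gamma>)) * \<epsilon> powr (- inverse \<Gamma>)" by (intro mult_right_mono) auto
  finally show ?thesis by linarith
qed

lemma wave_half_source:
  assumes "wave_half T \<epsilon> r f g b q u h F"
  shows "L1_L1 T h" "0 \<le> h t x" "AE t in lebesgue_on {0<..<T}. AE x in lebesgue. norm x > r + t \<longrightarrow> h t x = 0"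
proof -
  show "L1_L1 T h" "0 \<le> h t x" using assms by (auto simp: wave_half_def)
  have "AE t in lebesgue_on {0<..<T}. AE x in lebesgue. norm x > r + t \<longrightarrow> u t x = 0 \<and> h t x = 0"
    using assms by (simp add: wave_half_def)
  then show "AE t in lebesgue_on {0<..<T}. AE x in lebesgue. norm x > r + t \<longrightarrow> h t x = 0"
  proof eventually_elim
    case (elim t)
    then show ?case by eventually_elim simp
  qed
qed

lemma mult_right_le: "x \<le> c * y * z \<Longrightarrow> c \<le> c' \<Longrightarrow> 0 \<le> y \<Longrightarrow> 0 \<le> z \<Longrightarrow> x \<le> c' * y * (z::real)"
  by (meson mult_right_mono order_trans)

text \<open>\<beta> = m makes the time exponent (\<beta> + 1 - m) q / (q - 1) equal to q / (q - 1) >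
  1, so the weight integral converges and no logarithm appears.\<close>

lemma (in wave_data) lower_estimate:
  obtains c where "c > 0"
    "\<And>T \<epsilon> u h F R. wave_half T \<epsilon> r f g b q u h F \<Longrightarrow> \<epsilon> > 0 \<Longrightarrow> 1 \<le> R \<Longrightarrow> R < T \<Longrightarrow>
      \<epsilon> powr q \<le> c * R powr ((q - 1) * real CARD('n) - q - (real CARD('n) - 1) / 2 * q) * shell_mass n T R F"
proof -
  let ?m = "(real CARD('n) - 1) / 2"
  have s: "(?m + 1 - ?m) * (q / (q - 1)) > 1" using q by (simp add: field_simps)
  have m0: "?m \<ge> 0" "?m + 1 > ?m" by simp_all
  obtain \<mu> c where c: "c > 0" and e: "\<And>T \<epsilon> u h F R. wave_half T \<epsilon> r f g b q u h F \<Longrightarrow> \<epsilon> > 0 \<Longrightarrow> 1 \<le> R \<Longrightarrow> R < T \<Longrightarrow>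
      \<epsilon> powr q \<le> c * R powr ((q - 1) * real CARD('n) - q - ?m * q) * (if (?m + 1 - ?m) * (q / (q - 1)) = 1 then 1 + ln R else 1) powr (q - 1) * shell_mass n T R F"
    by (rule kern_estimate[OF m0 less_imp_le[OF s]]) blast
  show thesis
  proof (rule that[OF c])
    fix T \<epsilon> R :: real and u h F :: "real \<Rightarrow> real^'n \<Rightarrow> real"
    assume "wave_half T \<epsilon> r f g b q u h F" "\<epsilon> > 0" "1 \<le> R" "R < T"
    from e[OF this] show "\<epsilon> powr q \<le> c * R powr ((q - 1) * real CARD('n) - q - ?m * q) * shell_mass n T R F"
      using s by simp
  qed
qed

text \<open>This is the smallest \<beta> that \<open>kern_estimate\<close> admits: the time exponent
  equals 1 and costs a logarithm. A smaller \<beta> means less loss in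
  \<open>shell_mass_le_kern\<close>, and here the loss is just what criticality compensates.\<close>

lemma (in wave_data) log_estimate:
  assumes "(real CARD('n) - 1) / 2 - 1 / q \<ge> 0"
  obtains \<mu> c where "\<mu> \<ge> r + 2" "c > 0"
    "\<And>T \<epsilon> u h F R. wave_half T \<epsilon> r f g b q u h F \<Longrightarrow> \<epsilon> > 0 \<Longrightarrow> 1 \<le> R \<Longrightarrow> R < T \<Longrightarrow>
      cone_mass r n T R (shifted_kern ((real CARD('n) - 1) / 2 - 1 / q) \<mu>) h powr q
        \<le> c * R powr ((q - 1) * real CARD('n) - q - (real CARD('n) - 1) / 2 * q) * (1 + ln R) powr (q - 1) * shell_mass n T R F"
proof -
  let ?m = "(real CARD('n) - 1) / 2"
  let ?\<beta> = "?m - 1 / q"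
  have s: "(?\<beta> + 1 - ?m) * (q / (q - 1)) = 1" using q by (simp add: field_simps)
  have b1: "?\<beta> + 1 > ?m"
  proof -
    have "1 / q < 1" using q by simp
    then show ?thesis by linarith
  qed
  obtain \<mu> c where \<mu>: "\<mu> \<ge> r + 2" and c: "c > 0" and e: "\<And>T \<epsilon> u h F R. wave_half T \<epsilon> r f g b q u h F \<Longrightarrow> \<epsilon> > 0 \<Longrightarrow> 1 \<le> R \<Longrightarrow> R < T \<Longrightarrow>
      cone_mass r n T R (shifted_kern ?\<beta> \<mu>) h powr q
        \<le> c * R powr ((q - 1) * real CARD('n) - q - ?m * q) * (if (?\<beta> + 1 - ?m) * (q / (q - 1)) = 1 then 1 + ln R else 1) powr (q - 1) * shell_mass n T R F"
    by (rule kern_estimate[OF assms b1 eq_refl[OF s[symmetric]]]) blast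
  show thesis
  proof (rule that[OF \<mu> c])
    fix T \<epsilon> R :: real and u h F :: "real \<Rightarrow> real^'n \<Rightarrow> real"
    assume "wave_half T \<epsilon> r f g b q u h F" "\<epsilon> > 0" "1 \<le> R" "R < T"
    from e[OF this] show "cone_mass r n T R (shifted_kern ?\<beta> \<mu>) h powr q
        \<le> c * R powr ((q - 1) * real CARD('n) - q - ?m * q) * (1 + ln R) powr (q - 1) * shell_mass n T R F"
      unfolding s by simp
  qed
qed

lemma subcritical_lifespan:
  fixes f1 g1 f2 g2 :: "real^'n \<Rightarrow> real"
  assumes D1: "wave_data f1 g1 r b q n" and D2: "wave_data f2 g2 r a p n"
    and \<Gamma>: "F_SS CARD('n) p q > 0"
  shows "\<exists>C>0. \<forall>\<epsilon>\<in>{0<..1}. \<forall>T u v Gu Gv.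
    wave_half T \<epsilon> r f1 g1 b q u Gv Gu \<longrightarrow> wave_half T \<epsilon> r f2 g2 a p v Gu Gv \<longrightarrow>
    T \<le> C * \<epsilon> powr (- inverse (F_SS CARD('n) p q))"
proof -
  interpret D1: wave_data f1 g1 r b q n by (rule D1)
  interpret D2: wave_data f2 g2 r a p n by (rule D2)
  let ?N = "real CARD('n)"
  let ?m = "(?N - 1) / 2"
  let ?tot = "measure (sphere_measure :: (real^'n) measure) (space sphere_measure)"
  have tot: "?tot > 0" by (rule sphere_measure_pos)
  obtain c1 where c1: "c1 > 0" "\<And>T \<epsilon> u h F R. wave_half T \<epsilon> r f2 g2 a p u h F \<Longrightarrow> \<epsilon> > 0 \<Longrightarrow> 1 \<le> R \<Longrightarrow> R < T \<Longrightarrow>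
      cone_mass r n T R (\<lambda>_. 1) h powr p \<le> c1 * R powr ((?N + 1) * (p - 1) - 2 * p) * shell_mass n T R F"
    by (rule D2.const_estimate) blast
  obtain c2 where c2: "c2 > 0" "\<And>T \<epsilon> u h F R. wave_half T \<epsilon> r f1 g1 b q u h F \<Longrightarrow> \<epsilon> > 0 \<Longrightarrow> 1 \<le> R \<Longrightarrow> R < T \<Longrightarrow>
      cone_mass r n T R (\<lambda>_. 1) h powr q \<le> c2 * R powr ((?N + 1) * (q - 1) - 2 * q) * shell_mass n T R F"
    by (rule D1.const_estimate) blast
  obtain c3 where c3: "c3 > 0" "\<And>T \<epsilon> u h F R. wave_half T \<epsilon> r f1 g1 b q u h F \<Longrightarrow> \<epsilon> > 0 \<Longrightarrow> 1 \<le> R \<Longrightarrow> R < T \<Longrightarrow>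
      \<epsilon> powr q \<le> c3 * R powr ((q - 1) * ?N - q - ?m * q) * shell_mass n T R F"
    by (rule D1.lower_estimate) blast
  define c where "c = c1 + c2 + c3 + 1 / ?tot"
  have c: "c > 0" "c1 \<le> c" "c2 \<le> c" "c3 \<le> c" "1 / ?tot \<le> c" using c1 c2 c3 tot by (auto simp: c_def intro: add_pos_pos)
  obtain A where A: "A > 0" and main: "\<And>R \<epsilon> U Us V Vs. R \<ge> 1 \<Longrightarrow> \<epsilon> > 0 \<Longrightarrow> U \<ge> 0 \<Longrightarrow> Us \<ge> 0 \<Longrightarrow> V \<ge> 0 \<Longrightarrow> Vs \<ge> 0 \<Longrightarrow>
      U powr p \<le> c * R powr ((?N + 1) * (p - 1) - 2 * p) * Vs \<Longrightarrow>
      V powr q \<le> c * R powr ((?N + 1) * (q - 1) - 2 * q) * Us \<Longrightarrow>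
      Us \<le> c * U \<Longrightarrow> Vs \<le> c * V \<Longrightarrow>
      \<epsilon> powr q \<le> c * R powr ((q - 1) * ?N - q - ?m * q) * Us \<Longrightarrow>
      \<epsilon> \<le> A * R powr (- ((p + 2 + 1 / q) / (p * q - 1) - ?m))"
    by (rule subcritical_estimate[OF D2.q D1.q c(1), of ?N]) blast
  let ?\<Gamma> = "F_SS CARD('n) p q"
  show ?thesis
  proof (intro exI[of _ "2 * (1 + A powr (1 / ?\<Gamma>))"] conjI ballI allI impI)
    show "2 * (1 + A powr (1 / ?\<Gamma>)) > 0" by (simp add: add_pos_nonneg)
    fix \<epsilon> T :: real and u v Gu Gv :: "real \<Rightarrow> real^'n \<Rightarrow> real"
    assume \<epsilon>: "\<epsilon> \<in> {0<..1}" and w1: "wave_half T \<epsilon> r f1 g1 b q u Gv Gu" and w2: "wave_half T \<epsilon> r f2 g2 a p v Gu Gv"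
    note s1 = wave_half_source[OF w1] and s2 = wave_half_source[OF w2]
    show "T \<le> 2 * (1 + A powr (1 / ?\<Gamma>)) * \<epsilon> powr (- inverse ?\<Gamma>)"
    proof (rule lifespan_of_decay[OF \<Gamma> A])
      fix R assume R: "1 \<le> R" "R < T"
      have R0: "R > 0" and e0: "\<epsilon> > 0" using R \<epsilon> by auto
      let ?U = "cone_mass r n T R (\<lambda>_. 1) Gu" and ?V = "cone_mass r n T R (\<lambda>_. 1) Gv"
      have nn: "0 \<le> ?U" "0 \<le> ?V" "0 \<le> shell_mass n T R Gu" "0 \<le> shell_mass n T R Gv"
        by (intro cone_mass_nonneg shell_mass_nonneg s1 s2 avg_const_nonneg)+
      have "shell_mass n T R Gu \<le> 1 / ?tot * ?U" "shell_mass n T R Gv \<le> 1 / ?tot * ?V"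
        by (rule shell_mass_le_cone_mass[OF s2 R0 D1.n0], rule shell_mass_le_cone_mass[OF s1 R0 D1.n0])
      then have 1: "shell_mass n T R Gu \<le> c * ?U" "shell_mass n T R Gv \<le> c * ?V"
        using nn c(5) by (meson mult_right_mono order_trans)+
      have "\<epsilon> \<le> A * R powr (- ((p + 2 + 1 / q) / (p * q - 1) - ?m))"
        by (rule main[OF R(1) e0 nn(1,3,2,4) mult_right_le[OF c1(2)[OF w2 e0 R] c(2)] mult_right_le[OF c2(2)[OF w1 e0 R] c(3)] 1
          mult_right_le[OF c3(2)[OF w1 e0 R] c(4)]])
          (use nn in auto)
      then show "\<epsilon> \<le> A * R powr (- ?\<Gamma>)" by (simp add: F_SS_def)
    qed (use \<epsilon> in auto)
  qed
qed

text \<open>The kernel estimates ask for a nonnegative \<beta>. By criticality m = (p + 2 + 1/q) /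
  (p q - 1), and this is at least 1/q because (p q - 1) / q = p - 1/q.\<close>

lemma critical_exponent_ge:
  fixes N p q :: real
  assumes "p > 1" "q > 1" "(p + 2 + 1 / q) / (p * q - 1) - (N - 1) / 2 = 0"
  shows "(N - 1) / 2 - 1 / q \<ge> 0"
proof -
  have pq: "p * q > 1" using assms by (simp add: less_1_mult)
  have "1 / q * (p * q - 1) \<le> p + 2 + 1 / q" using assms by (simp add: field_simps)
  then have "1 / q \<le> (p + 2 + 1 / q) / (p * q - 1)" using pq by (simp add: pos_le_divide_eq)
  then show ?thesis using assms(3) by linarith
qed

lemma ln_dyadic_le: "1 + ln ((2::real) ^ J) \<le> 1 + real J"
proof -
  have "ln (2::real) \<le> 1" using ln_le_minus_one[of 2] by simp
  then have "real J * ln 2 \<le> real J * 1" by (intro mult_left_mono) auto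
  then show ?thesis by (simp add: ln_realpow)
qed

text \<open>\<open>S J\<close> and \<open>D J\<close> are the kernel-weighted cone and shell masses
  of \<open>Gv\<close> at R = 2^J. \<open>cone_mass_step\<close> supplies the increment inequality,
  and \<open>critical_estimate\<close> the power inequality with P = p q, k = p (q - 1) together
  with the lower bound on increments.\<close>

lemma critical_lifespan:
  fixes f1 g1 f2 g2 :: "real^'n \<Rightarrow> real"
  assumes D1: "wave_data f1 g1 r b q n" and D2: "wave_data f2 g2 r a p n"
    and \<Gamma>: "F_SS CARD('n) p q = 0"
  shows "\<exists>C>0. \<forall>\<epsilon>\<in>{0<..1}. \<forall>T u v Gu Gv.
    wave_half T \<epsilon> r f1 g1 b q u Gv Gu \<longrightarrow> wave_half T \<epsilon> r f2 g2 a p v Gu Gv \<longrightarrow>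
    T \<le> exp (C * \<epsilon> powr (- (q * (p * q - 1))))"
proof -
  interpret D1: wave_data f1 g1 r b q n by (rule D1)
  interpret D2: wave_data f2 g2 r a p n by (rule D2)
  let ?N = "real CARD('n)"
  let ?m = "(?N - 1) / 2"
  let ?\<gamma> = "?m - 1 / q"
  let ?tot = "measure (sphere_measure :: (real^'n) measure) (space sphere_measure)"
  have tot: "?tot > 0" by (rule sphere_measure_pos)
  note p = D2.q and q = D1.q
  have pq: "p * q > 1" using p q by (simp add: less_1_mult)
  have crit: "(p + 2 + 1 / q) / (p * q - 1) - ?m = 0" using \<Gamma> by (simp add: F_SS_def)
  have \<gamma>: "?\<gamma> \<ge> 0" by (rule critical_exponent_ge[OF p q crit])
  obtain c1 where c1: "c1 > 0" "\<And>T \<epsilon> u h F R. wave_half T \<epsilon> r f2 g2 a p u h F \<Longrightarrow> \<epsilon> > 0 \<Longrightarrow> 1 \<le> R \<Longrightarrow> R < T \<Longrightarrow>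
      cone_mass r n T R (\<lambda>_. 1) h powr p \<le> c1 * R powr ((?N + 1) * (p - 1) - 2 * p) * shell_mass n T R F"
    by (rule D2.const_estimate) blast
  obtain c3 where c3: "c3 > 0" "\<And>T \<epsilon> u h F R. wave_half T \<epsilon> r f1 g1 b q u h F \<Longrightarrow> \<epsilon> > 0 \<Longrightarrow> 1 \<le> R \<Longrightarrow> R < T \<Longrightarrow>
      \<epsilon> powr q \<le> c3 * R powr ((q - 1) * ?N - q - ?m * q) * shell_mass n T R F"
    by (rule D1.lower_estimate) blast
  obtain \<mu> c2 where \<mu>: "\<mu> \<ge> r + 2" and c2: "c2 > 0" "\<And>T \<epsilon> u h F R. wave_half T \<epsilon> r f1 g1 b q u h F \<Longrightarrow> \<epsilon> > 0 \<Longrightarrow> 1 \<le> R \<Longrightarrow> R < T \<Longrightarrow>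
      cone_mass r n T R (shifted_kern ?\<gamma> \<mu>) h powr q
        \<le> c2 * R powr ((q - 1) * ?N - q - ?m * q) * (1 + ln R) powr (q - 1) * shell_mass n T R F"
    by (rule D1.log_estimate[OF \<gamma>]) blast
  let ?\<kappa> = "shifted_kern ?\<gamma> \<mu>"
  define c4 where "c4 = (2 * (1 + \<mu>)) powr ?\<gamma> / ?tot"
  define c where "c = c1 + c2 + c3 + c4 + 1 / ?tot"
  have c4: "c4 \<ge> 0" using tot by (simp add: c4_def)
  have c: "c > 0" "c1 \<le> c" "c2 \<le> c" "c3 \<le> c" "c4 \<le> c" "1 / ?tot \<le> c"
    using c1(1) c2(1) c3(1) c4 divide_pos_pos[OF zero_less_one tot] unfolding c_def by linarith+
  obtain A where A: "A > 0" and main: "\<And>R \<epsilon> L U Us Vs W Ws. R \<ge> 1 \<Longrightarrow> L \<ge> 1 \<Longrightarrow> \<epsilon> > 0 \<Longrightarrow> U \<ge> 0 \<Longrightarrow> Us \<ge> 0 \<Longrightarrow> Vs \<ge> 0 \<Longrightarrow> W \<ge> 0 \<Longrightarrow> Ws \<ge> 0 \<Longrightarrow>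
      U powr p \<le> c * R powr ((?N + 1) * (p - 1) - 2 * p) * Vs \<Longrightarrow>
      Us \<le> c * U \<Longrightarrow> Vs \<le> c * R powr ?\<gamma> * Ws \<Longrightarrow>
      \<epsilon> powr q \<le> c * R powr ((q - 1) * ?N - q - ?m * q) * Us \<Longrightarrow>
      W powr q \<le> c * R powr ((q - 1) * ?N - q - ?m * q) * L powr (q - 1) * Us \<Longrightarrow>
      W powr (p * q) \<le> A * L powr (p * (q - 1)) * Ws \<and> \<epsilon> powr (p * q) \<le> A * Ws"
    by (rule critical_estimate[OF p q c(1) crit]) blast
  have k: "0 \<le> p * (q - 1)" "p * (q - 1) < p * q" using p q by (auto simp: algebra_simps)
  obtain B where B: "B > 0" and dy: "\<And>T \<delta> (S::nat \<Rightarrow> real) D. 0 < \<delta> \<Longrightarrow> \<delta> \<le> 1 \<Longrightarrow> 0 \<le> S 0 \<Longrightarrow>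
      (\<And>J. 1 \<le> J \<Longrightarrow> 2 ^ J < T \<Longrightarrow> S (J - 1) + D J \<le> S J) \<Longrightarrow>
      (\<And>J. 1 \<le> J \<Longrightarrow> 2 ^ J < T \<Longrightarrow> S J powr (p * q) \<le> A * (1 + real J) powr (p * (q - 1)) * D J) \<Longrightarrow>
      (\<And>J. 1 \<le> J \<Longrightarrow> 2 ^ J < T \<Longrightarrow> \<delta> \<le> A * D J) \<Longrightarrow>
      T \<le> exp (B * \<delta> powr (- ((p * q - 1) / (p * q - p * (q - 1)))))"
    by (rule dyadic_lifespan[OF pq k A]) blast
  show ?thesis
  proof (intro exI[of _ B] conjI ballI allI impI)
    show "B > 0" by (rule B)
    fix \<epsilon> T :: real and u v Gu Gv :: "real \<Rightarrow> real^'n \<Rightarrow> real"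
    assume \<epsilon>: "\<epsilon> \<in> {0<..1}" and w1: "wave_half T \<epsilon> r f1 g1 b q u Gv Gu" and w2: "wave_half T \<epsilon> r f2 g2 a p v Gu Gv"
    note s1 = wave_half_source[OF w1] and s2 = wave_half_source[OF w2]
    have e0: "\<epsilon> > 0" "\<epsilon> \<le> 1" using \<epsilon> by auto
    define S where "S J = cone_mass r n T (2 ^ J) ?\<kappa> Gv" for J :: nat
    define D where "D J = shell_kern_mass r n T (2 ^ J) ?\<kappa> Gv" for J :: nat
    have S0: "0 \<le> S J" and D0: "0 \<le> D J" for J
      unfolding S_def D_def by (intro cone_mass_nonneg shell_kern_mass_nonneg s1 avg_kern_nonneg[OF \<mu>]; assumption)+
    have est: "S J powr (p * q) \<le> A * (1 + real J) powr (p * (q - 1)) * D J \<and> \<epsilon> powr (p * q) \<le> A * D J"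
      if J: "2 ^ J < T" for J
    proof -
      let ?R = "(2::real) ^ J"
      have R: "1 \<le> ?R" "?R < T" "0 < ?R" using J by auto
      have L: "1 \<le> 1 + ln ?R" using R by simp
      have nn: "0 \<le> cone_mass r n T ?R (\<lambda>_. 1) Gu" "0 \<le> shell_mass n T ?R Gu" "0 \<le> shell_mass n T ?R Gv"
        by (intro cone_mass_nonneg shell_mass_nonneg s1 s2 avg_const_nonneg)+
      have "shell_mass n T ?R Gu \<le> 1 / ?tot * cone_mass r n T ?R (\<lambda>_. 1) Gu"
        by (rule shell_mass_le_cone_mass[OF s2 R(3) D1.n0])
      then have 1: "shell_mass n T ?R Gu \<le> c * cone_mass r n T ?R (\<lambda>_. 1) Gu"
        using nn c(6) by (meson mult_right_mono order_trans)
      have "shell_mass n T ?R Gv \<le> c4 * ?R powr ?\<gamma> * D J"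
        unfolding c4_def D_def by (rule shell_mass_le_kern[OF s1 R(1) D1.n0 D1.r \<mu> \<gamma>])
      then have 2: "shell_mass n T ?R Gv \<le> c * ?R powr ?\<gamma> * D J"
        by (rule mult_right_le[OF _ c(5) powr_ge_zero D0])
      have "S J powr q \<le> c2 * (?R powr ((q - 1) * ?N - q - ?m * q) * (1 + ln ?R) powr (q - 1)) * shell_mass n T ?R Gu"
        using c2(2)[OF w1 e0(1) R(1,2)] by (simp add: S_def mult.assoc)
      then have "S J powr q \<le> c * (?R powr ((q - 1) * ?N - q - ?m * q) * (1 + ln ?R) powr (q - 1)) * shell_mass n T ?R Gu"
        by (rule mult_right_le[OF _ c(3) _ nn(2)]) auto
      then have 3: "S J powr q \<le> c * ?R powr ((q - 1) * ?N - q - ?m * q) * (1 + ln ?R) powr (q - 1) * shell_mass n T ?R Gu"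
        by (simp only: mult.assoc)
      have 4: "S J powr (p * q) \<le> A * (1 + ln ?R) powr (p * (q - 1)) * D J \<and> \<epsilon> powr (p * q) \<le> A * D J"
        by (rule main[OF R(1) L e0(1) nn S0 D0
          mult_right_le[OF c1(2)[OF w2 e0(1) R(1,2)] c(2) powr_ge_zero nn(3)] 1 2
          mult_right_le[OF c3(2)[OF w1 e0(1) R(1,2)] c(4) powr_ge_zero nn(2)] 3])
      have "A * (1 + ln ?R) powr (p * (q - 1)) * D J \<le> A * (1 + real J) powr (p * (q - 1)) * D J"
        using A L k(1) ln_dyadic_le[of J] by (intro mult_right_mono mult_left_mono powr_mono2 D0) auto
      then show ?thesis using 4 by linarith
    qed
    have "T \<le> exp (B * (\<epsilon> powr (p * q)) powr (- ((p * q - 1) / (p * q - p * (q - 1)))))"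
    proof (rule dy[where S = S and D = D])
      show "0 < \<epsilon> powr (p * q)" using e0 by simp
      show "\<epsilon> powr (p * q) \<le> 1" using e0 pq by (intro powr_le1) auto
      show "0 \<le> S 0" by (rule S0)
      fix J :: nat assume J: "1 \<le> J" "2 ^ J < T"
      show "S J powr (p * q) \<le> A * (1 + real J) powr (p * (q - 1)) * D J" "\<epsilon> powr (p * q) \<le> A * D J"
        using est[OF J(2)] by auto
      have "(2::real) ^ J = 2 * 2 ^ (J - 1)" using J(1) by (cases J) auto
      then show "S (J - 1) + D J \<le> S J"
        unfolding S_def D_def
        using cone_mass_step[OF s1(1,2) _ D1.n0 smooth_shifted_kern avg_kern_nonneg[OF \<mu>], of "2 ^ (J - 1)" r] by simp
    qed
    \<comment> \<open>P - k = p and \<delta> = \<epsilon>^(p q), so the exponent is p q (p q - 1) /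
      p up to sign.\<close>
    also have "(\<epsilon> powr (p * q)) powr (- ((p * q - 1) / (p * q - p * (q - 1)))) = \<epsilon> powr (- (q * (p * q - 1)))"
    proof -
      have "p * q - p * (q - 1) = p" by (simp add: algebra_simps)
      then have "p * q * (- ((p * q - 1) / (p * q - p * (q - 1)))) = - (q * (p * q - 1))" using p by simp
      then show ?thesis unfolding powr_powr by (simp only:)
    qed
    finally show "T \<le> exp (B * \<epsilon> powr (- (q * (p * q - 1))))" .
  qed
qed

text \<open>The weighted masses of both sources are summed. Their kernels may have different shifts,
  since each shift is chosen from the data of its own equation. Here P - k = 1, which removes the
  factor p + 1 from the exponent p (p^2 - 1) of the general critical bound.\<close>

lemma critical_lifespan_diagonal:
  fixes f1 g1 f2 g2 :: "real^'n \<Rightarrow> real"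
  assumes D1: "wave_data f1 g1 r b p n" and D2: "wave_data f2 g2 r a p n"
    and \<Gamma>: "F_SS CARD('n) p p = 0"
  shows "\<exists>C>0. \<forall>\<epsilon>\<in>{0<..1}. \<forall>T u v Gu Gv.
    wave_half T \<epsilon> r f1 g1 b p u Gv Gu \<longrightarrow> wave_half T \<epsilon> r f2 g2 a p v Gu Gv \<longrightarrow>
    T \<le> exp (C * \<epsilon> powr (- (p * (p - 1))))"
proof -
  interpret D1: wave_data f1 g1 r b p n by (rule D1)
  interpret D2: wave_data f2 g2 r a p n by (rule D2)
  let ?N = "real CARD('n)"
  let ?m = "(?N - 1) / 2"
  let ?\<gamma> = "?m - 1 / p"
  let ?e = "(p - 1) * ?N - p - ?m * p"
  let ?tot = "measure (sphere_measure :: (real^'n) measure) (space sphere_measure)"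
  have tot: "?tot > 0" by (rule sphere_measure_pos)
  note p = D1.q
  have crit: "(p + 2 + 1 / p) / (p * p - 1) - ?m = 0" using \<Gamma> by (simp add: F_SS_def)
  have \<gamma>: "?\<gamma> \<ge> 0" by (rule critical_exponent_ge[OF p p crit])
  obtain c3 where c3: "c3 > 0" "\<And>T \<epsilon> u h F R. wave_half T \<epsilon> r f1 g1 b p u h F \<Longrightarrow> \<epsilon> > 0 \<Longrightarrow> 1 \<le> R \<Longrightarrow> R < T \<Longrightarrow>
      \<epsilon> powr p \<le> c3 * R powr ?e * shell_mass n T R F"
    by (rule D1.lower_estimate) blast
  obtain \<mu>1 c1 where \<mu>1: "\<mu>1 \<ge> r + 2" and c1: "c1 > 0" "\<And>T \<epsilon> u h F R. wave_half T \<epsilon> r f1 g1 b p u h F \<Longrightarrow> \<epsilon> > 0 \<Longrightarrow> 1 \<le> R \<Longrightarrow> R < T \<Longrightarrow>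
      cone_mass r n T R (shifted_kern ?\<gamma> \<mu>1) h powr p \<le> c1 * R powr ?e * (1 + ln R) powr (p - 1) * shell_mass n T R F"
    by (rule D1.log_estimate[OF \<gamma>]) blast
  obtain \<mu>2 c2 where \<mu>2: "\<mu>2 \<ge> r + 2" and c2: "c2 > 0" "\<And>T \<epsilon> u h F R. wave_half T \<epsilon> r f2 g2 a p u h F \<Longrightarrow> \<epsilon> > 0 \<Longrightarrow> 1 \<le> R \<Longrightarrow> R < T \<Longrightarrow>
      cone_mass r n T R (shifted_kern ?\<gamma> \<mu>2) h powr p \<le> c2 * R powr ?e * (1 + ln R) powr (p - 1) * shell_mass n T R F"
    by (rule D2.log_estimate[OF \<gamma>]) blast
  let ?\<kappa>1 = "shifted_kern ?\<gamma> \<mu>1" and ?\<kappa>2 = "shifted_kern ?\<gamma> \<mu>2"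
  define c4 where "c4 = (2 * (1 + \<mu>1)) powr ?\<gamma> / ?tot"
  define c5 where "c5 = (2 * (1 + \<mu>2)) powr ?\<gamma> / ?tot"
  define c where "c = c1 + c2 + c3 + c4 + c5"
  have c45: "c4 \<ge> 0" "c5 \<ge> 0" using tot by (simp_all add: c4_def c5_def)
  have c: "c > 0" "c1 \<le> c" "c2 \<le> c" "c3 \<le> c" "c4 \<le> c" "c5 \<le> c"
    using c1(1) c2(1) c3(1) c45 unfolding c_def by linarith+
  obtain A where A: "A > 0" and main: "\<And>R \<epsilon> L Us Vs Wu Wv Wus Wvs. R \<ge> 1 \<Longrightarrow> L \<ge> 1 \<Longrightarrow> \<epsilon> > 0 \<Longrightarrow> Us \<ge> 0 \<Longrightarrow> Vs \<ge> 0 \<Longrightarrow> Wu \<ge> 0 \<Longrightarrow> Wv \<ge> 0 \<Longrightarrow> Wus \<ge> 0 \<Longrightarrow> Wvs \<ge> 0 \<Longrightarrow>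
      Us \<le> c * R powr ?\<gamma> * Wus \<Longrightarrow> Vs \<le> c * R powr ?\<gamma> * Wvs \<Longrightarrow>
      \<epsilon> powr p \<le> c * R powr ?e * Us \<Longrightarrow>
      Wv powr p \<le> c * R powr ?e * L powr (p - 1) * Us \<Longrightarrow>
      Wu powr p \<le> c * R powr ?e * L powr (p - 1) * Vs \<Longrightarrow>
      (Wu + Wv) powr p \<le> A * L powr (p - 1) * (Wus + Wvs) \<and> \<epsilon> powr p \<le> A * (Wus + Wvs)"
    by (rule critical_estimate_diagonal[OF p c(1) crit]) blast
  have k: "0 \<le> p - 1" "p - 1 < p" using p by auto
  obtain B where B: "B > 0" and dy: "\<And>T \<delta> (S::nat \<Rightarrow> real) D. 0 < \<delta> \<Longrightarrow> \<delta> \<le> 1 \<Longrightarrow> 0 \<le> S 0 \<Longrightarrow>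
      (\<And>J. 1 \<le> J \<Longrightarrow> 2 ^ J < T \<Longrightarrow> S (J - 1) + D J \<le> S J) \<Longrightarrow>
      (\<And>J. 1 \<le> J \<Longrightarrow> 2 ^ J < T \<Longrightarrow> S J powr p \<le> A * (1 + real J) powr (p - 1) * D J) \<Longrightarrow>
      (\<And>J. 1 \<le> J \<Longrightarrow> 2 ^ J < T \<Longrightarrow> \<delta> \<le> A * D J) \<Longrightarrow>
      T \<le> exp (B * \<delta> powr (- ((p - 1) / (p - (p - 1)))))"
    by (rule dyadic_lifespan[OF p k A]) blast
  show ?thesis
  proof (intro exI[of _ B] conjI ballI allI impI)
    show "B > 0" by (rule B)
    fix \<epsilon> T :: real and u v Gu Gv :: "real \<Rightarrow> real^'n \<Rightarrow> real"
    assume \<epsilon>: "\<epsilon> \<in> {0<..1}" and w1: "wave_half T \<epsilon> r f1 g1 b p u Gv Gu" and w2: "wave_half T \<epsilon> r f2 g2 a p v Gu Gv"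
    note s1 = wave_half_source[OF w1] and s2 = wave_half_source[OF w2]
    have e0: "\<epsilon> > 0" "\<epsilon> \<le> 1" using \<epsilon> by auto
    define Sv where "Sv J = cone_mass r n T (2 ^ J) ?\<kappa>1 Gv" for J :: nat
    define Su where "Su J = cone_mass r n T (2 ^ J) ?\<kappa>2 Gu" for J :: nat
    define Dv where "Dv J = shell_kern_mass r n T (2 ^ J) ?\<kappa>1 Gv" for J :: nat
    define Du where "Du J = shell_kern_mass r n T (2 ^ J) ?\<kappa>2 Gu" for J :: nat
    have S0: "0 \<le> Sv J" "0 \<le> Dv J" for J
      unfolding Sv_def Dv_def by (intro cone_mass_nonneg shell_kern_mass_nonneg s1 avg_kern_nonneg[OF \<mu>1]; assumption)+
    have S0': "0 \<le> Su J" "0 \<le> Du J" for J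
      unfolding Su_def Du_def by (intro cone_mass_nonneg shell_kern_mass_nonneg s2 avg_kern_nonneg[OF \<mu>2]; assumption)+
    have est: "(Su J + Sv J) powr p \<le> A * (1 + real J) powr (p - 1) * (Du J + Dv J) \<and> \<epsilon> powr p \<le> A * (Du J + Dv J)"
      if J: "2 ^ J < T" for J
    proof -
      let ?R = "(2::real) ^ J"
      have R: "1 \<le> ?R" "?R < T" "0 < ?R" using J by auto
      have L: "1 \<le> 1 + ln ?R" using R by simp
      have nn: "0 \<le> shell_mass n T ?R Gu" "0 \<le> shell_mass n T ?R Gv"
        by (intro shell_mass_nonneg s1 s2)+
      have "shell_mass n T ?R Gv \<le> c4 * ?R powr ?\<gamma> * Dv J"
        unfolding c4_def Dv_def by (rule shell_mass_le_kern[OF s1 R(1) D1.n0 D1.r \<mu>1 \<gamma>])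
      then have 1: "shell_mass n T ?R Gv \<le> c * ?R powr ?\<gamma> * Dv J"
        by (rule mult_right_le[OF _ c(5) powr_ge_zero S0(2)])
      have "shell_mass n T ?R Gu \<le> c5 * ?R powr ?\<gamma> * Du J"
        unfolding c5_def Du_def by (rule shell_mass_le_kern[OF s2 R(1) D1.n0 D1.r \<mu>2 \<gamma>])
      then have 2: "shell_mass n T ?R Gu \<le> c * ?R powr ?\<gamma> * Du J"
        by (rule mult_right_le[OF _ c(6) powr_ge_zero S0'(2)])
      have "Sv J powr p \<le> c1 * (?R powr ?e * (1 + ln ?R) powr (p - 1)) * shell_mass n T ?R Gu"
        using c1(2)[OF w1 e0(1) R(1,2)] by (simp add: Sv_def mult.assoc)
      then have "Sv J powr p \<le> c * (?R powr ?e * (1 + ln ?R) powr (p - 1)) * shell_mass n T ?R Gu"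
        by (rule mult_right_le[OF _ c(2) _ nn(1)]) auto
      then have 3: "Sv J powr p \<le> c * ?R powr ?e * (1 + ln ?R) powr (p - 1) * shell_mass n T ?R Gu"
        by (simp only: mult.assoc)
      have "Su J powr p \<le> c2 * (?R powr ?e * (1 + ln ?R) powr (p - 1)) * shell_mass n T ?R Gv"
        using c2(2)[OF w2 e0(1) R(1,2)] by (simp add: Su_def mult.assoc)
      then have "Su J powr p \<le> c * (?R powr ?e * (1 + ln ?R) powr (p - 1)) * shell_mass n T ?R Gv"
        by (rule mult_right_le[OF _ c(3) _ nn(2)]) auto
      then have 4: "Su J powr p \<le> c * ?R powr ?e * (1 + ln ?R) powr (p - 1) * shell_mass n T ?R Gv"
        by (simp only: mult.assoc)
      have 5: "(Su J + Sv J) powr p \<le> A * (1 + ln ?R) powr (p - 1) * (Du J + Dv J) \<and> \<epsilon> powr p \<le> A * (Du J + Dv J)"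
        by (rule main[OF R(1) L e0(1) nn S0'(1) S0(1) S0'(2) S0(2) 2 1
          mult_right_le[OF c3(2)[OF w1 e0(1) R(1,2)] c(4) powr_ge_zero nn(1)] 3 4])
      have "A * (1 + ln ?R) powr (p - 1) * (Du J + Dv J) \<le> A * (1 + real J) powr (p - 1) * (Du J + Dv J)"
        using A L k(1) ln_dyadic_le[of J] S0(2)[of J] S0'(2)[of J] by (intro mult_right_mono mult_left_mono powr_mono2) auto
      then show ?thesis using 5 by linarith
    qed
    have "T \<le> exp (B * (\<epsilon> powr p) powr (- ((p - 1) / (p - (p - 1)))))"
    proof (rule dy[where S = "\<lambda>J. Su J + Sv J" and D = "\<lambda>J. Du J + Dv J"])
      show "0 < \<epsilon> powr p" using e0 by simp
      show "\<epsilon> powr p \<le> 1" using e0 p by (intro powr_le1) auto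
      show "0 \<le> Su 0 + Sv 0" by (intro add_nonneg_nonneg S0 S0')
      fix J :: nat assume J: "1 \<le> J" "2 ^ J < T"
      show "(Su J + Sv J) powr p \<le> A * (1 + real J) powr (p - 1) * (Du J + Dv J)" "\<epsilon> powr p \<le> A * (Du J + Dv J)"
        using est[OF J(2)] by auto
      have e: "(2::real) ^ J = 2 * 2 ^ (J - 1)" using J(1) by (cases J) auto
      then have "Sv (J - 1) + Dv J \<le> Sv J"
        unfolding Sv_def Dv_def
        using cone_mass_step[OF s1(1,2) _ D1.n0 smooth_shifted_kern avg_kern_nonneg[OF \<mu>1], of "2 ^ (J - 1)" r] by simp
      moreover have "Su (J - 1) + Du J \<le> Su J"
        unfolding Su_def Du_def using e
        using cone_mass_step[OF s2(1,2) _ D1.n0 smooth_shifted_kern avg_kern_nonneg[OF \<mu>2], of "2 ^ (J - 1)" r] by simp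
      ultimately show "Su (J - 1) + Sv (J - 1) + (Du J + Dv J) \<le> Su J + Sv J" by linarith
    qed
    also have "(\<epsilon> powr p) powr (- ((p - 1) / (p - (p - 1)))) = \<epsilon> powr (- (p * (p - 1)))"
      by (simp add: powr_powr algebra_simps)
    finally show "T \<le> exp (B * \<epsilon> powr (- (p * (p - 1))))" .
  qed
qed

section \<open>Support radius of the data and reduction to ordered exponents\<close>

lemma Cc_infty_continuous: "f \<in> Cc_infty UNIV \<Longrightarrow> continuous_on UNIV f"
proof -
  assume "f \<in> Cc_infty UNIV"
  then have "Ck_on 0 f UNIV" unfolding Cc_infty_def by blast
  then show ?thesis by simp
qed

text \<open>The supremum has to be taken over a nonempty set bounded above: compact supports give
  the bound, and the positive integral of \<open>g1\<close> a point where the data do not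
  vanish.\<close>

lemma Cc_infty_radius:
  fixes f1 f2 g1 g2 :: "real^'n \<Rightarrow> real"
  assumes cc: "f1 \<in> Cc_infty UNIV" "f2 \<in> Cc_infty UNIV" "g1 \<in> Cc_infty UNIV" "g2 \<in> Cc_infty UNIV"
    and pos: "(\<integral>x. g1 x \<partial>lebesgue) > 0"
    and r: "r = Sup {norm x |x. x \<in> supp (\<lambda>x. (f1 x, f2 x, g1 x, g2 x))}"
  shows "0 \<le> r" "\<And>x. norm x > r \<Longrightarrow> f1 x = 0 \<and> f2 x = 0 \<and> g1 x = 0 \<and> g2 x = 0"
proof -
  let ?F = "\<lambda>x. (f1 x, f2 x, g1 x, g2 x)"
  let ?S = "{norm x |x. x \<in> supp ?F}"
  have "\<exists>K. compact K \<and> (\<forall>x. x \<notin> K \<longrightarrow> f x = 0)" if "f \<in> Cc_infty UNIV" for f :: "real^'n \<Rightarrow> real"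
    using that unfolding Cc_infty_def by blast
  then obtain K1 K2 K3 K4 where K: "compact K1" "compact K2" "compact K3" "compact K4"
    "\<And>x. x \<notin> K1 \<Longrightarrow> f1 x = 0" "\<And>x. x \<notin> K2 \<Longrightarrow> f2 x = 0" "\<And>x. x \<notin> K3 \<Longrightarrow> g1 x = 0" "\<And>x. x \<notin> K4 \<Longrightarrow> g2 x = 0"
    using cc by metis
  let ?K = "K1 \<union> K2 \<union> K3 \<union> K4"
  have cK: "compact ?K" using K by (intro compact_Un)
  have "{x. ?F x \<noteq> 0} \<subseteq> ?K" using K by (auto simp: zero_prod_def)
  then have sub: "supp ?F \<subseteq> ?K" unfolding supp_def using cK by (intro closure_minimal compact_imp_closed)
  obtain B where B: "\<forall>x\<in>?K. norm x \<le> B" using compact_imp_bounded[OF cK] unfolding bounded_iff by blast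
  have bdd: "bdd_above ?S"
  proof (rule bdd_aboveI[of _ B])
    fix y assume "y \<in> ?S"
    then obtain x where "x \<in> supp ?F" "y = norm x" by blast
    then show "y \<le> B" using subsetD[OF sub] B by blast
  qed
  have up: "norm x \<le> r" if "?F x \<noteq> 0" for x
  proof -
    have "x \<in> supp ?F" unfolding supp_def by (rule subsetD[OF closure_subset], rule CollectI, rule that)
    then have "norm x \<in> ?S" by blast
    then show ?thesis unfolding r by (rule cSup_upper[OF _ bdd])
  qed
  show "norm x > r \<Longrightarrow> f1 x = 0 \<and> f2 x = 0 \<and> g1 x = 0 \<and> g2 x = 0" for x
    using up[of x] by (auto simp: zero_prod_def)
  have "\<exists>x. g1 x \<noteq> 0"
  proof (rule ccontr)
    assume "\<not> (\<exists>x. g1 x \<noteq> 0)"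
    then have "(\<integral>x. g1 x \<partial>lebesgue) = 0" by simp
    then show False using pos by simp
  qed
  then obtain x where "g1 x \<noteq> 0" ..
  then have "norm x \<le> r" by (intro up) (simp add: zero_prod_def)
  then show "0 \<le> r" using norm_ge_zero[of x] by linarith
qed

text \<open>So for q <= p the maximum in \<open>Gamma_SS\<close> is attained at the order (p, q),
  the one in which the chain of estimates takes its lower bound from the equation for u.\<close>

lemma F_SS_mono:
  assumes "p > 1" "q > 1" "q \<le> p"
  shows "F_SS N q p \<le> F_SS N p q"
proof -
  have pq: "p * q > 1" using assms by (simp add: less_1_mult)
  have "1 / p \<le> 1 / q" using assms by (simp add: frac_le)
  then have "q + 2 + 1 / p \<le> p + 2 + 1 / q" using assms by linarith
  then have "(q + 2 + 1 / p) / (p * q - 1) \<le> (p + 2 + 1 / q) / (p * q - 1)" using pq by (intro divide_right_mono) auto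
  then show ?thesis by (simp add: F_SS_def mult.commute)
qed

lemma lifespan_ordered:
  fixes f1 g1 f2 g2 :: "real^'n \<Rightarrow> real"
  assumes D1: "wave_data f1 g1 r b q n" and D2: "wave_data f2 g2 r a p n"
    and le: "q \<le> p" and \<Gamma>: "Gamma_SS CARD('n) p q \<ge> 0"
  shows "\<exists>C>0. \<forall>\<epsilon>\<in>{0<..1}. \<forall>T u v Gu Gv.
    wave_half T \<epsilon> r f1 g1 b q u Gv Gu \<longrightarrow> wave_half T \<epsilon> r f2 g2 a p v Gu Gv \<longrightarrow>
    T \<le> (if Gamma_SS CARD('n) p q > 0 then C * \<epsilon> powr (- inverse (Gamma_SS CARD('n) p q))
         else if p \<noteq> q then exp (C * \<epsilon> powr (- min (p * (p * q - 1)) (q * (p * q - 1))))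
         else exp (C * \<epsilon> powr (- (p * (p - 1)))))"
proof -
  have pq1: "p > 1" "q > 1" using D1 D2 by (auto simp: wave_data_def)
  have G: "Gamma_SS CARD('n) p q = F_SS CARD('n) p q"
    using F_SS_mono[OF pq1 le] by (simp add: Gamma_SS_def)
  have pq: "p * q > 1" using pq1 by (simp add: less_1_mult)
  have min: "min (p * (p * q - 1)) (q * (p * q - 1)) = q * (p * q - 1)"
    using le pq by (intro min_absorb2 mult_right_mono) auto
  consider "F_SS CARD('n) p q > 0" | "F_SS CARD('n) p q = 0" "p \<noteq> q" | "F_SS CARD('n) p q = 0" "p = q"
    using \<Gamma> G by linarith
  then show ?thesis
  proof cases
    case 1
    then show ?thesis using subcritical_lifespan[OF D1 D2 1] unfolding G by simp
  next
    case 2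
    then show ?thesis using critical_lifespan[OF D1 D2 2(1)] unfolding G min by simp
  next
    case 3
    then show ?thesis using critical_lifespan_diagonal[of f1 g1 r b p n f2 g2 a] D1 D2 unfolding G by simp
  qed
qed

theorem proposition7p1:
  fixes p q a b r0 :: real
    and G1 G2 :: "real \<Rightarrow> real"
    and f1 g1 f2 g2 :: "real^'n \<Rightarrow> real"
  assumes "p > 1" and "q > 1" and "a > 0" and "b > 0"
    and "G1 C1_differentiable_on UNIV" and "G2 C1_differentiable_on UNIV"
    and "G1 0 = 0" and "G2 0 = 0"
    and "\<And>s. G1 s \<ge> a * \<bar>s\<bar> powr p" and "\<And>s. G2 s \<ge> b * \<bar>s\<bar> powr q"
    and "f1 \<in> Cc_infty UNIV" and "g1 \<in> Cc_infty UNIV"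
    and "f2 \<in> Cc_infty UNIV" and "g2 \<in> Cc_infty UNIV"
    and "(\<integral>x. g1 x \<partial>lebesgue) > 0" and "(\<integral>x. g2 x \<partial>lebesgue) > 0"
    and "r0 = Sup {norm x |x. x \<in> supp (\<lambda>x. (f1 x, f2 x, g1 x, g2 x))}"
    and "Gamma_SS CARD('n) p q \<ge> 0"
  shows "\<exists>\<epsilon>0>0. \<exists>C>0. \<forall>\<epsilon>\<in>{0<..\<epsilon>0}. \<forall>T u v.
    weak_solution G1 G2 f1 g1 f2 g2 \<epsilon> T u v \<longrightarrow>
    ess_supp T (\<lambda>t x. (u t x, v t x)) \<subseteq> {(x, t). 0 \<le> t \<and> t < T \<and> norm x \<le> r0 + t} \<longrightarrow>
    T \<le> (if Gamma_SS CARD('n) p q > 0 then C * \<epsilon> powr (- inverse (Gamma_SS CARD('n) p q))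
         else if p \<noteq> q then exp (C * \<epsilon> powr (- min (p * (p * q - 1)) (q * (p * q - 1))))
         else exp (C * \<epsilon> powr (- (p * (p - 1)))))"
proof -
  have r0: "0 \<le> r0" and z: "\<And>x. norm x > r0 \<Longrightarrow> f1 x = 0 \<and> f2 x = 0 \<and> g1 x = 0 \<and> g2 x = 0"
    by (rule Cc_infty_radius[OF assms(11,13,12,14,15,17)], rule Cc_infty_radius(2)[OF assms(11,13,12,14,15,17)])
  \<comment> \<open>Both equations share one cutoff, so its power must be large enough for both
    exponents.\<close>
  obtain n :: nat where n: "real n * (1 - 1 / q) \<ge> 2" "real n * (1 - 1 / p) \<ge> 2"
  proof -
    obtain n :: nat where "real n \<ge> max (2 / (1 - 1 / q)) (2 / (1 - 1 / p))"
      using real_arch_simple by blast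
    then have "2 / (1 - 1 / q) \<le> real n" "2 / (1 - 1 / p) \<le> real n" by auto
    moreover have "1 - 1 / q > 0" "1 - 1 / p > 0" using assms(1,2) by auto
    ultimately show thesis using that[of n] by (simp add: pos_divide_le_eq)
  qed
  have D1: "wave_data f1 g1 r0 b q n" and D2: "wave_data f2 g2 r0 a p n"
    unfolding wave_data_def
    by (intro conjI allI impI Cc_infty_continuous assms(1,2,3,4,11,12,13,14,15,16) r0 n; simp add: z)+
  note half = wave_half_of_weak_solution[OF _ _ assms(3,4,7,8,9,10)]
  let ?bound = "\<lambda>C \<epsilon>. if Gamma_SS CARD('n) p q > 0 then C * \<epsilon> powr (- inverse (Gamma_SS CARD('n) p q))
         else if p \<noteq> q then exp (C * \<epsilon> powr (- min (p * (p * q - 1)) (q * (p * q - 1))))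
         else exp (C * \<epsilon> powr (- (p * (p - 1))))"
  have "\<exists>C>0. \<forall>\<epsilon>\<in>{0<..1}. \<forall>T u v Gu Gv.
    wave_half T \<epsilon> r0 f1 g1 b q u Gv Gu \<longrightarrow> wave_half T \<epsilon> r0 f2 g2 a p v Gu Gv \<longrightarrow> T \<le> ?bound C \<epsilon>"
  proof (cases "q \<le> p")
    case True
    then show ?thesis using lifespan_ordered[OF D1 D2 True assms(18)] by blast
  next
    case False
    \<comment> \<open>For p < q the two equations trade places; \<open>Gamma_SS\<close> and, for
      distinct exponents, the bound itself are symmetric in p and q.\<close>
    have sym: "Gamma_SS CARD('n) q p = Gamma_SS CARD('n) p q" by (simp add: Gamma_SS_def max.commute)
    have "\<exists>C>0. \<forall>\<epsilon>\<in>{0<..1}. \<forall>T u v Gu Gv.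
      wave_half T \<epsilon> r0 f2 g2 a p u Gv Gu \<longrightarrow> wave_half T \<epsilon> r0 f1 g1 b q v Gu Gv \<longrightarrow>
      T \<le> (if Gamma_SS CARD('n) p q > 0 then C * \<epsilon> powr (- inverse (Gamma_SS CARD('n) p q))
         else if q \<noteq> p then exp (C * \<epsilon> powr (- min (q * (q * p - 1)) (p * (q * p - 1))))
         else exp (C * \<epsilon> powr (- (q * (q - 1)))))"
      using lifespan_ordered[OF D2 D1] False assms(18) unfolding sym by simp
    moreover have "(if Gamma_SS CARD('n) p q > 0 then C * \<epsilon> powr (- inverse (Gamma_SS CARD('n) p q))
         else if q \<noteq> p then exp (C * \<epsilon> powr (- min (q * (q * p - 1)) (p * (q * p - 1))))
         else exp (C * \<epsilon> powr (- (q * (q - 1))))) = ?bound C \<epsilon>" for C \<epsilon>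
      using False by (simp add: min.commute mult.commute)
    ultimately show ?thesis by (simp only:) blast
  qed
  then obtain C where C: "C > 0" "\<And>\<epsilon> T u v Gu Gv. \<epsilon> \<in> {0<..1} \<Longrightarrow>
    wave_half T \<epsilon> r0 f1 g1 b q u Gv Gu \<Longrightarrow> wave_half T \<epsilon> r0 f2 g2 a p v Gu Gv \<Longrightarrow> T \<le> ?bound C \<epsilon>"
    by blast
  have "\<forall>\<epsilon>\<in>{0<..1}. \<forall>T u v.
    weak_solution G1 G2 f1 g1 f2 g2 \<epsilon> T u v \<longrightarrow>
    ess_supp T (\<lambda>t x. (u t x, v t x)) \<subseteq> {(x, t). 0 \<le> t \<and> t < T \<and> norm x \<le> r0 + t} \<longrightarrow> T \<le> ?bound C \<epsilon>"
  proof (intro ballI allI impI)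
    fix \<epsilon> T :: real and u v :: "real \<Rightarrow> real^'n \<Rightarrow> real"
    assume e: "\<epsilon> \<in> {0<..1}" and w: "weak_solution G1 G2 f1 g1 f2 g2 \<epsilon> T u v"
      and s: "ess_supp T (\<lambda>t x. (u t x, v t x)) \<subseteq> {(x, t). 0 \<le> t \<and> t < T \<and> norm x \<le> r0 + t}"
    show "T \<le> ?bound C \<epsilon>" by (rule C(2)[OF e half[OF w s]])
  qed
  \<comment> \<open>\<epsilon>0 = 1 is enough: smallness of \<epsilon> serves only to make its
    negative powers at least 1.\<close>
  then show ?thesis using C(1) by (intro exI[of _ 1] conjI exI[of _ C] zero_less_one)
qed

end
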